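(* Let $0<q<1$, $x>0$, and let $\mathscr{A}_x$ and $\Phi:U_q^{\Gamma_x}(\mathfrak{su}(1,1))\otimes U_q^{\Gamma_1}(\mathfrak{su}(1,1))\to\mathscr{A}_x$ be as in the context. The irreducible $*$-representations of $\mathscr{A}_x$ are of the form $\pi_{S,T}$ with $$\pi_{S,T}\circ\Phi=\pi_S\otimes\pi_T,$$ where $S,T\subseteq\mathbb R_{>0}$ are such that there exists $c\in\mathbb R$ with (1) $Z_S\subseteq\Lambda_{x^2}$ an irreducible $c$-set, (2) $Z_T\subseteq\Lambda_1$ an irreducible $(-c)$-set, and (3) $Z_SZ_T\subseteq x^2q^{2\mathbb Z}$. Here $Z_S=\{s^2\mid s\in S\}$, $Z_T=\{t^2\mid t\in T\}$, and $\pi_S$, $\pi_T$ are the irreducible $*$-representations of $U_q^{\Gamma_x}(\mathfrak{su}(1,1))$, respectively $U_q^{\Gamma_1}(\mathfrak{su}(1,1))$, associated to the irreducible $c$-set $Z_S$, respectively the irreducible $(-c)$-set $Z_T$.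
   Context: $\tau(y)=y+y^{-1}$, $w_\pm(y)=\tau(q^{\pm1}y)/\tau(y)$; for $y>0$: $\Lambda_y=yq^{\mathbb Z}$, $\Gamma_y=yq^{\frac12\mathbb Z}$. Greek indices range over $\{-1,1\}=\{-,+\}$. A $*$-representation is a non-degenerate $*$-representation by bounded operators on a Hilbert space; irreducibility and form of representations are understood up to unitary equivalence. $\mathscr{A}_x$ is the $*$-algebra generated by a copy of the $*$-algebra of finitely supported functions on $\Lambda_x\times\Lambda_x$, with Dirac functions $\mathbf 1_{y,z}$, and elements $u_{\epsilon,\nu;y,z}$ ($y,z\in\Lambda_x$) with defining relations $u_{\epsilon,\nu;y,z}\in\mathbf 1_{y,z}\mathscr{A}_x\mathbf 1_{q^\epsilon y,q^\nu z}$, $\sum_\mu u_{\mu,\epsilon;q^{-\mu}w,y}^*u_{\mu,\nu;q^{-\mu}w,z}=\delta_{\epsilon,\nu}\delta_{y,z}\mathbf 1_{w,q^\epsilon y}$, $\sum_\mu u_{\epsilon,\mu;y,w}u_{\nu,\mu;z,w}^*=\delta_{\epsilon,\nu}\delta_{y,z}\mathbf 1_{y,w}$, $u_{\epsilon,\nu;y,z}^*=\frac{\nu w_\nu(z)^{1/2}}{\epsilon w_\epsilon(y)^{1/2}}u_{-\epsilon,-\nu;q^\epsilon y,q^\nu z}$. In the multiplier $*$-algebra $M(\mathscr{A}_x)$ put $u_{\epsilon,\nu}=\sum_{y,z}u_{\epsilon,\nu;y,z}$, $\alpha=u_{--}$, $\beta=u_{-+}$, $\gamma=u_{+-}$, $\delta=u_{++}$,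 and for functions $f$ on $\Lambda_x$: $f(\lambda)=\sum_{y,z}f(y)\mathbf 1_{y,z}$, $f(\rho)=\sum_{y,z}f(z)\mathbf 1_{y,z}$ (so e.g. $\tau^{1/2}(q\rho)=\sum\tau(qz)^{1/2}\mathbf 1_{y,z}$). $U_q^{\Gamma_y}(\mathfrak{su}(1,1))$ is the (non-unital) $*$-algebra generated by a copy of the finitely supported functions on $\Gamma_y$, with Dirac functions $\mathbf 1_r$, and elements $E_r,F_r$ ($r\in\Gamma_y$) with $E_r^*=F_r$, $\mathbf 1_{qr}E_r=E_r=E_r\mathbf 1_r$, $\mathbf 1_rF_r=F_r=F_r\mathbf 1_{qr}$, $F_rE_r-E_{r/q}F_{r/q}=\frac{r^2-r^{-2}}{q-q^{-1}}\mathbf 1_r$. In its multiplier algebra put $K=\sum_rr\mathbf 1_r$, $E=\sum_rE_r$, $F=\sum_rF_r$, and $C=(q^{-1}-q)^2FE-qK^2-q^{-1}K^{-2}$ (Casimir element, central and self-adjoint). Upper indices $(1)$, $(2)$ refer to the generators of $U_q^{\Gamma_x}(\mathfrak{su}(1,1))$ and $U_q^{\Gamma_1}(\mathfrak{su}(1,1))$ in their tensor product. $\Phi$ is the unique non-degenerate $*$-homomorphism with $(q^{-1}-q)\Phi(E^{(1)})=\alpha\tau^{1/2}(\lambda)\tau^{1/2}(q\rho)$, $(q^{-1}-q)\Phi(E^{(2)})=\beta\tau^{1/2}(\lambda)\tau^{1/2}(\rho/q)$, $(q^{-1}-q)\Phi(F^{(1)})=\delta\tau^{1/2}(\lambda)\tau^{1/2}(\rho/q)$,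 $(q^{-1}-q)\Phi(F^{(2)})=-\gamma\tau^{1/2}(\lambda)\tau^{1/2}(q\rho)$, $\Phi(\mathbf 1_r^{(1)})=\sum_{z\in\Lambda_x}\mathbf 1_{r^2/z,z}$, $\Phi(\mathbf 1_s^{(2)})=\sum_{z\in\Lambda_x}\mathbf 1_{s^2z,z}$; it is surjective. $c$-sets: for $c\in\mathbb R$, $\epsilon\in\{\pm\}$, a number $z>0$ is $c_\epsilon$-adapted if $0\le c+\tau(q^{-\epsilon}z)$, strictly $c_\epsilon$-adapted if the inequality is strict, and $c$-adapted if both $c_+$- and $c_-$-adapted. A $c$-set is a non-empty set $Z\subseteq\mathbb R_{>0}$ of $c$-adapted points such that $q^{-2\epsilon}z\in Z$ whenever $z\in Z$ is strictly $c_\epsilon$-adapted. It is irreducible if it is not a union of two disjoint $c$-sets. For $T\subseteq\mathbb R_{>0}$ with $Z_T=\{t^2\mid t\in T\}\subseteq\Lambda_{y^2}$ an irreducible $c$-set, $\pi_T$ denotes the irreducible $*$-representation of $U_q^{\Gamma_y}(\mathfrak{su}(1,1))$, unique up to unitary equivalence, in which $C$ acts as the scalar $c$ (on the algebraic direct sum of the spaces $\pi_T(\mathbf 1_r)\mathcal H$) and for which $T=\{r\in\Gamma_y:\pi_T(\mathbf 1_r)\neq0\}$. *)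

theory Defs
  imports "HOL-Analysis.Analysis" "HOL-Algebra.Module" "HOL-Algebra.Generated_Groups"
begin

section \<open>Complex Hilbert spaces\<close>

text \<open>The inner product is conjugate-linear in the first argument.\<close>

class chilbert_space = real_inner + complete_space +
  fixes scaleC :: "complex \<Rightarrow> 'a \<Rightarrow> 'a"  (infixr \<open>*\<^sub>C\<close> 75)
    and cinner :: "'a \<Rightarrow> 'a \<Rightarrow> complex"
  assumes scaleC_add_right: "a *\<^sub>C (x + y) = a *\<^sub>C x + a *\<^sub>C y"
    and scaleC_add_left: "(a + b) *\<^sub>C x = a *\<^sub>C x + b *\<^sub>C x"
    and scaleC_scaleC: "a *\<^sub>C (b *\<^sub>C x) = (a * b) *\<^sub>C x"
    and scaleR_scaleC: "r *\<^sub>R x = complex_of_real r *\<^sub>C x"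
    and cinner_commute: "cinner x y = cnj (cinner y x)"
    and cinner_add_right: "cinner x (y + z) = cinner x y + cinner x z"
    and cinner_scaleC_right: "cinner x (a *\<^sub>C y) = a * cinner x y"
    and inner_eq_Re_cinner: "inner x y = Re (cinner x y)"

text \<open>Square-summable families, providing Hilbert spaces of every dimension.\<close>

typedef 'i ell2 = "{f :: 'i \<Rightarrow> complex. (\<lambda>i. (cmod (f i))\<^sup>2) summable_on UNIV}"
  morphisms ell2_fun Abs_ell2
  by (rule exI[of _ "\<lambda>_. 0"]) simp

lemma sq_summable_add:
  fixes f g :: "'i \<Rightarrow> complex"
  assumes "(\<lambda>i. (cmod (f i))\<^sup>2) summable_on UNIV" "(\<lambda>i. (cmod (g i))\<^sup>2) summable_on UNIV"
  shows "(\<lambda>i. (cmod (f i + g i))\<^sup>2) summable_on UNIV"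
proof (rule summable_on_comparison_test)
  show "(\<lambda>i. 2 * (cmod (f i))\<^sup>2 + 2 * (cmod (g i))\<^sup>2) summable_on UNIV"
    by (intro summable_on_add summable_on_cmult_right assms)
  fix i
  have "(cmod (f i + g i))\<^sup>2 \<le> (cmod (f i) + cmod (g i))\<^sup>2"
    by (intro power_mono norm_triangle_ineq) auto
  also have "\<dots> \<le> 2 * (cmod (f i))\<^sup>2 + 2 * (cmod (g i))\<^sup>2"
    using sum_squares_bound[of "cmod (f i)" "cmod (g i)"] by (simp add: power2_sum)
  finally show "(cmod (f i + g i))\<^sup>2 \<le> 2 * (cmod (f i))\<^sup>2 + 2 * (cmod (g i))\<^sup>2" .
qed auto

lemma sq_summable_scale:
  fixes f :: "'i \<Rightarrow> complex"
  assumes "(\<lambda>i. (cmod (f i))\<^sup>2) summable_on UNIV"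
  shows "(\<lambda>i. (cmod (c * f i))\<^sup>2) summable_on UNIV"
  using summable_on_cmult_right[OF assms, of "(cmod c)\<^sup>2"]
  by (simp add: norm_mult power_mult_distrib)

lemma sq_summable_prod:
  fixes f g :: "'i \<Rightarrow> complex"
  assumes "(\<lambda>i. (cmod (f i))\<^sup>2) summable_on UNIV" "(\<lambda>i. (cmod (g i))\<^sup>2) summable_on UNIV"
  shows "(\<lambda>i. cnj (f i) * g i) summable_on UNIV"
proof (rule abs_summable_summable, rule summable_on_comparison_test)
  show "(\<lambda>i. (cmod (f i))\<^sup>2 + (cmod (g i))\<^sup>2) summable_on UNIV"
    by (intro summable_on_add assms)
  fix i
  have "2 * (cmod (f i) * cmod (g i)) \<le> (cmod (f i))\<^sup>2 + (cmod (g i))\<^sup>2"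
    using sum_squares_bound[of "cmod (f i)" "cmod (g i)"] by simp
  moreover have "0 \<le> cmod (f i) * cmod (g i)" by simp
  ultimately show "cmod (cnj (f i) * g i) \<le> (cmod (f i))\<^sup>2 + (cmod (g i))\<^sup>2"
    unfolding norm_mult complex_mod_cnj by linarith
qed auto

setup_lifting type_definition_ell2
lift_definition ell2_scale :: "complex \<Rightarrow> 'i ell2 \<Rightarrow> 'i ell2" is "\<lambda>c f i. c * f i"
  by (rule sq_summable_scale)

lift_definition ell2_cinner :: "'i ell2 \<Rightarrow> 'i ell2 \<Rightarrow> complex"
  is "\<lambda>f g. \<Sum>\<^sub>\<infinity>i. cnj (f i) * g i" .

lemma ell2_sq_summable: "(\<lambda>i. (cmod (ell2_fun x i))\<^sup>2) summable_on UNIV"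
  using ell2_fun[of x] by simp

lemma ell2_cinner_commute: "ell2_cinner x y = cnj (ell2_cinner y x)"
  by transfer (simp add: mult.commute flip: infsum_cnj)

lemma ell2_cinner_scale: "ell2_cinner x (ell2_scale a y) = a * ell2_cinner x y"
  by transfer (simp add: mult.left_commute infsum_cmult_right')

lemma ell2_cinner_self: "Re (ell2_cinner x x) = (\<Sum>\<^sub>\<infinity>i. (cmod (ell2_fun x i))\<^sup>2)"
proof -
  have "(\<lambda>i. cnj (ell2_fun x i) * ell2_fun x i) summable_on UNIV"
    by (intro sq_summable_prod ell2_sq_summable)
  moreover have "Re (cnj z * z) = (cmod z)\<^sup>2" for z
    unfolding cmod_power2 by (simp add: power2_eq_square)
  ultimately show ?thesis
    unfolding ell2_cinner.rep_eq by (simp add: infsum_Re[symmetric])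
qed

instantiation ell2 :: (type) real_inner
begin

lift_definition zero_ell2 :: "'a ell2" is "\<lambda>_. 0" by simp
lift_definition plus_ell2 :: "'a ell2 \<Rightarrow> 'a ell2 \<Rightarrow> 'a ell2" is "\<lambda>f g i. f i + g i"
  by (rule sq_summable_add)
lift_definition uminus_ell2 :: "'a ell2 \<Rightarrow> 'a ell2" is "\<lambda>f i. - f i" by simp
lift_definition minus_ell2 :: "'a ell2 \<Rightarrow> 'a ell2 \<Rightarrow> 'a ell2" is "\<lambda>f g i. f i - g i"
  subgoal for f g using sq_summable_add[of f "\<lambda>i. - g i"] by simp done
definition scaleR_ell2 :: "real \<Rightarrow> 'a ell2 \<Rightarrow> 'a ell2" where
  "scaleR_ell2 r x = ell2_scale (complex_of_real r) x"
definition inner_ell2 :: "'a ell2 \<Rightarrow> 'a ell2 \<Rightarrow> real" where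
  "inner_ell2 x y = Re (ell2_cinner x y)"
definition norm_ell2 :: "'a ell2 \<Rightarrow> real" where "norm_ell2 x = sqrt (inner x x)"
definition sgn_ell2 :: "'a ell2 \<Rightarrow> 'a ell2" where "sgn_ell2 x = inverse (norm x) *\<^sub>R x"
definition dist_ell2 :: "'a ell2 \<Rightarrow> 'a ell2 \<Rightarrow> real" where "dist_ell2 x y = norm (x - y)"
definition uniformity_ell2 :: "('a ell2 \<times> 'a ell2) filter" where
  "uniformity_ell2 = (INF e\<in>{0<..}. principal {(x, y). dist x y < e})"
definition open_ell2 :: "'a ell2 set \<Rightarrow> bool" where
  "open_ell2 U = (\<forall>x\<in>U. eventually (\<lambda>(x', y). x' = x \<longrightarrow> y \<in> U) uniformity)"

lemma ell2_cinner_add: "ell2_cinner x (y + z) = ell2_cinner x y + ell2_cinner x z"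
  by transfer (simp add: distrib_left infsum_add sq_summable_prod)

instance
proof
  fix x y z :: "'a ell2" and r s :: real
  show "x + y + z = x + (y + z)" "x + y = y + x" "0 + x = x" "- x + x = 0" "x - y = x + - y"
    by (transfer; simp add: fun_eq_iff)+
  show "r *\<^sub>R (x + y) = r *\<^sub>R x + r *\<^sub>R y" "(r + s) *\<^sub>R x = r *\<^sub>R x + s *\<^sub>R x"
    "r *\<^sub>R s *\<^sub>R x = (r * s) *\<^sub>R x" "1 *\<^sub>R x = x"
    unfolding scaleR_ell2_def by (transfer; simp add: fun_eq_iff algebra_simps)+
  have comm: "inner x y = inner y x" for x y :: "'a ell2"
    unfolding inner_ell2_def by (subst ell2_cinner_commute) simp
  show "inner x y = inner y x" by (rule comm)
  show "inner (x + y) z = inner x z + inner y z"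
    unfolding comm[of _ z] unfolding inner_ell2_def by (simp add: ell2_cinner_add)
  show "inner (r *\<^sub>R x) y = r * inner x y"
    unfolding comm[of _ y] unfolding inner_ell2_def scaleR_ell2_def by (simp add: ell2_cinner_scale)
  show "0 \<le> inner x x" unfolding inner_ell2_def ell2_cinner_self by (simp add: infsum_nonneg)
  show "(inner x x = 0) = (x = 0)"
  proof
    assume "inner x x = 0"
    then have "(cmod (ell2_fun x i))\<^sup>2 = 0" for i
      unfolding inner_ell2_def ell2_cinner_self
      by (intro nonneg_infsum_le_0D[OF _ ell2_sq_summable]) auto
    then show "x = 0" by transfer (auto simp: fun_eq_iff)
  next
    assume "x = 0"
    then show "inner x x = 0"
      unfolding inner_ell2_def ell2_cinner_self by (simp add: zero_ell2.rep_eq)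
  qed
  show "norm x = sqrt (inner x x)" by (rule norm_ell2_def)
  show "sgn x = inverse (norm x) *\<^sub>R x" by (rule sgn_ell2_def)
  show "dist x y = norm (x - y)" by (rule dist_ell2_def)
  show "uniformity = (INF e\<in>{0<..}. principal {(x :: 'a ell2, y). dist x y < e})"
    by (rule uniformity_ell2_def)
  show "open U = (\<forall>x\<in>U. eventually (\<lambda>(x', y). x' = x \<longrightarrow> y \<in> U) uniformity)"
    for U :: "'a ell2 set" by (rule open_ell2_def)
qed

end

lemma ell2_norm_sq: "(norm x)\<^sup>2 = (\<Sum>\<^sub>\<infinity>i. (cmod (ell2_fun x i))\<^sup>2)"
  unfolding norm_ell2_def inner_ell2_def ell2_cinner_self by (simp add: infsum_nonneg)

lemma ell2_finite_sum_le: "finite F \<Longrightarrow> (\<Sum>i\<in>F. (cmod (ell2_fun x i))\<^sup>2) \<le> (norm x)\<^sup>2"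
  unfolding ell2_norm_sq by (intro finite_sum_le_infsum ell2_sq_summable) auto

lemma ell2_component_le: "cmod (ell2_fun x i) \<le> norm x"
  by (rule power2_le_imp_le) (use ell2_finite_sum_le[of "{i}" x] in simp_all)

instance ell2 :: (type) complete_space
proof
  fix X :: "nat \<Rightarrow> 'a ell2"
  assume X: "Cauchy X"
  have "Cauchy (\<lambda>n. ell2_fun (X n) i)" for i
  proof (rule metric_CauchyI)
    fix e :: real assume "e > 0"
    then obtain M where M: "dist (X m) (X n) < e" if "m \<ge> M" "n \<ge> M" for m n
      using metric_CauchyD[OF X] by blast
    have "dist (ell2_fun (X m) i) (ell2_fun (X n) i) < e" if "m \<ge> M" "n \<ge> M" for m n
      using ell2_component_le[of "X m - X n" i] M[OF that]
      by (simp add: dist_norm minus_ell2.rep_eq)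
    then show "\<exists>M. \<forall>m\<ge>M. \<forall>n\<ge>M. dist (ell2_fun (X m) i) (ell2_fun (X n) i) < e" by blast
  qed
  then have "(\<lambda>n. ell2_fun (X n) i) \<longlonglongrightarrow> lim (\<lambda>n. ell2_fun (X n) i)" for i
    by (simp add: Cauchy_convergent_iff convergent_LIMSEQ_iff)
  then obtain f where f: "(\<lambda>n. ell2_fun (X n) i) \<longlonglongrightarrow> f i" for i
    by (rule that)
  have bound: "(\<Sum>i\<in>F. (cmod (ell2_fun (X m) i - f i))\<^sup>2) \<le> e\<^sup>2"
    if "finite F" and M: "\<And>n. n \<ge> M \<Longrightarrow> dist (X m) (X n) < e" for F m M e
  proof (rule tendsto_upperbound)
    show "(\<lambda>n. \<Sum>i\<in>F. (cmod (ell2_fun (X m) i - ell2_fun (X n) i))\<^sup>2)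
        \<longlonglongrightarrow> (\<Sum>i\<in>F. (cmod (ell2_fun (X m) i - f i))\<^sup>2)"
      by (intro tendsto_intros f)
    have "(\<Sum>i\<in>F. (cmod (ell2_fun (X m) i - ell2_fun (X n) i))\<^sup>2) \<le> e\<^sup>2" if "n \<ge> M" for n
    proof -
      have "(norm (X m - X n))\<^sup>2 \<le> e\<^sup>2"
        using M[OF that] by (intro power_mono) (auto simp: dist_norm)
      with ell2_finite_sum_le[OF \<open>finite F\<close>, of "X m - X n"] show ?thesis
        by (simp add: minus_ell2.rep_eq)
    qed
    then show "\<forall>\<^sub>F n in sequentially.
        (\<Sum>i\<in>F. (cmod (ell2_fun (X m) i - ell2_fun (X n) i))\<^sup>2) \<le> e\<^sup>2"
      by (auto simp: eventually_sequentially)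
  qed simp
  have summ: "(\<lambda>i. (cmod (ell2_fun (X m) i - f i))\<^sup>2) summable_on UNIV"
    if "\<And>n. n \<ge> M \<Longrightarrow> dist (X m) (X n) < e" for m M e
  proof (rule nonneg_bdd_above_summable_on)
    show "bdd_above (sum (\<lambda>i. (cmod (ell2_fun (X m) i - f i))\<^sup>2) ` {F. F \<subseteq> UNIV \<and> finite F})"
      using bound[OF _ that] by (intro bdd_aboveI2[where M = "e\<^sup>2"]) auto
  qed simp
  obtain M1 where M1: "dist (X m) (X n) < 1" if "m \<ge> M1" "n \<ge> M1" for m n
    using metric_CauchyD[OF X, of 1] by auto
  have "(\<lambda>i. (cmod (ell2_fun (X M1) i - f i))\<^sup>2) summable_on UNIV"
    by (rule summ[where M = M1 and e = 1]) (rule M1[OF order_refl])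
  from sq_summable_add[OF ell2_sq_summable sq_summable_scale[where c = "- 1", OF this], of "X M1"]
  have "(\<lambda>i. (cmod (f i))\<^sup>2) summable_on UNIV"
    by simp
  then obtain L where L: "ell2_fun L = f"
    using Abs_ell2_inverse by blast
  have "X \<longlonglongrightarrow> L"
  proof (rule metric_LIMSEQ_I)
    fix e :: real assume "e > 0"
    then obtain M where M: "dist (X m) (X n) < e / 2" if "m \<ge> M" "n \<ge> M" for m n
      using metric_CauchyD[OF X, of "e / 2"] by auto
    have "dist (X m) L < e" if "m \<ge> M" for m
    proof -
      have "(norm (X m - L))\<^sup>2 \<le> (e / 2)\<^sup>2"
        unfolding ell2_norm_sq minus_ell2.rep_eq L
        using summ[OF M[OF that]] bound[OF _ M[OF that]] by (rule infsum_le_finite_sums)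
      then have "norm (X m - L) \<le> e / 2"
        by (rule power2_le_imp_le) (use \<open>e > 0\<close> in simp)
      then show ?thesis using \<open>e > 0\<close> by (simp add: dist_norm)
    qed
    then show "\<exists>M. \<forall>m\<ge>M. dist (X m) L < e" by blast
  qed
  then show "convergent X" by (auto simp: convergent_def)
qed

instantiation ell2 :: (type) chilbert_space
begin

definition scaleC_ell2 :: "complex \<Rightarrow> 'a ell2 \<Rightarrow> 'a ell2" where "scaleC_ell2 = ell2_scale"
definition cinner_ell2 :: "'a ell2 \<Rightarrow> 'a ell2 \<Rightarrow> complex" where "cinner_ell2 = ell2_cinner"

instance
proof
  fix x y z :: "'a ell2" and a b :: complex and r :: real
  show "a *\<^sub>C (x + y) = a *\<^sub>C x + a *\<^sub>C y" "(a + b) *\<^sub>C x = a *\<^sub>C x + b *\<^sub>C x"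
    "a *\<^sub>C (b *\<^sub>C x) = (a * b) *\<^sub>C x"
    unfolding scaleC_ell2_def by (transfer; simp add: fun_eq_iff algebra_simps)+
  show "r *\<^sub>R x = complex_of_real r *\<^sub>C x"
    by (simp add: scaleR_ell2_def scaleC_ell2_def)
  show "cinner x y = cnj (cinner y x)"
    unfolding cinner_ell2_def by (rule ell2_cinner_commute)
  show "cinner x (y + z) = cinner x y + cinner x z"
    unfolding cinner_ell2_def by (rule ell2_cinner_add)
  show "cinner x (a *\<^sub>C y) = a * cinner x y"
    unfolding cinner_ell2_def scaleC_ell2_def by (rule ell2_cinner_scale)
  show "inner x y = Re (cinner x y)"
    unfolding cinner_ell2_def by (rule inner_ell2_def)
qed

end


definition csubspace :: "'h::chilbert_space set \<Rightarrow> bool" where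
  "csubspace H \<longleftrightarrow> 0 \<in> H \<and> (\<forall>v\<in>H. \<forall>w\<in>H. v + w \<in> H) \<and> (\<forall>a. \<forall>v\<in>H. a *\<^sub>C v \<in> H)"

text \<open>
  Hilbert spaces are represented as closed complex subspaces of types of class
  \<open>chilbert_space\<close> (\<open>UNIV\<close> being one of them), so that they may also be trivial or
  finite-dimensional. Only the values on \<open>H\<close> of an operator on \<open>H\<close> matter.
\<close>

definition hilbert_on :: "'h::chilbert_space set \<Rightarrow> bool" where
  "hilbert_on H \<longleftrightarrow> csubspace H \<and> closed H"

definition clinear_on :: "'h::chilbert_space set \<Rightarrow> ('h \<Rightarrow> 'k::chilbert_space) \<Rightarrow> bool" where
  "clinear_on H V \<longleftrightarrow> (\<forall>v\<in>H. \<forall>w\<in>H. V (v + w) = V v + V w) \<and> (\<forall>a. \<forall>v\<in>H. V (a *\<^sub>C v) = a *\<^sub>C V v)"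

definition bounded_operator_on :: "'h::chilbert_space set \<Rightarrow> ('h \<Rightarrow> 'h) \<Rightarrow> bool" where
  "bounded_operator_on H V \<longleftrightarrow>
     (\<forall>v\<in>H. V v \<in> H) \<and> clinear_on H V \<and> (\<exists>B. \<forall>v\<in>H. norm (V v) \<le> B * norm v)"

definition unitary_on ::
  "'h::chilbert_space set \<Rightarrow> 'k::chilbert_space set \<Rightarrow> ('h \<Rightarrow> 'k) \<Rightarrow> bool" where
  "unitary_on H H' V \<longleftrightarrow>
     clinear_on H V \<and> V ` H = H' \<and> (\<forall>v\<in>H. \<forall>w\<in>H. cinner (V v) (V w) = cinner v w)"

text \<open>
  \<open>H\<close> with the bilinear map \<open>t\<close> is a (completed) tensor product of the Hilbert spaces
  \<open>H\<^sub>1\<close> and \<open>H\<^sub>2\<close>; this determines \<open>(H, t)\<close> up to a unique unitary.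
\<close>

definition hilbert_tensor ::
  "'h1::chilbert_space set \<Rightarrow> 'h2::chilbert_space set \<Rightarrow> 'h::chilbert_space set \<Rightarrow>
    ('h1 \<Rightarrow> 'h2 \<Rightarrow> 'h) \<Rightarrow> bool" where
  "hilbert_tensor H1 H2 H t \<longleftrightarrow>
     hilbert_on H1 \<and> hilbert_on H2 \<and> hilbert_on H \<and>
     (\<forall>v\<in>H1. clinear_on H2 (\<lambda>w. t v w)) \<and> (\<forall>w\<in>H2. clinear_on H1 (\<lambda>v. t v w)) \<and>
     (\<forall>v\<in>H1. \<forall>v'\<in>H1. \<forall>w\<in>H2. \<forall>w'\<in>H2.
        cinner (t v w) (t v' w') = cinner v v' * cinner w w') \<and>
     closure (span {t v w | v w. v \<in> H1 \<and> w \<in> H2}) = H"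


section \<open>Star algebras and their multipliers\<close>

text \<open>
  Complex *-algebras, not necessarily unital: the field \<open>one\<close> is meaningful only for
  multiplier algebras.
\<close>

record 'a star_algebra = "(complex, 'a) module" +
  adj :: "'a \<Rightarrow> 'a"

datatype 'g sterm =
    Gen 'g
  | TZero
  | TAdd "'g sterm" "'g sterm"
  | TScale complex "'g sterm"
  | TMult "'g sterm" "'g sterm"
  | TStar "'g sterm"

inductive pres_cong :: "('g sterm \<times> 'g sterm) set \<Rightarrow> 'g sterm \<Rightarrow> 'g sterm \<Rightarrow> bool"
  for Rel where
  rel: "(s, t) \<in> Rel \<Longrightarrow> pres_cong Rel s t"
| refl: "pres_cong Rel s s"
| sym: "pres_cong Rel s t \<Longrightarrow> pres_cong Rel t s"
| trans: "pres_cong Rel s t \<Longrightarrow> pres_cong Rel t u \<Longrightarrow> pres_cong Rel s u"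
| cong_add: "pres_cong Rel s s' \<Longrightarrow> pres_cong Rel t t' \<Longrightarrow> pres_cong Rel (TAdd s t) (TAdd s' t')"
| cong_scale: "pres_cong Rel s s' \<Longrightarrow> pres_cong Rel (TScale a s) (TScale a s')"
| cong_mult: "pres_cong Rel s s' \<Longrightarrow> pres_cong Rel t t' \<Longrightarrow> pres_cong Rel (TMult s t) (TMult s' t')"
| cong_star: "pres_cong Rel s s' \<Longrightarrow> pres_cong Rel (TStar s) (TStar s')"
| add_assoc: "pres_cong Rel (TAdd (TAdd s t) u) (TAdd s (TAdd t u))"
| add_commute: "pres_cong Rel (TAdd s t) (TAdd t s)"
| add_zero: "pres_cong Rel (TAdd TZero s) s"
| add_neg: "pres_cong Rel (TAdd (TScale (- 1) s) s) TZero"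
| scale_add_right: "pres_cong Rel (TScale a (TAdd s t)) (TAdd (TScale a s) (TScale a t))"
| scale_add_left: "pres_cong Rel (TScale (a + b) s) (TAdd (TScale a s) (TScale b s))"
| scale_scale: "pres_cong Rel (TScale a (TScale b s)) (TScale (a * b) s)"
| scale_one: "pres_cong Rel (TScale 1 s) s"
| mult_assoc: "pres_cong Rel (TMult (TMult s t) u) (TMult s (TMult t u))"
| mult_add_left: "pres_cong Rel (TMult (TAdd s t) u) (TAdd (TMult s u) (TMult t u))"
| mult_add_right: "pres_cong Rel (TMult s (TAdd t u)) (TAdd (TMult s t) (TMult s u))"
| mult_scale_left: "pres_cong Rel (TMult (TScale a s) t) (TScale a (TMult s t))"
| mult_scale_right: "pres_cong Rel (TMult s (TScale a t)) (TScale a (TMult s t))"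
| star_add: "pres_cong Rel (TStar (TAdd s t)) (TAdd (TStar s) (TStar t))"
| star_scale: "pres_cong Rel (TStar (TScale a s)) (TScale (cnj a) (TStar s))"
| star_mult: "pres_cong Rel (TStar (TMult s t)) (TMult (TStar t) (TStar s))"
| star_star: "pres_cong Rel (TStar (TStar s)) s"

definition pres_cls :: "('g sterm \<times> 'g sterm) set \<Rightarrow> 'g sterm \<Rightarrow> 'g sterm set" where
  "pres_cls Rel s = {t. pres_cong Rel s t}"

text \<open>
  The universal *-algebra generated by the elements of \<open>G\<close> subject to the relations \<open>Rel\<close>.
\<close>

definition pres_alg ::
  "'g set \<Rightarrow> ('g sterm \<times> 'g sterm) set \<Rightarrow> 'g sterm set star_algebra" where
  "pres_alg G Rel =
    \<lparr> carrier = {pres_cls Rel s | s. set_sterm s \<subseteq> G},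
      mult = (\<lambda>X Y. \<Union>s\<in>X. \<Union>t\<in>Y. pres_cls Rel (TMult s t)),
      one = undefined,
      zero = pres_cls Rel TZero,
      add = (\<lambda>X Y. \<Union>s\<in>X. \<Union>t\<in>Y. pres_cls Rel (TAdd s t)),
      smult = (\<lambda>a X. \<Union>s\<in>X. pres_cls Rel (TScale a s)),
      adj = (\<lambda>X. \<Union>s\<in>X. pres_cls Rel (TStar s)) \<rparr>"

definition star_hom :: "'a star_algebra \<Rightarrow> 'b star_algebra \<Rightarrow> ('a \<Rightarrow> 'b) \<Rightarrow> bool" where
  "star_hom A B f \<longleftrightarrow>
     f \<in> carrier A \<rightarrow> carrier B \<and>
     (\<forall>a\<in>carrier A. \<forall>b\<in>carrier A.
        f (a \<oplus>\<^bsub>A\<^esub> b) = f a \<oplus>\<^bsub>B\<^esub> f b \<and> f (a \<otimes>\<^bsub>A\<^esub> b) = f a \<otimes>\<^bsub>B\<^esub> f b) \<and>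
     (\<forall>c. \<forall>a\<in>carrier A. f (c \<odot>\<^bsub>A\<^esub> a) = c \<odot>\<^bsub>B\<^esub> f a) \<and>
     (\<forall>a\<in>carrier A. f (adj A a) = adj B (f a))"

text \<open>
  Non-degeneracy \<open>f(A)B = B\<close>; as the set of products is closed under scalars, the
  additive subgroup it generates is its linear span.
\<close>

definition nondegenerate_hom :: "'a star_algebra \<Rightarrow> 'b star_algebra \<Rightarrow> ('a \<Rightarrow> 'b) \<Rightarrow> bool" where
  "nondegenerate_hom A B f \<longleftrightarrow>
     generate (add_monoid B) {f a \<otimes>\<^bsub>B\<^esub> b | a b. a \<in> carrier A \<and> b \<in> carrier B} = carrier B"

text \<open>
  Multipliers are pairs \<open>(a \<mapsto> m a, a \<mapsto> a m)\<close> of maps on \<open>A\<close>, extended by \<open>undefined\<close> outside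
  \<open>A\<close>. For algebras with local units, such as all those below, the maps are automatically linear.
\<close>

type_synonym 'a multiplier = "('a \<Rightarrow> 'a) \<times> ('a \<Rightarrow> 'a)"

definition mult_alg :: "'a star_algebra \<Rightarrow> 'a multiplier star_algebra" where
  "mult_alg A =
    \<lparr> carrier = {(L, R). L \<in> carrier A \<rightarrow>\<^sub>E carrier A \<and> R \<in> carrier A \<rightarrow>\<^sub>E carrier A \<and>
        (\<forall>a\<in>carrier A. \<forall>b\<in>carrier A.
           L (a \<otimes>\<^bsub>A\<^esub> b) = L a \<otimes>\<^bsub>A\<^esub> b \<and> R (a \<otimes>\<^bsub>A\<^esub> b) = a \<otimes>\<^bsub>A\<^esub> R b \<and> R a \<otimes>\<^bsub>A\<^esub> b = a \<otimes>\<^bsub>A\<^esub> L b)},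
      mult = (\<lambda>(L, R) (L', R').
        (\<lambda>a\<in>carrier A. L (L' a), \<lambda>a\<in>carrier A. R' (R a))),
      one = (\<lambda>a\<in>carrier A. a, \<lambda>a\<in>carrier A. a),
      zero = (\<lambda>a\<in>carrier A. \<zero>\<^bsub>A\<^esub>, \<lambda>a\<in>carrier A. \<zero>\<^bsub>A\<^esub>),
      add = (\<lambda>(L, R) (L', R').
        (\<lambda>a\<in>carrier A. L a \<oplus>\<^bsub>A\<^esub> L' a, \<lambda>a\<in>carrier A. R a \<oplus>\<^bsub>A\<^esub> R' a)),
      smult = (\<lambda>c (L, R). (\<lambda>a\<in>carrier A. c \<odot>\<^bsub>A\<^esub> L a, \<lambda>a\<in>carrier A. c \<odot>\<^bsub>A\<^esub> R a)),
      adj = (\<lambda>(L, R).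
        (\<lambda>a\<in>carrier A. adj A (R (adj A a)), \<lambda>a\<in>carrier A. adj A (L (adj A a)))) \<rparr>"

text \<open>
  The strict sum \<open>\<Sum>i\<in>I. f i\<close> of a family of elements of \<open>A\<close> such that, for every \<open>a\<close> in \<open>A\<close>,
  only finitely many of the products \<open>f i a\<close> and \<open>a f i\<close> are nonzero.
\<close>

definition strict_sum :: "'a star_algebra \<Rightarrow> 'i set \<Rightarrow> ('i \<Rightarrow> 'a) \<Rightarrow> 'a multiplier" where
  "strict_sum A I f =
    (\<lambda>a\<in>carrier A. \<Oplus>\<^bsub>A\<^esub>i\<in>{i \<in> I. f i \<otimes>\<^bsub>A\<^esub> a \<noteq> \<zero>\<^bsub>A\<^esub>}. f i \<otimes>\<^bsub>A\<^esub> a,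
     \<lambda>a\<in>carrier A. \<Oplus>\<^bsub>A\<^esub>i\<in>{i \<in> I. a \<otimes>\<^bsub>A\<^esub> f i \<noteq> \<zero>\<^bsub>A\<^esub>}. a \<otimes>\<^bsub>A\<^esub> f i)"

text \<open>
  For a non-degenerate *-homomorphism \<open>f\<close>, the extension of \<open>f\<close> to multipliers maps \<open>m\<close> to the
  multiplier \<open>m'\<close> characterised by \<open>m' f(a) = f(m a)\<close> and \<open>f(a) m' = f(a m)\<close>.
\<close>

definition extension_maps ::
  "'a star_algebra \<Rightarrow> 'b star_algebra \<Rightarrow> ('a \<Rightarrow> 'b) \<Rightarrow> 'a multiplier \<Rightarrow> 'b multiplier \<Rightarrow> bool" where
  "extension_maps A B f m m' \<longleftrightarrow>
     m' \<in> carrier (mult_alg B) \<and>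
     (\<forall>a\<in>carrier A. fst m' (f a) = f (fst m a) \<and> snd m' (f a) = f (snd m a))"

text \<open>
  The algebraic tensor product: the elementary tensors, represented by the generators \<open>(a, b)\<close>,
  are subject to bilinearity, \<open>(a \<otimes> b)(a' \<otimes> b') = a a' \<otimes> b b'\<close> and \<open>(a \<otimes> b)* = a* \<otimes> b*\<close>.
  The last two families of relations reduce every term to a linear combination of
  elementary tensors.
\<close>

definition tensor_rel ::
  "'a star_algebra \<Rightarrow> 'b star_algebra \<Rightarrow> (('a \<times> 'b) sterm \<times> ('a \<times> 'b) sterm) set" where
  "tensor_rel A B =
     {(Gen (a \<oplus>\<^bsub>A\<^esub> a', b), TAdd (Gen (a, b)) (Gen (a', b))) | a a' b.
        a \<in> carrier A \<and> a' \<in> carrier A \<and> b \<in> carrier B} \<union>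
     {(Gen (a, b \<oplus>\<^bsub>B\<^esub> b'), TAdd (Gen (a, b)) (Gen (a, b'))) | a b b'.
        a \<in> carrier A \<and> b \<in> carrier B \<and> b' \<in> carrier B} \<union>
     {(Gen (c \<odot>\<^bsub>A\<^esub> a, b), TScale c (Gen (a, b))) | c a b. a \<in> carrier A \<and> b \<in> carrier B} \<union>
     {(Gen (a, c \<odot>\<^bsub>B\<^esub> b), TScale c (Gen (a, b))) | c a b. a \<in> carrier A \<and> b \<in> carrier B} \<union>
     {(TMult (Gen (a, b)) (Gen (a', b')), Gen (a \<otimes>\<^bsub>A\<^esub> a', b \<otimes>\<^bsub>B\<^esub> b')) | a a' b b'.
        a \<in> carrier A \<and> a' \<in> carrier A \<and> b \<in> carrier B \<and> b' \<in> carrier B} \<union>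
     {(TStar (Gen (a, b)), Gen (adj A a, adj B b)) | a b. a \<in> carrier A \<and> b \<in> carrier B}"

definition tensor_alg ::
  "'a star_algebra \<Rightarrow> 'b star_algebra \<Rightarrow> ('a \<times> 'b) sterm set star_algebra" where
  "tensor_alg A B = pres_alg (carrier A \<times> carrier B) (tensor_rel A B)"

definition tens :: "'a star_algebra \<Rightarrow> 'b star_algebra \<Rightarrow> 'a \<Rightarrow> 'b \<Rightarrow> ('a \<times> 'b) sterm set" where
  "tens A B a b = pres_cls (tensor_rel A B) (Gen (a, b))"


section \<open>Star representations\<close>

definition star_rep :: "'a star_algebra \<Rightarrow> 'h::chilbert_space set \<Rightarrow> ('a \<Rightarrow> 'h \<Rightarrow> 'h) \<Rightarrow> bool" where
  "star_rep A H \<pi> \<longleftrightarrow>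
     hilbert_on H \<and>
     (\<forall>a\<in>carrier A. bounded_operator_on H (\<pi> a)) \<and>
     (\<forall>a\<in>carrier A. \<forall>b\<in>carrier A. \<forall>v\<in>H.
        \<pi> (a \<oplus>\<^bsub>A\<^esub> b) v = \<pi> a v + \<pi> b v \<and> \<pi> (a \<otimes>\<^bsub>A\<^esub> b) v = \<pi> a (\<pi> b v)) \<and>
     (\<forall>c. \<forall>a\<in>carrier A. \<forall>v\<in>H. \<pi> (c \<odot>\<^bsub>A\<^esub> a) v = c *\<^sub>C \<pi> a v) \<and>
     (\<forall>a\<in>carrier A. \<forall>v\<in>H. \<forall>w\<in>H. cinner (\<pi> (adj A a) v) w = cinner v (\<pi> a w)) \<and>
     closure (span {\<pi> a v | a v. a \<in> carrier A \<and> v \<in> H}) = H"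

definition irreducible_rep ::
  "'a star_algebra \<Rightarrow> 'h::chilbert_space set \<Rightarrow> ('a \<Rightarrow> 'h \<Rightarrow> 'h) \<Rightarrow> bool" where
  "irreducible_rep A H \<pi> \<longleftrightarrow>
     star_rep A H \<pi> \<and> H \<noteq> {0} \<and>
     (\<forall>W. hilbert_on W \<and> W \<subseteq> H \<and> (\<forall>a\<in>carrier A. \<forall>v\<in>W. \<pi> a v \<in> W) \<longrightarrow> W = {0} \<or> W = H)"

definition unitarily_equivalent ::
  "'a star_algebra \<Rightarrow> 'h::chilbert_space set \<Rightarrow> ('a \<Rightarrow> 'h \<Rightarrow> 'h) \<Rightarrow>
    'k::chilbert_space set \<Rightarrow> ('a \<Rightarrow> 'k \<Rightarrow> 'k) \<Rightarrow> bool" where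
  "unitarily_equivalent A H \<pi> H' \<pi>' \<longleftrightarrow>
     (\<exists>V. unitary_on H H' V \<and> (\<forall>a\<in>carrier A. \<forall>v\<in>H. V (\<pi> a v) = \<pi>' a (V v)))"

text \<open>
  \<open>\<rho>\<close> is the tensor product \<open>\<pi>\<^sub>1 \<otimes> \<pi>\<^sub>2\<close>, realised on the tensor product \<open>(H, t)\<close> of the
  underlying Hilbert spaces.
\<close>

definition tensor_rep ::
  "'a star_algebra \<Rightarrow> 'h1::chilbert_space set \<Rightarrow> ('a \<Rightarrow> 'h1 \<Rightarrow> 'h1) \<Rightarrow>
   'b star_algebra \<Rightarrow> 'h2::chilbert_space set \<Rightarrow> ('b \<Rightarrow> 'h2 \<Rightarrow> 'h2) \<Rightarrow>
   'h::chilbert_space set \<Rightarrow> ('h1 \<Rightarrow> 'h2 \<Rightarrow> 'h) \<Rightarrow> (('a \<times> 'b) sterm set \<Rightarrow> 'h \<Rightarrow> 'h) \<Rightarrow> bool" where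
  "tensor_rep A H1 \<pi>1 B H2 \<pi>2 H t \<rho> \<longleftrightarrow>
     hilbert_tensor H1 H2 H t \<and> star_rep (tensor_alg A B) H \<rho> \<and>
     (\<forall>a\<in>carrier A. \<forall>b\<in>carrier B. \<forall>v\<in>H1. \<forall>w\<in>H2.
        \<rho> (tens A B a b) (t v w) = t (\<pi>1 a v) (\<pi>2 b w))"


section \<open>The dynamical quantum group algebra and the quantized enveloping algebra\<close>

definition \<tau> :: "real \<Rightarrow> real" where "\<tau> y = y + inverse y"

definition wfun :: "real \<Rightarrow> int \<Rightarrow> real \<Rightarrow> real" where
  "wfun q \<epsilon> y = \<tau> (q powi \<epsilon> * y) / \<tau> y"

definition \<Lambda> :: "real \<Rightarrow> real \<Rightarrow> real set" where
  "\<Lambda> q y = {y * q powi n | n :: int. True}"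

definition \<Gamma> :: "real \<Rightarrow> real \<Rightarrow> real set" where
  "\<Gamma> q y = {y * q powr (of_int n / 2) | n :: int. True}"

text \<open>
  Greek indices are integers in \<open>{-1, 1}\<close>. \<open>One2 y z\<close> is the Dirac function at \<open>(y, z)\<close> and
  \<open>Uel \<epsilon> \<nu> y z\<close> is \<open>u\<^sub>\<epsilon>\<^sub>,\<^sub>\<nu>\<^sub>;\<^sub>y\<^sub>,\<^sub>z\<close>.
\<close>

datatype dyn_gen = One2 real real | Uel int int real real

definition dyn_gens :: "real \<Rightarrow> real \<Rightarrow> dyn_gen set" where
  "dyn_gens q x =
     {One2 y z | y z. y \<in> \<Lambda> q x \<and> z \<in> \<Lambda> q x} \<union>
     {Uel \<epsilon> \<nu> y z | \<epsilon> \<nu> y z. \<epsilon> \<in> {-1, 1} \<and> \<nu> \<in> {-1, 1} \<and> y \<in> \<Lambda> q x \<and> z \<in> \<Lambda> q x}"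

definition dyn_rel :: "real \<Rightarrow> real \<Rightarrow> (dyn_gen sterm \<times> dyn_gen sterm) set" where
  "dyn_rel q x =
     {(TMult (Gen (One2 y z)) (Gen (One2 y' z')),
       if y = y' \<and> z = z' then Gen (One2 y z) else TZero) | y z y' z'.
        y \<in> \<Lambda> q x \<and> z \<in> \<Lambda> q x \<and> y' \<in> \<Lambda> q x \<and> z' \<in> \<Lambda> q x} \<union>
     {(TStar (Gen (One2 y z)), Gen (One2 y z)) | y z. y \<in> \<Lambda> q x \<and> z \<in> \<Lambda> q x} \<union>
     {(TMult (Gen (One2 y z)) (Gen (Uel \<epsilon> \<nu> y z)), Gen (Uel \<epsilon> \<nu> y z)) | \<epsilon> \<nu> y z.
        \<epsilon> \<in> {-1, 1} \<and> \<nu> \<in> {-1, 1} \<and> y \<in> \<Lambda> q x \<and> z \<in> \<Lambda> q x} \<union>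
     {(TMult (Gen (Uel \<epsilon> \<nu> y z)) (Gen (One2 (q powi \<epsilon> * y) (q powi \<nu> * z))), Gen (Uel \<epsilon> \<nu> y z))
        | \<epsilon> \<nu> y z. \<epsilon> \<in> {-1, 1} \<and> \<nu> \<in> {-1, 1} \<and> y \<in> \<Lambda> q x \<and> z \<in> \<Lambda> q x} \<union>
     {(TAdd (TMult (TStar (Gen (Uel (-1) \<epsilon> (q * w) y))) (Gen (Uel (-1) \<nu> (q * w) z)))
            (TMult (TStar (Gen (Uel 1 \<epsilon> (w / q) y))) (Gen (Uel 1 \<nu> (w / q) z))),
       if \<epsilon> = \<nu> \<and> y = z then Gen (One2 w (q powi \<epsilon> * y)) else TZero) | \<epsilon> \<nu> w y z.
        \<epsilon> \<in> {-1, 1} \<and> \<nu> \<in> {-1, 1} \<and> w \<in> \<Lambda> q x \<and> y \<in> \<Lambda> q x \<and> z \<in> \<Lambda> q x} \<union>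
     {(TAdd (TMult (Gen (Uel \<epsilon> (-1) y w)) (TStar (Gen (Uel \<nu> (-1) z w))))
            (TMult (Gen (Uel \<epsilon> 1 y w)) (TStar (Gen (Uel \<nu> 1 z w)))),
       if \<epsilon> = \<nu> \<and> y = z then Gen (One2 y w) else TZero) | \<epsilon> \<nu> w y z.
        \<epsilon> \<in> {-1, 1} \<and> \<nu> \<in> {-1, 1} \<and> w \<in> \<Lambda> q x \<and> y \<in> \<Lambda> q x \<and> z \<in> \<Lambda> q x} \<union>
     {(TStar (Gen (Uel \<epsilon> \<nu> y z)),
       TScale (complex_of_real
                (of_int \<nu> * sqrt (wfun q \<nu> z) / (of_int \<epsilon> * sqrt (wfun q \<epsilon> y))))
              (Gen (Uel (- \<epsilon>) (- \<nu>) (q powi \<epsilon> * y) (q powi \<nu> * z)))) | \<epsilon> \<nu> y z.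
        \<epsilon> \<in> {-1, 1} \<and> \<nu> \<in> {-1, 1} \<and> y \<in> \<Lambda> q x \<and> z \<in> \<Lambda> q x}"

definition dyn_alg :: "real \<Rightarrow> real \<Rightarrow> dyn_gen sterm set star_algebra" where
  "dyn_alg q x = pres_alg (dyn_gens q x) (dyn_rel q x)"

definition dyn_one :: "real \<Rightarrow> real \<Rightarrow> real \<Rightarrow> real \<Rightarrow> dyn_gen sterm set" where
  "dyn_one q x y z = pres_cls (dyn_rel q x) (Gen (One2 y z))"

definition dyn_u :: "real \<Rightarrow> real \<Rightarrow> int \<Rightarrow> int \<Rightarrow> dyn_gen sterm set multiplier" where
  "dyn_u q x \<epsilon> \<nu> = strict_sum (dyn_alg q x) (\<Lambda> q x \<times> \<Lambda> q x)
     (\<lambda>(y, z). pres_cls (dyn_rel q x) (Gen (Uel \<epsilon> \<nu> y z)))"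

definition fun_lam :: "real \<Rightarrow> real \<Rightarrow> (real \<Rightarrow> real) \<Rightarrow> dyn_gen sterm set multiplier" where
  "fun_lam q x f = strict_sum (dyn_alg q x) (\<Lambda> q x \<times> \<Lambda> q x)
     (\<lambda>(y, z). complex_of_real (f y) \<odot>\<^bsub>dyn_alg q x\<^esub> dyn_one q x y z)"

definition fun_rho :: "real \<Rightarrow> real \<Rightarrow> (real \<Rightarrow> real) \<Rightarrow> dyn_gen sterm set multiplier" where
  "fun_rho q x f = strict_sum (dyn_alg q x) (\<Lambda> q x \<times> \<Lambda> q x)
     (\<lambda>(y, z). complex_of_real (f z) \<odot>\<^bsub>dyn_alg q x\<^esub> dyn_one q x y z)"

datatype su_gen = One1 real | Egen real | Fgen real

definition su_gens :: "real \<Rightarrow> real \<Rightarrow> su_gen set" where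
  "su_gens q y = One1 ` \<Gamma> q y \<union> Egen ` \<Gamma> q y \<union> Fgen ` \<Gamma> q y"

definition su_rel :: "real \<Rightarrow> real \<Rightarrow> (su_gen sterm \<times> su_gen sterm) set" where
  "su_rel q y =
     {(TMult (Gen (One1 r)) (Gen (One1 s)), if r = s then Gen (One1 r) else TZero) | r s.
        r \<in> \<Gamma> q y \<and> s \<in> \<Gamma> q y} \<union>
     {(TStar (Gen (One1 r)), Gen (One1 r)) | r. r \<in> \<Gamma> q y} \<union>
     {(TStar (Gen (Egen r)), Gen (Fgen r)) | r. r \<in> \<Gamma> q y} \<union>
     {(TMult (Gen (One1 (q * r))) (Gen (Egen r)), Gen (Egen r)) | r. r \<in> \<Gamma> q y} \<union>
     {(TMult (Gen (Egen r)) (Gen (One1 r)), Gen (Egen r)) | r. r \<in> \<Gamma> q y} \<union>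
     {(TMult (Gen (One1 r)) (Gen (Fgen r)), Gen (Fgen r)) | r. r \<in> \<Gamma> q y} \<union>
     {(TMult (Gen (Fgen r)) (Gen (One1 (q * r))), Gen (Fgen r)) | r. r \<in> \<Gamma> q y} \<union>
     {(TAdd (TMult (Gen (Fgen r)) (Gen (Egen r)))
            (TScale (- 1) (TMult (Gen (Egen (r / q))) (Gen (Fgen (r / q))))),
       TScale (complex_of_real ((r powi 2 - r powi (-2)) / (q - inverse q))) (Gen (One1 r))) | r.
        r \<in> \<Gamma> q y}"

definition su_alg :: "real \<Rightarrow> real \<Rightarrow> su_gen sterm set star_algebra" where
  "su_alg q y = pres_alg (su_gens q y) (su_rel q y)"

definition su_one :: "real \<Rightarrow> real \<Rightarrow> real \<Rightarrow> su_gen sterm set" where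
  "su_one q y r = pres_cls (su_rel q y) (Gen (One1 r))"

definition su_Er :: "real \<Rightarrow> real \<Rightarrow> real \<Rightarrow> su_gen sterm set" where
  "su_Er q y r = pres_cls (su_rel q y) (Gen (Egen r))"

definition su_Fr :: "real \<Rightarrow> real \<Rightarrow> real \<Rightarrow> su_gen sterm set" where
  "su_Fr q y r = pres_cls (su_rel q y) (Gen (Fgen r))"

definition su_E :: "real \<Rightarrow> real \<Rightarrow> su_gen sterm set multiplier" where
  "su_E q y = strict_sum (su_alg q y) (\<Gamma> q y) (su_Er q y)"

definition su_F :: "real \<Rightarrow> real \<Rightarrow> su_gen sterm set multiplier" where
  "su_F q y = strict_sum (su_alg q y) (\<Gamma> q y) (su_Fr q y)"

text \<open>The integer powers \<open>K\<^sup>n\<close> of the invertible multiplier \<open>K\<close>, the sum of all \<open>r 1\<^sub>r\<close>.\<close>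

definition su_K :: "real \<Rightarrow> real \<Rightarrow> int \<Rightarrow> su_gen sterm set multiplier" where
  "su_K q y n = strict_sum (su_alg q y) (\<Gamma> q y)
     (\<lambda>r. complex_of_real (r powi n) \<odot>\<^bsub>su_alg q y\<^esub> su_one q y r)"

definition casimir :: "real \<Rightarrow> real \<Rightarrow> su_gen sterm set multiplier" where
  "casimir q y = (let M = mult_alg (su_alg q y) in
     complex_of_real ((inverse q - q)\<^sup>2) \<odot>\<^bsub>M\<^esub> (su_F q y \<otimes>\<^bsub>M\<^esub> su_E q y)
     \<oplus>\<^bsub>M\<^esub> complex_of_real (- q) \<odot>\<^bsub>M\<^esub> su_K q y 2
     \<oplus>\<^bsub>M\<^esub> complex_of_real (- inverse q) \<odot>\<^bsub>M\<^esub> su_K q y (-2))"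


section \<open>The homomorphism from the tensor product\<close>

abbreviation su_tensor ::
  "real \<Rightarrow> real \<Rightarrow> (su_gen sterm set \<times> su_gen sterm set) sterm set star_algebra" where
  "su_tensor q x \<equiv> tensor_alg (su_alg q x) (su_alg q 1)"

text \<open>
  The legs \<open>X\<^sup>(\<^sup>1\<^sup>) = X \<otimes> 1\<close> and \<open>X\<^sup>(\<^sup>2\<^sup>) = 1 \<otimes> X\<close> of a strict sum \<open>X\<close> of elements \<open>f i\<close>, using that the
  unit of the multiplier algebra is the strict sum of all \<open>1\<^sub>r\<close>.
\<close>

definition leg1 ::
  "real \<Rightarrow> real \<Rightarrow> real set \<Rightarrow> (real \<Rightarrow> su_gen sterm set) \<Rightarrow>
    (su_gen sterm set \<times> su_gen sterm set) sterm set multiplier" where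
  "leg1 q x I f = strict_sum (su_tensor q x) (I \<times> \<Gamma> q 1)
     (\<lambda>(r, s). tens (su_alg q x) (su_alg q 1) (f r) (su_one q 1 s))"

definition leg2 ::
  "real \<Rightarrow> real \<Rightarrow> real set \<Rightarrow> (real \<Rightarrow> su_gen sterm set) \<Rightarrow>
    (su_gen sterm set \<times> su_gen sterm set) sterm set multiplier" where
  "leg2 q x I f = strict_sum (su_tensor q x) (\<Gamma> q x \<times> I)
     (\<lambda>(r, s). tens (su_alg q x) (su_alg q 1) (su_one q x r) (f s))"

definition is_\<Phi> ::
  "real \<Rightarrow> real \<Rightarrow>
    ((su_gen sterm set \<times> su_gen sterm set) sterm set \<Rightarrow> dyn_gen sterm set) \<Rightarrow> bool" where
  "is_\<Phi> q x \<Phi> \<longleftrightarrow>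
    (let U = su_tensor q x; A = dyn_alg q x; MU = mult_alg U; MA = mult_alg A;
         k = complex_of_real (inverse q - q);
         \<alpha> = dyn_u q x (-1) (-1); \<beta> = dyn_u q x (-1) 1;
         \<gamma> = dyn_u q x 1 (-1); \<delta> = dyn_u q x 1 1;
         \<tau>l = fun_lam q x (\<lambda>y. sqrt (\<tau> y));
         \<tau>qr = fun_rho q x (\<lambda>z. sqrt (\<tau> (q * z)));
         \<tau>rq = fun_rho q x (\<lambda>z. sqrt (\<tau> (z / q)))
     in star_hom U A \<Phi> \<and> nondegenerate_hom U A \<Phi> \<and>
        extension_maps U A \<Phi> (k \<odot>\<^bsub>MU\<^esub> leg1 q x (\<Gamma> q x) (su_Er q x)) (\<alpha> \<otimes>\<^bsub>MA\<^esub> \<tau>l \<otimes>\<^bsub>MA\<^esub> \<tau>qr) \<and>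
        extension_maps U A \<Phi> (k \<odot>\<^bsub>MU\<^esub> leg2 q x (\<Gamma> q 1) (su_Er q 1)) (\<beta> \<otimes>\<^bsub>MA\<^esub> \<tau>l \<otimes>\<^bsub>MA\<^esub> \<tau>rq) \<and>
        extension_maps U A \<Phi> (k \<odot>\<^bsub>MU\<^esub> leg1 q x (\<Gamma> q x) (su_Fr q x)) (\<delta> \<otimes>\<^bsub>MA\<^esub> \<tau>l \<otimes>\<^bsub>MA\<^esub> \<tau>rq) \<and>
        extension_maps U A \<Phi> (k \<odot>\<^bsub>MU\<^esub> leg2 q x (\<Gamma> q 1) (su_Fr q 1))
          ((- 1) \<odot>\<^bsub>MA\<^esub> (\<gamma> \<otimes>\<^bsub>MA\<^esub> \<tau>l \<otimes>\<^bsub>MA\<^esub> \<tau>qr)) \<and>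
        (\<forall>r\<in>\<Gamma> q x. extension_maps U A \<Phi> (leg1 q x {r} (su_one q x))
          (strict_sum A (\<Lambda> q x) (\<lambda>z. dyn_one q x (r\<^sup>2 / z) z))) \<and>
        (\<forall>s\<in>\<Gamma> q 1. extension_maps U A \<Phi> (leg2 q x {s} (su_one q 1))
          (strict_sum A (\<Lambda> q x) (\<lambda>z. dyn_one q x (s\<^sup>2 * z) z))))"


section \<open>\<open>c\<close>-sets and the representations they parametrise\<close>

definition c_adapted :: "real \<Rightarrow> real \<Rightarrow> int \<Rightarrow> real \<Rightarrow> bool" where
  "c_adapted q c \<epsilon> z \<longleftrightarrow> 0 \<le> c + \<tau> (q powi (- \<epsilon>) * z)"

definition strictly_c_adapted :: "real \<Rightarrow> real \<Rightarrow> int \<Rightarrow> real \<Rightarrow> bool" where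
  "strictly_c_adapted q c \<epsilon> z \<longleftrightarrow> 0 < c + \<tau> (q powi (- \<epsilon>) * z)"

definition c_set :: "real \<Rightarrow> real \<Rightarrow> real set \<Rightarrow> bool" where
  "c_set q c Z \<longleftrightarrow> Z \<noteq> {} \<and> Z \<subseteq> {0<..} \<and>
     (\<forall>z\<in>Z. \<forall>\<epsilon>\<in>{-1, 1}. c_adapted q c \<epsilon> z \<and>
        (strictly_c_adapted q c \<epsilon> z \<longrightarrow> q powi (- 2 * \<epsilon>) * z \<in> Z))"

definition irreducible_c_set :: "real \<Rightarrow> real \<Rightarrow> real set \<Rightarrow> bool" where
  "irreducible_c_set q c Z \<longleftrightarrow> c_set q c Z \<and>
     \<not> (\<exists>Z1 Z2. c_set q c Z1 \<and> c_set q c Z2 \<and> Z1 \<inter> Z2 = {} \<and> Z = Z1 \<union> Z2)"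

definition Zset :: "real set \<Rightarrow> real set" where
  "Zset T = (\<lambda>t. t\<^sup>2) ` T"

text \<open>
  \<open>(H, \<pi>)\<close> is (a realisation of) \<open>\<pi>\<^sub>T\<close>, for \<open>Zset T\<close> an irreducible \<open>c\<close>-set. Note that \<open>T\<close> need not
  determine \<open>c\<close>. The multiplier \<open>C\<close> acts on \<open>\<pi>(1\<^sub>r)H\<close> by \<open>C \<pi>(1\<^sub>r)v = \<pi>(C 1\<^sub>r)v\<close>.
\<close>

definition is_\<pi> ::
  "real \<Rightarrow> real \<Rightarrow> real \<Rightarrow> real set \<Rightarrow> 'h::chilbert_space set \<Rightarrow>
    (su_gen sterm set \<Rightarrow> 'h \<Rightarrow> 'h) \<Rightarrow> bool" where
  "is_\<pi> q y c T H \<pi> \<longleftrightarrow>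
     irreducible_rep (su_alg q y) H \<pi> \<and>
     (\<forall>r\<in>\<Gamma> q y. \<forall>v\<in>H.
        \<pi> (fst (casimir q y) (su_one q y r)) v = complex_of_real c *\<^sub>C \<pi> (su_one q y r) v) \<and>
     T = {r \<in> \<Gamma> q y. \<exists>v\<in>H. \<pi> (su_one q y r) v \<noteq> 0}"

definition admissible :: "real \<Rightarrow> real \<Rightarrow> real \<Rightarrow> real set \<Rightarrow> real set \<Rightarrow> bool" where
  "admissible q x c S T \<longleftrightarrow>
     S \<subseteq> {0<..} \<and> T \<subseteq> {0<..} \<and>
     Zset S \<subseteq> \<Lambda> q (x\<^sup>2) \<and> irreducible_c_set q c (Zset S) \<and>
     Zset T \<subseteq> \<Lambda> q 1 \<and> irreducible_c_set q (- c) (Zset T) \<and>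
     (\<forall>z\<in>Zset S. \<forall>z'\<in>Zset T. \<exists>n::int. z * z' = x\<^sup>2 * q powi (2 * n))"

text \<open>
  \<open>(H, \<pi>)\<close> is an irreducible *-representation \<open>\<pi>\<^sub>S\<^sub>,\<^sub>T\<close> of the dynamical algebra. The unitary
  implementing \<open>\<pi>\<^sub>S\<^sub>,\<^sub>T \<circ> \<Phi> \<cong> \<pi>\<^sub>S \<otimes> \<pi>\<^sub>T\<close> is absorbed into the choice of the tensor product map \<open>t\<close>.
  As \<open>\<pi>\<^sub>S\<close> and \<open>\<pi>\<^sub>T\<close> are unique up to unitary equivalence and have one-dimensional weight
  spaces, fixing the type of their underlying spaces is no restriction.
\<close>

definition is_\<pi>ST ::
  "real \<Rightarrow> real \<Rightarrow> ((su_gen sterm set \<times> su_gen sterm set) sterm set \<Rightarrow> dyn_gen sterm set) \<Rightarrow>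
    real \<Rightarrow> real set \<Rightarrow> real set \<Rightarrow> 'h::chilbert_space set \<Rightarrow> (dyn_gen sterm set \<Rightarrow> 'h \<Rightarrow> 'h) \<Rightarrow> bool"
  where
  "is_\<pi>ST q x \<Phi> c S T H \<pi> \<longleftrightarrow>
     irreducible_rep (dyn_alg q x) H \<pi> \<and>
     (\<exists>(HS :: real ell2 set) \<pi>S (HT :: real ell2 set) \<pi>T t.
        is_\<pi> q x c S HS \<pi>S \<and> is_\<pi> q 1 (- c) T HT \<pi>T \<and>
        tensor_rep (su_alg q x) HS \<pi>S (su_alg q 1) HT \<pi>T H t (\<pi> \<circ> \<Phi>))"

end

theory Submission
  imports Defs
begin

text \<open>
  In a representation of the dynamical algebra the generators, rescaled by the functions \<open>\<tau>\<close>, act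
  between the weight spaces at \<open>(y, z)\<close> as two commuting pairs of ladder operators, shifting
  \<open>y z\<close> and \<open>y / z\<close> respectively, whose Casimir operators are negatives of each other. In an
  irreducible representation the Casimir operator acts as a scalar \<open>c\<close>: the square root of
  \<open>(C - a)\<^sup>2\<close> on a weight space is the limit of an explicit iteration, so an invariant subspace can
  be split off without the spectral theorem. Starting from a weight vector, the ladder operators
  then generate an orthonormal basis indexed by the weights with \<open>y z\<close> in the irreducible \<open>c\<close>-set
  \<open>Z\<^sub>S\<close> and \<open>y / z\<close> in the irreducible \<open>(-c)\<close>-set \<open>Z\<^sub>T\<close>, with matrix coefficients depending only
  on \<open>c\<close>. The substitution \<open>y = r s\<close>, \<open>z = r / s\<close> turns it into the product basis of
  \<open>\<pi>\<^sub>S \<otimes> \<pi>\<^sub>T\<close>. Conversely, the same coefficients define a representation for all admissible \<open>S\<close>, \<open>T\<close>.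
\<close>

text \<open>Write E1, F1 and E2, F2 for the rescaled ladder operators of the two copies. The
  unitarity relations say that F1 E1 + E2 F2 and F1 E1 + F2 E2 act at \<open>(y, z)\<close> by the
  scalars \<open>\<tau> y * \<tau> (q * z)\<close> and \<open>\<tau> (q * y) * \<tau> z\<close>; the
  identity \<open>\<tau> y * \<tau> z = \<tau> (y * z) + \<tau> (y / z)\<close> splits each of them
  into one part per copy, and this makes the two Casimir operators opposite. The parity condition
  linking \<open>S\<close> and \<open>T\<close> comes from
  \<open>y\<^sup>2 = (y * z) * (y / z)\<close> with \<open>y\<close> in
  \<open>\<Lambda> q x\<close>. Two obstacles shape the proof. The algebras have no unit, and
  \<open>\<Phi>\<close> is described only by multipliers acting on its image: the image of a unit
  tensor has to be recovered from non-degeneracy, and inductions over tensors run through local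
  units. Moreover ladders may break off. In a \<open>c\<close>-set the coefficient leading out of
  the set is 0, so the operators can be truncated without spoiling the relations; and whenever two
  products have to cancel, both intermediate points lie in the index set.\<close>

lemma scaleC_one [simp]: "1 *\<^sub>C x = x"
  using scaleR_scaleC[of 1 x] by simp

lemma scaleC_zero_left [simp]: "0 *\<^sub>C x = 0"
  using scaleR_scaleC[of 0 x] by simp

lemma scaleC_zero_right [simp]: "a *\<^sub>C 0 = 0"
  using scaleC_add_right[of a 0 0] by simp

lemma scaleC_minus_right: "a *\<^sub>C (- x) = - (a *\<^sub>C x)"
  using scaleC_add_right[of a x "- x"] by (simp add: eq_neg_iff_add_eq_0 add.commute)

lemma scaleC_minus_left: "(- a) *\<^sub>C x = - (a *\<^sub>C x)"
  using scaleC_add_left[of a "- a" x] by (simp add: eq_neg_iff_add_eq_0 add.commute)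

lemma scaleC_diff_right: "a *\<^sub>C (x - y) = a *\<^sub>C x - a *\<^sub>C y"
  using scaleC_add_right[of a x "- y"] by (simp add: scaleC_minus_right)

lemma scaleC_diff_left: "(a - b) *\<^sub>C x = a *\<^sub>C x - b *\<^sub>C x"
  using scaleC_add_left[of a "- b" x] by (simp add: scaleC_minus_left)

lemma scaleC_left_commute: "a *\<^sub>C (b *\<^sub>C x) = b *\<^sub>C (a *\<^sub>C x)"
  by (simp add: scaleC_scaleC mult.commute)

lemma scaleC_scaleR: "a *\<^sub>C (r *\<^sub>R x) = r *\<^sub>R (a *\<^sub>C x)"
  by (simp add: scaleR_scaleC scaleC_left_commute)

lemma cinner_zero_right [simp]: "cinner x 0 = 0"
  using cinner_add_right[of x 0 0] by simp

lemma cinner_zero_left [simp]: "cinner 0 x = 0"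
  by (subst cinner_commute) simp

lemma cinner_add_left: "cinner (x + y) z = cinner x z + cinner y z"
  by (subst (1 2 3) cinner_commute) (simp add: cinner_add_right)

lemma cinner_scaleC_left: "cinner (a *\<^sub>C x) y = cnj a * cinner x y"
  by (subst (1 2) cinner_commute) (simp add: cinner_scaleC_right)

lemma cinner_minus_right: "cinner x (- y) = - cinner x y"
  using cinner_add_right[of x y "- y"] by (simp add: eq_neg_iff_add_eq_0 add.commute)

lemma cinner_diff_right: "cinner x (y - z) = cinner x y - cinner x z"
  using cinner_add_right[of x y "- z"] by (simp add: cinner_minus_right)

lemma cinner_diff_left: "cinner (x - y) z = cinner x z - cinner y z"
  by (subst (1 2 3) cinner_commute) (simp add: cinner_diff_right)

lemma cinner_scaleR_right: "cinner x (r *\<^sub>R y) = of_real r * cinner x y"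
  by (simp add: scaleR_scaleC cinner_scaleC_right)

lemma cinner_scaleR_left: "cinner (r *\<^sub>R x) y = of_real r * cinner x y"
  by (simp add: scaleR_scaleC cinner_scaleC_left)

lemma cinner_self: "cinner x x = of_real ((norm x)\<^sup>2)"
proof -
  have "Im (cinner x x) = 0"
    using arg_cong[OF cinner_commute[of x x], of Im] by simp
  moreover have "Re (cinner x x) = (norm x)\<^sup>2"
    by (simp add: inner_eq_Re_cinner[symmetric] power2_norm_eq_inner)
  ultimately show ?thesis by (simp add: complex_eq_iff)
qed

lemma norm_scaleC: "norm (a *\<^sub>C x) = cmod a * norm x"
proof -
  have "of_real ((norm (a *\<^sub>C x))\<^sup>2) = cnj a * (a * cinner x x)"
    by (simp only: cinner_self[symmetric] cinner_scaleC_left cinner_scaleC_right mult.left_commute)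
  also have "\<dots> = of_real ((cmod a)\<^sup>2) * of_real ((norm x)\<^sup>2)"
    by (simp add: cinner_self complex_norm_square mult.commute mult.left_commute del: of_real_power)
  finally have "(norm (a *\<^sub>C x))\<^sup>2 = (cmod a * norm x)\<^sup>2"
    by (simp only: of_real_mult[symmetric] of_real_eq_iff power_mult_distrib)
  then show ?thesis by (simp add: power2_eq_iff_nonneg)
qed

text \<open>Multiplying \<open>y\<close> by the phase \<open>a\<close> makes the product real and
  nonnegative, so the Cauchy-Schwarz inequality of the underlying real inner product
  applies.\<close>

lemma cmod_cinner_le: "cmod (cinner x y) \<le> norm x * norm y"
proof (cases "cinner x y = 0")
  case False
  define a where "a = cnj (sgn (cinner x y))"
  have a: "cmod a = 1" using False by (simp add: a_def norm_sgn)
  have "cinner x (a *\<^sub>C y) = of_real (cmod (cinner x y))"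
  proof -
    have "cnj z * z = of_real (cmod z) * of_real (cmod z)" for z
      using complex_norm_square[of z] by (simp add: mult.commute power2_eq_square)
    then show ?thesis using False by (simp add: cinner_scaleC_right a_def sgn_eq)
  qed
  then have "cmod (cinner x y) = inner x (a *\<^sub>C y)" by (simp add: inner_eq_Re_cinner)
  also have "\<dots> \<le> norm x * norm (a *\<^sub>C y)" by (rule norm_cauchy_schwarz)
  finally show ?thesis using a by (simp add: norm_scaleC)
qed simp

lemma bounded_linear_scaleC: "bounded_linear (\<lambda>x. a *\<^sub>C x)"
  by (rule bounded_linear_intro[where K = "cmod a"])
    (simp_all add: scaleC_add_right scaleC_scaleR norm_scaleC mult.commute)

lemma bounded_bilinear_cinner: "bounded_bilinear cinner"
proof
  show "\<exists>K. \<forall>a b. norm (cinner a b) \<le> norm a * norm b * K"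
    by (rule exI[of _ 1]) (simp add: cmod_cinner_le)
qed (simp_all add: cinner_add_left cinner_add_right cinner_scaleR_left cinner_scaleR_right
    scaleR_conv_of_real)

lemmas tendsto_cinner [tendsto_intros] = bounded_bilinear.tendsto[OF bounded_bilinear_cinner]
lemmas continuous_on_cinner [continuous_intros] =
  bounded_bilinear.continuous_on[OF bounded_bilinear_cinner]
lemmas tendsto_scaleC [tendsto_intros] = bounded_linear.tendsto[OF bounded_linear_scaleC]
lemmas continuous_on_scaleC [continuous_intros] =
  bounded_linear.continuous_on[OF bounded_linear_scaleC]

section \<open>Complex subspaces and closed complex spans\<close>

lemma csubspace_imp_subspace: "csubspace W \<Longrightarrow> subspace W"
  unfolding csubspace_def subspace_def by (metis scaleR_scaleC)

lemma csubspace_0: "csubspace W \<Longrightarrow> 0 \<in> W"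
  and csubspace_add: "csubspace W \<Longrightarrow> v \<in> W \<Longrightarrow> w \<in> W \<Longrightarrow> v + w \<in> W"
  and csubspace_scaleC: "csubspace W \<Longrightarrow> v \<in> W \<Longrightarrow> a *\<^sub>C v \<in> W"
  by (auto simp: csubspace_def)

lemma csubspace_diff: "csubspace W \<Longrightarrow> v \<in> W \<Longrightarrow> w \<in> W \<Longrightarrow> v - w \<in> W"
  by (rule subspace_diff[OF csubspace_imp_subspace])

lemma csubspace_sum: "csubspace W \<Longrightarrow> (\<And>i. i \<in> A \<Longrightarrow> f i \<in> W) \<Longrightarrow> sum f A \<in> W"
  by (rule subspace_sum[OF csubspace_imp_subspace])

text \<open>Realised as a real span of complex multiples so that induction over \<open>span\<close>
  remains available.\<close>

definition cspan :: "'h::chilbert_space set \<Rightarrow> 'h set" where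
  "cspan A = span {a *\<^sub>C v | a v. v \<in> A}"

text \<open>A complex multiple of a real combination is the real combination of the complex
  multiples, so closure has to be checked on generators only.\<close>

lemma csubspace_span:
  assumes "\<And>a v. v \<in> A \<Longrightarrow> a *\<^sub>C v \<in> span A"
  shows "csubspace (span A)"
proof -
  have "a *\<^sub>C v \<in> span A" if "v \<in> span A" for a v
    using that
  proof (induction rule: span_induct_alt)
    case (step c x y)
    then show ?case by (simp add: scaleC_add_right scaleC_scaleR assms span_add span_scale)
  qed (simp add: span_zero)
  then show ?thesis by (auto simp: csubspace_def span_add span_zero)
qed

lemma csubspace_cspan: "csubspace (cspan A)"
  unfolding cspan_def by (rule csubspace_span) (rule span_base, use scaleC_scaleC in fastforce)

lemma cspan_superset: "v \<in> A \<Longrightarrow> v \<in> cspan A"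
  unfolding cspan_def by (rule span_base) (auto intro!: exI[of _ 1] exI[of _ v])

lemma cspan_minimal: "A \<subseteq> W \<Longrightarrow> csubspace W \<Longrightarrow> cspan A \<subseteq> W"
  unfolding cspan_def
  by (rule span_minimal) (auto intro: csubspace_scaleC csubspace_imp_subspace)

lemma closureE:
  fixes W :: "'a::metric_space set"
  assumes "v \<in> closure W"
  obtains f where "\<And>n. f n \<in> W" "f \<longlonglongrightarrow> v"
  using assms unfolding closure_sequential by blast

lemma subspace_closure:
  fixes W :: "'a::real_normed_vector set"
  assumes "subspace W"
  shows "subspace (closure W)"
  unfolding subspace_def
proof (intro conjI ballI allI)
  show "0 \<in> closure W" using subspace_0[OF assms] closure_subset by blast
next
  fix v w assume "v \<in> closure W" "w \<in> closure W"
  then obtain f g where fg: "\<And>n. f n \<in> W" "f \<longlonglongrightarrow> v" "\<And>n. g n \<in> W" "g \<longlonglongrightarrow> w"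
    by (auto elim!: closureE)
  then have "(\<lambda>n. f n + g n) \<longlonglongrightarrow> v + w" by (intro tendsto_intros)
  then show "v + w \<in> closure W"
    unfolding closure_sequential using subspace_add[OF assms fg(1) fg(3)]
    by (intro exI[of _ "\<lambda>n. f n + g n"]) auto
next
  fix c v assume "v \<in> closure W"
  then obtain f where f: "\<And>n. f n \<in> W" "f \<longlonglongrightarrow> v" by (rule closureE) blast
  then have "(\<lambda>n. c *\<^sub>R f n) \<longlonglongrightarrow> c *\<^sub>R v" by (intro tendsto_intros)
  then show "c *\<^sub>R v \<in> closure W"
    unfolding closure_sequential using subspace_scale[OF assms f(1)]
    by (intro exI[of _ "\<lambda>n. c *\<^sub>R f n"]) auto
qed

lemma csubspace_closure:
  assumes "csubspace W"
  shows "csubspace (closure W)"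
proof -
  have "subspace (closure W)" by (intro subspace_closure csubspace_imp_subspace assms)
  moreover have "a *\<^sub>C v \<in> closure W" if v: "v \<in> closure W" for a v
  proof -
    obtain f where f: "\<And>n. f n \<in> W" "f \<longlonglongrightarrow> v" using v by (rule closureE) blast
    then have "(\<lambda>n. a *\<^sub>C f n) \<longlonglongrightarrow> a *\<^sub>C v" by (intro tendsto_intros)
    then show ?thesis
      unfolding closure_sequential using f(1) csubspace_scaleC[OF assms]
      by (intro exI[of _ "\<lambda>n. a *\<^sub>C f n"]) auto
  qed
  ultimately show ?thesis by (auto simp: csubspace_def subspace_def)
qed

lemma hilbert_on_closure_cspan: "hilbert_on (closure (cspan A))"
  unfolding hilbert_on_def by (simp add: csubspace_closure csubspace_cspan)

lemma closure_cspan_minimal: "A \<subseteq> W \<Longrightarrow> hilbert_on W \<Longrightarrow> closure (cspan A) \<subseteq> W"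
  unfolding hilbert_on_def by (intro closure_minimal cspan_minimal) auto

lemma closure_cspan_superset: "v \<in> A \<Longrightarrow> v \<in> closure (cspan A)"
  using cspan_superset closure_subset by blast

text \<open>The vectors orthogonal to \<open>v\<close> form a closed complex subspace; once it
  contains \<open>A\<close> it contains \<open>H\<close>, and so \<open>v\<close> itself.\<close>

lemma eq_zero_if_cinner_total:
  assumes "closure (cspan A) = H" "v \<in> H" "\<And>w. w \<in> A \<Longrightarrow> cinner w v = 0"
  shows "v = 0"
proof -
  have "hilbert_on {w. cinner w v = 0}"
    unfolding hilbert_on_def csubspace_def
    by (auto simp: cinner_add_left cinner_scaleC_left intro!: closed_Collect_eq continuous_intros)
  then have "closure (cspan A) \<subseteq> {w. cinner w v = 0}"
    using assms(3) by (intro closure_cspan_minimal) auto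
  then have "cinner v v = 0" using assms by auto
  then show ?thesis by (simp add: cinner_self)
qed

section \<open>Bounded operators on closed subspaces\<close>

lemma clinear_onD:
  assumes "clinear_on H V"
  shows "v \<in> H \<Longrightarrow> w \<in> H \<Longrightarrow> V (v + w) = V v + V w" "v \<in> H \<Longrightarrow> V (a *\<^sub>C v) = a *\<^sub>C V v"
  using assms by (auto simp: clinear_on_def)

lemma clinear_on_0: "clinear_on H V \<Longrightarrow> csubspace H \<Longrightarrow> V 0 = 0"
  using clinear_onD(2)[of H V 0 0] by (simp add: csubspace_0)

lemma clinear_on_diff:
  assumes "clinear_on H V" "csubspace H" "v \<in> H" "w \<in> H"
  shows "V (v - w) = V v - V w"
proof -
  have "V (v - w) + V w = V v"
    using clinear_onD(1)[OF assms(1) csubspace_diff[OF assms(2,3,4)] assms(4)] by simp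
  then show ?thesis by (simp add: eq_diff_eq)
qed

lemma bounded_operator_onD:
  assumes "bounded_operator_on H V"
  shows "v \<in> H \<Longrightarrow> V v \<in> H" "clinear_on H V"
  using assms by (auto simp: bounded_operator_on_def)

lemma bounded_operator_on_bound:
  assumes "bounded_operator_on H V"
  obtains B where "B > 0" "\<And>v. v \<in> H \<Longrightarrow> norm (V v) \<le> B * norm v"
proof -
  obtain B where B: "\<And>v. v \<in> H \<Longrightarrow> norm (V v) \<le> B * norm v"
    using assms by (auto simp: bounded_operator_on_def)
  show ?thesis
  proof (rule that[of "max B 1"])
    fix v assume "v \<in> H"
    then have "norm (V v) \<le> B * norm v" by (rule B)
    also have "\<dots> \<le> max B 1 * norm v" by (intro mult_right_mono) auto
    finally show "norm (V v) \<le> max B 1 * norm v" .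
  qed simp
qed

lemma bounded_operator_on_tendsto:
  assumes V: "bounded_operator_on H V" and "csubspace H"
    and f: "\<And>n. f n \<in> H" "v \<in> H" "f \<longlonglongrightarrow> v"
  shows "(\<lambda>n. V (f n)) \<longlonglongrightarrow> V v"
proof -
  obtain B where B: "\<And>v. v \<in> H \<Longrightarrow> norm (V v) \<le> B * norm v"
    using bounded_operator_on_bound[OF V] by metis
  show ?thesis
  proof (rule Lim_null_comparison[where g = "\<lambda>n. B * norm (f n - v)", THEN LIM_zero_cancel])
    have "norm (V (f n) - V v) \<le> B * norm (f n - v)" for n
      using B[of "f n - v"] clinear_on_diff[OF bounded_operator_onD(2)[OF V] assms(2) f(1) f(2)]
        csubspace_diff[OF assms(2) f(1) f(2)] by simp
    then show "\<forall>\<^sub>F n in sequentially. norm (V (f n) - V v) \<le> B * norm (f n - v)" by simp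
    show "(\<lambda>n. B * norm (f n - v)) \<longlonglongrightarrow> 0"
      using f(3) by (intro tendsto_mult_right_zero tendsto_norm_zero LIM_zero)
  qed
qed

lemma bounded_operator_on_diff:
  assumes "csubspace H" "bounded_operator_on H V" "bounded_operator_on H V'"
  shows "bounded_operator_on H (\<lambda>v. V v - V' v)"
proof -
  obtain B where B: "\<And>v. v \<in> H \<Longrightarrow> norm (V v) \<le> B * norm v"
    using bounded_operator_on_bound[OF assms(2)] by metis
  obtain B' where B': "\<And>v. v \<in> H \<Longrightarrow> norm (V' v) \<le> B' * norm v"
    using bounded_operator_on_bound[OF assms(3)] by metis
  have "norm (V v - V' v) \<le> (B + B') * norm v" if "v \<in> H" for v
    using norm_triangle_ineq4[of "V v" "V' v"] B[OF that] B'[OF that]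
    unfolding distrib_right by linarith
  then show ?thesis
    using assms bounded_operator_onD[OF assms(2)] bounded_operator_onD[OF assms(3)]
    unfolding bounded_operator_on_def clinear_on_def
    by (auto simp: csubspace_diff scaleC_diff_right)
qed

lemma bounded_operator_on_compose:
  assumes "bounded_operator_on H V" "bounded_operator_on H V'"
  shows "bounded_operator_on H (\<lambda>v. V (V' v))"
proof -
  obtain B where B: "B > 0" "\<And>v. v \<in> H \<Longrightarrow> norm (V v) \<le> B * norm v"
    using bounded_operator_on_bound[OF assms(1)] by metis
  obtain B' where B': "\<And>v. v \<in> H \<Longrightarrow> norm (V' v) \<le> B' * norm v"
    using bounded_operator_on_bound[OF assms(2)] by metis
  have "norm (V (V' v)) \<le> (B * B') * norm v" if "v \<in> H" for v
  proof -
    have "norm (V (V' v)) \<le> B * norm (V' v)"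
      using B(2) bounded_operator_onD(1)[OF assms(2) that] by blast
    also have "\<dots> \<le> B * (B' * norm v)" using B(1) B'[OF that] by simp
    finally show ?thesis by (simp add: mult.assoc)
  qed
  then show ?thesis
    using bounded_operator_onD[OF assms(1)] bounded_operator_onD[OF assms(2)]
    unfolding bounded_operator_on_def clinear_on_def by auto
qed

lemma bounded_operator_on_scaleC:
  assumes "csubspace H" "bounded_operator_on H V"
  shows "bounded_operator_on H (\<lambda>v. a *\<^sub>C V v)"
proof -
  obtain B where B: "\<And>v. v \<in> H \<Longrightarrow> norm (V v) \<le> B * norm v"
    using bounded_operator_on_bound[OF assms(2)] by metis
  have "norm (a *\<^sub>C V v) \<le> (cmod a * B) * norm v" if "v \<in> H" for v
    using mult_left_mono[OF B[OF that], of "cmod a"] by (simp add: norm_scaleC mult.assoc)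
  then show ?thesis
    using assms bounded_operator_onD[OF assms(2)]
    unfolding bounded_operator_on_def clinear_on_def
    by (auto simp: csubspace_scaleC scaleC_add_right scaleC_left_commute)
qed

lemma hilbert_on_kernel:
  assumes H: "hilbert_on H" and V: "bounded_operator_on H V"
  shows "hilbert_on {v \<in> H. V v = 0}"
proof -
  have H': "csubspace H" "closed H" using H by (auto simp: hilbert_on_def)
  have "csubspace {v \<in> H. V v = 0}"
    using H'(1) clinear_onD[OF bounded_operator_onD(2)[OF V]]
      clinear_on_0[OF bounded_operator_onD(2)[OF V] H'(1)]
    unfolding csubspace_def by auto
  moreover have "closed {v \<in> H. V v = 0}"
    unfolding closed_sequential_limits
  proof (intro allI impI)
    fix f l assume f: "(\<forall>n. f n \<in> {v \<in> H. V v = 0}) \<and> f \<longlonglongrightarrow> l"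
    then have l: "l \<in> H" using H'(2) unfolding closed_sequential_limits by blast
    have "(\<lambda>n. V (f n)) \<longlonglongrightarrow> V l"
      using f l by (intro bounded_operator_on_tendsto[OF V H'(1)]) auto
    then have "V l = 0" using f by (simp add: LIMSEQ_const_iff)
    then show "l \<in> {v \<in> H. V v = 0}" using l by simp
  qed
  ultimately show ?thesis by (simp add: hilbert_on_def)
qed

text \<open>The kernel of \<open>V - V'\<close> is a closed complex subspace, so agreement on a
  total set suffices.\<close>

lemma bounded_operator_on_eqI:
  assumes V: "bounded_operator_on H V" "bounded_operator_on H V'"
    and "A \<subseteq> H" "closure (cspan A) = H" "\<And>v. v \<in> A \<Longrightarrow> V v = V' v" "v \<in> H"
  shows "V v = V' v"
proof -
  have H: "hilbert_on H" using assms(4) hilbert_on_closure_cspan by blast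
  then have "hilbert_on {v \<in> H. V v - V' v = 0}"
    using V by (intro hilbert_on_kernel bounded_operator_on_diff) (auto simp: hilbert_on_def)
  then have "closure (cspan A) \<subseteq> {v \<in> H. V v - V' v = 0}"
    using assms(3,5) by (intro closure_cspan_minimal) auto
  then show ?thesis using assms(4,6) by auto
qed

subsection \<open>Unitaries from equal Gram matrices\<close>

text \<open>Along an isometric graph, Cauchy sequences in the first coordinate are Cauchy in the
  second, so by completeness limits lift to the closed graph. This is how a map on a dense span is
  extended.\<close>

lemma fst_closure_isometric_graph:
  fixes G :: "('h::chilbert_space \<times> 'k::chilbert_space) set"
  assumes G: "subspace G" "\<And>p. p \<in> G \<Longrightarrow> norm (fst p) = norm (snd p)"
  shows "fst ` closure G = closure (fst ` G)"
proof
  have "continuous_on (closure G) fst" by (intro continuous_intros)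
  then show "fst ` closure G \<subseteq> closure (fst ` G)"
    by (rule image_closure_subset) (auto intro: closure_subset[THEN subsetD])
  show "closure (fst ` G) \<subseteq> fst ` closure G"
  proof
    fix v assume "v \<in> closure (fst ` G)"
    then obtain g where g: "\<And>n. g n \<in> fst ` G" "g \<longlonglongrightarrow> v" by (auto simp: closure_sequential)
    then have "\<forall>n. \<exists>p. p \<in> G \<and> fst p = g n" by (force simp: image_iff)
    then obtain p where p: "\<And>n. p n \<in> G" "\<And>n. fst (p n) = g n" by metis
    have "dist (snd (p m)) (snd (p n)) = dist (g m) (g n)" for m n
      using G(2)[OF subspace_diff[OF G(1) p(1)[of m] p(1)[of n]]] by (simp add: dist_norm p(2))
    moreover have "Cauchy g" using g(2) by (rule LIMSEQ_imp_Cauchy)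
    ultimately have "Cauchy (\<lambda>n. snd (p n))" by (simp add: Cauchy_def)
    then obtain w where w: "(\<lambda>n. snd (p n)) \<longlonglongrightarrow> w"
      using Cauchy_convergent convergentD by blast
    have "p = (\<lambda>n. (g n, snd (p n)))" using p(2) by (metis prod.collapse)
    moreover have "(\<lambda>n. (g n, snd (p n))) \<longlonglongrightarrow> (v, w)" by (intro tendsto_Pair g(2) w)
    ultimately have "p \<longlonglongrightarrow> (v, w)" by simp
    then have "(v, w) \<in> closure G" using p(1) by (auto simp: closure_sequential)
    then show "v \<in> fst ` closure G" by force
  qed
qed

text \<open>The swap is continuous and its own inverse, so one inclusion used twice gives equality.
  It transfers \<open>fst_closure_isometric_graph\<close> to the second projection.\<close>

lemma closure_swap:
  fixes G :: "('a::metric_space \<times> 'b::metric_space) set"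
  shows "prod.swap ` closure G = closure (prod.swap ` G)"
proof -
  have sub: "prod.swap ` closure K \<subseteq> closure (prod.swap ` K)"
    for K :: "('c::metric_space \<times> 'd::metric_space) set"
    by (rule image_closure_subset)
      (auto intro: continuous_on_swap closure_subset[THEN subsetD])
  have "prod.swap ` closure (prod.swap ` G) \<subseteq> closure G"
    using sub[of "prod.swap ` G"] by (simp add: image_image)
  then have "closure (prod.swap ` G) \<subseteq> prod.swap ` closure G"
    by (force simp: image_iff)
  then show ?thesis using sub[of G] by blast
qed

text \<open>The unitary is built as a closed graph, not by formulas on linear combinations: equal
  Gram matrices make the span of the pairs \<open>(f a, f' a)\<close> isometric, and an isometric
  linear graph is single-valued. Linear dependencies within the families thus need no separate
  treatment.\<close>

lemma unitary_of_equal_gram: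
  fixes f :: "'x \<Rightarrow> 'h::chilbert_space" and f' :: "'x \<Rightarrow> 'k::chilbert_space"
  assumes gram: "\<And>a b. a \<in> X \<Longrightarrow> b \<in> X \<Longrightarrow> cinner (f a) (f b) = cinner (f' a) (f' b)"
    and H: "closure (cspan (f ` X)) = H" and H': "closure (cspan (f' ` X)) = H'"
  obtains V where "unitary_on H H' V" "\<And>a. a \<in> X \<Longrightarrow> V (f a) = f' a"
proof -
  \<comment> \<open>Complex multiples are put among the generators because \<open>span\<close> is
    real.\<close>
  define B where "B = {(c *\<^sub>C f a, c *\<^sub>C f' a) | c a. a \<in> X}"
  define G where "G = span B"
  have iso0: "cinner (fst p) (fst p') = cinner (snd p) (snd p')" if "p \<in> G" "p' \<in> G" for p p'
    using that(1) unfolding G_def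
  proof (induction rule: span_induct_alt)
    case (step c x y)
    have "cinner (fst x) (fst p') = cinner (snd x) (snd p')"
      using that(2) unfolding G_def
    proof (induction rule: span_induct_alt)
      case (step c' x' y')
      then show ?case using \<open>x \<in> B\<close>
        by (auto simp: B_def cinner_add_right cinner_scaleR_right cinner_scaleC_left
            cinner_scaleC_right gram)
    qed simp
    then show ?case using step by (simp add: cinner_add_left cinner_scaleR_left)
  qed simp
  have iso: "cinner (fst p) (fst p') = cinner (snd p) (snd p')"
    if pp: "p \<in> closure G" "p' \<in> closure G" for p p'
  proof -
    obtain g g' where g: "\<And>n. g n \<in> G" "g \<longlonglongrightarrow> p" "\<And>n. g' n \<in> G" "g' \<longlonglongrightarrow> p'"
      using closureE[OF pp(1)] closureE[OF pp(2)] by metis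
    have "(\<lambda>n. cinner (fst (g n)) (fst (g' n))) \<longlonglongrightarrow> cinner (fst p) (fst p')"
      "(\<lambda>n. cinner (snd (g n)) (snd (g' n))) \<longlonglongrightarrow> cinner (snd p) (snd p')"
      by (intro tendsto_intros g)+
    then show ?thesis using iso0[OF g(1) g(3)] LIMSEQ_unique by auto
  qed
  have nrm: "norm (fst p) = norm (snd p)" if "p \<in> closure G" for p
    using iso[OF that that] by (simp add: cinner_self power2_eq_iff_nonneg flip: of_real_power)
  have sG: "subspace G" by (simp add: G_def)
  have scB: "(a *\<^sub>C fst p, a *\<^sub>C snd p) \<in> G" if "p \<in> G" for a p
    using that unfolding G_def
  proof (induction rule: span_induct_alt)
    case (step c x y)
    have "(a *\<^sub>C fst x, a *\<^sub>C snd x) \<in> span B"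
      using step(1) by (intro span_base) (fastforce simp: B_def scaleC_scaleC)
    then have "c *\<^sub>R (a *\<^sub>C fst x, a *\<^sub>C snd x) + (a *\<^sub>C fst y, a *\<^sub>C snd y) \<in> span B"
      by (intro span_add span_scale step)
    then show ?case by (simp add: scaleC_add_right scaleC_scaleR)
  qed (auto simp: span_zero zero_prod_def[symmetric])
  have sc: "(a *\<^sub>C v, a *\<^sub>C w) \<in> closure G" if vw: "(v, w) \<in> closure G" for a v w
  proof -
    obtain g where g: "\<And>n. g n \<in> G" "g \<longlonglongrightarrow> (v, w)" using vw by (auto simp: closure_sequential)
    have "(\<lambda>n. (a *\<^sub>C fst (g n), a *\<^sub>C snd (g n))) \<longlonglongrightarrow> (a *\<^sub>C fst (v, w), a *\<^sub>C snd (v, w))"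
      by (intro tendsto_intros g)
    then show ?thesis using scB[OF g(1)] unfolding closure_sequential
      by (intro exI[of _ "\<lambda>n. (a *\<^sub>C fst (g n), a *\<^sub>C snd (g n))"]) auto
  qed
  have sub: "subspace (closure G)" by (rule subspace_closure[OF sG])
  have img: "fst ` G = cspan (f ` X)" "snd ` G = cspan (f' ` X)"
  proof -
    have "fst ` B = {c *\<^sub>C v | c v. v \<in> f ` X}" "snd ` B = {c *\<^sub>C v | c v. v \<in> f' ` X}"
      unfolding B_def by force+
    then show "fst ` G = cspan (f ` X)" "snd ` G = cspan (f' ` X)"
      unfolding G_def cspan_def
      using linear_span_image[OF bounded_linear.linear[OF bounded_linear_fst], of B]
        linear_span_image[OF bounded_linear.linear[OF bounded_linear_snd], of B] by simp_all
  qed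
  have fstH: "fst ` closure G = H"
    unfolding H[symmetric] img(1)[symmetric]
    by (rule fst_closure_isometric_graph[OF sG]) (use nrm closure_subset in blast)
  have sndH: "snd ` closure G = H'"
  proof -
    have "fst ` closure (prod.swap ` G) = closure (fst ` (prod.swap ` G))"
    proof (rule fst_closure_isometric_graph)
      have "linear (prod.swap :: 'h \<times> 'k \<Rightarrow> _)" by (rule linearI) auto
      then show "subspace (prod.swap ` G)" using sG by (rule linear_subspace_image)
    next
      fix p assume "p \<in> prod.swap ` G"
      then show "norm (fst p) = norm (snd p)" using nrm closure_subset[of G] by fastforce
    qed
    moreover have "prod.swap ` closure G = closure (prod.swap ` G)"
      by (rule closure_swap)
    ultimately show ?thesis unfolding H'[symmetric] img(2)[symmetric]
      by (metis (no_types, lifting) fst_swap image_cong image_image)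
  qed
  define V where "V v = (SOME w. (v, w) \<in> closure G)" for v
  have V: "(v, V v) \<in> closure G" if "v \<in> H" for v
    using that unfolding V_def fstH[symmetric] by (auto intro: someI)
  \<comment> \<open>The difference of two pairs over \<open>v\<close> has first component 0, hence
    second component of norm 0.\<close>
  have uniq: "w = w'" if "(v, w) \<in> closure G" "(v, w') \<in> closure G" for v w w'
    using nrm[OF subspace_diff[OF sub that]] by simp
  have "unitary_on H H' V"
    unfolding unitary_on_def clinear_on_def
  proof (intro conjI ballI allI)
    fix v w assume "v \<in> H" "w \<in> H"
    then show "cinner (V v) (V w) = cinner v w"
      using iso[OF V V] by simp
    have "(v, V v) + (w, V w) \<in> closure G"
      using V \<open>v \<in> H\<close> \<open>w \<in> H\<close> by (intro subspace_add[OF sub])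
    moreover have "v + w \<in> H"
      using \<open>v \<in> H\<close> \<open>w \<in> H\<close> hilbert_on_closure_cspan[of "f ` X"] csubspace_add
      unfolding H hilbert_on_def by blast
    ultimately show "V (v + w) = V v + V w"
      using uniq[OF V[of "v + w"]] by simp
  next
    fix a v assume "v \<in> H"
    moreover have "a *\<^sub>C v \<in> H"
      using \<open>v \<in> H\<close> hilbert_on_closure_cspan[of "f ` X"] csubspace_scaleC
      unfolding H hilbert_on_def by blast
    ultimately show "V (a *\<^sub>C v) = a *\<^sub>C V v"
      using uniq[OF V sc[OF V]] by simp
  next
    show "V ` H = H'"
    proof
      show "V ` H \<subseteq> H'" using V sndH by force
      show "H' \<subseteq> V ` H"
      proof
        fix w assume "w \<in> H'"
        then obtain v where v: "(v, w) \<in> closure G" unfolding sndH[symmetric] by auto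
        then have "v \<in> H" using fstH by force
        then show "w \<in> V ` H" using uniq[OF V v] by blast
      qed
    qed
  qed
  moreover have "V (f a) = f' a" if "a \<in> X" for a
  proof (rule uniq)
    show "(f a, V (f a)) \<in> closure G"
      using that by (intro V) (auto simp: H[symmetric] intro: closure_cspan_superset)
    have "(1 *\<^sub>C f a, 1 *\<^sub>C f' a) \<in> B" using that unfolding B_def by blast
    then show "(f a, f' a) \<in> closure G"
      unfolding G_def using span_base closure_subset by fastforce
  qed
  ultimately show ?thesis by (rule that)
qed

lemma unitary_onD:
  assumes "unitary_on H H' V"
  shows "clinear_on H V" "V ` H = H'" "v \<in> H \<Longrightarrow> V v \<in> H'"
    "v \<in> H \<Longrightarrow> w \<in> H \<Longrightarrow> cinner (V v) (V w) = cinner v w"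
  using assms by (auto simp: unitary_on_def)

subsection \<open>Presented star algebras\<close>

lemma pres_cls_eq_iff: "pres_cls Rel s = pres_cls Rel t \<longleftrightarrow> pres_cong Rel s t"
  unfolding pres_cls_def by (blast intro: pres_cong.refl pres_cong.sym pres_cong.trans)

lemma mem_pres_cls: "t \<in> pres_cls Rel s \<longleftrightarrow> pres_cong Rel s t"
  by (simp add: pres_cls_def)

lemma pres_cls_eqI: "pres_cong Rel s t \<Longrightarrow> pres_cls Rel s = pres_cls Rel t"
  by (simp add: pres_cls_eq_iff)

text \<open>The operations of \<open>pres_alg\<close> are unions over all representatives; since
  \<open>pres_cong\<close> is a congruence, all classes in such a union coincide.\<close>

lemma pres_alg_simps:
  "zero (pres_alg G Rel) = pres_cls Rel TZero"
  "pres_cls Rel s \<oplus>\<^bsub>pres_alg G Rel\<^esub> pres_cls Rel t = pres_cls Rel (TAdd s t)"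
  "pres_cls Rel s \<otimes>\<^bsub>pres_alg G Rel\<^esub> pres_cls Rel t = pres_cls Rel (TMult s t)"
  "c \<odot>\<^bsub>pres_alg G Rel\<^esub> pres_cls Rel s = pres_cls Rel (TScale c s)"
  "adj (pres_alg G Rel) (pres_cls Rel s) = pres_cls Rel (TStar s)"
proof -
  have refl: "s \<in> pres_cls Rel s" for s by (simp add: mem_pres_cls pres_cong.refl)
  have 2: "(\<Union>s\<in>pres_cls Rel s. \<Union>t\<in>pres_cls Rel t. pres_cls Rel (f s t)) = pres_cls Rel (f s t)"
    if f: "\<And>s s' t t'. pres_cong Rel s s' \<Longrightarrow> pres_cong Rel t t' \<Longrightarrow> pres_cong Rel (f s t) (f s' t')"
    for f :: "'a sterm \<Rightarrow> 'a sterm \<Rightarrow> 'a sterm" and s t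
  proof -
    have "pres_cls Rel (f s' t') = pres_cls Rel (f s t)"
      if "s' \<in> pres_cls Rel s" "t' \<in> pres_cls Rel t" for s' t'
      by (rule f[THEN pres_cls_eqI, symmetric]) (use that in \<open>auto simp only: mem_pres_cls\<close>)
    then have "(\<Union>s'\<in>pres_cls Rel s. \<Union>t'\<in>pres_cls Rel t. pres_cls Rel (f s' t')) =
        (\<Union>s'\<in>pres_cls Rel s. \<Union>t'\<in>pres_cls Rel t. pres_cls Rel (f s t))"
      by (intro SUP_cong HOL.refl)
    also have "\<dots> = pres_cls Rel (f s t)" using refl by (metis UN_constant empty_iff)
    finally show ?thesis .
  qed
  have 1: "(\<Union>s\<in>pres_cls Rel s. pres_cls Rel (f s)) = pres_cls Rel (f s)"
    if "\<And>s s'. pres_cong Rel s s' \<Longrightarrow> pres_cong Rel (f s) (f s')"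
    for f :: "'a sterm \<Rightarrow> 'a sterm" and s
  proof -
    have "(\<Union>s'\<in>pres_cls Rel s. pres_cls Rel (f s')) =
        (\<Union>s'\<in>pres_cls Rel s. \<Union>t'\<in>pres_cls Rel s. pres_cls Rel (f s'))"
      using refl by (metis UN_constant empty_iff)
    also have "\<dots> = pres_cls Rel (f s)" by (rule 2) (rule that)
    finally show ?thesis .
  qed
  show "zero (pres_alg G Rel) = pres_cls Rel TZero" by (simp add: pres_alg_def)
  show "pres_cls Rel s \<oplus>\<^bsub>pres_alg G Rel\<^esub> pres_cls Rel t = pres_cls Rel (TAdd s t)"
    by (simp add: pres_alg_def 2[of TAdd] pres_cong.cong_add)
  show "pres_cls Rel s \<otimes>\<^bsub>pres_alg G Rel\<^esub> pres_cls Rel t = pres_cls Rel (TMult s t)"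
    by (simp add: pres_alg_def 2[of TMult] pres_cong.cong_mult)
  show "c \<odot>\<^bsub>pres_alg G Rel\<^esub> pres_cls Rel s = pres_cls Rel (TScale c s)"
    by (simp add: pres_alg_def 1[of "TScale c"] pres_cong.cong_scale)
  show "adj (pres_alg G Rel) (pres_cls Rel s) = pres_cls Rel (TStar s)"
    by (simp add: pres_alg_def 1[of TStar] pres_cong.cong_star)
qed

lemma pres_alg_carrier: "carrier (pres_alg G Rel) = {pres_cls Rel s | s. set_sterm s \<subseteq> G}"
  by (simp add: pres_alg_def)

lemma pres_cls_closed [simp, intro]: "set_sterm s \<subseteq> G \<Longrightarrow> pres_cls Rel s \<in> carrier (pres_alg G Rel)"
  by (auto simp: pres_alg_carrier)

lemma pres_algE:
  assumes "X \<in> carrier (pres_alg G Rel)"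
  obtains s where "set_sterm s \<subseteq> G" "X = pres_cls Rel s"
  using assms by (auto simp: pres_alg_carrier)

text \<open>The computational laws of a presented algebra, without a unit; the record field
  \<open>one\<close> stays unspecified. Annihilation by \<open>\<zero>\<close> is derived from
  \<open>smult_zero\<close>.\<close>

locale star_alg =
  fixes A :: "'a star_algebra" (structure)
  assumes abel: "abelian_group A"
    and m_closed [simp, intro]: "a \<in> carrier A \<Longrightarrow> b \<in> carrier A \<Longrightarrow> a \<otimes> b \<in> carrier A"
    and smult_closed [simp, intro]: "a \<in> carrier A \<Longrightarrow> c \<odot> a \<in> carrier A"
    and adj_closed [simp, intro]: "a \<in> carrier A \<Longrightarrow> adj A a \<in> carrier A"
    and m_assoc: "a \<in> carrier A \<Longrightarrow> b \<in> carrier A \<Longrightarrow> d \<in> carrier A \<Longrightarrow>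
      (a \<otimes> b) \<otimes> d = a \<otimes> (b \<otimes> d)"
    and l_distr: "a \<in> carrier A \<Longrightarrow> b \<in> carrier A \<Longrightarrow> d \<in> carrier A \<Longrightarrow>
      (a \<oplus> b) \<otimes> d = a \<otimes> d \<oplus> b \<otimes> d"
    and r_distr: "a \<in> carrier A \<Longrightarrow> b \<in> carrier A \<Longrightarrow> d \<in> carrier A \<Longrightarrow>
      d \<otimes> (a \<oplus> b) = d \<otimes> a \<oplus> d \<otimes> b"
    and smult_l: "a \<in> carrier A \<Longrightarrow> b \<in> carrier A \<Longrightarrow> (c \<odot> a) \<otimes> b = c \<odot> (a \<otimes> b)"
    and smult_r: "a \<in> carrier A \<Longrightarrow> b \<in> carrier A \<Longrightarrow> a \<otimes> (c \<odot> b) = c \<odot> (a \<otimes> b)"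
    and smult_smult: "a \<in> carrier A \<Longrightarrow> c \<odot> (c' \<odot> a) = (c * c') \<odot> a"
    and smult_one [simp]: "a \<in> carrier A \<Longrightarrow> 1 \<odot> a = a"
    and smult_zero [simp]: "a \<in> carrier A \<Longrightarrow> 0 \<odot> a = \<zero>"
    and adj_mult: "a \<in> carrier A \<Longrightarrow> b \<in> carrier A \<Longrightarrow> adj A (a \<otimes> b) = adj A b \<otimes> adj A a"
    and adj_adj [simp]: "a \<in> carrier A \<Longrightarrow> adj A (adj A a) = a"
begin

sublocale abelian_group A by (rule abel)

lemma zero_mult [simp]: "a \<in> carrier A \<Longrightarrow> \<zero> \<otimes> a = \<zero>"
  using smult_l[of a a 0] by simp

lemma mult_zero [simp]: "a \<in> carrier A \<Longrightarrow> a \<otimes> \<zero> = \<zero>"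
  using smult_r[of a a 0] by simp

text \<open>The index set is filtered by nonvanishing of the terms, as in \<open>strict_sum\<close>;
  the index \<open>i0\<close> itself drops out when its term is zero, whence the case
  distinction.\<close>

lemma finsum_single:
  assumes "i0 \<in> I" "f i0 \<in> carrier A" "\<And>i. i \<in> I \<Longrightarrow> i \<noteq> i0 \<Longrightarrow> f i = \<zero>"
  shows "(\<Oplus>i\<in>{i\<in>I. f i \<noteq> \<zero>}. f i) = f i0"
proof (cases "f i0 = \<zero>")
  case True
  then have "{i\<in>I. f i \<noteq> \<zero>} = {}" using assms by auto
  then show ?thesis using True by (simp only: finsum_empty)
next
  case False
  then have "{i\<in>I. f i \<noteq> \<zero>} = {i0}" using assms by auto
  then show ?thesis using assms(2) by simp
qed

lemma finsum_none:
  assumes "\<And>i. i \<in> I \<Longrightarrow> f i = \<zero>"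
  shows "(\<Oplus>i\<in>{i\<in>I. f i \<noteq> \<zero>}. f i) = \<zero>"
proof -
  have "{i\<in>I. f i \<noteq> \<zero>} = {}" using assms by auto
  then show ?thesis by (simp only: finsum_empty)
qed

end

text \<open>The congruence has no rule for the scalar 0; it is reached through
  \<open>0 = - 1 + 1\<close> and \<open>add_neg\<close>.\<close>

lemma pres_cong_smult_zero: "pres_cong Rel (TScale 0 s) TZero"
proof -
  have "pres_cong Rel (TScale (- 1 + 1) s) (TAdd (TScale (- 1) s) (TScale 1 s))"
    by (rule pres_cong.scale_add_left)
  moreover have "pres_cong Rel (TAdd (TScale (- 1) s) (TScale 1 s)) (TAdd (TScale (- 1) s) s)"
    by (intro pres_cong.cong_add pres_cong.refl pres_cong.scale_one)
  moreover have "pres_cong Rel (TAdd (TScale (- 1) s) s) TZero" by (rule pres_cong.add_neg)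
  ultimately have "pres_cong Rel (TScale (- 1 + 1) s) TZero" by (blast intro: pres_cong.trans)
  then show ?thesis by simp
qed

lemma star_alg_pres_alg: "star_alg (pres_alg G Rel)"
proof -
  let ?A = "pres_alg G Rel"
  note s = pres_alg_simps[of G Rel]
  note law = pres_cong.add_assoc[THEN pres_cls_eqI] pres_cong.add_zero[THEN pres_cls_eqI]
    pres_cong.add_neg[THEN pres_cls_eqI] pres_cong_smult_zero[THEN pres_cls_eqI]
    pres_cong.mult_assoc[THEN pres_cls_eqI] pres_cong.mult_add_left[THEN pres_cls_eqI]
    pres_cong.mult_add_right[THEN pres_cls_eqI] pres_cong.mult_scale_left[THEN pres_cls_eqI]
    pres_cong.mult_scale_right[THEN pres_cls_eqI] pres_cong.scale_scale[THEN pres_cls_eqI]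
    pres_cong.scale_one[THEN pres_cls_eqI] pres_cong.star_mult[THEN pres_cls_eqI]
    pres_cong.star_star[THEN pres_cls_eqI]
  have grp: "abelian_group ?A"
  proof (rule abelian_groupI)
    fix X assume "X \<in> carrier ?A"
    then obtain t where "set_sterm t \<subseteq> G" "X = pres_cls Rel t" by (rule pres_algE)
    then show "\<exists>Y\<in>carrier ?A. Y \<oplus>\<^bsub>?A\<^esub> X = \<zero>\<^bsub>?A\<^esub>"
      by (intro bexI[of _ "pres_cls Rel (TScale (- 1) t)"]) (simp_all add: s law)
  next
    fix X Y assume "X \<in> carrier ?A" "Y \<in> carrier ?A"
    then show "X \<oplus>\<^bsub>?A\<^esub> Y = Y \<oplus>\<^bsub>?A\<^esub> X"
      by (elim pres_algE) (simp add: s pres_cong.add_commute[THEN pres_cls_eqI])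
  qed ((elim pres_algE)?; simp add: s law)+
  show ?thesis
    by (rule star_alg.intro, rule grp) ((elim pres_algE)?; simp add: s law)+
qed

text \<open>
  When the span of the generators is closed under the adjoint, every element is a linear
  combination of words in the generators.
\<close>

lemma pres_alg_induct [consumes 1, case_names star zero add smult gen mult]:
  assumes X: "X \<in> carrier (pres_alg G Rel)"
    and star: "\<And>g. g \<in> G \<Longrightarrow> \<exists>h\<in>G. \<exists>c. pres_cong Rel (TStar (Gen g)) (TScale c (Gen h))"
    and zero: "P \<zero>\<^bsub>pres_alg G Rel\<^esub>"
    and add: "\<And>X Y. X \<in> carrier (pres_alg G Rel) \<Longrightarrow> Y \<in> carrier (pres_alg G Rel) \<Longrightarrow>
      P X \<Longrightarrow> P Y \<Longrightarrow> P (X \<oplus>\<^bsub>pres_alg G Rel\<^esub> Y)"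
    and smult: "\<And>c X. X \<in> carrier (pres_alg G Rel) \<Longrightarrow> P X \<Longrightarrow> P (c \<odot>\<^bsub>pres_alg G Rel\<^esub> X)"
    and gen: "\<And>g. g \<in> G \<Longrightarrow> P (pres_cls Rel (Gen g))"
    and mult: "\<And>g X. g \<in> G \<Longrightarrow> X \<in> carrier (pres_alg G Rel) \<Longrightarrow> P X \<Longrightarrow>
      P (pres_cls Rel (Gen g) \<otimes>\<^bsub>pres_alg G Rel\<^esub> X)"
  shows "P X"
proof -
  let ?A = "pres_alg G Rel"
  interpret star_alg ?A by (rule star_alg_pres_alg)
  note s = pres_alg_simps[of G Rel]
  \<comment> \<open>The predicate is strengthened by stability under left multiplication by
    \<open>X\<close>, so that arbitrary products reduce to left multiplication by single
    generators.\<close>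
  define Q where "Q X \<longleftrightarrow> X \<in> carrier ?A \<and> P X \<and>
    (\<forall>Y\<in>carrier ?A. P Y \<longrightarrow> P (X \<otimes>\<^bsub>?A\<^esub> Y))" for X
  have Qgen: "Q (pres_cls Rel (Gen g))" if "g \<in> G" for g
    using that by (auto simp: Q_def gen mult)
  have Qzero: "Q (pres_cls Rel TZero)"
    using zero zero_closed by (auto simp: Q_def s(1)[symmetric])
  have Qadd: "Q X \<Longrightarrow> Q Y \<Longrightarrow> Q (X \<oplus>\<^bsub>?A\<^esub> Y)" for X Y
    by (auto simp: Q_def l_distr add)
  have Qsmult: "Q X \<Longrightarrow> Q (c \<odot>\<^bsub>?A\<^esub> X)" for c X
    by (auto simp: Q_def smult_l smult)
  have Qmult: "Q X \<Longrightarrow> Q Y \<Longrightarrow> Q (X \<otimes>\<^bsub>?A\<^esub> Y)" for X Y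
    by (auto simp: Q_def m_assoc)
  \<comment> \<open>A term and its adjoint are treated together, because the adjoint of a product
    involves the adjoints of both factors.\<close>
  have Q: "Q (pres_cls Rel t) \<and> Q (pres_cls Rel (TStar t))" if "set_sterm t \<subseteq> G" for t
    using that
  proof (induction t)
    case (Gen g)
    then obtain h c where h: "h \<in> G" "pres_cong Rel (TStar (Gen g)) (TScale c (Gen h))"
      using star[of g] by auto
    then show ?case
      using Qgen Gen Qsmult[OF Qgen[OF h(1)], of c] by (simp add: s pres_cls_eqI[OF h(2)])
  next
    case TZero
    \<comment> \<open>Zero is written as a multiple with scalar 0, and the scalar is then moved out
      of the adjoint.\<close>
    have "pres_cong Rel (TStar TZero) (TStar (TScale 0 TZero))"
      by (intro pres_cong.cong_star pres_cong.sym[OF pres_cong_smult_zero])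
    then have "pres_cong Rel (TStar TZero) (TScale (cnj 0) (TStar TZero))"
      by (rule pres_cong.trans) (rule pres_cong.star_scale)
    then have "pres_cong Rel (TStar TZero) TZero"
      by (rule pres_cong.trans) (simp add: pres_cong_smult_zero)
    then show ?case using Qzero by (simp add: pres_cls_eqI)
  next
    case (TAdd t u)
    then show ?case
      using Qadd[of "pres_cls Rel t" "pres_cls Rel u"]
        Qadd[of "pres_cls Rel (TStar t)" "pres_cls Rel (TStar u)"]
      by (simp add: s pres_cls_eqI[OF pres_cong.star_add])
  next
    case (TScale c t)
    then show ?case
      using Qsmult[of "pres_cls Rel t" c] Qsmult[of "pres_cls Rel (TStar t)" "cnj c"]
      by (simp add: s pres_cls_eqI[OF pres_cong.star_scale])
  next
    case (TMult t u)
    then show ?case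
      using Qmult[of "pres_cls Rel t" "pres_cls Rel u"]
        Qmult[of "pres_cls Rel (TStar u)" "pres_cls Rel (TStar t)"]
      by (simp add: s pres_cls_eqI[OF pres_cong.star_mult])
  next
    case (TStar t)
    then show ?case by (simp add: pres_cls_eqI[OF pres_cong.star_star])
  qed
  obtain t where "set_sterm t \<subseteq> G" "X = pres_cls Rel t" using X by (rule pres_algE)
  then show ?thesis using Q[of t] by (simp add: Q_def)
qed

subsection \<open>Representations\<close>

lemma star_repD:
  assumes "star_rep A H \<pi>"
  shows "hilbert_on H" "csubspace H" "closed H" "a \<in> carrier A \<Longrightarrow> bounded_operator_on H (\<pi> a)"
    "a \<in> carrier A \<Longrightarrow> v \<in> H \<Longrightarrow> \<pi> a v \<in> H"
    "a \<in> carrier A \<Longrightarrow> b \<in> carrier A \<Longrightarrow> v \<in> H \<Longrightarrow> \<pi> (a \<oplus>\<^bsub>A\<^esub> b) v = \<pi> a v + \<pi> b v"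
    "a \<in> carrier A \<Longrightarrow> b \<in> carrier A \<Longrightarrow> v \<in> H \<Longrightarrow> \<pi> (a \<otimes>\<^bsub>A\<^esub> b) v = \<pi> a (\<pi> b v)"
    "a \<in> carrier A \<Longrightarrow> v \<in> H \<Longrightarrow> \<pi> (c \<odot>\<^bsub>A\<^esub> a) v = c *\<^sub>C \<pi> a v"
    "a \<in> carrier A \<Longrightarrow> v \<in> H \<Longrightarrow> w \<in> H \<Longrightarrow> cinner (\<pi> (adj A a) v) w = cinner v (\<pi> a w)"
    "closure (span {\<pi> a v | a v. a \<in> carrier A \<and> v \<in> H}) = H"
  using assms by (auto simp: star_rep_def hilbert_on_def bounded_operator_on_def)

lemma star_rep_linear:
  assumes "star_rep A H \<pi>" "a \<in> carrier A"
  shows "v \<in> H \<Longrightarrow> w \<in> H \<Longrightarrow> \<pi> a (v + w) = \<pi> a v + \<pi> a w"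
    "v \<in> H \<Longrightarrow> \<pi> a (c *\<^sub>C v) = c *\<^sub>C \<pi> a v" "\<pi> a 0 = 0"
    "v \<in> H \<Longrightarrow> w \<in> H \<Longrightarrow> \<pi> a (v - w) = \<pi> a v - \<pi> a w"
  using bounded_operator_onD(2)[OF star_repD(4)[OF assms]] star_repD(2)[OF assms(1)]
  by (simp_all add: clinear_onD clinear_on_0 clinear_on_diff)

lemma star_rep_zero:
  assumes "star_rep A H \<pi>" "star_alg A" "v \<in> H"
  shows "\<pi> \<zero>\<^bsub>A\<^esub> v = 0"
proof -
  interpret star_alg A by fact
  show ?thesis using star_repD(8)[OF assms(1) zero_closed assms(3), of 0] by simp
qed

text \<open>Up to scalars the generators are closed under adjoints, so the algebra consists of
  linear combinations of words, and intertwining can be tested on generators.\<close>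

lemma intertwiner_pres_alg:
  assumes \<pi>: "star_rep (pres_alg G Rel) H \<pi>" and \<pi>': "star_rep (pres_alg G Rel) H' \<pi>'"
    and star: "\<And>g. g \<in> G \<Longrightarrow> \<exists>h\<in>G. \<exists>c. pres_cong Rel (TStar (Gen g)) (TScale c (Gen h))"
    and V: "clinear_on H V" "\<And>v. v \<in> H \<Longrightarrow> V v \<in> H'"
    and gen: "\<And>g v. g \<in> G \<Longrightarrow> v \<in> H \<Longrightarrow>
      V (\<pi> (pres_cls Rel (Gen g)) v) = \<pi>' (pres_cls Rel (Gen g)) (V v)"
    and a: "a \<in> carrier (pres_alg G Rel)"
  shows "\<forall>v\<in>H. V (\<pi> a v) = \<pi>' a (V v)"
  using a
proof (induction rule: pres_alg_induct)
  case zero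
  then show ?case
    using V star_rep_zero[OF \<pi> star_alg_pres_alg] star_rep_zero[OF \<pi>' star_alg_pres_alg]
      clinear_on_0[OF V(1) star_repD(2)[OF \<pi>]] by simp
next
  case (mult g X)
  then have "pres_cls Rel (Gen g) \<in> carrier (pres_alg G Rel)" by auto
  then show ?case
    using mult V gen by (simp add: star_repD[OF \<pi>] star_repD[OF \<pi>'])
qed (use V in \<open>simp_all add: star gen star_repD[OF \<pi>] star_repD[OF \<pi>'] clinear_onD\<close>)

subsection \<open>Representations by operators of rank one\<close>

text \<open>The pattern behind both explicit models: with respect to an orthonormal family, a
  generator \<open>g\<close> acts as the matrix unit from \<open>src g\<close> to
  \<open>tgt g\<close> with coefficient \<open>m g\<close>.\<close>

locale rank_one_data =
  fixes e :: "'i \<Rightarrow> 'h::chilbert_space" and I :: "'i set"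
    and src tgt :: "'g \<Rightarrow> 'i" and m :: "'g \<Rightarrow> complex"
  assumes orthonormal: "i \<in> I \<Longrightarrow> j \<in> I \<Longrightarrow> cinner (e i) (e j) = (if i = j then 1 else 0)"
begin

text \<open>Matrix units with an index outside \<open>I\<close> are 0, so a generator leading out of
  the index set is truncated automatically.\<close>

definition rk :: "complex \<Rightarrow> 'i \<Rightarrow> 'i \<Rightarrow> 'h \<Rightarrow> 'h" where
  "rk c a b v = (if a \<in> I \<and> b \<in> I then (c * cinner (e b) v) *\<^sub>C e a else 0)"

text \<open>The second component is the adjoint operator.\<close>

primrec ev :: "'g sterm \<Rightarrow> ('h \<Rightarrow> 'h) \<times> ('h \<Rightarrow> 'h)" where
  "ev (Gen g) = (rk (m g) (tgt g) (src g), rk (cnj (m g)) (src g) (tgt g))"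
| "ev TZero = (\<lambda>_. 0, \<lambda>_. 0)"
| "ev (TAdd s t) = (\<lambda>v. fst (ev s) v + fst (ev t) v, \<lambda>v. snd (ev s) v + snd (ev t) v)"
| "ev (TScale c s) = (\<lambda>v. c *\<^sub>C fst (ev s) v, \<lambda>v. cnj c *\<^sub>C snd (ev s) v)"
| "ev (TMult s t) = (\<lambda>v. fst (ev s) (fst (ev t) v), \<lambda>v. snd (ev t) (snd (ev s) v))"
| "ev (TStar s) = (snd (ev s), fst (ev s))"

lemma rk_linear: "rk c a b (v + w) = rk c a b v + rk c a b w" "rk c a b (d *\<^sub>C v) = d *\<^sub>C rk c a b v"
  by (simp_all add: rk_def cinner_add_right cinner_scaleC_right distrib_left scaleC_add_left
      scaleC_scaleC mult_ac)

lemma rk_zero_coeff [simp]: "rk 0 a b = (\<lambda>_. 0)"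
  by (simp add: rk_def fun_eq_iff)

lemma rk_rk: "rk c a b (rk d a' b' v) = (if b = a' \<and> b \<in> I then rk (c * d) a b' v else 0)"
  by (auto simp: rk_def cinner_scaleC_right orthonormal mult_ac)

lemma rk_outside: "\<not> (a \<in> I \<and> b \<in> I) \<Longrightarrow> rk c a b v = 0"
  by (auto simp: rk_def)

lemma rk_add: "rk c a b v + rk d a b v = rk (c + d) a b v"
  by (simp add: rk_def distrib_right scaleC_add_left)

lemma rk_scale: "d *\<^sub>C rk c a b v = rk (d * c) a b v"
  by (simp add: rk_def scaleC_scaleC mult_ac)

lemma ev_linear:
  "fst (ev s) (v + w) = fst (ev s) v + fst (ev s) w \<and> fst (ev s) (c *\<^sub>C v) = c *\<^sub>C fst (ev s) v \<and>
   snd (ev s) (v + w) = snd (ev s) v + snd (ev s) w \<and> snd (ev s) (c *\<^sub>C v) = c *\<^sub>C snd (ev s) v"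
proof (induction s arbitrary: v w c)
  case (TScale a s)
  then show ?case
    by (simp add: scaleC_add_right scaleC_left_commute[of a] scaleC_left_commute[of "cnj a"])
qed (simp_all add: rk_linear scaleC_add_right ac_simps)

lemma cinner_rk: "cinner (rk (cnj c) b a v) w = cinner v (rk c a b w)"
proof -
  have "cnj (cinner (e a) v) = cinner v (e a)" by (simp add: cinner_commute[of v])
  then show ?thesis
    by (simp add: rk_def cinner_scaleC_left cinner_scaleC_right)
qed

text \<open>Because \<open>ev\<close> carries the adjoint along, \<open>TStar\<close> is interpreted
  by exchanging components; the induction confirms that the two components stay adjoint to each
  other.\<close>

lemma cinner_ev: "cinner (snd (ev s) v) w = cinner v (fst (ev s) w) \<and>
    cinner (fst (ev s) v) w = cinner v (snd (ev s) w)"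
proof (induction s arbitrary: v w)
  case (Gen g)
  show ?case using cinner_rk[of "m g"] cinner_rk[of "cnj (m g)"] by simp
qed (simp_all add: cinner_add_left cinner_add_right cinner_scaleC_left cinner_scaleC_right)

lemma ev_in:
  assumes "hilbert_on H" "e ` I \<subseteq> H"
  shows "v \<in> H \<Longrightarrow> fst (ev s) v \<in> H \<and> snd (ev s) v \<in> H"
  using assms
  by (induction s arbitrary: v)
    (auto simp: rk_def hilbert_on_def csubspace_0 csubspace_add csubspace_scaleC)

lemma norm_rk_le: "norm (rk c a b v) \<le> cmod c * norm v"
proof (cases "a \<in> I \<and> b \<in> I")
  case True
  then have "norm (e a) = 1" "norm (e b) = 1"
    using orthonormal[of a a] orthonormal[of b b]
    by (simp_all add: cinner_self power2_eq_1_iff flip: of_real_power) (smt (verit) norm_ge_zero)+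
  then show ?thesis
    using True cmod_cinner_le[of "e b" v]
    by (simp add: rk_def norm_scaleC norm_mult mult_left_mono)
qed (auto simp: rk_def)

lemma ev_bounded: "\<exists>B\<ge>0. \<forall>v. norm (fst (ev s) v) \<le> B * norm v \<and> norm (snd (ev s) v) \<le> B * norm v"
proof (induction s)
  case (Gen g)
  show ?case
    using norm_rk_le[of "m g"] norm_rk_le[of "cnj (m g)"] by (intro exI[of _ "cmod (m g)"]) auto
next
  case (TAdd s t)
  then obtain B B' where B: "\<And>v. norm (fst (ev s) v) \<le> B * norm v \<and> norm (snd (ev s) v) \<le> B * norm v"
    "\<And>v. norm (fst (ev t) v) \<le> B' * norm v \<and> norm (snd (ev t) v) \<le> B' * norm v" "B \<ge> 0" "B' \<ge> 0"
    by blast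
  have "norm (fst (ev (TAdd s t)) v) \<le> (B + B') * norm v \<and>
      norm (snd (ev (TAdd s t)) v) \<le> (B + B') * norm v" for v
    unfolding ev.simps fst_conv snd_conv distrib_right
    using B(1,2) by (blast intro: norm_triangle_le add_mono)
  then show ?case using B(3,4) by (intro exI[of _ "B + B'"]) auto
next
  case (TScale c s)
  then obtain B where B: "\<And>v. norm (fst (ev s) v) \<le> B * norm v \<and> norm (snd (ev s) v) \<le> B * norm v"
    "B \<ge> 0" by blast
  then show ?case
    by (intro exI[of _ "cmod c * B"]) (auto simp: norm_scaleC mult.assoc intro!: mult_left_mono)
next
  case (TMult s t)
  then obtain B B' where B: "\<And>v. norm (fst (ev s) v) \<le> B * norm v \<and> norm (snd (ev s) v) \<le> B * norm v"
    "\<And>v. norm (fst (ev t) v) \<le> B' * norm v \<and> norm (snd (ev t) v) \<le> B' * norm v" "B \<ge> 0" "B' \<ge> 0"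
    by blast
  have "norm (fst (ev (TMult s t)) v) \<le> (B * B') * norm v \<and>
      norm (snd (ev (TMult s t)) v) \<le> (B * B') * norm v" for v
  proof
    have "norm (fst (ev s) (fst (ev t) v)) \<le> B * norm (fst (ev t) v)" using B(1) by blast
    also have "\<dots> \<le> B * (B' * norm v)" using B(2,3) by (intro mult_left_mono) auto
    finally show "norm (fst (ev (TMult s t)) v) \<le> (B * B') * norm v" by (simp add: mult.assoc)
    have "norm (snd (ev t) (snd (ev s) v)) \<le> B' * norm (snd (ev s) v)" using B(2) by blast
    also have "\<dots> \<le> B' * (B * norm v)" using B(1,4) by (intro mult_left_mono) auto
    finally show "norm (snd (ev (TMult s t)) v) \<le> (B * B') * norm v" by (simp add: mult_ac)
  qed
  then show ?case using B(3,4) by (intro exI[of _ "B * B'"]) auto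
qed auto

end

text \<open>\<open>respects\<close> compares pairs, so a relation has to hold for the operators and
  for their adjoints. \<open>unit\<close> provides for every index a generator acting as the
  projection onto its basis vector, which yields both non-degeneracy and irreducibility.\<close>

locale rank_one_rep = rank_one_data e I src tgt m
  for e :: "'i \<Rightarrow> 'h::chilbert_space" and I and src tgt :: "'g \<Rightarrow> 'i" and m +
  fixes G :: "'g set" and Rel
  assumes respects: "(s, t) \<in> Rel \<Longrightarrow> ev s = ev t"
    and unit: "i \<in> I \<Longrightarrow> \<exists>g\<in>G. src g = i \<and> tgt g = i \<and> m g = 1"
begin

lemma ev_cong: "pres_cong Rel s t \<Longrightarrow> ev s = ev t"
proof (induction rule: pres_cong.induct)
  case (add_neg s)
  then show ?case by (auto simp: fun_eq_iff scaleC_minus_left)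
qed (use ev_linear in \<open>auto simp: respects fun_eq_iff add.assoc add.commute scaleC_add_right
    scaleC_add_left scaleC_scaleC mult.commute\<close>)

text \<open>An arbitrary representative is evaluated; by \<open>ev_cong\<close> the choice does not
  matter.\<close>

definition \<pi> :: "'g sterm set \<Rightarrow> 'h \<Rightarrow> 'h" where
  "\<pi> X = fst (ev (SOME s. s \<in> X))"

lemma \<pi>_cls: "\<pi> (pres_cls Rel s) = fst (ev s)"
proof -
  have "s \<in> pres_cls Rel s" by (simp add: mem_pres_cls pres_cong.refl)
  then have "(SOME t. t \<in> pres_cls Rel s) \<in> pres_cls Rel s" by (rule someI)
  then show ?thesis unfolding \<pi>_def by (metis ev_cong mem_pres_cls)
qed

lemma \<pi>_unit:
  assumes "i \<in> I"
  obtains a where "a \<in> carrier (pres_alg G Rel)" "\<And>v. \<pi> a v = cinner (e i) v *\<^sub>C e i"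
proof -
  obtain g where "g \<in> G" "src g = i" "tgt g = i" "m g = 1" using unit[OF assms] by blast
  then show ?thesis
    using assms by (intro that[of "pres_cls Rel (Gen g)"]) (auto simp: \<pi>_cls rk_def)
qed

lemma star_rep_\<pi>:
  assumes H: "H = closure (cspan (e ` I))"
  shows "star_rep (pres_alg G Rel) H \<pi>"
proof -
  let ?A = "pres_alg G Rel"
  note s = pres_alg_simps[of G Rel]
  have hH: "hilbert_on H" unfolding H by (rule hilbert_on_closure_cspan)
  have eH: "e ` I \<subseteq> H" unfolding H by (intro subsetI closure_cspan_superset)
  have \<pi>H: "\<pi> a v \<in> H" if "a \<in> carrier ?A" "v \<in> H" for a v
    using that(1) by (rule pres_algE) (simp add: \<pi>_cls ev_in[OF hH eH that(2)])
  have "bounded_operator_on H (\<pi> a)" if a: "a \<in> carrier ?A" for a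
  proof -
    obtain t where t: "a = pres_cls Rel t" using a by (rule pres_algE)
    show ?thesis
      unfolding bounded_operator_on_def clinear_on_def
      using \<pi>H[OF a] ev_linear[of t] ev_bounded[of t] by (auto simp: t \<pi>_cls)
  qed
  moreover have "closure (span {\<pi> a v | a v. a \<in> carrier ?A \<and> v \<in> H}) = H"
  proof
    have "span {\<pi> a v | a v. a \<in> carrier ?A \<and> v \<in> H} \<subseteq> H"
      using \<pi>H hH by (intro span_minimal) (auto simp: hilbert_on_def csubspace_imp_subspace)
    then show "closure (span {\<pi> a v | a v. a \<in> carrier ?A \<and> v \<in> H}) \<subseteq> H"
      using hH by (intro closure_minimal) (auto simp: hilbert_on_def)
    have "c *\<^sub>C e i \<in> {\<pi> a v | a v. a \<in> carrier ?A \<and> v \<in> H}" if i: "i \<in> I" for c i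
    proof -
      obtain a where a: "a \<in> carrier ?A" "\<And>v. \<pi> a v = cinner (e i) v *\<^sub>C e i"
        using i by (rule \<pi>_unit) blast
      have "\<pi> a (c *\<^sub>C e i) = c *\<^sub>C e i" using i by (simp add: a(2) cinner_scaleC_right orthonormal)
      moreover have "c *\<^sub>C e i \<in> H" using hH eH i by (auto simp: hilbert_on_def csubspace_scaleC)
      ultimately show ?thesis using a(1) by (metis (mono_tags, lifting) mem_Collect_eq)
    qed
    then show "H \<subseteq> closure (span {\<pi> a v | a v. a \<in> carrier ?A \<and> v \<in> H})"
      unfolding H[unfolded cspan_def] by (intro closure_mono span_mono) (auto simp: H[unfolded cspan_def])
  qed
  ultimately show ?thesis
    unfolding star_rep_def using hH cinner_ev
    by (auto simp: s \<pi>_cls elim!: pres_algE)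
qed

text \<open>A nonzero invariant subspace contains a vector with a nonzero coefficient, hence by
  projection a basis vector, and \<open>conn\<close> spreads it along the graph whose edges are the
  generators with nonzero coefficient. Connectivity is phrased through edge-closed sets
  \<open>J\<close>, which avoids paths.\<close>

lemma irreducible_rep_\<pi>:
  assumes H: "H = closure (cspan (e ` I))" and "I \<noteq> {}"
    and conn: "\<And>i J. i \<in> I \<Longrightarrow> i \<in> J \<Longrightarrow>
      (\<And>g. g \<in> G \<Longrightarrow> m g \<noteq> 0 \<Longrightarrow> src g \<in> J \<Longrightarrow> src g \<in> I \<Longrightarrow> tgt g \<in> I \<Longrightarrow> tgt g \<in> J) \<Longrightarrow> I \<subseteq> J"
  shows "irreducible_rep (pres_alg G Rel) H \<pi>"
  unfolding irreducible_rep_def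
proof (intro conjI allI impI)
  let ?A = "pres_alg G Rel"
  show "star_rep ?A H \<pi>" using H by (rule star_rep_\<pi>)
  have eH: "e i \<in> H" if "i \<in> I" for i using that unfolding H by (simp add: closure_cspan_superset)
  show "H \<noteq> {0}"
  proof
    assume "H = {0}"
    obtain i where "i \<in> I" using \<open>I \<noteq> {}\<close> by blast
    then show False using eH[of i] orthonormal[of i i] \<open>H = {0}\<close> by simp
  qed
  fix W assume W: "hilbert_on W \<and> W \<subseteq> H \<and> (\<forall>a\<in>carrier ?A. \<forall>v\<in>W. \<pi> a v \<in> W)"
  show "W = {0} \<or> W = H"
  proof (cases "W = {0}")
    case False
    have csW: "csubspace W" using W by (simp add: hilbert_on_def)
    then obtain w where w: "w \<in> W" "w \<noteq> 0" using False csubspace_0 by blast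
    obtain i where i: "i \<in> I" "cinner (e i) w \<noteq> 0"
      using eq_zero_if_cinner_total[OF H[symmetric]] w W by blast
    have "e i \<in> W"
    proof -
      obtain a where a: "a \<in> carrier ?A" "\<And>v. \<pi> a v = cinner (e i) v *\<^sub>C e i"
        using i(1) by (rule \<pi>_unit) blast
      have "inverse (cinner (e i) w) *\<^sub>C \<pi> a w \<in> W" using W a(1) w(1) csW csubspace_scaleC by blast
      then show ?thesis using i(2) by (simp add: a(2) scaleC_scaleC)
    qed
    have "I \<subseteq> {j. e j \<in> W}"
    proof (rule conn)
      fix g assume g: "g \<in> G" "m g \<noteq> 0" "src g \<in> {j. e j \<in> W}" "src g \<in> I" "tgt g \<in> I"
      have "pres_cls Rel (Gen g) \<in> carrier ?A" using g(1) by auto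
      then have "inverse (m g) *\<^sub>C \<pi> (pres_cls Rel (Gen g)) (e (src g)) \<in> W"
        using W g csW csubspace_scaleC by blast
      then show "tgt g \<in> {j. e j \<in> W}"
        using g by (simp add: \<pi>_cls rk_def orthonormal scaleC_scaleC)
    qed (use i \<open>e i \<in> W\<close> in auto)
    then have "H \<subseteq> W" unfolding H using W by (intro closure_cspan_minimal) auto
    then show ?thesis using W by blast
  qed simp
qed

end

subsection \<open>Square-summable families\<close>

lemma ell2_eqI: "(\<And>i. ell2_fun f i = ell2_fun g i) \<Longrightarrow> f = g"
  using ell2_fun_inject by blast

lemma ell2_fun_simps [simp]:
  "ell2_fun 0 i = 0"
  "ell2_fun (f + g) i = ell2_fun f i + ell2_fun g i"
  "ell2_fun (f - g) i = ell2_fun f i - ell2_fun g i"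
  "ell2_fun (c *\<^sub>C f) i = c * ell2_fun f i"
  by (simp_all add: zero_ell2.rep_eq plus_ell2.rep_eq minus_ell2.rep_eq scaleC_ell2_def
      ell2_scale.rep_eq)

lemma ell2_fun_sum [simp]: "ell2_fun (sum f F) i = (\<Sum>k\<in>F. ell2_fun (f k) i)"
  by (induction F rule: infinite_finite_induct) auto

definition \<delta> :: "'i \<Rightarrow> 'i ell2" where
  "\<delta> i = Abs_ell2 (\<lambda>j. if j = i then 1 else 0)"

lemma ell2_fun_\<delta>: "ell2_fun (\<delta> i) j = (if j = i then 1 else 0)"
proof -
  have "(\<lambda>j. (cmod (if j = i then 1 else 0))\<^sup>2) summable_on UNIV"
    by (rule finite_nonzero_values_imp_summable_on) (rule finite_subset[of _ "{i}"], auto)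
  then show ?thesis unfolding \<delta>_def by (subst Abs_ell2_inverse) auto
qed

lemma cinner_\<delta>: "cinner (\<delta> i) f = ell2_fun f i"
proof -
  have "(\<Sum>\<^sub>\<infinity>j. cnj (ell2_fun (\<delta> i) j) * ell2_fun f j) =
      (\<Sum>\<^sub>\<infinity>j\<in>{i}. cnj (ell2_fun (\<delta> i) j) * ell2_fun f j)"
    by (rule infsum_cong_neutral) (auto simp: ell2_fun_\<delta>)
  then show ?thesis by (simp add: cinner_ell2_def ell2_cinner.rep_eq ell2_fun_\<delta>)
qed

lemma cinner_\<delta>_\<delta>: "cinner (\<delta> i) (\<delta> j) = (if i = j then 1 else 0)"
  by (simp add: cinner_\<delta> ell2_fun_\<delta>)

definition ell2_on :: "'i set \<Rightarrow> 'i ell2 set" where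
  "ell2_on I = {f. \<forall>i. i \<notin> I \<longrightarrow> ell2_fun f i = 0}"

lemma \<delta>_in_ell2_on: "i \<in> I \<Longrightarrow> \<delta> i \<in> ell2_on I"
  by (auto simp: ell2_on_def ell2_fun_\<delta>)

lemma hilbert_on_ell2_on: "hilbert_on (ell2_on I)"
proof -
  have "ell2_on I = (\<Inter>i\<in>-I. {f. cinner (\<delta> i) f = 0})" by (auto simp: ell2_on_def cinner_\<delta>)
  moreover have "closed (\<Inter>i\<in>-I. {f. cinner (\<delta> i) f = 0})"
    by (intro closed_INT ballI closed_Collect_eq continuous_intros)
  ultimately show ?thesis by (auto simp: hilbert_on_def csubspace_def ell2_on_def cinner_add_right cinner_scaleC_right)
qed

text \<open>Finite truncations converge: the squared distance from \<open>f\<close> to a truncation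
  is the missing tail of the sum for \<open>(norm f)\<^sup>2\<close>.\<close>

lemma closure_cspan_\<delta>: "closure (cspan (\<delta> ` I)) = ell2_on I"
proof
  show "closure (cspan (\<delta> ` I)) \<subseteq> ell2_on I"
    by (rule closure_cspan_minimal) (auto intro: hilbert_on_ell2_on \<delta>_in_ell2_on)
  show "ell2_on I \<subseteq> closure (cspan (\<delta> ` I))"
  proof
    fix f assume f: "f \<in> ell2_on I"
    show "f \<in> closure (cspan (\<delta> ` I))"
      unfolding closure_approachable
    proof (intro allI impI)
      fix \<epsilon> :: real assume "\<epsilon> > 0"
      then obtain F where F: "finite F"
        "dist (\<Sum>i\<in>F. (cmod (ell2_fun f i))\<^sup>2) ((norm f)\<^sup>2) \<le> (\<epsilon> / 2)\<^sup>2"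
        using infsum_finite_approximation[OF ell2_sq_summable[of f], of "(\<epsilon> / 2)\<^sup>2"]
        by (auto simp: ell2_norm_sq)
      define g where "g = (\<Sum>i\<in>F. ell2_fun f i *\<^sub>C \<delta> i)"
      have g: "ell2_fun g i = (if i \<in> F then ell2_fun f i else 0)" for i
        using F(1) by (simp add: g_def ell2_fun_\<delta> if_distrib[of "(*) _"] cong: if_cong)
      have "cinner h (\<Sum>i\<in>G. a i *\<^sub>C \<delta> i) = (\<Sum>i\<in>G. a i * cnj (ell2_fun h i))" for h a G
      proof (induction G rule: infinite_finite_induct)
        case (insert i G)
        then show ?case
          by (simp add: cinner_add_right cinner_scaleC_right cinner_commute[of h] cinner_\<delta>)
      qed auto
      then have cg: "cinner h g = (\<Sum>i\<in>F. ell2_fun f i * cnj (ell2_fun h i))" for h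
        by (simp add: g_def)
      have "cinner (f - g) (f - g) = cinner (f - g) f"
        by (simp add: cinner_diff_right[of "f - g"] cg g)
      also have "\<dots> = cinner f f - cnj (cinner f g)"
        by (simp add: cinner_diff_left cinner_commute[of g f])
      also have "\<dots> = of_real ((norm f)\<^sup>2 - (\<Sum>i\<in>F. (cmod (ell2_fun f i))\<^sup>2))"
        by (simp add: cg cinner_self complex_norm_square mult.commute flip: of_real_power)
      finally have "(norm (f - g))\<^sup>2 = (norm f)\<^sup>2 - (\<Sum>i\<in>F. (cmod (ell2_fun f i))\<^sup>2)"
        by (simp only: cinner_self of_real_eq_iff)
      then have "(norm (f - g))\<^sup>2 \<le> (\<epsilon> / 2)\<^sup>2"
        using F(2) unfolding dist_real_def by linarith
      then have "norm (f - g) \<le> \<epsilon> / 2" using \<open>\<epsilon> > 0\<close> by (auto intro: power2_le_imp_le)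
      then have "dist g f < \<epsilon>" using \<open>\<epsilon> > 0\<close> by (simp add: dist_norm norm_minus_commute)
      moreover have "g \<in> cspan (\<delta> ` I)"
        unfolding g_def
      proof (intro csubspace_sum csubspace_cspan)
        fix i
        show "ell2_fun f i *\<^sub>C \<delta> i \<in> cspan (\<delta> ` I)"
        proof (cases "i \<in> I")
          case True
          then show ?thesis by (intro csubspace_scaleC csubspace_cspan cspan_superset) auto
        next
          case False
          then show ?thesis using f csubspace_0[OF csubspace_cspan] by (simp add: ell2_on_def)
        qed
      qed
      ultimately show "\<exists>y\<in>cspan (\<delta> ` I). dist y f < \<epsilon>" by blast
    qed
  qed
qed

text \<open>Fubini for nonnegative families; every row sum is a multiple of one fixed sum.\<close>

lemma summable_on_tensor:
  fixes a :: "'i \<Rightarrow> complex" and b :: "'j \<Rightarrow> complex"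
  assumes "(\<lambda>i. cmod (a i)) summable_on UNIV" "(\<lambda>j. cmod (b j)) summable_on UNIV"
  shows "(\<lambda>x. cmod (case x of (i, j) \<Rightarrow> a i * b j)) summable_on UNIV"
proof -
  have "(\<lambda>x. cmod (case x of (i, j) \<Rightarrow> a i * b j)) summable_on Sigma UNIV (\<lambda>_. UNIV)"
    unfolding Infinite_Sum.abs_summable_on_Sigma_iff
    using summable_on_cmult_left[OF assms(1), of "\<Sum>\<^sub>\<infinity>j. cmod (b j)"]
      summable_on_cmult_right[OF assms(2)]
    by (simp add: norm_mult infsum_cmult_right' infsum_nonneg abs_mult)
  then show ?thesis by simp
qed

lemma infsum_tensor:
  fixes a :: "'i \<Rightarrow> complex" and b :: "'j \<Rightarrow> complex"
  assumes "(\<lambda>i. cmod (a i)) summable_on UNIV" "(\<lambda>j. cmod (b j)) summable_on UNIV"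
  shows "(\<Sum>\<^sub>\<infinity>(i, j). a i * b j) = (\<Sum>\<^sub>\<infinity>i. a i) * (\<Sum>\<^sub>\<infinity>j. b j)"
proof -
  have "(\<lambda>(i, j). a i * b j) summable_on Sigma UNIV (\<lambda>_. UNIV)"
    using abs_summable_summable[OF summable_on_tensor[OF assms]] by simp
  then have "(\<Sum>\<^sub>\<infinity>(i, j)\<in>Sigma UNIV (\<lambda>_. UNIV). a i * b j) = (\<Sum>\<^sub>\<infinity>i. \<Sum>\<^sub>\<infinity>j. a i * b j)"
    by (subst infsum_Sigma_banach[symmetric]) auto
  then show ?thesis by (simp add: infsum_cmult_right' infsum_cmult_left')
qed

definition ell2_tensor :: "'i ell2 \<Rightarrow> 'j ell2 \<Rightarrow> ('i \<times> 'j) ell2" where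
  "ell2_tensor v w = Abs_ell2 (\<lambda>(i, j). ell2_fun v i * ell2_fun w j)"

lemma ell2_tensor_apply: "ell2_fun (ell2_tensor v w) (i, j) = ell2_fun v i * ell2_fun w j"
proof -
  have "(\<lambda>i. cmod (complex_of_real ((cmod (ell2_fun v i))\<^sup>2))) summable_on UNIV" for v :: "'c ell2"
    using ell2_sq_summable[of v] by (simp add: norm_power)
  from summable_on_tensor[OF this[of v] this[of w]]
  have "(\<lambda>ij. (cmod (case ij of (i, j) \<Rightarrow> ell2_fun v i * ell2_fun w j))\<^sup>2) summable_on UNIV"
    by (simp add: norm_mult norm_power power_mult_distrib case_prod_unfold)
  then show ?thesis unfolding ell2_tensor_def by (subst Abs_ell2_inverse) auto
qed

lemma cinner_ell2_tensor:
  "cinner (ell2_tensor v w) (ell2_tensor v' w') = cinner v v' * cinner w w'"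
proof -
  have abs: "(\<lambda>i. cmod (cnj (ell2_fun v i) * ell2_fun v' i)) summable_on UNIV" for v v' :: "'c ell2"
    using abs_summable_product[of "\<lambda>i. cnj (ell2_fun v i)" UNIV "ell2_fun v'"]
      ell2_sq_summable[of v] ell2_sq_summable[of v']
    by (simp add: norm_mult power2_eq_square)
  have "cinner (ell2_tensor v w) (ell2_tensor v' w') =
      (\<Sum>\<^sub>\<infinity>(i, j). (cnj (ell2_fun v i) * ell2_fun v' i) * (cnj (ell2_fun w j) * ell2_fun w' j))"
    unfolding cinner_ell2_def ell2_cinner.rep_eq
    by (rule infsum_cong) (auto simp: ell2_tensor_apply)
  also have "\<dots> = cinner v v' * cinner w w'"
    by (simp add: infsum_tensor[OF abs abs] cinner_ell2_def ell2_cinner.rep_eq)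
  finally show ?thesis .
qed

lemma ell2_tensor_\<delta>: "ell2_tensor (\<delta> i) (\<delta> j) = \<delta> (i, j)"
  by (rule ell2_eqI) (auto simp: ell2_tensor_apply ell2_fun_\<delta> split: prod.split if_splits)

text \<open>The concrete tensor product with values in \<open>ell2_on (S \<times> T)\<close> is
  transported by the unitary taking \<open>\<delta> (r, s)\<close> to \<open>e (r, s)\<close>. Any
  orthonormal basis indexed by a product thus exhibits its space as a tensor product.\<close>

lemma hilbert_tensor_of_basis:
  fixes e :: "'i \<times> 'j \<Rightarrow> 'h::chilbert_space"
  assumes on: "\<And>i j. i \<in> S \<times> T \<Longrightarrow> j \<in> S \<times> T \<Longrightarrow> cinner (e i) (e j) = (if i = j then 1 else 0)"
    and H: "closure (cspan (e ` (S \<times> T))) = H"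
  obtains t where "hilbert_tensor (ell2_on S) (ell2_on T) H t"
    "\<And>r s. r \<in> S \<Longrightarrow> s \<in> T \<Longrightarrow> t (\<delta> r) (\<delta> s) = e (r, s)"
    "\<And>v w r s. v \<in> ell2_on S \<Longrightarrow> w \<in> ell2_on T \<Longrightarrow> r \<in> S \<Longrightarrow> s \<in> T \<Longrightarrow>
      cinner (e (r, s)) (t v w) = ell2_fun v r * ell2_fun w s"
proof -
  obtain V where V: "unitary_on (ell2_on (S \<times> T)) H V" "\<And>i. i \<in> S \<times> T \<Longrightarrow> V (\<delta> i) = e i"
    using unitary_of_equal_gram[of "S \<times> T" \<delta> e, OF _ closure_cspan_\<delta> H] on
    by (metis cinner_\<delta>_\<delta>)
  have ST: "ell2_tensor v w \<in> ell2_on (S \<times> T)" if "v \<in> ell2_on S" "w \<in> ell2_on T" for v w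
    using that by (auto simp: ell2_on_def ell2_tensor_apply)
  define t where "t v w = V (ell2_tensor v w)" for v w
  note VD = unitary_onD[OF V(1)]
  have tens: "t (\<delta> r) (\<delta> s) = e (r, s)" if "r \<in> S" "s \<in> T" for r s
    using that by (simp add: t_def ell2_tensor_\<delta> V(2))
  have lin: "ell2_tensor (v + v') w = ell2_tensor v w + ell2_tensor v' w"
    "ell2_tensor v (w + w') = ell2_tensor v w + ell2_tensor v w'"
    "ell2_tensor (a *\<^sub>C v) w = a *\<^sub>C ell2_tensor v w"
    "ell2_tensor v (a *\<^sub>C w) = a *\<^sub>C ell2_tensor v w"
    for v v' :: "'i ell2" and w w' :: "'j ell2" and a
    by (rule ell2_eqI; auto simp: ell2_tensor_apply algebra_simps)+
  have "hilbert_tensor (ell2_on S) (ell2_on T) H t"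
    unfolding hilbert_tensor_def
  proof (intro conjI ballI)
    let ?X = "{t v w | v w. v \<in> ell2_on S \<and> w \<in> ell2_on T}"
    show "hilbert_on H" using H hilbert_on_closure_cspan by blast
    show "clinear_on (ell2_on T) (t v)" if "v \<in> ell2_on S" for v
      using that clinear_onD[OF VD(1)] ST unfolding clinear_on_def t_def by (simp add: lin)
    show "clinear_on (ell2_on S) (\<lambda>v. t v w)" if "w \<in> ell2_on T" for w
      using that clinear_onD[OF VD(1)] ST unfolding clinear_on_def t_def by (simp add: lin)
    show "cinner (t v w) (t v' w') = cinner v v' * cinner w w'"
      if "v \<in> ell2_on S" "v' \<in> ell2_on S" "w \<in> ell2_on T" "w' \<in> ell2_on T" for v v' w w'
      using that ST by (simp add: t_def VD cinner_ell2_tensor)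
    show "closure (span ?X) = H"
    proof
      have "?X \<subseteq> H" using ST VD(3) by (auto simp: t_def)
      then show "closure (span ?X) \<subseteq> H"
        using \<open>hilbert_on H\<close>
        by (intro closure_minimal span_minimal) (auto simp: hilbert_on_def csubspace_imp_subspace)
      have "{a *\<^sub>C v | a v. v \<in> e ` (S \<times> T)} \<subseteq> ?X"
      proof clarify
        fix a r s assume rs: "r \<in> S" "s \<in> T"
        have "a *\<^sub>C \<delta> r \<in> ell2_on S"
          using hilbert_on_ell2_on[of S] \<delta>_in_ell2_on[OF rs(1)]
          by (simp add: hilbert_on_def csubspace_scaleC)
        moreover have "a *\<^sub>C e (r, s) = t (a *\<^sub>C \<delta> r) (\<delta> s)"
          using rs clinear_onD(2)[OF VD(1) \<delta>_in_ell2_on[of "(r, s)"]]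
          by (simp add: t_def lin ell2_tensor_\<delta> V(2))
        ultimately show "\<exists>v w. a *\<^sub>C e (r, s) = t v w \<and> v \<in> ell2_on S \<and> w \<in> ell2_on T"
          using \<delta>_in_ell2_on[OF rs(2)] by metis
      qed
      then show "H \<subseteq> closure (span ?X)"
        unfolding H[symmetric] cspan_def by (intro closure_mono span_mono)
    qed
  qed (rule hilbert_on_ell2_on)+
  moreover have "cinner (e (r, s)) (t v w) = ell2_fun v r * ell2_fun w s"
    if "v \<in> ell2_on S" "w \<in> ell2_on T" "r \<in> S" "s \<in> T" for v w r s
  proof -
    have "cinner (e (r, s)) (t v w) = cinner (V (\<delta> (r, s))) (V (ell2_tensor v w))"
      using that by (simp add: t_def V(2))
    also have "\<dots> = cinner (\<delta> (r, s)) (ell2_tensor v w)"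
      using that ST by (intro VD(4) \<delta>_in_ell2_on) auto
    finally show ?thesis by (simp add: cinner_\<delta> ell2_tensor_apply)
  qed
  ultimately show ?thesis using that tens by blast
qed

subsection \<open>Irreducible \<open>c\<close>-sets\<close>

lemma \<tau>_pos: "y > 0 \<Longrightarrow> \<tau> y > 0"
  by (simp add: \<tau>_def add_pos_pos)

lemma \<tau>_mult: "y \<noteq> 0 \<Longrightarrow> z \<noteq> 0 \<Longrightarrow> \<tau> y * \<tau> z = \<tau> (y * z) + \<tau> (y / z)"
  by (simp add: \<tau>_def field_simps)

lemma c_set_iff:
  assumes "q > 0"
  shows "c_set q c Z \<longleftrightarrow> Z \<noteq> {} \<and> Z \<subseteq> {0<..} \<and>
    (\<forall>z\<in>Z. 0 \<le> c + \<tau> (q * z) \<and> 0 \<le> c + \<tau> (z / q) \<and>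
      (0 < c + \<tau> (q * z) \<longrightarrow> q\<^sup>2 * z \<in> Z) \<and> (0 < c + \<tau> (z / q) \<longrightarrow> z / q\<^sup>2 \<in> Z))"
  unfolding c_set_def c_adapted_def strictly_c_adapted_def
  by (auto simp: power_int_minus field_simps power_int_def)

text \<open>The steps ask for a nonzero value, not for a positive one; inside a \<open>c\<close>-set
  adaptedness makes the two equivalent. A step and its reverse are governed by the same number, so
  components behave like classes of an equivalence relation.\<close>

inductive_set c_component :: "real \<Rightarrow> real \<Rightarrow> real \<Rightarrow> real set" for q c z0 where
  base: "z0 \<in> c_component q c z0"
| up: "z \<in> c_component q c z0 \<Longrightarrow> c + \<tau> (q * z) \<noteq> 0 \<Longrightarrow> q\<^sup>2 * z \<in> c_component q c z0"
| down: "z \<in> c_component q c z0 \<Longrightarrow> c + \<tau> (z / q) \<noteq> 0 \<Longrightarrow> z / q\<^sup>2 \<in> c_component q c z0"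

lemma c_component_pos: "z \<in> c_component q c z0 \<Longrightarrow> q > 0 \<Longrightarrow> z0 > 0 \<Longrightarrow> z > 0"
  by (induction rule: c_component.induct) auto

text \<open>Only even powers of \<open>q\<close> occur, which later yields the parity condition on
  \<open>S\<close> and \<open>T\<close>.\<close>

lemma c_component_form:
  assumes "z \<in> c_component q c z0" "q > 0"
  shows "\<exists>n::int. z = z0 * q powi (2 * n)"
  using assms(1)
proof induction
  case base
  then show ?case by (intro exI[of _ 0]) simp
next
  case (up z)
  then obtain n :: int where "z = z0 * q powi (2 * n)" by blast
  moreover have "q powi (2 * (n + 1)) = q\<^sup>2 * q powi (2 * n)"
    using assms(2) by (simp add: distrib_left power_int_add)
  ultimately show ?case by (intro exI[of _ "n + 1"]) (simp add: mult_ac)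
next
  case (down z)
  then obtain n :: int where "z = z0 * q powi (2 * n)" by blast
  moreover have "q powi (2 * (n - 1)) = q powi (2 * n) / q\<^sup>2"
    using assms(2) by (simp add: right_diff_distrib power_int_diff)
  ultimately show ?case by (intro exI[of _ "n - 1"]) simp
qed

lemma c_component_subset:
  assumes q: "q > 0" and Z: "c_set q c Z" "z0 \<in> Z"
  shows "c_component q c z0 \<subseteq> Z"
proof
  fix z assume "z \<in> c_component q c z0"
  then show "z \<in> Z"
    by induction (use Z in \<open>auto simp: c_set_iff[OF q] less_le\<close>)
qed

lemma c_set_component:
  assumes q: "q > 0" and z0: "z0 > 0"
    and "\<And>z. z \<in> c_component q c z0 \<Longrightarrow> 0 \<le> c + \<tau> (q * z) \<and> 0 \<le> c + \<tau> (z / q)"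
  shows "c_set q c (c_component q c z0)"
  using assms c_component_pos[OF _ q z0]
  by (auto simp: c_set_iff[OF q] intro: c_component.intros)

text \<open>A \<open>c\<close>-set inside the component that contains \<open>z0\<close> is already
  everything, so in a disjoint decomposition the other part would be empty.\<close>

lemma irreducible_c_set_component:
  assumes q: "q > 0" and z0: "z0 > 0"
    and "\<And>z. z \<in> c_component q c z0 \<Longrightarrow> 0 \<le> c + \<tau> (q * z) \<and> 0 \<le> c + \<tau> (z / q)"
  shows "irreducible_c_set q c (c_component q c z0)"
  unfolding irreducible_c_set_def
proof (intro conjI notI)
  show "c_set q c (c_component q c z0)" by (rule c_set_component) fact+
  assume "\<exists>Z1 Z2. c_set q c Z1 \<and> c_set q c Z2 \<and> Z1 \<inter> Z2 = {} \<and> c_component q c z0 = Z1 \<union> Z2"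
  then obtain Z1 Z2 where Z: "c_set q c Z1" "c_set q c Z2" "Z1 \<inter> Z2 = {}"
    "c_component q c z0 = Z1 \<union> Z2" by blast
  have "Z1 \<noteq> {}" "Z2 \<noteq> {}" using Z by (auto simp: c_set_iff[OF q])
  moreover have "z0 \<in> Z1 \<union> Z2" using Z(4) c_component.base by blast
  ultimately show False
    using c_component_subset[OF q Z(1), of z0] c_component_subset[OF q Z(2), of z0] Z(3,4) by blast
qed

text \<open>Steps are reversible, so removing a component leaves a set that is again closed under
  the steps; if nonempty, it would split \<open>Z\<close>.\<close>

lemma irreducible_c_set_eq_component:
  assumes q: "q > 0" and Z: "irreducible_c_set q c Z" and z0: "z0 \<in> Z"
  shows "Z = c_component q c z0"
proof (rule ccontr)
  assume neq: "Z \<noteq> c_component q c z0"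
  have cZ: "c_set q c Z" using Z by (simp add: irreducible_c_set_def)
  have sub: "c_component q c z0 \<subseteq> Z" by (rule c_component_subset[OF q cZ z0])
  have pos: "z > 0" if "z \<in> Z" for z using that cZ by (auto simp: c_set_iff[OF q])
  have comp: "c_set q c (c_component q c z0)"
    by (rule c_set_component[OF q pos[OF z0]]) (use sub cZ in \<open>auto simp: c_set_iff[OF q]\<close>)
  have "c_set q c (Z - c_component q c z0)"
    unfolding c_set_iff[OF q]
  proof (intro conjI ballI impI)
    fix z assume z: "z \<in> Z - c_component q c z0"
    show "q\<^sup>2 * z \<in> Z - c_component q c z0" if "0 < c + \<tau> (q * z)"
    proof -
      \<comment> \<open>Otherwise the step back down, governed by the same nonzero value, would put
        \<open>z\<close> into the component.\<close>
      have "q\<^sup>2 * z \<notin> c_component q c z0"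
        using that z c_component.down[of "q\<^sup>2 * z" q c z0] q by (auto simp: power2_eq_square)
      then show ?thesis using cZ z that by (auto simp: c_set_iff[OF q])
    qed
    show "z / q\<^sup>2 \<in> Z - c_component q c z0" if "0 < c + \<tau> (z / q)"
    proof -
      have "z / q\<^sup>2 \<notin> c_component q c z0"
        using that z c_component.up[of "z / q\<^sup>2" q c z0] q by (auto simp: power2_eq_square)
      then show ?thesis using cZ z that by (auto simp: c_set_iff[OF q])
    qed
  qed (use neq sub cZ in \<open>auto simp: c_set_iff[OF q]\<close>)
  with comp sub Z show False unfolding irreducible_c_set_def
    by (metis Diff_disjoint Diff_partition)
qed

section \<open>Strict sums and multipliers evaluated on single elements\<close>

lemma strict_sum_fst:
  assumes "a \<in> carrier A"
  shows "fst (strict_sum A I f) a = (\<Oplus>\<^bsub>A\<^esub>i\<in>{i \<in> I. f i \<otimes>\<^bsub>A\<^esub> a \<noteq> \<zero>\<^bsub>A\<^esub>}. f i \<otimes>\<^bsub>A\<^esub> a)"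
    and strict_sum_snd:
      "snd (strict_sum A I f) a = (\<Oplus>\<^bsub>A\<^esub>i\<in>{i \<in> I. a \<otimes>\<^bsub>A\<^esub> f i \<noteq> \<zero>\<^bsub>A\<^esub>}. a \<otimes>\<^bsub>A\<^esub> f i)"
  using assms by (simp_all add: strict_sum_def)

context star_alg
begin

lemma smult_zero_right [simp]: "c \<odot> \<zero> = \<zero>"
  using smult_smult[of \<zero> c 0] by simp

text \<open>Multipliers are evaluated on elements of definite weight, which all but at most one
  summand annihilate; infinite sums thereby disappear from the calculations.\<close>

lemma strict_sum_fst_single:
  assumes "a \<in> carrier A" "k \<in> I" "f k \<otimes> a = b" "b \<in> carrier A"
    "\<And>i. i \<in> I \<Longrightarrow> i \<noteq> k \<Longrightarrow> f i \<otimes> a = \<zero>"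
  shows "fst (strict_sum A I f) a = b"
  using finsum_single[of k I "\<lambda>i. f i \<otimes> a"] assms by (simp add: strict_sum_fst)

lemma strict_sum_snd_single:
  assumes "a \<in> carrier A" "k \<in> I" "a \<otimes> f k = b" "b \<in> carrier A"
    "\<And>i. i \<in> I \<Longrightarrow> i \<noteq> k \<Longrightarrow> a \<otimes> f i = \<zero>"
  shows "snd (strict_sum A I f) a = b"
  using finsum_single[of k I "\<lambda>i. a \<otimes> f i"] assms by (simp add: strict_sum_snd)

lemma strict_sum_snd_none:
  assumes "a \<in> carrier A" "\<And>i. i \<in> I \<Longrightarrow> a \<otimes> f i = \<zero>"
  shows "snd (strict_sum A I f) a = \<zero>"
  using finsum_none[of I "\<lambda>i. a \<otimes> f i"] assms by (simp add: strict_sum_snd)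

end

lemma mult_alg_simps:
  assumes "a \<in> carrier A"
  shows "fst (m \<otimes>\<^bsub>mult_alg A\<^esub> m') a = fst m (fst m' a)"
    "snd (m \<otimes>\<^bsub>mult_alg A\<^esub> m') a = snd m' (snd m a)"
    "fst (m \<oplus>\<^bsub>mult_alg A\<^esub> m') a = fst m a \<oplus>\<^bsub>A\<^esub> fst m' a"
    "fst (c \<odot>\<^bsub>mult_alg A\<^esub> m) a = c \<odot>\<^bsub>A\<^esub> fst m a"
    "snd (c \<odot>\<^bsub>mult_alg A\<^esub> m) a = c \<odot>\<^bsub>A\<^esub> snd m a"
  using assms by (simp_all add: mult_alg_def case_prod_unfold)

subsection \<open>The quantized enveloping algebra\<close>

lemma \<Lambda>_powi: "q > 0 \<Longrightarrow> y \<in> \<Lambda> q x \<Longrightarrow> q powi n * y \<in> \<Lambda> q x"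
proof -
  assume "q > 0" "y \<in> \<Lambda> q x"
  then obtain k where "y = x * q powi k" by (auto simp: \<Lambda>_def)
  then have "q powi n * y = x * q powi (n + k)"
    using \<open>q > 0\<close> by (simp add: power_int_add)
  then show ?thesis by (auto simp: \<Lambda>_def)
qed

lemma \<Lambda>_mult_q: "q > 0 \<Longrightarrow> y \<in> \<Lambda> q x \<Longrightarrow> q * y \<in> \<Lambda> q x"
  and \<Lambda>_div_q: "q > 0 \<Longrightarrow> y \<in> \<Lambda> q x \<Longrightarrow> y / q \<in> \<Lambda> q x"
  using \<Lambda>_powi[of q y x 1] \<Lambda>_powi[of q y x "-1"] by (simp_all add: field_simps)

lemma \<Lambda>_pos: "q > 0 \<Longrightarrow> x > 0 \<Longrightarrow> y \<in> \<Lambda> q x \<Longrightarrow> y > 0"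
  by (auto simp: \<Lambda>_def)

text \<open>Squaring removes the half-integer exponents: the points of \<open>\<Gamma> q y\<close>
  are the positive roots of points of \<open>\<Lambda> q (y\<^sup>2)\<close>, in line with
  \<open>Zset\<close>.\<close>

lemma \<Gamma>_iff:
  assumes "q > 0" "y > 0"
  shows "r \<in> \<Gamma> q y \<longleftrightarrow> r > 0 \<and> r\<^sup>2 \<in> \<Lambda> q (y\<^sup>2)"
proof
  assume "r \<in> \<Gamma> q y"
  then obtain n :: int where r: "r = y * q powr (of_int n / 2)" by (auto simp: \<Gamma>_def)
  have "(q powr (of_int n / 2))\<^sup>2 = q powr (of_int n)"
    by (simp add: power2_eq_square flip: powr_add)
  then have "r\<^sup>2 = y\<^sup>2 * q powi n"
    using assms by (simp add: r power_mult_distrib powr_real_of_int')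
  then show "r > 0 \<and> r\<^sup>2 \<in> \<Lambda> q (y\<^sup>2)" using assms by (auto simp: r \<Lambda>_def)
next
  assume r: "r > 0 \<and> r\<^sup>2 \<in> \<Lambda> q (y\<^sup>2)"
  then obtain n :: int where n: "r\<^sup>2 = y\<^sup>2 * q powi n" by (auto simp: \<Lambda>_def)
  have "(q powr (of_int n / 2))\<^sup>2 = q powr (of_int n)"
    by (simp add: power2_eq_square flip: powr_add)
  then have "r\<^sup>2 = (y * q powr (of_int n / 2))\<^sup>2"
    using assms n by (simp add: power_mult_distrib powr_real_of_int')
  then have "r = y * q powr (of_int n / 2)"
    using r assms by (simp add: power2_eq_iff_nonneg)
  then show "r \<in> \<Gamma> q y" by (auto simp: \<Gamma>_def)
qed

lemma \<Gamma>_pos: "q > 0 \<Longrightarrow> y > 0 \<Longrightarrow> r \<in> \<Gamma> q y \<Longrightarrow> r > 0"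
  by (simp add: \<Gamma>_iff)

lemma \<Gamma>_mult_q: "q > 0 \<Longrightarrow> y > 0 \<Longrightarrow> r \<in> \<Gamma> q y \<Longrightarrow> q * r \<in> \<Gamma> q y"
  and \<Gamma>_div_q: "q > 0 \<Longrightarrow> y > 0 \<Longrightarrow> r \<in> \<Gamma> q y \<Longrightarrow> r / q \<in> \<Gamma> q y"
  using \<Lambda>_powi[of q "r\<^sup>2" "y\<^sup>2" 2] \<Lambda>_powi[of q "r\<^sup>2" "y\<^sup>2" "-2"]
  by (simp_all add: \<Gamma>_iff power_mult_distrib power_divide power_int_minus field_simps)

locale su =
  fixes q y :: real
  assumes q: "0 < q" "q < 1" and y: "0 < y"
begin

lemmas \<Gamma>_q = \<Gamma>_mult_q[OF q(1) y] \<Gamma>_div_q[OF q(1) y] \<Gamma>_pos[OF q(1) y]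

sublocale A: star_alg "su_alg q y"
  unfolding su_alg_def by (rule star_alg_pres_alg)

lemma su_closed [simp]:
  "r \<in> \<Gamma> q y \<Longrightarrow> su_one q y r \<in> carrier (su_alg q y)"
  "r \<in> \<Gamma> q y \<Longrightarrow> su_Er q y r \<in> carrier (su_alg q y)"
  "r \<in> \<Gamma> q y \<Longrightarrow> su_Fr q y r \<in> carrier (su_alg q y)"
  by (auto simp: su_alg_def su_one_def su_Er_def su_Fr_def su_gens_def)

lemma su_eqI:
  "(s, t) \<in> su_rel q y \<Longrightarrow> pres_cls (su_rel q y) s = pres_cls (su_rel q y) t"
  by (rule pres_cls_eqI[OF pres_cong.rel])

lemma su_one_one:
  assumes "r \<in> \<Gamma> q y" "s \<in> \<Gamma> q y"
  shows "su_one q y r \<otimes>\<^bsub>su_alg q y\<^esub> su_one q y s =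
    (if r = s then su_one q y r else \<zero>\<^bsub>su_alg q y\<^esub>)"
  unfolding su_alg_def su_one_def pres_alg_simps
  by (subst su_eqI[of _ "if r = s then Gen (One1 r) else TZero"])
    (use assms in \<open>auto simp: su_rel_def\<close>)

lemma su_adj:
  assumes "r \<in> \<Gamma> q y"
  shows "adj (su_alg q y) (su_one q y r) = su_one q y r"
    "adj (su_alg q y) (su_Er q y r) = su_Fr q y r"
    "adj (su_alg q y) (su_Fr q y r) = su_Er q y r"
proof -
  show "adj (su_alg q y) (su_one q y r) = su_one q y r"
    unfolding su_alg_def su_one_def pres_alg_simps
    by (rule su_eqI) (use assms in \<open>auto simp: su_rel_def\<close>)
  show *: "adj (su_alg q y) (su_Er q y r) = su_Fr q y r"
    unfolding su_alg_def su_Er_def su_Fr_def pres_alg_simps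
    by (rule su_eqI) (use assms in \<open>auto simp: su_rel_def\<close>)
  show "adj (su_alg q y) (su_Fr q y r) = su_Er q y r"
    using assms by (simp flip: *)
qed

lemma su_units:
  assumes "r \<in> \<Gamma> q y"
  shows "su_one q y (q * r) \<otimes>\<^bsub>su_alg q y\<^esub> su_Er q y r = su_Er q y r"
    "su_Er q y r \<otimes>\<^bsub>su_alg q y\<^esub> su_one q y r = su_Er q y r"
    "su_one q y r \<otimes>\<^bsub>su_alg q y\<^esub> su_Fr q y r = su_Fr q y r"
    "su_Fr q y r \<otimes>\<^bsub>su_alg q y\<^esub> su_one q y (q * r) = su_Fr q y r"
  unfolding su_alg_def su_one_def su_Er_def su_Fr_def pres_alg_simps
  by (rule su_eqI, use assms in \<open>force simp: su_rel_def\<close>)+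

text \<open>A local unit is inserted next to the generator by \<open>su_units\<close>; orthogonality
  of the units then decides the product.\<close>

lemma su_one_E:
  assumes "r \<in> \<Gamma> q y" "s \<in> \<Gamma> q y"
  shows "su_one q y s \<otimes>\<^bsub>su_alg q y\<^esub> su_Er q y r =
      (if s = q * r then su_Er q y r else \<zero>\<^bsub>su_alg q y\<^esub>)"
    "su_Er q y r \<otimes>\<^bsub>su_alg q y\<^esub> su_one q y s =
      (if s = r then su_Er q y r else \<zero>\<^bsub>su_alg q y\<^esub>)"
    "su_one q y s \<otimes>\<^bsub>su_alg q y\<^esub> su_Fr q y r =
      (if s = r then su_Fr q y r else \<zero>\<^bsub>su_alg q y\<^esub>)"
    "su_Fr q y r \<otimes>\<^bsub>su_alg q y\<^esub> su_one q y s =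
      (if s = q * r then su_Fr q y r else \<zero>\<^bsub>su_alg q y\<^esub>)"
proof -
  note u = su_units[OF assms(1)] and g = assms \<Gamma>_q(1)[OF assms(1)]
  show "su_one q y s \<otimes>\<^bsub>su_alg q y\<^esub> su_Er q y r =
      (if s = q * r then su_Er q y r else \<zero>\<^bsub>su_alg q y\<^esub>)"
    using g A.m_assoc[of "su_one q y s" "su_one q y (q * r)" "su_Er q y r"]
    by (auto simp: u su_one_one split: if_splits)
  show "su_Er q y r \<otimes>\<^bsub>su_alg q y\<^esub> su_one q y s =
      (if s = r then su_Er q y r else \<zero>\<^bsub>su_alg q y\<^esub>)"
    using g A.m_assoc[of "su_Er q y r" "su_one q y r" "su_one q y s"]
    by (auto simp: u su_one_one split: if_splits)
  show "su_one q y s \<otimes>\<^bsub>su_alg q y\<^esub> su_Fr q y r =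
      (if s = r then su_Fr q y r else \<zero>\<^bsub>su_alg q y\<^esub>)"
    using g A.m_assoc[of "su_one q y s" "su_one q y r" "su_Fr q y r"]
    by (auto simp: u su_one_one split: if_splits)
  show "su_Fr q y r \<otimes>\<^bsub>su_alg q y\<^esub> su_one q y s =
      (if s = q * r then su_Fr q y r else \<zero>\<^bsub>su_alg q y\<^esub>)"
    using g A.m_assoc[of "su_Fr q y r" "su_one q y (q * r)" "su_one q y s"]
    by (auto simp: u su_one_one split: if_splits)
qed

lemma su_star_gens:
  assumes "g \<in> su_gens q y"
  shows "\<exists>h\<in>su_gens q y. \<exists>c. pres_cong (su_rel q y) (TStar (Gen g)) (TScale c (Gen h))"
proof -
  have "\<exists>h\<in>su_gens q y. pres_cong (su_rel q y) (TStar (Gen g)) (Gen h)"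
  proof (cases g)
    case (One1 r)
    then have "pres_cong (su_rel q y) (TStar (Gen g)) (Gen (One1 r))"
      using assms by (intro pres_cong.rel) (auto simp: su_gens_def su_rel_def)
    then show ?thesis using assms One1 by blast
  next
    case (Egen r)
    then have "pres_cong (su_rel q y) (TStar (Gen g)) (Gen (Fgen r))"
      using assms by (intro pres_cong.rel) (auto simp: su_gens_def su_rel_def)
    then show ?thesis using assms Egen by (force simp: su_gens_def)
  next
    case (Fgen r)
    then have r: "r \<in> \<Gamma> q y" using assms by (auto simp: su_gens_def)
    then have "pres_cls (su_rel q y) (TStar (Gen g)) = pres_cls (su_rel q y) (Gen (Egen r))"
      using su_adj(3)[OF r]
      by (simp add: su_alg_def su_Fr_def su_Er_def pres_alg_simps Fgen)
    then show ?thesis using r by (force simp: su_gens_def pres_cls_eq_iff)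
  qed
  then show ?thesis by (meson pres_cong.scale_one pres_cong.sym pres_cong.trans)
qed

text \<open>A word inherits the left weight of its first letter. The \<open>weight\<close> case
  replaces a unit of the algebra: each such element is fixed by a single
  \<open>su_one\<close>.\<close>

lemma su_induct [consumes 1, case_names zero add smult weight]:
  assumes "a \<in> carrier (su_alg q y)"
    and "P \<zero>\<^bsub>su_alg q y\<^esub>"
    and "\<And>a b. a \<in> carrier (su_alg q y) \<Longrightarrow> b \<in> carrier (su_alg q y) \<Longrightarrow> P a \<Longrightarrow> P b \<Longrightarrow>
      P (a \<oplus>\<^bsub>su_alg q y\<^esub> b)"
    and "\<And>c a. a \<in> carrier (su_alg q y) \<Longrightarrow> P a \<Longrightarrow> P (c \<odot>\<^bsub>su_alg q y\<^esub> a)"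
    and weight: "\<And>r a. r \<in> \<Gamma> q y \<Longrightarrow> a \<in> carrier (su_alg q y) \<Longrightarrow>
      su_one q y r \<otimes>\<^bsub>su_alg q y\<^esub> a = a \<Longrightarrow> P a"
  shows "P a"
  using assms(1) unfolding su_alg_def
proof (induction rule: pres_alg_induct)
  have gen: "\<exists>r\<in>\<Gamma> q y. su_one q y r \<otimes>\<^bsub>su_alg q y\<^esub> pres_cls (su_rel q y) (Gen g) =
      pres_cls (su_rel q y) (Gen g) \<and> pres_cls (su_rel q y) (Gen g) \<in> carrier (su_alg q y)"
    if "g \<in> su_gens q y" for g
    using that su_units su_one_one \<Gamma>_q(1) su_closed
    unfolding su_gens_def su_one_def su_Er_def su_Fr_def by fastforce
  {
    fix g assume "g \<in> su_gens q y"
    then show "P (pres_cls (su_rel q y) (Gen g))" using gen weight by blast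
  next
    fix g X assume g: "g \<in> su_gens q y" and X: "X \<in> carrier (pres_alg (su_gens q y) (su_rel q y))"
    have X: "X \<in> carrier (su_alg q y)" using X by (simp add: su_alg_def)
    let ?g = "pres_cls (su_rel q y) (Gen g)"
    obtain r where r: "r \<in> \<Gamma> q y" "su_one q y r \<otimes>\<^bsub>su_alg q y\<^esub> ?g = ?g"
      "?g \<in> carrier (su_alg q y)" using gen[OF g] by blast
    have "su_one q y r \<otimes>\<^bsub>su_alg q y\<^esub> (?g \<otimes>\<^bsub>su_alg q y\<^esub> X) = ?g \<otimes>\<^bsub>su_alg q y\<^esub> X"
      using r X A.m_assoc[of "su_one q y r" ?g X] by simp
    then have "P (?g \<otimes>\<^bsub>su_alg q y\<^esub> X)" using r X by (intro weight[OF r(1)]) auto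
    then show "P (?g \<otimes>\<^bsub>pres_alg (su_gens q y) (su_rel q y)\<^esub> X)" by (simp add: su_alg_def)
  }
qed (use assms(2-4) su_star_gens in \<open>simp_all add: su_alg_def\<close>)

text \<open>On a single \<open>su_one\<close> each strict sum in \<open>casimir\<close> contributes
  one term, so the multiplier becomes an explicit element of the algebra.\<close>

lemma fst_casimir:
  assumes r: "r \<in> \<Gamma> q y"
  shows "fst (casimir q y) (su_one q y r) =
    complex_of_real ((inverse q - q)\<^sup>2) \<odot>\<^bsub>su_alg q y\<^esub> (su_Fr q y r \<otimes>\<^bsub>su_alg q y\<^esub> su_Er q y r)
    \<oplus>\<^bsub>su_alg q y\<^esub> complex_of_real (- q) \<odot>\<^bsub>su_alg q y\<^esub> (complex_of_real (r powi 2) \<odot>\<^bsub>su_alg q y\<^esub> su_one q y r)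
    \<oplus>\<^bsub>su_alg q y\<^esub> complex_of_real (- inverse q) \<odot>\<^bsub>su_alg q y\<^esub>
      (complex_of_real (r powi (-2)) \<odot>\<^bsub>su_alg q y\<^esub> su_one q y r)"
proof -
  have E: "fst (su_E q y) (su_one q y r) = su_Er q y r"
    unfolding su_E_def
    by (rule A.strict_sum_fst_single[where k = r]) (use r in \<open>auto simp: su_one_E\<close>)
  have FE: "su_Fr q y s \<otimes>\<^bsub>su_alg q y\<^esub> su_Er q y r = \<zero>\<^bsub>su_alg q y\<^esub>" if "s \<in> \<Gamma> q y" "s \<noteq> r" for s
    using that r q(1) A.m_assoc[of "su_Fr q y s" "su_one q y (q * r)" "su_Er q y r"] \<Gamma>_q(1)[OF r]
    by (simp add: su_units(1) su_one_E(4))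
  have F: "fst (su_F q y) (su_Er q y r) = su_Fr q y r \<otimes>\<^bsub>su_alg q y\<^esub> su_Er q y r"
    unfolding su_F_def
    by (rule A.strict_sum_fst_single[where k = r]) (use r in \<open>auto simp: FE\<close>)
  have K: "fst (su_K q y n) (su_one q y r) = complex_of_real (r powi n) \<odot>\<^bsub>su_alg q y\<^esub> su_one q y r" for n
    unfolding su_K_def
    by (rule A.strict_sum_fst_single[where k = r]) (use r in \<open>auto simp: A.smult_l su_one_one\<close>)
  show ?thesis
    unfolding casimir_def Let_def using r by (simp add: mult_alg_simps E F K del: of_real_power of_real_minus)
qed

primrec su_src :: "su_gen \<Rightarrow> real" where
  "su_src (One1 r) = r" | "su_src (Egen r) = r" | "su_src (Fgen r) = q * r"

primrec su_tgt :: "su_gen \<Rightarrow> real" where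
  "su_tgt (One1 r) = r" | "su_tgt (Egen r) = q * r" | "su_tgt (Fgen r) = r"

text \<open>Solving the equation that the Casimir element is \<open>c\<close> for \<open>F E\<close>
  at weight \<open>r\<close> gives
  \<open>(c + \<tau> (q * r\<^sup>2)) / (inverse q - q)\<^sup>2\<close>; its square root serves as
  the coefficient of both \<open>E\<close> and \<open>F\<close>.\<close>

definition ladder :: "real \<Rightarrow> real \<Rightarrow> real" where
  "ladder c r = sqrt (c + \<tau> (q * r\<^sup>2)) / (inverse q - q)"

primrec su_coeff :: "real \<Rightarrow> su_gen \<Rightarrow> complex" where
  "su_coeff c (One1 r) = 1"
| "su_coeff c (Egen r) = of_real (ladder c r)"
| "su_coeff c (Fgen r) = of_real (ladder c r)"

lemma inverse_q_minus_q: "inverse q - q > 0"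
  using one_less_inverse[OF q] q by linarith

text \<open>\<open>E\<close> and \<open>F\<close> act as weighted shifts on the basis indexed by
  \<open>S\<close>. The relations survive truncation to \<open>S\<close>, because in a
  \<open>c\<close>-set a coefficient leading out of the set is 0.\<close>

lemma su_model:
  assumes S: "S \<subseteq> {0<..}" "Zset S \<subseteq> \<Lambda> q (y\<^sup>2)" "irreducible_c_set q c (Zset S)"
  obtains \<pi> where "is_\<pi> q y c S (ell2_on S) \<pi>"
    "\<And>r v. r \<in> \<Gamma> q y \<Longrightarrow> \<pi> (su_one q y r) v = (if r \<in> S then ell2_fun v r *\<^sub>C \<delta> r else 0)"
    "\<And>r v. r \<in> \<Gamma> q y \<Longrightarrow> \<pi> (su_Er q y r) v =
      (if r \<in> S \<and> q * r \<in> S then (of_real (ladder c r) * ell2_fun v r) *\<^sub>C \<delta> (q * r) else 0)"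
    "\<And>r v. r \<in> \<Gamma> q y \<Longrightarrow> \<pi> (su_Fr q y r) v =
      (if r \<in> S \<and> q * r \<in> S then (of_real (ladder c r) * ell2_fun v (q * r)) *\<^sub>C \<delta> r else 0)"
proof -
  have S\<Gamma>: "S \<subseteq> \<Gamma> q y" using S(1,2) by (fastforce simp: \<Gamma>_iff[OF q(1) y] Zset_def)
  have pos: "r > 0" if "r \<in> S" for r using that S(1) by auto
  have mem: "r \<in> S \<longleftrightarrow> r\<^sup>2 \<in> Zset S" if "r > 0" for r
    using that pos by (auto simp: Zset_def power2_eq_iff_nonneg less_imp_le)
  have cs: "c_set q c (Zset S)" using S(3) by (simp add: irreducible_c_set_def)
  \<comment> \<open>A strictly positive value would put the neighbour into \<open>S\<close>, so an
    absent neighbour means value 0; likewise for \<open>cdown\<close>.\<close>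
  have cup: "0 \<le> c + \<tau> (q * r\<^sup>2)" "q * r \<notin> S \<Longrightarrow> c + \<tau> (q * r\<^sup>2) = 0" if "r \<in> S" for r
    using cs that mem[of r] mem[of "q * r"] pos[OF that] q
    by (auto simp: c_set_iff power_mult_distrib less_le)
  have cdown: "0 \<le> c + \<tau> (r\<^sup>2 / q)" "r / q \<notin> S \<Longrightarrow> c + \<tau> (r\<^sup>2 / q) = 0" if "r \<in> S" for r
    using cs that mem[of r] mem[of "r / q"] pos[OF that] q
    by (auto simp: c_set_iff power_divide less_le)
  have lad2: "(ladder c r)\<^sup>2 = (c + \<tau> (q * r\<^sup>2)) / (inverse q - q)\<^sup>2" if "r \<in> S \<or> q * r \<in> S" for r
  proof -
    have "0 \<le> c + \<tau> (q * r\<^sup>2)"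
      using that cup(1)[of r] cdown(1)[of "q * r"] q by (auto simp: power2_eq_square mult_ac)
    then show ?thesis by (simp add: ladder_def power_divide)
  qed
  interpret R: rank_one_data "\<delta> :: real \<Rightarrow> real ell2" S su_src su_tgt "su_coeff c"
    by unfold_locales (rule cinner_\<delta>_\<delta>)
  \<comment> \<open>The commutator relation at weight \<open>r\<close>. The diagonal entries of
    \<open>F E\<close> and \<open>E F\<close> keep their generic formula at the ends of
    \<open>S\<close>, since the formula gives 0 there as well.\<close>
  have comm: "R.rk (ladder c r) r (q * r) (R.rk (ladder c r) (q * r) r v) -
      R.rk (ladder c (r / q)) r (r / q) (R.rk (ladder c (r / q)) (r / q) r v) =
      R.rk (complex_of_real ((r powi 2 - r powi (-2)) / (q - inverse q))) r r v"
    if "r > 0" for r v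
  proof (cases "r \<in> S")
    case True
    define A B where "A = (if q * r \<in> S then (ladder c r)\<^sup>2 else 0)"
      and "B = (if r / q \<in> S then (ladder c (r / q))\<^sup>2 else 0)"
    have "A = (c + \<tau> (q * r\<^sup>2)) / (inverse q - q)\<^sup>2"
      using lad2[of r] cup(2)[OF True] True by (auto simp: A_def)
    moreover have "B = (c + \<tau> (r\<^sup>2 / q)) / (inverse q - q)\<^sup>2"
      using lad2[of "r / q"] cdown(2)[OF True] True q
      by (auto simp: B_def power_divide power2_eq_square)
    ultimately have "A - B = (\<tau> (q * r\<^sup>2) - \<tau> (r\<^sup>2 / q)) / (inverse q - q)\<^sup>2"
      by (simp flip: diff_divide_distrib)
    also have "\<tau> (q * r\<^sup>2) - \<tau> (r\<^sup>2 / q) = (q - inverse q) * (r powi 2 - r powi (-2))"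
      using q \<open>r > 0\<close> by (simp add: \<tau>_def power_int_minus field_simps)
    also have "\<dots> / (inverse q - q)\<^sup>2 = (r powi 2 - r powi (-2)) / (q - inverse q)"
    proof -
      have "d * X / d\<^sup>2 = X / d" for d X :: real by (simp add: power2_eq_square)
      then show ?thesis by (metis power2_commute)
    qed
    finally have AB: "A - B = (r powi 2 - r powi (-2)) / (q - inverse q)" .
    have "R.rk (ladder c r) r (q * r) (R.rk (ladder c r) (q * r) r v) = R.rk (of_real A) r r v"
      by (simp add: A_def R.rk_rk power2_eq_square)
    moreover have "R.rk (ladder c (r / q)) r (r / q) (R.rk (ladder c (r / q)) (r / q) r v) =
        R.rk (of_real B) r r v"
      by (simp add: B_def R.rk_rk power2_eq_square)
    ultimately show ?thesis
      unfolding AB[symmetric] by (simp add: R.rk_def scaleC_diff_left left_diff_distrib)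
  qed (simp add: R.rk_outside)
  interpret R: rank_one_rep "\<delta> :: real \<Rightarrow> real ell2" S su_src su_tgt "su_coeff c"
    "su_gens q y" "su_rel q y"
  proof
    fix s t assume "(s, t) \<in> su_rel q y"
    then show "R.ev s = R.ev t"
      unfolding su_rel_def
    proof (elim UnE CollectE exE conjE Pair_inject)
      fix r assume *: "s = TAdd (TMult (Gen (Fgen r)) (Gen (Egen r)))
            (TScale (- 1) (TMult (Gen (Egen (r / q))) (Gen (Fgen (r / q)))))"
        "t = TScale (complex_of_real ((r powi 2 - r powi (-2)) / (q - inverse q))) (Gen (One1 r))"
        "r \<in> \<Gamma> q y"
      have "q * (r / q) = r" using q by simp
      then show ?thesis
        using comm[OF \<Gamma>_q(3)[OF *(3)]]
        by (simp add: * fun_eq_iff scaleC_minus_left del: times_divide_eq_right)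
          (simp add: R.rk_scale)
    qed (auto simp: fun_eq_iff R.rk_rk R.rk_outside)
  next
    fix r assume "r \<in> S"
    then show "\<exists>g\<in>su_gens q y. su_src g = r \<and> su_tgt g = r \<and> su_coeff c g = 1"
      using S\<Gamma> by (intro bexI[of _ "One1 r"]) (auto simp: su_gens_def)
  qed
  have irr: "irreducible_rep (su_alg q y) (ell2_on S) R.\<pi>"
    unfolding su_alg_def
  proof (rule R.irreducible_rep_\<pi>)
    show "ell2_on S = closure (cspan (\<delta> ` S))" by (rule closure_cspan_\<delta>[symmetric])
    show "S \<noteq> {}" using cs q by (auto simp: c_set_iff Zset_def)
  next
    fix r J assume r: "r \<in> S" "r \<in> J" and J: "\<And>g. g \<in> su_gens q y \<Longrightarrow> su_coeff c g \<noteq> 0 \<Longrightarrow>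
      su_src g \<in> J \<Longrightarrow> su_src g \<in> S \<Longrightarrow> su_tgt g \<in> S \<Longrightarrow> su_tgt g \<in> J"
    \<comment> \<open>Connectivity follows the generation of the component: \<open>up\<close> is an
      edge of \<open>Egen\<close>, \<open>down\<close> one of \<open>Fgen\<close>, with coefficient
      nonzero because the step is allowed.\<close>
    have "sqrt z \<in> S \<and> sqrt z \<in> J" if "z \<in> c_component q c (r\<^sup>2)" for z
      using that
    proof induction
      case base
      then show ?case using r pos[of r] by simp
    next
      case (up z)
      have s: "sqrt (q\<^sup>2 * z) = q * sqrt z" using q by (simp add: real_sqrt_mult)
      have z: "z > 0" using pos[of "sqrt z"] up by simp
      have "q * sqrt z \<in> S" using up.IH up.hyps(2) \<open>z > 0\<close> cup(2)[of "sqrt z"] by auto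
      moreover have "ladder c (sqrt z) \<noteq> 0"
        using up.hyps(2) z inverse_q_minus_q by (simp add: ladder_def)
      ultimately show ?case
        unfolding s using up.IH S\<Gamma> J[of "Egen (sqrt z)"] by (auto simp: su_gens_def)
    next
      case (down z)
      have s: "sqrt (z / q\<^sup>2) = sqrt z / q" using q by (simp add: real_sqrt_divide)
      have z: "z > 0" using pos[of "sqrt z"] down by simp
      have "sqrt z / q \<in> S" using down.IH down.hyps(2) \<open>z > 0\<close> cdown(2)[of "sqrt z"] by auto
      moreover have "q * (sqrt z / q)\<^sup>2 = z / q"
        using q z by (simp add: power_divide power2_eq_square)
      then have "ladder c (sqrt z / q) \<noteq> 0"
        using down.hyps(2) inverse_q_minus_q by (simp add: ladder_def del: times_divide_eq_right)
      ultimately show ?case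
        unfolding s using down.IH q S\<Gamma> J[of "Fgen (sqrt z / q)"] by (auto simp: su_gens_def)
    qed
    moreover have "Zset S = c_component q c (r\<^sup>2)"
      using irreducible_c_set_eq_component[OF q(1) S(3)] r(1) by (auto simp: Zset_def)
    ultimately show "S \<subseteq> J" using mem pos by (metis less_imp_le real_sqrt_unique subsetI)
  qed
  have one: "R.\<pi> (su_one q y r) v = (if r \<in> S then ell2_fun v r *\<^sub>C \<delta> r else 0)" for r v
    by (simp add: su_one_def R.\<pi>_cls R.rk_def cinner_\<delta>)
  have E: "R.\<pi> (su_Er q y r) v =
      (if r \<in> S \<and> q * r \<in> S then (of_real (ladder c r) * ell2_fun v r) *\<^sub>C \<delta> (q * r) else 0)" for r v
    by (simp add: su_Er_def R.\<pi>_cls R.rk_def cinner_\<delta>)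
  have F: "R.\<pi> (su_Fr q y r) v =
      (if r \<in> S \<and> q * r \<in> S then (of_real (ladder c r) * ell2_fun v (q * r)) *\<^sub>C \<delta> r else 0)" for r v
    by (simp add: su_Fr_def R.\<pi>_cls R.rk_def cinner_\<delta>)
  have rep: "star_rep (su_alg q y) (ell2_on S) R.\<pi>" using irr by (simp add: irreducible_rep_def)
  have "is_\<pi> q y c S (ell2_on S) R.\<pi>"
    unfolding is_\<pi>_def
  proof (intro conjI ballI irr)
    fix r v assume r: "r \<in> \<Gamma> q y" and v: "v \<in> ell2_on S"
    show "R.\<pi> (fst (casimir q y) (su_one q y r)) v = complex_of_real c *\<^sub>C R.\<pi> (su_one q y r) v"
    proof (cases "r \<in> S")
      case True
      define A where "A = (if q * r \<in> S then (ladder c r)\<^sup>2 else 0)"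
      define w where "w = ell2_fun v r *\<^sub>C \<delta> r"
      have "(inverse q - q)\<^sup>2 * A = c + \<tau> (q * r\<^sup>2)"
        using lad2[of r] cup(2)[of r] True inverse_q_minus_q by (auto simp: A_def)
      then have c: "(inverse q - q)\<^sup>2 * A + - q * r powi 2 + - inverse q * r powi (-2) = c"
        by (simp add: \<tau>_def power_int_minus)
      have FE: "R.\<pi> (su_Fr q y r \<otimes>\<^bsub>su_alg q y\<^esub> su_Er q y r) v = complex_of_real A *\<^sub>C w"
        using r v True
        by (simp add: star_repD[OF rep] E F scaleC_scaleC ell2_fun_\<delta> A_def w_def power2_eq_square mult.assoc)
      have w: "R.\<pi> (su_one q y r) v = w" using True by (simp add: one w_def)
      have "R.\<pi> (fst (casimir q y) (su_one q y r)) v =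
          complex_of_real ((inverse q - q)\<^sup>2 * A + - q * r powi 2 + - inverse q * r powi (-2)) *\<^sub>C w"
        using r v
        by (simp only: fst_casimir[OF r] star_repD[OF rep] su_closed A.m_closed A.smult_closed
            A.a_closed FE w scaleC_scaleC scaleC_add_left of_real_add of_real_mult)
      then show ?thesis by (simp only: c w)
    next
      case False
      then show ?thesis using r v by (simp add: fst_casimir star_repD[OF rep] one E F)
    qed
  next
    show "S = {r \<in> \<Gamma> q y. \<exists>v\<in>ell2_on S. R.\<pi> (su_one q y r) v \<noteq> 0}"
    proof (intro equalityI subsetI)
      fix r assume r: "r \<in> S"
      have "\<delta> r \<noteq> 0" using cinner_\<delta>_\<delta>[of r r] by auto
      then show "r \<in> {r \<in> \<Gamma> q y. \<exists>v\<in>ell2_on S. R.\<pi> (su_one q y r) v \<noteq> 0}"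
        using r S\<Gamma> \<delta>_in_ell2_on[OF r] by (auto simp: one ell2_fun_\<delta> intro!: bexI[of _ "\<delta> r"])
    qed (auto simp: one split: if_splits)
  qed
  then show ?thesis using one E F by (rule that)
qed

end

subsection \<open>The dynamical algebra\<close>

text \<open>Non-degeneracy is formulated with a real span; passing to the complex span enlarges
  nothing inside the closed complex subspace \<open>H\<close>.\<close>

lemma star_rep_total:
  assumes "star_rep A H \<pi>"
  shows "closure (cspan {\<pi> a v | a v. a \<in> carrier A \<and> v \<in> H}) = H"
proof
  show "closure (cspan {\<pi> a v | a v. a \<in> carrier A \<and> v \<in> H}) \<subseteq> H"
    by (rule closure_cspan_minimal) (auto simp: star_repD[OF assms])
  have "span {\<pi> a v | a v. a \<in> carrier A \<and> v \<in> H} \<subseteq> cspan {\<pi> a v | a v. a \<in> carrier A \<and> v \<in> H}"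
    by (intro span_minimal csubspace_imp_subspace csubspace_cspan subsetI cspan_superset)
  then show "H \<subseteq> closure (cspan {\<pi> a v | a v. a \<in> carrier A \<and> v \<in> H})"
    using closure_mono[of "span {\<pi> a v | a v. a \<in> carrier A \<and> v \<in> H}"]
    unfolding star_repD(10)[OF assms] by blast
qed

locale dyn =
  fixes q x :: real
  assumes q: "0 < q" "q < 1" and x: "0 < x"
begin

lemmas \<Lambda>_q = \<Lambda>_powi[OF q(1)] \<Lambda>_mult_q[OF q(1)] \<Lambda>_div_q[OF q(1)] \<Lambda>_pos[OF q(1) x]

lemma powi_cancel [simp]:
  "q powi (- n) * (q powi n * a) = a" "q powi n * (q powi (- n) * a) = a"
  using q by (simp_all add: power_int_minus)

lemma powi_eq_iff: "q powi n * a = b \<longleftrightarrow> a = q powi (- n) * b" "b = q powi n * a \<longleftrightarrow> a = q powi (- n) * b"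
  using powi_cancel by metis+

sublocale A: star_alg "dyn_alg q x"
  unfolding dyn_alg_def by (rule star_alg_pres_alg)

definition u :: "int \<Rightarrow> int \<Rightarrow> real \<Rightarrow> real \<Rightarrow> dyn_gen sterm set" where
  "u \<epsilon> \<nu> y z = pres_cls (dyn_rel q x) (Gen (Uel \<epsilon> \<nu> y z))"

lemma dyn_closed [simp]:
  "y \<in> \<Lambda> q x \<Longrightarrow> z \<in> \<Lambda> q x \<Longrightarrow> dyn_one q x y z \<in> carrier (dyn_alg q x)"
  "\<epsilon> \<in> {-1, 1} \<Longrightarrow> \<nu> \<in> {-1, 1} \<Longrightarrow> y \<in> \<Lambda> q x \<Longrightarrow> z \<in> \<Lambda> q x \<Longrightarrow> u \<epsilon> \<nu> y z \<in> carrier (dyn_alg q x)"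
  by (auto simp: dyn_alg_def dyn_one_def u_def dyn_gens_def)

lemma dyn_eqI: "(s, t) \<in> dyn_rel q x \<Longrightarrow> pres_cls (dyn_rel q x) s = pres_cls (dyn_rel q x) t"
  by (rule pres_cls_eqI[OF pres_cong.rel])

lemma one_one:
  assumes "y \<in> \<Lambda> q x" "z \<in> \<Lambda> q x" "y' \<in> \<Lambda> q x" "z' \<in> \<Lambda> q x"
  shows "dyn_one q x y z \<otimes>\<^bsub>dyn_alg q x\<^esub> dyn_one q x y' z' =
    (if y = y' \<and> z = z' then dyn_one q x y z else \<zero>\<^bsub>dyn_alg q x\<^esub>)"
  unfolding dyn_alg_def dyn_one_def pres_alg_simps
  by (subst dyn_eqI[of _ "if y = y' \<and> z = z' then Gen (One2 y z) else TZero"])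
    (use assms in \<open>auto simp: dyn_rel_def\<close>)

lemma adj_one:
  assumes "y \<in> \<Lambda> q x" "z \<in> \<Lambda> q x"
  shows "adj (dyn_alg q x) (dyn_one q x y z) = dyn_one q x y z"
  unfolding dyn_alg_def dyn_one_def pres_alg_simps
  by (rule dyn_eqI) (use assms in \<open>force simp: dyn_rel_def\<close>)

context
  fixes \<epsilon> \<nu> :: int
  assumes \<epsilon>\<nu>: "\<epsilon> \<in> {-1, 1}" "\<nu> \<in> {-1, 1}"
begin

lemma u_units:
  assumes "y \<in> \<Lambda> q x" "z \<in> \<Lambda> q x"
  shows "dyn_one q x y z \<otimes>\<^bsub>dyn_alg q x\<^esub> u \<epsilon> \<nu> y z = u \<epsilon> \<nu> y z"
    "u \<epsilon> \<nu> y z \<otimes>\<^bsub>dyn_alg q x\<^esub> dyn_one q x (q powi \<epsilon> * y) (q powi \<nu> * z) = u \<epsilon> \<nu> y z"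
proof -
  have 1: "(TMult (Gen (One2 y z)) (Gen (Uel \<epsilon> \<nu> y z)), Gen (Uel \<epsilon> \<nu> y z)) \<in> dyn_rel q x"
    using assms \<epsilon>\<nu> by (simp add: dyn_rel_def)
  have 2: "(TMult (Gen (Uel \<epsilon> \<nu> y z)) (Gen (One2 (q powi \<epsilon> * y) (q powi \<nu> * z))),
      Gen (Uel \<epsilon> \<nu> y z)) \<in> dyn_rel q x"
    using assms \<epsilon>\<nu> by (simp add: dyn_rel_def)
  from 1[THEN dyn_eqI] 2[THEN dyn_eqI] show
    "dyn_one q x y z \<otimes>\<^bsub>dyn_alg q x\<^esub> u \<epsilon> \<nu> y z = u \<epsilon> \<nu> y z"
    "u \<epsilon> \<nu> y z \<otimes>\<^bsub>dyn_alg q x\<^esub> dyn_one q x (q powi \<epsilon> * y) (q powi \<nu> * z) = u \<epsilon> \<nu> y z"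
    by (simp_all add: dyn_alg_def u_def dyn_one_def pres_alg_simps)
qed

lemma one_u:
  assumes "y \<in> \<Lambda> q x" "z \<in> \<Lambda> q x" "a \<in> \<Lambda> q x" "b \<in> \<Lambda> q x"
  shows "dyn_one q x a b \<otimes>\<^bsub>dyn_alg q x\<^esub> u \<epsilon> \<nu> y z =
      (if a = y \<and> b = z then u \<epsilon> \<nu> y z else \<zero>\<^bsub>dyn_alg q x\<^esub>)"
    "u \<epsilon> \<nu> y z \<otimes>\<^bsub>dyn_alg q x\<^esub> dyn_one q x a b =
      (if a = q powi \<epsilon> * y \<and> b = q powi \<nu> * z then u \<epsilon> \<nu> y z else \<zero>\<^bsub>dyn_alg q x\<^esub>)"
proof -
  let ?A = "dyn_alg q x" and ?u = "u \<epsilon> \<nu> y z"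
    and ?s = "dyn_one q x (q powi \<epsilon> * y) (q powi \<nu> * z)"
  note \<Lambda> = \<Lambda>_q(1)[OF assms(1), of \<epsilon>] \<Lambda>_q(1)[OF assms(2), of \<nu>]
  have "dyn_one q x a b \<otimes>\<^bsub>?A\<^esub> (dyn_one q x y z \<otimes>\<^bsub>?A\<^esub> ?u) =
      (dyn_one q x a b \<otimes>\<^bsub>?A\<^esub> dyn_one q x y z) \<otimes>\<^bsub>?A\<^esub> ?u"
    using assms \<epsilon>\<nu> by (intro A.m_assoc[symmetric] dyn_closed)
  then show "dyn_one q x a b \<otimes>\<^bsub>?A\<^esub> ?u = (if a = y \<and> b = z then ?u else \<zero>\<^bsub>?A\<^esub>)"
    using assms \<epsilon>\<nu> by (simp add: u_units(1) one_one)
  have "?u \<otimes>\<^bsub>?A\<^esub> ?s \<otimes>\<^bsub>?A\<^esub> dyn_one q x a b = ?u \<otimes>\<^bsub>?A\<^esub> (?s \<otimes>\<^bsub>?A\<^esub> dyn_one q x a b)"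
    using assms \<epsilon>\<nu> \<Lambda> by (intro A.m_assoc dyn_closed)
  moreover have "?s \<otimes>\<^bsub>?A\<^esub> dyn_one q x a b =
      (if a = q powi \<epsilon> * y \<and> b = q powi \<nu> * z then ?s else \<zero>\<^bsub>?A\<^esub>)"
    using one_one[OF \<Lambda> assms(3,4)] by auto
  ultimately show "?u \<otimes>\<^bsub>?A\<^esub> dyn_one q x a b =
      (if a = q powi \<epsilon> * y \<and> b = q powi \<nu> * z then ?u else \<zero>\<^bsub>?A\<^esub>)"
    using u_units(2)[OF assms(1,2)] dyn_closed(2)[OF \<epsilon>\<nu> assms(1,2)]
    by (cases "a = q powi \<epsilon> * y \<and> b = q powi \<nu> * z")
      (simp_all only: A.mult_zero if_True if_False simp_thms)
qed

lemma adj_u: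
  assumes "y \<in> \<Lambda> q x" "z \<in> \<Lambda> q x"
  shows "adj (dyn_alg q x) (u \<epsilon> \<nu> y z) =
    complex_of_real (of_int \<nu> * sqrt (wfun q \<nu> z) / (of_int \<epsilon> * sqrt (wfun q \<epsilon> y))) \<odot>\<^bsub>dyn_alg q x\<^esub>
      u (- \<epsilon>) (- \<nu>) (q powi \<epsilon> * y) (q powi \<nu> * z)"
  unfolding dyn_alg_def u_def pres_alg_simps
  by (rule dyn_eqI, unfold dyn_rel_def) (use assms \<epsilon>\<nu> in blast)

lemma u_rel1:
  assumes "w \<in> \<Lambda> q x" "y \<in> \<Lambda> q x"
  shows "adj (dyn_alg q x) (u (-1) \<epsilon> (q * w) y) \<otimes>\<^bsub>dyn_alg q x\<^esub> u (-1) \<nu> (q * w) y \<oplus>\<^bsub>dyn_alg q x\<^esub>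
      adj (dyn_alg q x) (u 1 \<epsilon> (w / q) y) \<otimes>\<^bsub>dyn_alg q x\<^esub> u 1 \<nu> (w / q) y =
    (if \<epsilon> = \<nu> then dyn_one q x w (q powi \<epsilon> * y) else \<zero>\<^bsub>dyn_alg q x\<^esub>)"
proof -
  have "(TAdd (TMult (TStar (Gen (Uel (-1) \<epsilon> (q * w) y))) (Gen (Uel (-1) \<nu> (q * w) y)))
      (TMult (TStar (Gen (Uel 1 \<epsilon> (w / q) y))) (Gen (Uel 1 \<nu> (w / q) y))),
      if \<epsilon> = \<nu> \<and> y = y then Gen (One2 w (q powi \<epsilon> * y)) else TZero) \<in> dyn_rel q x"
    unfolding dyn_rel_def using assms \<epsilon>\<nu> by blast
  from dyn_eqI[OF this] show ?thesis
    by (simp only: dyn_alg_def u_def dyn_one_def pres_alg_simps if_distrib[of "pres_cls _"]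
        simp_thms)
qed

lemma u_rel2:
  assumes "y \<in> \<Lambda> q x" "z \<in> \<Lambda> q x" "w \<in> \<Lambda> q x"
  shows "u \<epsilon> (-1) y w \<otimes>\<^bsub>dyn_alg q x\<^esub> adj (dyn_alg q x) (u \<nu> (-1) z w) \<oplus>\<^bsub>dyn_alg q x\<^esub>
      u \<epsilon> 1 y w \<otimes>\<^bsub>dyn_alg q x\<^esub> adj (dyn_alg q x) (u \<nu> 1 z w) =
    (if \<epsilon> = \<nu> \<and> y = z then dyn_one q x y w else \<zero>\<^bsub>dyn_alg q x\<^esub>)"
proof -
  have "(TAdd (TMult (Gen (Uel \<epsilon> (-1) y w)) (TStar (Gen (Uel \<nu> (-1) z w))))
      (TMult (Gen (Uel \<epsilon> 1 y w)) (TStar (Gen (Uel \<nu> 1 z w)))),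
      if \<epsilon> = \<nu> \<and> y = z then Gen (One2 y w) else TZero) \<in> dyn_rel q x"
    unfolding dyn_rel_def using assms \<epsilon>\<nu> by blast
  from dyn_eqI[OF this] show ?thesis
    by (simp only: dyn_alg_def u_def dyn_one_def pres_alg_simps if_distrib[of "pres_cls _"])
qed

end

lemma dyn_star_gens:
  assumes "g \<in> dyn_gens q x"
  shows "\<exists>h\<in>dyn_gens q x. \<exists>c. pres_cong (dyn_rel q x) (TStar (Gen g)) (TScale c (Gen h))"
proof (cases g)
  case (One2 y z)
  then have "y \<in> \<Lambda> q x" "z \<in> \<Lambda> q x" using assms by (auto simp: dyn_gens_def)
  from adj_one[OF this] have "pres_cong (dyn_rel q x) (TStar (Gen g)) (Gen g)"
    by (simp add: dyn_alg_def dyn_one_def pres_alg_simps One2 pres_cls_eq_iff)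
  then show ?thesis using assms by (meson pres_cong.scale_one pres_cong.sym pres_cong.trans)
next
  case (Uel \<epsilon> \<nu> y z)
  then have *: "\<epsilon> \<in> {-1, 1}" "\<nu> \<in> {-1, 1}" "y \<in> \<Lambda> q x" "z \<in> \<Lambda> q x"
    using assms by (auto simp: dyn_gens_def)
  have "Uel (- \<epsilon>) (- \<nu>) (q powi \<epsilon> * y) (q powi \<nu> * z) \<in> dyn_gens q x"
    using * \<Lambda>_q(1) by (auto simp: dyn_gens_def)
  then show ?thesis using adj_u[OF *]
    by (auto simp: dyn_alg_def u_def pres_alg_simps Uel pres_cls_eq_iff)
qed

lemma dyn_induct [consumes 1, case_names zero add smult one u mult_one mult_u]:
  assumes "a \<in> carrier (dyn_alg q x)"
    and "P \<zero>\<^bsub>dyn_alg q x\<^esub>"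
    and "\<And>a b. a \<in> carrier (dyn_alg q x) \<Longrightarrow> b \<in> carrier (dyn_alg q x) \<Longrightarrow> P a \<Longrightarrow> P b \<Longrightarrow>
      P (a \<oplus>\<^bsub>dyn_alg q x\<^esub> b)"
    and "\<And>c a. a \<in> carrier (dyn_alg q x) \<Longrightarrow> P a \<Longrightarrow> P (c \<odot>\<^bsub>dyn_alg q x\<^esub> a)"
    and "\<And>y z. y \<in> \<Lambda> q x \<Longrightarrow> z \<in> \<Lambda> q x \<Longrightarrow> P (dyn_one q x y z)"
    and "\<And>\<epsilon> \<nu> y z. \<epsilon> \<in> {-1, 1} \<Longrightarrow> \<nu> \<in> {-1, 1} \<Longrightarrow> y \<in> \<Lambda> q x \<Longrightarrow> z \<in> \<Lambda> q x \<Longrightarrow> P (u \<epsilon> \<nu> y z)"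
    and "\<And>y z a. y \<in> \<Lambda> q x \<Longrightarrow> z \<in> \<Lambda> q x \<Longrightarrow> a \<in> carrier (dyn_alg q x) \<Longrightarrow> P a \<Longrightarrow>
      P (dyn_one q x y z \<otimes>\<^bsub>dyn_alg q x\<^esub> a)"
    and "\<And>\<epsilon> \<nu> y z a. \<epsilon> \<in> {-1, 1} \<Longrightarrow> \<nu> \<in> {-1, 1} \<Longrightarrow> y \<in> \<Lambda> q x \<Longrightarrow> z \<in> \<Lambda> q x \<Longrightarrow>
      a \<in> carrier (dyn_alg q x) \<Longrightarrow> P a \<Longrightarrow> P (u \<epsilon> \<nu> y z \<otimes>\<^bsub>dyn_alg q x\<^esub> a)"
  shows "P a"
  using assms(1) unfolding dyn_alg_def
proof (induction rule: pres_alg_induct)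
  case (gen g)
  then show ?case using assms(5,6) by (auto simp: dyn_gens_def u_def dyn_one_def)
next
  case (mult g X)
  then show ?case using assms(7,8) by (auto simp: dyn_gens_def u_def dyn_one_def dyn_alg_def)
qed (use assms(2-4) dyn_star_gens in \<open>simp_all add: dyn_alg_def\<close>)

text \<open>The minus sign that \<open>is_\<Phi>\<close> attaches to the image of the second
  \<open>F\<close>, whose index pair is (-1, 1).\<close>

definition sg :: "int \<Rightarrow> int \<Rightarrow> real" where
  "sg \<alpha> \<beta> = (if \<alpha> = -1 \<and> \<beta> = 1 then - 1 else 1)"

text \<open>Equal indices belong to the first copy, which sees the Casimir value \<open>c\<close>;
  unequal ones to the second, which sees \<open>- c\<close>.\<close>

definition sig :: "int \<Rightarrow> int \<Rightarrow> real" where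
  "sig \<alpha> \<beta> = (if \<alpha> = \<beta> then 1 else - 1)"

text \<open>The squared weight of the copy that moves: \<open>r\<^sup>2 = y * z\<close> for the
  first, \<open>s\<^sup>2 = y / z\<close> for the second.\<close>

definition pr :: "int \<Rightarrow> int \<Rightarrow> real \<Rightarrow> real \<Rightarrow> real" where
  "pr \<alpha> \<beta> y z = (if \<alpha> = \<beta> then y * z else y / z)"

text \<open>Up to signs, the coefficient in the relation for the adjoint of a generator is a
  quotient of the normalising factors of two opposite ladder operators. This is why these become
  adjoint without any factor.\<close>

lemma adj_coeff:
  assumes "\<epsilon> \<in> {-1, 1}" "\<nu> \<in> {-1, 1}" "y > 0" "z > 0"
  shows "of_int \<nu> * sqrt (wfun q \<nu> z) / (of_int \<epsilon> * sqrt (wfun q \<epsilon> y)) =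
    sg (- \<epsilon>) (- \<nu>) / sqrt (\<tau> (q powi \<epsilon> * y) * \<tau> z) * (sg \<epsilon> \<nu> * sqrt (\<tau> y * \<tau> (q powi \<nu> * z)))"
proof -
  let ?k = "sqrt (\<tau> (q powi \<epsilon> * y) * \<tau> z)"
  have "q powi \<epsilon> * y > 0" "q powi \<nu> * z > 0" using q assms by simp_all
  then have y: "\<tau> (q powi \<epsilon> * y) > 0" "\<tau> z > 0" "\<tau> y > 0" "\<tau> (q powi \<nu> * z) > 0"
    using assms by (simp_all add: \<tau>_pos)
  have sgn: "of_int \<nu> / of_int \<epsilon> = sg (- \<epsilon>) (- \<nu>) * sg \<epsilon> \<nu>"
    using assms(1,2) by (auto simp: sg_def)
  have "sg (- \<epsilon>) (- \<nu>) / ?k * (sg \<epsilon> \<nu> * sqrt (\<tau> y * \<tau> (q powi \<nu> * z))) =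
      (of_int \<nu> / of_int \<epsilon>) * (sqrt (\<tau> y * \<tau> (q powi \<nu> * z)) / ?k)"
    by (simp add: sgn)
  also have "sqrt (\<tau> y * \<tau> (q powi \<nu> * z)) / ?k = sqrt (wfun q \<nu> z) / sqrt (wfun q \<epsilon> y)"
    using y by (simp add: wfun_def real_sqrt_mult real_sqrt_divide mult.commute)
  finally show ?thesis by simp
qed

end

section \<open>Weight projections and ladder operators of a representation\<close>

locale dyn_rep = dyn +
  fixes H :: "'h::chilbert_space set" and \<pi> :: "dyn_gen sterm set \<Rightarrow> 'h \<Rightarrow> 'h"
  assumes rep: "star_rep (dyn_alg q x) H \<pi>"
begin

lemmas repD = star_repD[OF rep] and rep_linear = star_rep_linear[OF rep]

definition P :: "real \<Rightarrow> real \<Rightarrow> 'h \<Rightarrow> 'h" where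
  "P y z = \<pi> (dyn_one q x y z)"

text \<open>
  The operator \<open>D \<alpha> \<beta> y z\<close> from the weight space at \<open>(y, z)\<close> to the one at
  \<open>(q\<^sup>\<alpha> y, q\<^sup>\<beta> z)\<close> is, up to the factor \<open>q\<^sup>-\<^sup>1 - q\<close>, the image of \<open>E\<^sup>(\<^sup>1\<^sup>)\<close>, \<open>E\<^sup>(\<^sup>2\<^sup>)\<close>, \<open>F\<^sup>(\<^sup>2\<^sup>)\<close>,
  \<open>F\<^sup>(\<^sup>1\<^sup>)\<close> for \<open>(\<alpha>, \<beta>) = (+, +), (+, -), (-, +), (-, -)\<close>.
\<close>

definition D :: "int \<Rightarrow> int \<Rightarrow> real \<Rightarrow> real \<Rightarrow> 'h \<Rightarrow> 'h" where
  "D \<alpha> \<beta> y z v = complex_of_real (sg \<alpha> \<beta> * sqrt (\<tau> y * \<tau> (q powi \<beta> * z))) *\<^sub>C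
     \<pi> (u (- \<alpha>) (- \<beta>) (q powi \<alpha> * y) (q powi \<beta> * z)) v"

lemma sign_minus: "\<alpha> \<in> {-1, 1} \<Longrightarrow> - \<alpha> \<in> {-1, 1 :: int}"
  by auto

lemma P_bounded: "y \<in> \<Lambda> q x \<Longrightarrow> z \<in> \<Lambda> q x \<Longrightarrow> bounded_operator_on H (P y z)"
  unfolding P_def by (rule repD(4)) simp

lemma D_bounded:
  "\<alpha> \<in> {-1, 1} \<Longrightarrow> \<beta> \<in> {-1, 1} \<Longrightarrow> y \<in> \<Lambda> q x \<Longrightarrow> z \<in> \<Lambda> q x \<Longrightarrow> bounded_operator_on H (D \<alpha> \<beta> y z)"
  unfolding D_def
  by (intro bounded_operator_on_scaleC repD(2) repD(4) dyn_closed \<Lambda>_q(1) sign_minus)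

lemma P_in [simp]: "y \<in> \<Lambda> q x \<Longrightarrow> z \<in> \<Lambda> q x \<Longrightarrow> v \<in> H \<Longrightarrow> P y z v \<in> H"
  using bounded_operator_onD(1)[OF P_bounded] .

lemma D_in [simp]:
  "\<alpha> \<in> {-1, 1} \<Longrightarrow> \<beta> \<in> {-1, 1} \<Longrightarrow> y \<in> \<Lambda> q x \<Longrightarrow> z \<in> \<Lambda> q x \<Longrightarrow> v \<in> H \<Longrightarrow> D \<alpha> \<beta> y z v \<in> H"
  using bounded_operator_onD(1)[OF D_bounded] .

lemma P_P:
  assumes "y \<in> \<Lambda> q x" "z \<in> \<Lambda> q x" "y' \<in> \<Lambda> q x" "z' \<in> \<Lambda> q x" "v \<in> H"
  shows "P y z (P y' z' v) = (if y = y' \<and> z = z' then P y z v else 0)"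
  using assms repD(7)[of "dyn_one q x y z" "dyn_one q x y' z'" v]
  by (auto simp: P_def one_one star_rep_zero[OF rep A.star_alg_axioms])

lemma cinner_P:
  assumes "y \<in> \<Lambda> q x" "z \<in> \<Lambda> q x" "v \<in> H" "w \<in> H"
  shows "cinner (P y z v) w = cinner v (P y z w)"
  using repD(9)[of "dyn_one q x y z" v w] assms by (simp add: P_def adj_one)

lemma P_D:
  assumes "\<alpha> \<in> {-1, 1}" "\<beta> \<in> {-1, 1}" "y \<in> \<Lambda> q x" "z \<in> \<Lambda> q x" "a \<in> \<Lambda> q x" "b \<in> \<Lambda> q x" "v \<in> H"
  shows "P a b (D \<alpha> \<beta> y z v) = (if a = q powi \<alpha> * y \<and> b = q powi \<beta> * z then D \<alpha> \<beta> y z v else 0)"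
    "D \<alpha> \<beta> y z (P a b v) = (if a = y \<and> b = z then D \<alpha> \<beta> y z v else 0)"
proof -
  let ?u = "u (- \<alpha>) (- \<beta>) (q powi \<alpha> * y) (q powi \<beta> * z)"
  note c = sign_minus[OF assms(1)] sign_minus[OF assms(2)]
    \<Lambda>_q(1)[OF assms(3), of \<alpha>] \<Lambda>_q(1)[OF assms(4), of \<beta>]
  have "P a b (\<pi> ?u v) = (if a = q powi \<alpha> * y \<and> b = q powi \<beta> * z then \<pi> ?u v else 0)"
    using repD(7)[of "dyn_one q x a b" ?u v] c assms(5-7)
    by (auto simp: P_def one_u(1)[OF c assms(5,6)] star_rep_zero[OF rep A.star_alg_axioms] split: if_splits)
  then show "P a b (D \<alpha> \<beta> y z v) = (if a = q powi \<alpha> * y \<and> b = q powi \<beta> * z then D \<alpha> \<beta> y z v else 0)"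
    unfolding D_def P_def using c assms by (simp add: rep_linear repD(5))
  have "\<pi> ?u (P a b v) = (if a = y \<and> b = z then \<pi> ?u v else 0)"
    using repD(7)[of ?u "dyn_one q x a b" v] c assms(5-7)
    by (auto simp: P_def one_u(2)[OF c assms(5,6)] star_rep_zero[OF rep A.star_alg_axioms] split: if_splits)
  then show "D \<alpha> \<beta> y z (P a b v) = (if a = y \<and> b = z then D \<alpha> \<beta> y z v else 0)"
    unfolding D_def by simp
qed

text \<open>Every word begins with a letter fixed on the left by some \<open>dyn_one\<close>, so all
  vectors \<open>\<pi> a w\<close> lie in sums of ranges of weight projections, and \<open>v\<close>
  is orthogonal to these ranges.\<close>

lemma weight_zero:
  assumes "v \<in> H" "\<And>y z. y \<in> \<Lambda> q x \<Longrightarrow> z \<in> \<Lambda> q x \<Longrightarrow> P y z v = 0"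
  shows "v = 0"
proof (rule eq_zero_if_cinner_total[OF star_rep_total[OF rep] assms(1)])
  have "\<forall>w\<in>H. cinner (\<pi> a w) v = 0" if "a \<in> carrier (dyn_alg q x)" for a
    using that
  proof (induction rule: dyn_induct)
    have P: "cinner (P y z w) v = 0" if "y \<in> \<Lambda> q x" "z \<in> \<Lambda> q x" "w \<in> H" for y z w
      using that assms by (simp add: cinner_P)
    {
      fix \<epsilon> \<nu> y z assume *: "\<epsilon> \<in> {-1, 1 :: int}" "\<nu> \<in> {-1, 1 :: int}" "y \<in> \<Lambda> q x" "z \<in> \<Lambda> q x"
      have u: "cinner (\<pi> (u \<epsilon> \<nu> y z) w) v = 0" if "w \<in> H" for w
        using that * repD(7)[of "dyn_one q x y z" "u \<epsilon> \<nu> y z" w] P[of y z "\<pi> (u \<epsilon> \<nu> y z) w"]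
        by (simp add: u_units(1)[OF *] P_def repD(5))
      then show "\<forall>w\<in>H. cinner (\<pi> (u \<epsilon> \<nu> y z) w) v = 0" by blast
      fix a assume "a \<in> carrier (dyn_alg q x)"
      then show "\<forall>w\<in>H. cinner (\<pi> (u \<epsilon> \<nu> y z \<otimes>\<^bsub>dyn_alg q x\<^esub> a) w) v = 0"
        using * u by (simp add: repD)
    next
      fix y z assume *: "y \<in> \<Lambda> q x" "z \<in> \<Lambda> q x"
      then show "\<forall>w\<in>H. cinner (\<pi> (dyn_one q x y z) w) v = 0" using P by (simp add: P_def)
      fix a assume "a \<in> carrier (dyn_alg q x)"
      then show "\<forall>w\<in>H. cinner (\<pi> (dyn_one q x y z \<otimes>\<^bsub>dyn_alg q x\<^esub> a) w) v = 0"
        using * P by (simp add: repD P_def)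
    }
  qed (simp_all add: star_rep_zero[OF rep A.star_alg_axioms] repD cinner_add_left cinner_scaleC_left)
  then show "cinner w v = 0" if "w \<in> {\<pi> a v | a v. a \<in> carrier (dyn_alg q x) \<and> v \<in> H}" for w
    using that by blast
qed

lemma weight_eqI:
  assumes "v \<in> H" "w \<in> H" "\<And>y z. y \<in> \<Lambda> q x \<Longrightarrow> z \<in> \<Lambda> q x \<Longrightarrow> P y z v = P y z w"
  shows "v = w"
proof -
  have "v - w = 0"
    by (rule weight_zero) (use assms in \<open>simp_all add: csubspace_diff[OF repD(2)] P_def rep_linear\<close>)
  then show ?thesis by simp
qed

text \<open>A generator and its adjoint carry the same factor in front of the ladder operators.
  Products of the two kinds in the unitarity relations therefore acquire a common denominator, which
  can be cleared.\<close>

lemma u_eq_D: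
  assumes "\<epsilon> \<in> {-1, 1}" "\<nu> \<in> {-1, 1}" "y \<in> \<Lambda> q x" "z \<in> \<Lambda> q x" "v \<in> H"
  shows "\<pi> (u \<epsilon> \<nu> y z) v = complex_of_real (sg (- \<epsilon>) (- \<nu>) / sqrt (\<tau> (q powi \<epsilon> * y) * \<tau> z)) *\<^sub>C
      D (- \<epsilon>) (- \<nu>) (q powi \<epsilon> * y) (q powi \<nu> * z) v"
    "\<pi> (adj (dyn_alg q x) (u \<epsilon> \<nu> y z)) v =
      complex_of_real (sg (- \<epsilon>) (- \<nu>) / sqrt (\<tau> (q powi \<epsilon> * y) * \<tau> z)) *\<^sub>C D \<epsilon> \<nu> y z v"
proof -
  have y: "\<tau> (q powi \<epsilon> * y) > 0" "\<tau> z > 0" "\<tau> y > 0" "\<tau> (q powi \<nu> * z) > 0"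
    by (rule \<tau>_pos, rule \<Lambda>_q(4), use assms(3,4) \<Lambda>_q(1) in blast)+
  have sg: "sg a b * sg a b = 1" for a b by (simp add: sg_def)
  let ?k = "sqrt (\<tau> (q powi \<epsilon> * y) * \<tau> z)"
  have "sg (- \<epsilon>) (- \<nu>) / ?k * (sg (- \<epsilon>) (- \<nu>) * ?k) = 1"
    using y sg[of "- \<epsilon>" "- \<nu>"] by (simp add: field_simps)
  then have 1: "complex_of_real (sg (- \<epsilon>) (- \<nu>) / ?k) * complex_of_real (sg (- \<epsilon>) (- \<nu>) * ?k) = 1"
    by (simp only: of_real_mult[symmetric] of_real_1)
  then show "\<pi> (u \<epsilon> \<nu> y z) v = complex_of_real (sg (- \<epsilon>) (- \<nu>) / ?k) *\<^sub>C
      D (- \<epsilon>) (- \<nu>) (q powi \<epsilon> * y) (q powi \<nu> * z) v"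
    by (simp only: D_def powi_cancel minus_minus scaleC_scaleC scaleC_one)
  have "complex_of_real (of_int \<nu> * sqrt (wfun q \<nu> z) / (of_int \<epsilon> * sqrt (wfun q \<epsilon> y))) =
      complex_of_real (sg (- \<epsilon>) (- \<nu>) / ?k) * complex_of_real (sg \<epsilon> \<nu> * sqrt (\<tau> y * \<tau> (q powi \<nu> * z)))"
    by (subst adj_coeff) (use assms \<Lambda>_q(4) in \<open>simp_all only: of_real_mult\<close>)
  then show "\<pi> (adj (dyn_alg q x) (u \<epsilon> \<nu> y z)) v = complex_of_real (sg (- \<epsilon>) (- \<nu>) / ?k) *\<^sub>C D \<epsilon> \<nu> y z v"
    using assms sign_minus \<Lambda>_q(1)
    by (simp only: adj_u[OF assms(1-4)] D_def scaleC_scaleC repD(8)[OF dyn_closed(2)])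
qed

text \<open>Opposite ladder operators are adjoint because the square roots in \<open>D\<close>
  balance those in the adjoint relation of the generators.\<close>

lemma cinner_D:
  assumes "\<alpha> \<in> {-1, 1}" "\<beta> \<in> {-1, 1}" "y \<in> \<Lambda> q x" "z \<in> \<Lambda> q x" "v \<in> H" "w \<in> H"
  shows "cinner (D \<alpha> \<beta> y z v) w = cinner v (D (- \<alpha>) (- \<beta>) (q powi \<alpha> * y) (q powi \<beta> * z) w)"
proof -
  let ?u = "u (- \<alpha>) (- \<beta>) (q powi \<alpha> * y) (q powi \<beta> * z)"
  let ?k = "sqrt (\<tau> y * \<tau> (q powi \<beta> * z))"
  note c = sign_minus[OF assms(1)] sign_minus[OF assms(2)]
    \<Lambda>_q(1)[OF assms(3), of \<alpha>] \<Lambda>_q(1)[OF assms(4), of \<beta>]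
  have pos: "?k > 0" using \<Lambda>_q(4)[OF c(4)] \<Lambda>_q(4)[OF assms(3)] by (simp add: \<tau>_pos)
  have "cinner (\<pi> ?u v) w = cinner v (\<pi> (adj (dyn_alg q x) ?u) w)"
    using repD(9)[of "adj (dyn_alg q x) ?u" v w] c assms(5,6) by simp
  moreover have "sg \<alpha> \<beta> * ?k * (sg \<alpha> \<beta> / ?k) = 1"
    using less_imp_neq[OF pos] unfolding sg_def by (simp del: real_sqrt_eq_0_iff)
  then have "complex_of_real (sg \<alpha> \<beta> * ?k) * complex_of_real (sg \<alpha> \<beta> / ?k) = 1"
    by (simp only: of_real_mult[symmetric] of_real_1)
  then have "complex_of_real (sg \<alpha> \<beta> * ?k) * (complex_of_real (sg \<alpha> \<beta> / ?k) * b) = b" for b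
    by (metis mult.assoc mult_1)
  ultimately show ?thesis
    by (simp only: u_eq_D(2)[OF c assms(6)] D_def[of \<alpha> \<beta>] cinner_scaleC_left cinner_scaleC_right
        complex_cnj_complex_of_real powi_cancel minus_minus)
qed

end

context dyn_rep
begin

lemma D_linear:
  assumes "\<alpha> \<in> {-1, 1}" "\<beta> \<in> {-1, 1}" "y \<in> \<Lambda> q x" "z \<in> \<Lambda> q x"
  shows "v \<in> H \<Longrightarrow> w \<in> H \<Longrightarrow> D \<alpha> \<beta> y z (v + w) = D \<alpha> \<beta> y z v + D \<alpha> \<beta> y z w"
    "v \<in> H \<Longrightarrow> D \<alpha> \<beta> y z (c *\<^sub>C v) = c *\<^sub>C D \<alpha> \<beta> y z v"
    "v \<in> H \<Longrightarrow> w \<in> H \<Longrightarrow> D \<alpha> \<beta> y z (v - w) = D \<alpha> \<beta> y z v - D \<alpha> \<beta> y z w"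
    "D \<alpha> \<beta> y z 0 = 0"
  using bounded_operator_onD(2)[OF D_bounded[OF assms]] repD(2)
  by (simp_all add: clinear_onD clinear_on_0 clinear_on_diff)

lemma P_linear:
  assumes "y \<in> \<Lambda> q x" "z \<in> \<Lambda> q x"
  shows "v \<in> H \<Longrightarrow> w \<in> H \<Longrightarrow> P y z (v + w) = P y z v + P y z w"
    "v \<in> H \<Longrightarrow> P y z (c *\<^sub>C v) = c *\<^sub>C P y z v"
    "v \<in> H \<Longrightarrow> w \<in> H \<Longrightarrow> P y z (v - w) = P y z v - P y z w"
    "P y z 0 = 0"
  using bounded_operator_onD(2)[OF P_bounded[OF assms]] repD(2)
  by (simp_all add: clinear_onD clinear_on_0 clinear_on_diff)

lemma scaleC_sqrt_sqrt:
  "k > 0 \<Longrightarrow> complex_of_real (s / sqrt k) *\<^sub>C complex_of_real (t / sqrt k) *\<^sub>C v =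
    complex_of_real (1 / k) *\<^sub>C complex_of_real (s * t) *\<^sub>C v"
  by (simp add: scaleC_scaleC flip: of_real_mult)

lemma scaleC_cancel: "k > 0 \<Longrightarrow> complex_of_real (1 / k) *\<^sub>C v = w \<Longrightarrow> v = complex_of_real k *\<^sub>C w"
  by (auto simp: scaleC_scaleC)

text \<open>Orthonormality of the columns of \<open>u\<close>, multiplied through by the common
  denominator \<open>\<tau> w * \<tau> y\<close>. Equal indices yield a sum rule, different ones a
  commutation rule.\<close>

lemma D_rel1:
  assumes \<epsilon>\<nu>: "\<epsilon> \<in> {-1, 1}" "\<nu> \<in> {-1, 1}" and wy: "w \<in> \<Lambda> q x" "y \<in> \<Lambda> q x" and v: "v \<in> H"
  shows "D (-1) \<epsilon> (q * w) y (D 1 (- \<nu>) w (q powi \<nu> * y) v) +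
      complex_of_real (if \<epsilon> = \<nu> then 1 else - 1) *\<^sub>C D 1 \<epsilon> (w / q) y (D (-1) (- \<nu>) w (q powi \<nu> * y) v) =
    (if \<epsilon> = \<nu> then complex_of_real (\<tau> w * \<tau> y) *\<^sub>C P w (q powi \<epsilon> * y) v else 0)"
proof -
  let ?A = "dyn_alg q x"
  have pm: "(-1::int) \<in> {-1, 1}" "(1::int) \<in> {-1, 1}" by auto
  note \<Lambda> = wy \<Lambda>_q(2,3)[OF wy(1)] \<Lambda>_q(1)[OF wy(2), of \<nu>] \<Lambda>_q(1)[OF wy(2), of \<epsilon>]
  note \<epsilon>\<nu>' = \<epsilon>\<nu> sign_minus[OF \<epsilon>\<nu>(1)] sign_minus[OF \<epsilon>\<nu>(2)]
  have q1: "q powi (-1) * (q * w) = w" "q powi 1 * (w / q) = w" using q by auto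
  have k: "\<tau> w * \<tau> y > 0" using \<Lambda>_q(4) wy by (simp add: \<tau>_pos)
  let ?t = "\<lambda>\<mu> w'. D \<mu> \<epsilon> w' y (D (- \<mu>) (- \<nu>) w (q powi \<nu> * y) v)"
  have 1: "\<pi> (adj ?A (u \<mu> \<epsilon> w' y) \<otimes>\<^bsub>?A\<^esub> u \<mu> \<nu> w' y) v =
      complex_of_real (1 / (\<tau> w * \<tau> y)) *\<^sub>C
        complex_of_real (sg (- \<mu>) (- \<epsilon>) * sg (- \<mu>) (- \<nu>)) *\<^sub>C ?t \<mu> w'"
    if \<mu>: "\<mu> \<in> {-1, 1}" and w': "w' \<in> \<Lambda> q x" "q powi \<mu> * w' = w" for \<mu> w'
  proof -
    note \<mu>' = \<mu> sign_minus[OF \<mu>]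
    have "\<pi> (adj ?A (u \<mu> \<epsilon> w' y) \<otimes>\<^bsub>?A\<^esub> u \<mu> \<nu> w' y) v = \<pi> (adj ?A (u \<mu> \<epsilon> w' y)) (\<pi> (u \<mu> \<nu> w' y) v)"
      using \<mu>' \<epsilon>\<nu>' w' \<Lambda> v by (intro repD(7) A.adj_closed dyn_closed)
    also have "\<dots> = complex_of_real (sg (- \<mu>) (- \<epsilon>) / sqrt (\<tau> w * \<tau> y)) *\<^sub>C
        D \<mu> \<epsilon> w' y (\<pi> (u \<mu> \<nu> w' y) v)"
      using u_eq_D(2)[OF \<mu> \<epsilon>\<nu>(1) w'(1) wy(2) repD(5)[OF dyn_closed(2)[OF \<mu> \<epsilon>\<nu>(2) w'(1) wy(2)] v]]
      by (simp only: w'(2))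
    also have "\<pi> (u \<mu> \<nu> w' y) v = complex_of_real (sg (- \<mu>) (- \<nu>) / sqrt (\<tau> w * \<tau> y)) *\<^sub>C
        D (- \<mu>) (- \<nu>) w (q powi \<nu> * y) v"
      using u_eq_D(1)[OF \<mu> \<epsilon>\<nu>(2) w'(1) wy(2) v] by (simp only: w'(2))
    also have "D \<mu> \<epsilon> w' y \<dots> = complex_of_real (sg (- \<mu>) (- \<nu>) / sqrt (\<tau> w * \<tau> y)) *\<^sub>C ?t \<mu> w'"
      by (intro D_linear(2) D_in \<mu>' \<epsilon>\<nu>' w' \<Lambda> v)
    finally show ?thesis by (simp only: scaleC_sqrt_sqrt[OF k])
  qed
  have rel: "\<pi> (if \<epsilon> = \<nu> then dyn_one q x w (q powi \<epsilon> * y) else \<zero>\<^bsub>?A\<^esub>) v =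
      \<pi> (adj ?A (u (-1) \<epsilon> (q * w) y) \<otimes>\<^bsub>?A\<^esub> u (-1) \<nu> (q * w) y) v +
      \<pi> (adj ?A (u 1 \<epsilon> (w / q) y) \<otimes>\<^bsub>?A\<^esub> u 1 \<nu> (w / q) y) v"
    unfolding u_rel1[OF \<epsilon>\<nu> wy, symmetric]
    by (intro repD(6) A.m_closed A.adj_closed dyn_closed \<Lambda> \<epsilon>\<nu> pm v)
  have sg: "sg (- (-1)) a = 1" "sg (- 1) (- \<epsilon>) * sg (- 1) (- \<nu>) = (if \<epsilon> = \<nu> then 1 else - 1)" for a
    using \<epsilon>\<nu> by (auto simp: sg_def)
  have "complex_of_real (1 / (\<tau> w * \<tau> y)) *\<^sub>C (?t (-1) (q * w) +
      complex_of_real (if \<epsilon> = \<nu> then 1 else - 1) *\<^sub>C ?t 1 (w / q)) =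
      (if \<epsilon> = \<nu> then P w (q powi \<epsilon> * y) v else 0)"
    using rel
    unfolding 1[OF pm(1) \<Lambda>(3) q1(1)] 1[OF pm(2) \<Lambda>(4) q1(2)] sg
    by (auto simp: scaleC_add_right P_def star_rep_zero[OF rep A.star_alg_axioms v])
  from scaleC_cancel[OF k this] show ?thesis by simp
qed

text \<open>The same for the rows of \<open>u\<close>. The hypothesis \<open>eq\<close> makes the
  inner ladder operator end at the weight where the outer one starts.\<close>

lemma D_rel2:
  assumes \<epsilon>\<nu>: "\<epsilon> \<in> {-1, 1}" "\<nu> \<in> {-1, 1}" and yz: "y \<in> \<Lambda> q x" "z \<in> \<Lambda> q x" "w \<in> \<Lambda> q x"
    and eq: "q powi \<epsilon> * y = q powi \<nu> * z" and v: "v \<in> H"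
  shows "D (- \<epsilon>) (-1) (q powi \<epsilon> * y) (q * w) (D \<nu> 1 z w v) +
      complex_of_real (if \<epsilon> = \<nu> then 1 else - 1) *\<^sub>C D (- \<epsilon>) 1 (q powi \<epsilon> * y) (w / q) (D \<nu> (-1) z w v) =
    (if \<epsilon> = \<nu> then complex_of_real (\<tau> (q powi \<epsilon> * y) * \<tau> w) *\<^sub>C P y w v else 0)"
proof -
  let ?A = "dyn_alg q x" and ?m = "q powi \<epsilon> * y"
  have pm: "(-1::int) \<in> {-1, 1}" "(1::int) \<in> {-1, 1}" by auto
  note \<Lambda> = yz \<Lambda>_q(1)[OF yz(1), of \<epsilon>] \<Lambda>_q(1)[OF yz(2), of \<nu>] \<Lambda>_q(1)[OF yz(3)]
  note \<epsilon>\<nu>' = \<epsilon>\<nu> sign_minus[OF \<epsilon>\<nu>(1)] sign_minus[OF \<epsilon>\<nu>(2)]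
  have k: "\<tau> ?m * \<tau> w > 0" using \<Lambda>_q(4) \<Lambda> by (simp add: \<tau>_pos)
  let ?t = "\<lambda>\<mu>. D (- \<epsilon>) (- \<mu>) ?m (q powi \<mu> * w) (D \<nu> \<mu> z w v)"
  have 1: "\<pi> (u \<epsilon> \<mu> y w \<otimes>\<^bsub>?A\<^esub> adj ?A (u \<nu> \<mu> z w)) v =
      complex_of_real (1 / (\<tau> ?m * \<tau> w)) *\<^sub>C
        complex_of_real (sg (- \<epsilon>) (- \<mu>) * sg (- \<nu>) (- \<mu>)) *\<^sub>C ?t \<mu>"
    if \<mu>: "\<mu> \<in> {-1, 1}" for \<mu>
  proof -
    note \<mu>' = \<mu> sign_minus[OF \<mu>]
    have "\<pi> (u \<epsilon> \<mu> y w \<otimes>\<^bsub>?A\<^esub> adj ?A (u \<nu> \<mu> z w)) v = \<pi> (u \<epsilon> \<mu> y w) (\<pi> (adj ?A (u \<nu> \<mu> z w)) v)"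
      using \<mu>' \<epsilon>\<nu>' \<Lambda> v by (intro repD(7) A.adj_closed dyn_closed)
    also have "\<pi> (adj ?A (u \<nu> \<mu> z w)) v =
        complex_of_real (sg (- \<nu>) (- \<mu>) / sqrt (\<tau> ?m * \<tau> w)) *\<^sub>C D \<nu> \<mu> z w v"
      using u_eq_D(2)[OF \<epsilon>\<nu>(2) \<mu> yz(2,3) v] by (simp only: eq)
    also have "\<pi> (u \<epsilon> \<mu> y w) \<dots> = complex_of_real (sg (- \<nu>) (- \<mu>) / sqrt (\<tau> ?m * \<tau> w)) *\<^sub>C
        \<pi> (u \<epsilon> \<mu> y w) (D \<nu> \<mu> z w v)"
      by (intro rep_linear(2) dyn_closed D_in \<mu>' \<epsilon>\<nu>' \<Lambda> v)
    also have "\<pi> (u \<epsilon> \<mu> y w) (D \<nu> \<mu> z w v) =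
        complex_of_real (sg (- \<epsilon>) (- \<mu>) / sqrt (\<tau> ?m * \<tau> w)) *\<^sub>C ?t \<mu>"
      by (intro u_eq_D(1) D_in \<mu>' \<epsilon>\<nu>' \<Lambda> v)
    finally show ?thesis by (simp only: scaleC_sqrt_sqrt[OF k] mult.commute[of "sg (- \<nu>) (- \<mu>)"])
  qed
  have yz_eq: "\<epsilon> = \<nu> \<Longrightarrow> y = z" using eq q by simp
  have rel: "\<pi> (if \<epsilon> = \<nu> then dyn_one q x y w else \<zero>\<^bsub>?A\<^esub>) v =
      \<pi> (u \<epsilon> (-1) y w \<otimes>\<^bsub>?A\<^esub> adj ?A (u \<nu> (-1) z w)) v +
      \<pi> (u \<epsilon> 1 y w \<otimes>\<^bsub>?A\<^esub> adj ?A (u \<nu> 1 z w)) v"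
  proof -
    have "(if \<epsilon> = \<nu> then dyn_one q x y w else \<zero>\<^bsub>?A\<^esub>) =
        u \<epsilon> (-1) y w \<otimes>\<^bsub>?A\<^esub> adj ?A (u \<nu> (-1) z w) \<oplus>\<^bsub>?A\<^esub> u \<epsilon> 1 y w \<otimes>\<^bsub>?A\<^esub> adj ?A (u \<nu> 1 z w)"
      using u_rel2[OF \<epsilon>\<nu> yz] yz_eq by auto
    then show ?thesis
      by (simp only:) (intro repD(6) A.m_closed A.adj_closed dyn_closed \<Lambda> \<epsilon>\<nu> pm v)
  qed
  have sg: "sg (- \<epsilon>) (- 1) * sg (- \<nu>) (- 1) = 1"
    "sg (- \<epsilon>) (- (- 1)) * sg (- \<nu>) (- (- 1)) = (if \<epsilon> = \<nu> then 1 else - 1)"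
    using \<epsilon>\<nu> by (auto simp: sg_def)
  have t: "?t 1 = D (- \<epsilon>) (-1) ?m (q * w) (D \<nu> 1 z w v)" "?t (-1) = D (- \<epsilon>) 1 ?m (w / q) (D \<nu> (-1) z w v)"
    by (simp_all add: divide_inverse mult.commute)
  have "complex_of_real (1 / (\<tau> ?m * \<tau> w)) *\<^sub>C (?t 1 +
      complex_of_real (if \<epsilon> = \<nu> then 1 else - 1) *\<^sub>C ?t (-1)) =
      (if \<epsilon> = \<nu> then P y w v else 0)"
    using rel
    unfolding 1[OF pm(1)] 1[OF pm(2)] sg
    by (auto simp: scaleC_add_right P_def star_rep_zero[OF rep A.star_alg_axioms v] add.commute)
  from scaleC_cancel[OF k this] show ?thesis unfolding t by simp
qed

text \<open>The off-diagonal case of \<open>D_rel1\<close>: the first \<open>E\<close> commutes with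
  the second \<open>F\<close>, and the first \<open>F\<close> with the second
  \<open>E\<close>.\<close>

lemma D_commute1:
  assumes \<beta>: "\<beta> \<in> {-1, 1}" and yz: "y \<in> \<Lambda> q x" "z \<in> \<Lambda> q x" and v: "v \<in> H"
  shows "D (-1) \<beta> (q * y) (q powi \<beta> * z) (D 1 \<beta> y z v) =
    D 1 \<beta> (y / q) (q powi \<beta> * z) (D (-1) \<beta> y z v)"
  using D_rel1[OF \<beta> sign_minus[OF \<beta>] yz(1) \<Lambda>_q(1)[OF yz(2), of \<beta>] v] \<beta>
  by (auto simp: scaleC_minus_left eq_neg_iff_add_eq_0)

text \<open>The off-diagonal case of \<open>D_rel2\<close>: the two \<open>E\<close> commute, and so
  do the two \<open>F\<close>.\<close>

lemma D_commute2:
  assumes \<alpha>: "\<alpha> \<in> {-1, 1}" and yz: "y \<in> \<Lambda> q x" "z \<in> \<Lambda> q x" and v: "v \<in> H"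
  shows "D \<alpha> (-1) (q powi \<alpha> * y) (q * z) (D \<alpha> 1 y z v) =
    D \<alpha> 1 (q powi \<alpha> * y) (z / q) (D \<alpha> (-1) y z v)"
  using D_rel2[OF sign_minus[OF \<alpha>] \<alpha> \<Lambda>_q(1)[OF \<Lambda>_q(1)[OF yz(1), of \<alpha>], of \<alpha>] yz powi_cancel(1) v] \<alpha>
  by (auto simp: scaleC_minus_left eq_neg_iff_add_eq_0)

text \<open>The diagonal case of \<open>D_rel1\<close>: \<open>F E\<close> of one copy and
  \<open>E F\<close> of the other add up to a scalar on each weight space.\<close>

lemma D_sum1:
  assumes \<beta>: "\<beta> \<in> {-1, 1}" and yz: "y \<in> \<Lambda> q x" "z \<in> \<Lambda> q x" and v: "v \<in> H"
  shows "D (-1) (- \<beta>) (q * y) (q powi \<beta> * z) (D 1 \<beta> y z v) +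
    D 1 (- \<beta>) (y / q) (q powi \<beta> * z) (D (-1) \<beta> y z v) =
    complex_of_real (\<tau> y * \<tau> (q powi \<beta> * z)) *\<^sub>C P y z v"
  using D_rel1[OF sign_minus[OF \<beta>] sign_minus[OF \<beta>] yz(1) \<Lambda>_q(1)[OF yz(2), of \<beta>] v]
  by simp

text \<open>The diagonal case of \<open>D_rel2\<close>: the products \<open>F E\<close> of the two
  copies add up to a scalar, and so do the products \<open>E F\<close>.\<close>

lemma D_sum2:
  assumes \<alpha>: "\<alpha> \<in> {-1, 1}" and yz: "y \<in> \<Lambda> q x" "z \<in> \<Lambda> q x" and v: "v \<in> H"
  shows "D (- \<alpha>) (-1) (q powi \<alpha> * y) (q * z) (D \<alpha> 1 y z v) +
    D (- \<alpha>) 1 (q powi \<alpha> * y) (z / q) (D \<alpha> (-1) y z v) =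
    complex_of_real (\<tau> (q powi \<alpha> * y) * \<tau> z) *\<^sub>C P y z v"
  using D_rel2[OF \<alpha> \<alpha> yz(1) yz(1) yz(2) HOL.refl v] by simp

subsection \<open>The Casimir operator\<close>

end

context dyn
begin

lemma q_cancel [simp]: "inverse q * (q * t) = t" "q * (inverse q * t) = t" "q * (t / q) = t"
  using q by simp_all

end

context dyn_rep
begin

text \<open>The Casimir element of the first copy on one weight space: there
  \<open>r\<^sup>2 = y * z\<close>, and the factor \<open>(inverse q - q)\<^sup>2\<close> is already
  contained in the two \<open>D\<close>.\<close>

definition C :: "real \<Rightarrow> real \<Rightarrow> 'h \<Rightarrow> 'h" where
  "C y z v = D (-1) (-1) (q * y) (q * z) (D 1 1 y z v) - complex_of_real (\<tau> (q * (y * z))) *\<^sub>C P y z v"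

text \<open>All four products are reached from the one defining \<open>C\<close> through the sum
  rules, and \<open>\<tau>_mult\<close> separates the scalars of the two copies. The sign
  \<open>sig\<close> expresses that the Casimir operator of the second copy is the negative of that
  of the first.\<close>

lemma D_D:
  assumes \<alpha>\<beta>: "\<alpha> \<in> {-1, 1}" "\<beta> \<in> {-1, 1}" and yz: "y \<in> \<Lambda> q x" "z \<in> \<Lambda> q x" and v: "v \<in> H"
  shows "D (- \<alpha>) (- \<beta>) (q powi \<alpha> * y) (q powi \<beta> * z) (D \<alpha> \<beta> y z v) =
    complex_of_real (sig \<alpha> \<beta>) *\<^sub>C C y z v + complex_of_real (\<tau> (q powi \<alpha> * pr \<alpha> \<beta> y z)) *\<^sub>C P y z v"
proof -
  have pos: "y > 0" "z > 0" using yz \<Lambda>_q(4) by auto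
  have pm: "(-1::int) \<in> {-1, 1}" "(1::int) \<in> {-1, 1}" by auto
  define N where "N = D (-1) (-1) (q * y) (q * z) (D 1 1 y z v)"
  define p where "p = P y z v"
  have C: "C y z v = N - complex_of_real (\<tau> (q * (y * z))) *\<^sub>C p" by (simp add: C_def N_def p_def)
  have 1: "N + D 1 (-1) (y / q) (q * z) (D (-1) 1 y z v) = complex_of_real (\<tau> y * \<tau> (q * z)) *\<^sub>C p"
    using D_sum1[OF pm(2) yz v] by (simp add: N_def p_def)
  have 2: "N + D (-1) 1 (q * y) (z / q) (D 1 (-1) y z v) = complex_of_real (\<tau> (q * y) * \<tau> z) *\<^sub>C p"
    using D_sum2[OF pm(2) yz v] by (simp add: N_def p_def)
  have 3: "D 1 (-1) (y / q) (q * z) (D (-1) 1 y z v) + D 1 1 (y / q) (z / q) (D (-1) (-1) y z v) =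
      complex_of_real (\<tau> (y / q) * \<tau> z) *\<^sub>C p"
    using D_sum2[OF pm(1) yz v] by (simp add: p_def divide_inverse mult.commute)
  have \<tau>: "\<tau> y * \<tau> (q * z) = \<tau> (q * (y * z)) + \<tau> (y / (q * z))"
    "\<tau> (q * y) * \<tau> z = \<tau> (q * (y * z)) + \<tau> (q * (y / z))"
    "\<tau> (y / q) * \<tau> z = \<tau> (y / (q * z)) + \<tau> ((y * z) / q)"
    using \<tau>_mult[of y "q * z"] \<tau>_mult[of "q * y" z] \<tau>_mult[of "y / q" z] pos q
    by (simp_all add: mult.assoc mult.left_commute)
  have "q powi (-1) * t = t / q" for t by (simp add: field_simps)
  then consider "\<alpha> = 1" "\<beta> = 1" | "\<alpha> = 1" "\<beta> = -1" | "\<alpha> = -1" "\<beta> = 1" | "\<alpha> = -1" "\<beta> = -1"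
    using \<alpha>\<beta> by auto
  then show ?thesis
  proof cases
    case 1
    then show ?thesis by (simp add: C sig_def pr_def N_def[symmetric] p_def)
  next
    case c: 2
    from 2 have "D (-1) 1 (q * y) (z / q) (D 1 (-1) y z v) = complex_of_real (\<tau> (q * y) * \<tau> z) *\<^sub>C p - N"
      by (simp add: eq_diff_eq add.commute)
    then show ?thesis unfolding \<tau>
      by (simp add: c C sig_def pr_def p_def scaleC_add_left scaleC_minus_left divide_inverse mult.commute)
  next
    case c: 3
    from 1 have "D 1 (-1) (y / q) (q * z) (D (-1) 1 y z v) = complex_of_real (\<tau> y * \<tau> (q * z)) *\<^sub>C p - N"
      by (simp add: eq_diff_eq add.commute)
    then show ?thesis unfolding \<tau>
      by (simp add: c C sig_def pr_def p_def scaleC_add_left scaleC_minus_left divide_inverse mult_ac)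
  next
    case c: 4
    from 1 have "D 1 (-1) (y / q) (q * z) (D (-1) 1 y z v) = complex_of_real (\<tau> y * \<tau> (q * z)) *\<^sub>C p - N"
      by (simp add: eq_diff_eq add.commute)
    moreover from 3 have "D 1 1 (y / q) (z / q) (D (-1) (-1) y z v) =
        complex_of_real (\<tau> (y / q) * \<tau> z) *\<^sub>C p - D 1 (-1) (y / q) (q * z) (D (-1) 1 y z v)"
      by (simp add: eq_diff_eq add.commute)
    ultimately have "D 1 1 (y / q) (z / q) (D (-1) (-1) y z v) =
        complex_of_real (\<tau> (y / q) * \<tau> z) *\<^sub>C p - (complex_of_real (\<tau> y * \<tau> (q * z)) *\<^sub>C p - N)"
      by (simp only:)
    note eq = this
    have e: "D (- (-1)) (- (-1)) (q powi (-1) * y) (q powi (-1) * z) = D 1 1 (y / q) (z / q)"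
      by (simp add: divide_inverse mult.commute)
    have e': "q powi (-1) * pr (-1) (-1) y z = (y * z) / q"
      by (simp add: pr_def divide_inverse mult.commute)
    have "a + b - (d + a - N) = N - d + b" for a b d :: 'h by simp
    moreover have "sig (-1) (-1) = 1" by (simp add: sig_def)
    ultimately show ?thesis
      by (simp only: c C e e' eq \<tau> p_def[symmetric] of_real_1 of_real_add scaleC_one scaleC_add_left)
  qed
qed

lemma C_bounded:
  assumes "y \<in> \<Lambda> q x" "z \<in> \<Lambda> q x"
  shows "bounded_operator_on H (C y z)"
proof -
  have "bounded_operator_on H (\<lambda>v. D (-1) (-1) (q * y) (q * z) (D 1 1 y z v))"
    by (rule bounded_operator_on_compose) (use assms \<Lambda>_q(2) in \<open>simp_all add: D_bounded\<close>)
  moreover have "bounded_operator_on H (\<lambda>v. complex_of_real (\<tau> (q * (y * z))) *\<^sub>C P y z v)"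
    using assms by (intro bounded_operator_on_scaleC repD(2) P_bounded)
  ultimately show ?thesis unfolding C_def by (rule bounded_operator_on_diff[OF repD(2)])
qed

lemma C_in [simp]: "y \<in> \<Lambda> q x \<Longrightarrow> z \<in> \<Lambda> q x \<Longrightarrow> v \<in> H \<Longrightarrow> C y z v \<in> H"
  using bounded_operator_onD(1)[OF C_bounded] .

lemma C_linear:
  assumes "y \<in> \<Lambda> q x" "z \<in> \<Lambda> q x"
  shows "v \<in> H \<Longrightarrow> w \<in> H \<Longrightarrow> C y z (v + w) = C y z v + C y z w"
    "v \<in> H \<Longrightarrow> C y z (c *\<^sub>C v) = c *\<^sub>C C y z v"
    "C y z 0 = 0"
  using bounded_operator_onD(2)[OF C_bounded[OF assms]] repD(2)
  by (simp_all add: clinear_onD clinear_on_0)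

lemma C_P:
  assumes "y \<in> \<Lambda> q x" "z \<in> \<Lambda> q x" "a \<in> \<Lambda> q x" "b \<in> \<Lambda> q x" "v \<in> H"
  shows "C y z (P a b v) = (if a = y \<and> b = z then C y z v else 0)"
    "P a b (C y z v) = (if a = y \<and> b = z then C y z v else 0)"
proof -
  show "C y z (P a b v) = (if a = y \<and> b = z then C y z v else 0)"
    using assms \<Lambda>_q(2) unfolding C_def by (auto simp: P_D P_P D_linear)
  show "P a b (C y z v) = (if a = y \<and> b = z then C y z v else 0)"
    using assms \<Lambda>_q(2) unfolding C_def
    by (auto simp: P_linear csubspace_scaleC[OF repD(2)] P_D(1) P_P)
qed

lemma cinner_C:
  assumes "y \<in> \<Lambda> q x" "z \<in> \<Lambda> q x" "v \<in> H" "w \<in> H"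
  shows "cinner (C y z v) w = cinner v (C y z w)"
proof -
  have "cinner (D (-1) (-1) (q * y) (q * z) (D 1 1 y z v)) w =
      cinner v (D (-1) (-1) (q * y) (q * z) (D 1 1 y z w))"
    using assms \<Lambda>_q(2) by (simp add: cinner_D)
  then show ?thesis
    using assms by (simp add: C_def cinner_diff_left cinner_diff_right cinner_scaleC_left
        cinner_scaleC_right cinner_P)
qed

text \<open>A ladder operator, its adjoint and itself again are multiplied, and \<open>D_D\<close>
  is applied at the source and at the target; the scalar terms agree and cancel.\<close>

lemma C_D:
  assumes \<alpha>\<beta>: "\<alpha> \<in> {-1, 1}" "\<beta> \<in> {-1, 1}" and yz: "y \<in> \<Lambda> q x" "z \<in> \<Lambda> q x" and v: "v \<in> H"
  shows "C (q powi \<alpha> * y) (q powi \<beta> * z) (D \<alpha> \<beta> y z v) = D \<alpha> \<beta> y z (C y z v)"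
proof -
  let ?y = "q powi \<alpha> * y" and ?z = "q powi \<beta> * z" and ?d = "D \<alpha> \<beta> y z v"
  note yz' = \<Lambda>_q(1)[OF yz(1), of \<alpha>] \<Lambda>_q(1)[OF yz(2), of \<beta>]
  note \<alpha>\<beta>' = sign_minus[OF \<alpha>\<beta>(1)] sign_minus[OF \<alpha>\<beta>(2)]
  have d: "?d \<in> H" by (intro D_in \<alpha>\<beta> yz v)
  have pos: "y > 0" "z > 0" using yz \<Lambda>_q(4) by auto
  have pr: "q powi (- \<alpha>) * pr (- \<alpha>) (- \<beta>) ?y ?z = q powi \<alpha> * pr \<alpha> \<beta> y z"
    using \<alpha>\<beta> q pos by (auto simp: pr_def field_simps)
  have sig: "sig (- \<alpha>) (- \<beta>) = sig \<alpha> \<beta>" by (simp add: sig_def)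
  have Pd: "P ?y ?z ?d = ?d" "D \<alpha> \<beta> y z (P y z v) = ?d"
    using P_D[OF \<alpha>\<beta> yz yz' v] P_D[OF \<alpha>\<beta> yz yz v] by auto
  let ?t = "complex_of_real (\<tau> (q powi \<alpha> * pr \<alpha> \<beta> y z))" and ?s = "complex_of_real (sig \<alpha> \<beta>)"
  have "D \<alpha> \<beta> y z (D (- \<alpha>) (- \<beta>) ?y ?z ?d) = ?s *\<^sub>C C ?y ?z ?d + ?t *\<^sub>C ?d"
    using D_D[OF \<alpha>\<beta>' yz' d] by (simp only: minus_minus powi_cancel pr sig Pd)
  moreover have "D \<alpha> \<beta> y z (D (- \<alpha>) (- \<beta>) ?y ?z ?d) = ?s *\<^sub>C D \<alpha> \<beta> y z (C y z v) + ?t *\<^sub>C ?d"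
    unfolding D_D[OF \<alpha>\<beta> yz v]
    using \<alpha>\<beta> yz v Pd(2) by (simp add: D_linear csubspace_scaleC[OF repD(2)])
  ultimately have "?s *\<^sub>C C ?y ?z ?d = ?s *\<^sub>C D \<alpha> \<beta> y z (C y z v)" by simp
  then show ?thesis by (auto simp: sig_def scaleC_minus_left split: if_splits)
qed

text \<open>The Casimir operators of the different weights are not assembled into one operator on
  \<open>H\<close>; centrality is expressed by an identity between blocks, for each pair of
  weights.\<close>

lemma C_central:
  assumes "a \<in> carrier (dyn_alg q x)"
  shows "\<forall>v\<in>H. \<forall>y\<in>\<Lambda> q x. \<forall>z\<in>\<Lambda> q x. \<forall>y'\<in>\<Lambda> q x. \<forall>z'\<in>\<Lambda> q x.
    C y z (\<pi> a (P y' z' v)) = P y z (\<pi> a (C y' z' v))"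
  using assms
proof (induction rule: dyn_induct)
  case zero
  then show ?case by (simp add: star_rep_zero[OF rep A.star_alg_axioms] C_linear P_linear)
next
  case (add a b)
  then show ?case by (simp add: repD C_linear P_linear)
next
  case (smult c a)
  then show ?case by (simp add: repD C_linear P_linear)
next
  case (one y z)
  then show ?case unfolding P_def[symmetric] by (auto simp: C_P P_P C_linear P_linear)
next
  case (mult_one y z a)
  then show ?case
    by (simp add: repD P_def[of y z, symmetric] C_P P_P C_linear P_linear)
next
  {
    fix \<epsilon> \<nu> y z assume *: "\<epsilon> \<in> {-1, 1 :: int}" "\<nu> \<in> {-1, 1 :: int}" "y \<in> \<Lambda> q x" "z \<in> \<Lambda> q x"
    note m = sign_minus[OF *(1)] sign_minus[OF *(2)] \<Lambda>_q(1)[OF *(3), of \<epsilon>] \<Lambda>_q(1)[OF *(4), of \<nu>]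
    let ?y = "q powi \<epsilon> * y" and ?z = "q powi \<nu> * z"
    let ?d = "D (- \<epsilon>) (- \<nu>) ?y ?z"
    define k where "k = complex_of_real (sg (- \<epsilon>) (- \<nu>) / sqrt (\<tau> ?y * \<tau> z))"
    have u: "\<pi> (u \<epsilon> \<nu> y z) v = k *\<^sub>C ?d v" if "v \<in> H" for v
      unfolding k_def by (rule u_eq_D(1)[OF * that])
    have Pd: "P a b (?d v) = (if a = y \<and> b = z then ?d v else 0)"
      if "a \<in> \<Lambda> q x" "b \<in> \<Lambda> q x" "v \<in> H" for a b v
      using P_D(1)[OF m that] by simp
    have Cd: "C a b (?d v) = (if a = y \<and> b = z then ?d (C ?y ?z v) else 0)"
      if "a \<in> \<Lambda> q x" "b \<in> \<Lambda> q x" "v \<in> H" for a b v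
    proof -
      have dH: "?d v \<in> H" using m that by simp
      have "C a b (?d v) = C a b (P y z (?d v))" using Pd[OF *(3,4) that(3)] by simp
      also have "\<dots> = (if a = y \<and> b = z then C y z (?d v) else 0)"
        using C_P(1)[OF that(1,2) *(3,4) dH] by auto
      also have "C y z (?d v) = ?d (C ?y ?z v)" using C_D[OF m that(3)] by simp
      finally show ?thesis .
    qed
    \<comment> \<open>Moves the Casimir operator past one letter, from its target weight to its
      source weight; this settles the single generator and the induction step alike.\<close>
    have key: "C a b (k *\<^sub>C ?d v) = P a b (k *\<^sub>C ?d w)"
      if "a \<in> \<Lambda> q x" "b \<in> \<Lambda> q x" "v \<in> H" "w \<in> H" "C ?y ?z v = P ?y ?z w" for a b v w
    proof -
      have "?d (C ?y ?z v) = ?d w" using P_D(2)[OF m m(3,4) that(4)] by (simp add: that(5))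
      then show ?thesis
        using Cd[OF that(1-3)] Pd[OF that(1,2,4)] m that by (simp add: C_linear P_linear)
    qed
    show "\<forall>v\<in>H. \<forall>a\<in>\<Lambda> q x. \<forall>b\<in>\<Lambda> q x. \<forall>y'\<in>\<Lambda> q x. \<forall>z'\<in>\<Lambda> q x.
      C a b (\<pi> (u \<epsilon> \<nu> y z) (P y' z' v)) = P a b (\<pi> (u \<epsilon> \<nu> y z) (C y' z' v))"
    proof (intro ballI)
      fix v a b y' z' assume **: "v \<in> H" "a \<in> \<Lambda> q x" "b \<in> \<Lambda> q x" "y' \<in> \<Lambda> q x" "z' \<in> \<Lambda> q x"
      have "C ?y ?z (P y' z' v) = P ?y ?z (C y' z' v)" using ** m by (auto simp: C_P)
      then show "C a b (\<pi> (u \<epsilon> \<nu> y z) (P y' z' v)) = P a b (\<pi> (u \<epsilon> \<nu> y z) (C y' z' v))"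
        using ** by (simp add: u key)
    qed
    fix X assume X: "X \<in> carrier (dyn_alg q x)" "\<forall>v\<in>H. \<forall>a\<in>\<Lambda> q x. \<forall>b\<in>\<Lambda> q x. \<forall>y'\<in>\<Lambda> q x. \<forall>z'\<in>\<Lambda> q x.
      C a b (\<pi> X (P y' z' v)) = P a b (\<pi> X (C y' z' v))"
    show "\<forall>v\<in>H. \<forall>a\<in>\<Lambda> q x. \<forall>b\<in>\<Lambda> q x. \<forall>y'\<in>\<Lambda> q x. \<forall>z'\<in>\<Lambda> q x.
      C a b (\<pi> (u \<epsilon> \<nu> y z \<otimes>\<^bsub>dyn_alg q x\<^esub> X) (P y' z' v)) =
      P a b (\<pi> (u \<epsilon> \<nu> y z \<otimes>\<^bsub>dyn_alg q x\<^esub> X) (C y' z' v))"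
      using X(2) m * by (simp add: repD(7)[OF dyn_closed(2) X(1)] u key repD(5)[OF X(1)])
  }
qed

end

subsection \<open>Schur's lemma for a self-adjoint operator\<close>

text \<open>
  The square root of \<open>T\<^sup>2\<close> for a self-adjoint contraction \<open>T\<close> is \<open>1 - Y\<close>, where \<open>Y\<close> is the limit of
  the iteration \<open>Y \<mapsto> (1 - T\<^sup>2 + Y\<^sup>2) / 2\<close>, which is dominated by its scalar analogue.
\<close>

fun sq_iter :: "('h::real_vector \<Rightarrow> 'h) \<Rightarrow> nat \<Rightarrow> 'h \<Rightarrow> 'h" where
  "sq_iter X 0 v = 0"
| "sq_iter X (Suc n) v = (1 / 2) *\<^sub>R (X v + sq_iter X n (sq_iter X n v))"

fun sq_bound :: "nat \<Rightarrow> real" where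
  "sq_bound 0 = 0"
| "sq_bound (Suc n) = (1 + (sq_bound n)\<^sup>2) / 2"

text \<open>Monotonicity of the scalar iteration \<open>b \<mapsto> (1 + b\<^sup>2) / 2\<close> is
  the inequality \<open>0 \<le> (1 - b)\<^sup>2\<close>; its fixed point 1 bounds it.\<close>

lemma sq_bound: "0 \<le> sq_bound n" "sq_bound n \<le> 1" "sq_bound n \<le> sq_bound (Suc n)"
proof -
  show *: "0 \<le> sq_bound n" for n by (cases n) auto
  show "sq_bound n \<le> 1"
    using * by (induction n) (auto simp: abs_square_le_1)
  have "0 \<le> (1 - sq_bound n)\<^sup>2" by simp
  then show "sq_bound n \<le> sq_bound (Suc n)" by (simp add: power2_diff)
qed

text \<open>Convergence follows from norm estimates alone: each difference of iterates is dominated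
  by the corresponding difference of the bounded increasing sequence \<open>sq_bound\<close>. The
  iterates are polynomials in \<open>X\<close>, so whatever commutes with \<open>X\<close> commutes
  with the limit.\<close>

lemma sq_iter_limit:
  fixes X :: "'h::chilbert_space \<Rightarrow> 'h"
  assumes H: "hilbert_on H" and X: "bounded_operator_on H X" "\<And>v. v \<in> H \<Longrightarrow> norm (X v) \<le> norm v"
  obtains Y where "bounded_operator_on H Y" "\<And>v. v \<in> H \<Longrightarrow> norm (Y v) \<le> norm v"
    "\<And>v. v \<in> H \<Longrightarrow> 2 *\<^sub>R Y v = X v + Y (Y v)"
    "\<And>B v. bounded_operator_on H B \<Longrightarrow> (\<And>v. v \<in> H \<Longrightarrow> B (X v) = X (B v)) \<Longrightarrow> v \<in> H \<Longrightarrow> B (Y v) = Y (B v)"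
proof -
  have cs: "csubspace H" and cl: "closed H" using H by (auto simp: hilbert_on_def)
  let ?Y = "sq_iter X" and ?y = sq_bound
  have scR: "r *\<^sub>R v \<in> H" if "v \<in> H" for r v
    using csubspace_imp_subspace[OF cs] that by (rule subspace_scale)
  have YH: "?Y n v \<in> H" if "v \<in> H" for n v
    using that
    by (induction n arbitrary: v)
      (auto simp: csubspace_0[OF cs] intro!: scR csubspace_add[OF cs] bounded_operator_onD(1)[OF X(1)])
  have lin: "clinear_on H (?Y n)" for n
  proof (induction n)
    case (Suc n)
    then show ?case
      using clinear_onD[OF bounded_operator_onD(2)[OF X(1)]] YH
      unfolding clinear_on_def by (auto simp: scaleC_add_right scaleC_scaleR algebra_simps)
  qed (simp add: clinear_on_def)
  have nrm: "norm (?Y n v) \<le> ?y n * norm v" if "v \<in> H" for n v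
    using that
  proof (induction n arbitrary: v)
    case (Suc n)
    have "norm (?Y n (?Y n v)) \<le> ?y n * norm (?Y n v)" using Suc YH by blast
    also have "\<dots> \<le> ?y n * (?y n * norm v)" using Suc sq_bound(1) by (intro mult_left_mono) auto
    finally have "norm (X v + ?Y n (?Y n v)) \<le> norm v + ?y n * (?y n * norm v)"
      using X(2)[OF Suc.prems] by (intro norm_triangle_le) linarith
    also have "\<dots> = (1 + (?y n)\<^sup>2) * norm v" by (simp add: power2_eq_square algebra_simps)
    finally show ?case by simp
  qed simp
  have dif: "norm (?Y (Suc n) v - ?Y n v) \<le> (?y (Suc n) - ?y n) * norm v" if "v \<in> H" for n v
    using that
  proof (induction n arbitrary: v)
    case 0
    then show ?case using X(2)[OF 0] by simp
  next
    case (Suc n)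
    let ?A = "?Y (Suc n)" and ?B = "?Y n" and ?a = "?y (Suc n)" and ?b = "?y n"
    have in1: "?A v - ?B v \<in> H" by (intro csubspace_diff[OF cs] YH Suc)
    have "?Y (Suc (Suc n)) v - ?A v = (1 / 2) *\<^sub>R (?A (?A v) - ?B (?B v))"
      by (subst (2) sq_iter.simps(2), subst sq_iter.simps(2)) (simp add: algebra_simps)
    \<comment> \<open>Splitting the difference of squares bounds it by
      \<open>(?a + ?b) * (?a - ?b)\<close>, which is twice the next difference of the scalar
      sequence.\<close>
    also have "?A (?A v) - ?B (?B v) = ?A (?A v - ?B v) + (?A (?B v) - ?B (?B v))"
      using clinear_on_diff[OF lin cs YH[OF Suc.prems] YH[OF Suc.prems], of "Suc n" "Suc n" n]
      by (simp del: sq_iter.simps)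
    finally have eq: "?Y (Suc (Suc n)) v - ?A v = (1 / 2) *\<^sub>R (?A (?A v - ?B v) + (?A (?B v) - ?B (?B v)))" .
    have "norm (?A (?A v - ?B v)) \<le> ?a * norm (?A v - ?B v)" by (rule nrm[OF in1])
    also have "\<dots> \<le> ?a * ((?a - ?b) * norm v)"
      by (intro mult_left_mono Suc.IH Suc.prems sq_bound)
    finally have 1: "norm (?A (?A v - ?B v)) \<le> ?a * ((?a - ?b) * norm v)" .
    have "norm (?A (?B v) - ?B (?B v)) \<le> (?a - ?b) * norm (?B v)" by (rule Suc.IH[OF YH[OF Suc.prems]])
    also have "\<dots> \<le> (?a - ?b) * (?b * norm v)"
      using sq_bound(3)[of n] by (intro mult_left_mono nrm Suc.prems) simp
    finally have 2: "norm (?A (?B v) - ?B (?B v)) \<le> (?a - ?b) * (?b * norm v)" .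
    have "norm (?Y (Suc (Suc n)) v - ?A v) \<le> (1 / 2) * (?a * ((?a - ?b) * norm v) + (?a - ?b) * (?b * norm v))"
      unfolding eq norm_scaleR using 1 2 norm_triangle_ineq[of "?A (?A v - ?B v)" "?A (?B v) - ?B (?B v)"]
      by simp
    also have "\<dots> = (?y (Suc (Suc n)) - ?a) * norm v"
      by (subst (2) sq_bound.simps(2), subst (5) sq_bound.simps(2))
        (simp add: power2_eq_square algebra_simps del: sq_bound.simps)
    finally show ?case .
  qed
  have dif': "norm (?Y m v - ?Y n v) \<le> (?y m - ?y n) * norm v" if "v \<in> H" "n \<le> m" for v n m
    using that(2)
  proof (induction m rule: dec_induct)
    case (step m)
    have "norm (?Y (Suc m) v - ?Y n v) \<le> norm (?Y (Suc m) v - ?Y m v) + norm (?Y m v - ?Y n v)"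
      using norm_triangle_ineq[of "?Y (Suc m) v - ?Y m v" "?Y m v - ?Y n v"]
      by (simp del: sq_iter.simps)
    also have "\<dots> \<le> (?y (Suc m) - ?y m) * norm v + (?y m - ?y n) * norm v"
      by (rule add_mono[OF dif[OF that(1)] step.IH])
    finally show ?case by (simp only: left_diff_distrib)
  qed simp
  have "incseq ?y" by (rule incseq_SucI) (rule sq_bound(3))
  then obtain L where "?y \<longlonglongrightarrow> L" using incseq_convergent[of ?y 1] sq_bound(2) by blast
  then have cy: "Cauchy ?y" by (rule LIMSEQ_imp_Cauchy)
  have "Cauchy (\<lambda>n. ?Y n v)" if v: "v \<in> H" for v
  proof (rule metric_CauchyI)
    fix e :: real assume e: "e > 0"
    have n: "norm v + 1 > 0" using norm_ge_zero[of v] by linarith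
    with e have "e / (norm v + 1) > 0" by simp
    then obtain M where M: "\<And>m n. m \<ge> M \<Longrightarrow> n \<ge> M \<Longrightarrow> dist (?y m) (?y n) < e / (norm v + 1)"
      using metric_CauchyD[OF cy] by blast
    have le: "dist (?Y m v) (?Y n v) < e" if "m \<ge> n" "n \<ge> M" for m n
    proof -
      have "dist (?Y m v) (?Y n v) \<le> (?y m - ?y n) * norm v" using dif'[OF v that(1)] by (simp add: dist_norm)
      also have "\<dots> \<le> dist (?y m) (?y n) * norm v" by (intro mult_right_mono) (auto simp: dist_real_def)
      also have "\<dots> \<le> e / (norm v + 1) * norm v"
        using M[of m n] that by (intro mult_right_mono) auto
      also have "\<dots> < e" using e n by (simp add: field_simps)
      finally show ?thesis .
    qed
    then have "\<forall>m\<ge>M. \<forall>n\<ge>M. dist (?Y m v) (?Y n v) < e" by (metis dist_commute nle_le)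
    then show "\<exists>M. \<forall>m\<ge>M. \<forall>n\<ge>M. dist (?Y m v) (?Y n v) < e" by blast
  qed
  then have conv: "(\<lambda>n. ?Y n v) \<longlonglongrightarrow> lim (\<lambda>n. ?Y n v)" if "v \<in> H" for v
    using Cauchy_convergent[of "\<lambda>n. ?Y n v"] that by (simp add: convergent_LIMSEQ_iff)
  define Y where "Y v = lim (\<lambda>n. ?Y n v)" for v
  have Yl: "(\<lambda>n. ?Y n v) \<longlonglongrightarrow> Y v" if "v \<in> H" for v using conv[OF that] by (simp add: Y_def)
  have YinH: "Y v \<in> H" if "v \<in> H" for v
    by (rule closed_sequentially[OF cl _ Yl[OF that]]) (rule YH[OF that])
  have Yn: "norm (Y v) \<le> norm v" if "v \<in> H" for v
  proof (rule LIMSEQ_le_const2[OF tendsto_norm[OF Yl[OF that]]])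
    have "norm (?Y n v) \<le> norm v" for n
      using nrm[OF that, of n] mult_right_mono[OF sq_bound(2)[of n], of "norm v"] by simp
    then show "\<exists>N. \<forall>n\<ge>N. norm (?Y n v) \<le> norm v" by blast
  qed
  have Ylin: "clinear_on H Y"
    unfolding clinear_on_def
  proof (intro conjI ballI allI)
    fix v w assume vw: "v \<in> H" "w \<in> H"
    have "(\<lambda>n. ?Y n v + ?Y n w) \<longlonglongrightarrow> Y v + Y w" by (intro tendsto_intros Yl vw)
    moreover have "(\<lambda>n. ?Y n v + ?Y n w) \<longlonglongrightarrow> Y (v + w)"
      using Yl[OF csubspace_add[OF cs vw]] by (simp add: clinear_onD(1)[OF lin vw])
    ultimately show "Y (v + w) = Y v + Y w" using LIMSEQ_unique by blast
  next
    fix a v assume v: "v \<in> H"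
    have "(\<lambda>n. a *\<^sub>C ?Y n v) \<longlonglongrightarrow> a *\<^sub>C Y v" by (intro tendsto_intros Yl v)
    moreover have "(\<lambda>n. a *\<^sub>C ?Y n v) \<longlonglongrightarrow> Y (a *\<^sub>C v)"
      using Yl[OF csubspace_scaleC[OF cs v]] by (simp add: clinear_onD(2)[OF lin v])
    ultimately show "Y (a *\<^sub>C v) = a *\<^sub>C Y v" using LIMSEQ_unique by blast
  qed
  have Yb: "bounded_operator_on H Y"
    unfolding bounded_operator_on_def using YinH Ylin Yn by (metis mult_1)
  have "2 *\<^sub>R Y v = X v + Y (Y v)" if v: "v \<in> H" for v
  proof -
    have "(\<lambda>n. ?Y n (?Y n v)) \<longlonglongrightarrow> Y (Y v)"
    proof (rule Lim_null_comparison[THEN LIM_zero_cancel])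
      have "norm (?Y n (?Y n v) - Y (Y v)) \<le> norm (?Y n v - Y v) + norm (?Y n (Y v) - Y (Y v))" for n
      proof -
        have "?Y n (?Y n v) - Y (Y v) = ?Y n (?Y n v - Y v) + (?Y n (Y v) - Y (Y v))"
          using clinear_on_diff[OF lin cs YH[OF v] YinH[OF v], of n n] by simp
        moreover have "norm (?Y n (?Y n v - Y v)) \<le> norm (?Y n v - Y v)"
          using nrm[OF csubspace_diff[OF cs YH[OF v] YinH[OF v]], of n n]
            mult_right_mono[OF sq_bound(2)[of n], of "norm (?Y n v - Y v)"] by simp
        ultimately show ?thesis by (metis add_mono norm_triangle_le order_refl)
      qed
      then show "\<forall>\<^sub>F n in sequentially.
          norm (?Y n (?Y n v) - Y (Y v)) \<le> norm (?Y n v - Y v) + norm (?Y n (Y v) - Y (Y v))" by simp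
      show "(\<lambda>n. norm (?Y n v - Y v) + norm (?Y n (Y v) - Y (Y v))) \<longlonglongrightarrow> 0"
        using tendsto_add[OF tendsto_norm_zero[OF LIM_zero[OF Yl[OF v]]]
            tendsto_norm_zero[OF LIM_zero[OF Yl[OF YinH[OF v]]]]] by simp
    qed
    then have "(\<lambda>n. X v + ?Y n (?Y n v)) \<longlonglongrightarrow> X v + Y (Y v)" by (intro tendsto_intros)
    moreover have "(\<lambda>n. 2 *\<^sub>R ?Y (Suc n) v) \<longlonglongrightarrow> 2 *\<^sub>R Y v"
      by (intro tendsto_intros LIMSEQ_Suc Yl v)
    then have "(\<lambda>n. X v + ?Y n (?Y n v)) \<longlonglongrightarrow> 2 *\<^sub>R Y v" by simp
    ultimately show ?thesis using LIMSEQ_unique by blast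
  qed
  moreover have "B (Y v) = Y (B v)"
    if B: "bounded_operator_on H B" "\<And>v. v \<in> H \<Longrightarrow> B (X v) = X (B v)" and v: "v \<in> H" for B v
  proof -
    have comm: "B (?Y n v) = ?Y n (B v)" if "v \<in> H" for n v
      using that
    proof (induction n arbitrary: v)
      case 0
      then show ?case using clinear_on_0[OF bounded_operator_onD(2)[OF B(1)] cs] by simp
    next
      case (Suc n)
      have "B (r *\<^sub>R w) = r *\<^sub>R B w" if "w \<in> H" for r w
        using clinear_onD(2)[OF bounded_operator_onD(2)[OF B(1)] that] by (simp add: scaleR_scaleC)
      then show ?case
        using Suc YH bounded_operator_onD(1)[OF X(1)] bounded_operator_onD(1)[OF B(1)]
        by (simp add: clinear_onD(1)[OF bounded_operator_onD(2)[OF B(1)]] csubspace_add[OF cs] B(2))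
    qed
    have "(\<lambda>n. B (?Y n v)) \<longlonglongrightarrow> B (Y v)"
      by (intro bounded_operator_on_tendsto[OF B(1) cs] YH YinH Yl v)
    moreover have "(\<lambda>n. B (?Y n v)) \<longlonglongrightarrow> Y (B v)"
      using Yl[OF bounded_operator_onD(1)[OF B(1) v]] by (simp add: comm v)
    ultimately show ?thesis using LIMSEQ_unique by blast
  qed
  ultimately show ?thesis using that Yb Yn by blast
qed

text \<open>\<open>irr\<close> concerns operators in the double commutant of \<open>T\<close>, which
  covers those obtained from polynomials in \<open>T\<close> by limits. For each real
  \<open>l\<close> it makes \<open>T - l\<close> semidefinite, which leaves only one possible value
  for the quadratic form of \<open>T\<close> on unit vectors.\<close>

lemma schur_selfadjoint:
  fixes T :: "'h::chilbert_space \<Rightarrow> 'h"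
  assumes H: "hilbert_on H" "H \<noteq> {0}" and T: "bounded_operator_on H T"
    and sa: "\<And>v w. v \<in> H \<Longrightarrow> w \<in> H \<Longrightarrow> cinner (T v) w = cinner v (T w)"
    and irr: "\<And>S. bounded_operator_on H S \<Longrightarrow>
      (\<And>B v. bounded_operator_on H B \<Longrightarrow> (\<And>v. v \<in> H \<Longrightarrow> B (T v) = T (B v)) \<Longrightarrow> v \<in> H \<Longrightarrow> B (S v) = S (B v)) \<Longrightarrow>
      {v \<in> H. S v = 0} = {0} \<or> {v \<in> H. S v = 0} = H"
  obtains c :: real where "\<And>v. v \<in> H \<Longrightarrow> T v = complex_of_real c *\<^sub>C v"
proof -
  have cs: "csubspace H" using H by (simp add: hilbert_on_def)
  note sub = csubspace_imp_subspace[OF cs]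
  have TH: "T v \<in> H" if "v \<in> H" for v using bounded_operator_onD(1)[OF T that] .
  have Tlin: "clinear_on H T" using bounded_operator_onD(2)[OF T] .
  have saR: "inner (T v) w = inner v (T w)" if "v \<in> H" "w \<in> H" for v w
    using sa[OF that] by (simp add: inner_eq_Re_cinner)
  obtain b where b: "b > 0" "\<And>v. v \<in> H \<Longrightarrow> norm (T v) \<le> b * norm v"
    using bounded_operator_on_bound[OF T] by metis
  \<comment> \<open>With \<open>M\<close> a rescaled \<open>T - l\<close> and \<open>1 - Y\<close>
    the square root of \<open>M\<^sup>2\<close>, the operator \<open>S\<close> below is twice the
    negative part of \<open>M\<close>. If \<open>S = 0\<close>, then \<open>M\<close> is
    nonnegative; if \<open>S\<close> is injective, then \<open>S (1 - Y + M) = 0\<close> forces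
    \<open>M = - (1 - Y)\<close>, which is nonpositive.\<close>
  have dich: "(\<forall>v\<in>H. l * inner v v \<le> inner v (T v)) \<or> (\<forall>v\<in>H. inner v (T v) \<le> l * inner v v)" for l
  proof -
    \<comment> \<open>\<open>K\<close> exceeds the norm of \<open>T - l\<close>, so that
      \<open>M\<close> is a contraction.\<close>
    define K where "K = b + \<bar>l\<bar> + 1"
    have K: "K > 0" using b(1) by (simp add: K_def)
    define M where "M v = (1 / K) *\<^sub>R (T v - l *\<^sub>R v)" for v
    have M_eq: "M = (\<lambda>v. complex_of_real (1 / K) *\<^sub>C (T v - complex_of_real l *\<^sub>C v))"
      unfolding M_def scaleR_scaleC ..
    have id: "bounded_operator_on H (\<lambda>v. v)"
      unfolding bounded_operator_on_def clinear_on_def by (auto intro: exI[of _ 1])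
    have Mb: "bounded_operator_on H M"
      unfolding M_eq using bounded_operator_on_scaleC[OF cs bounded_operator_on_diff[OF cs T bounded_operator_on_scaleC[OF cs id]]] .
    have MH: "M v \<in> H" if "v \<in> H" for v using bounded_operator_onD(1)[OF Mb that] .
    have Mn: "norm (M v) \<le> norm v" if v: "v \<in> H" for v
    proof -
      have "norm (T v - l *\<^sub>R v) \<le> b * norm v + \<bar>l\<bar> * norm v"
        using norm_triangle_ineq4[of "T v" "l *\<^sub>R v"] b(2)[OF v] by simp
      also have "\<dots> \<le> K * norm v" by (simp add: K_def algebra_simps)
      finally show ?thesis using K unfolding M_def norm_scaleR by (simp add: divide_le_eq mult.commute)
    qed
    have Msa: "inner (M v) w = inner v (M w)" if "v \<in> H" "w \<in> H" for v w
      using saR[OF that] by (simp add: M_def inner_diff_left inner_diff_right)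
    define X where "X v = v - M (M v)" for v
    have Xb: "bounded_operator_on H X"
      unfolding X_def by (rule bounded_operator_on_diff[OF cs id bounded_operator_on_compose[OF Mb Mb]])
    \<comment> \<open>When the square is expanded, the cross term
      \<open>2 * (norm (M v))\<^sup>2\<close> outweighs
      \<open>(norm (M (M v)))\<^sup>2\<close>.\<close>
    have Xn: "norm (X v) \<le> norm v" if v: "v \<in> H" for v
    proof (rule power2_le_imp_le)
      have "(norm (X v))\<^sup>2 = (norm v)\<^sup>2 - 2 * inner v (M (M v)) + (norm (M (M v)))\<^sup>2"
        by (simp add: X_def power2_norm_eq_inner inner_diff_left inner_diff_right inner_commute)
      also have "inner v (M (M v)) = (norm (M v))\<^sup>2"
        using Msa[OF v MH[OF v]] by (simp add: power2_norm_eq_inner)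
      also have "(norm (M (M v)))\<^sup>2 \<le> (norm (M v))\<^sup>2" using Mn[OF MH[OF v]] by (simp add: power_mono)
      finally show "(norm (X v))\<^sup>2 \<le> (norm v)\<^sup>2"
        using zero_le_power2[of "norm (M v)"] by linarith
    qed simp
    obtain Y where Y: "bounded_operator_on H Y" "\<And>v. v \<in> H \<Longrightarrow> norm (Y v) \<le> norm v"
      "\<And>v. v \<in> H \<Longrightarrow> 2 *\<^sub>R Y v = X v + Y (Y v)"
      "\<And>B v. bounded_operator_on H B \<Longrightarrow> (\<And>v. v \<in> H \<Longrightarrow> B (X v) = X (B v)) \<Longrightarrow> v \<in> H \<Longrightarrow> B (Y v) = Y (B v)"
    proof (rule sq_iter_limit[OF H(1) Xb Xn], goal_cases)
      case (2 Y)
      show ?case by (rule 2(1)[OF 2(2-5)])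
    qed
    have YH: "Y v \<in> H" if "v \<in> H" for v using bounded_operator_onD(1)[OF Y(1) that] .
    define S where "S v = (v - Y v) - M v" for v
    have Sb: "bounded_operator_on H S"
      unfolding S_def by (intro bounded_operator_on_diff[OF cs] id Y(1) Mb)
    have commM: "B (M v) = M (B v)"
      if B: "bounded_operator_on H B" "\<And>v. v \<in> H \<Longrightarrow> B (T v) = T (B v)" and v: "v \<in> H" for B v
      using clinear_onD(2)[OF bounded_operator_onD(2)[OF B(1)]]
        clinear_on_diff[OF bounded_operator_onD(2)[OF B(1)] cs] v TH B(2) csubspace_scaleC[OF cs]
        csubspace_diff[OF cs]
      by (simp add: M_eq)
    have commX: "B (X v) = X (B v)"
      if B: "bounded_operator_on H B" "\<And>v. v \<in> H \<Longrightarrow> B (M v) = M (B v)" and v: "v \<in> H" for B v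
      using clinear_on_diff[OF bounded_operator_onD(2)[OF B(1)] cs] v MH B(2) by (simp add: X_def)
    have MY: "M (Y v) = Y (M v)" if "v \<in> H" for v
      by (rule Y(4)[OF Mb _ that]) (rule commX[OF Mb], auto)
    have "{v \<in> H. S v = 0} = {0} \<or> {v \<in> H. S v = 0} = H"
    proof (rule irr[OF Sb])
      fix B v assume B: "bounded_operator_on H B" "\<And>v. v \<in> H \<Longrightarrow> B (T v) = T (B v)" and v: "v \<in> H"
      have "B (Y v) = Y (B v)" by (rule Y(4)[OF B(1) commX[OF B(1) commM[OF B]] v])
      then show "B (S v) = S (B v)"
        using clinear_on_diff[OF bounded_operator_onD(2)[OF B(1)] cs] v MH YH commM[OF B v]
          csubspace_diff[OF cs]
        by (simp add: S_def)
    qed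
    then have "(\<forall>v\<in>H. 0 \<le> inner v (M v)) \<or> (\<forall>v\<in>H. inner v (M v) \<le> 0)"
    proof
      have pos: "0 \<le> inner v (v - Y v)" if "v \<in> H" for v
      proof -
        have "inner v (Y v) \<le> norm v * norm (Y v)" by (rule norm_cauchy_schwarz)
        also have "\<dots> \<le> norm v * norm v" using Y(2)[OF that] by (intro mult_left_mono) auto
        also have "\<dots> = inner v v" by (simp add: power2_norm_eq_inner[symmetric] power2_eq_square)
        finally show ?thesis by (simp add: inner_diff_right)
      qed
      {
        assume "{v \<in> H. S v = 0} = H"
        then have "S v = 0" if "v \<in> H" for v using that by blast
        then have "M v = v - Y v" if "v \<in> H" for v using that by (simp add: S_def)
        then show ?thesis using pos by auto
      next
        assume ker: "{v \<in> H. S v = 0} = {0}"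
        have "M v = - (v - Y v)" if v: "v \<in> H" for v
        proof -
          let ?w = "(v - Y v) + M v"
          note Yl = clinear_onD(1)[OF bounded_operator_onD(2)[OF Y(1)]]
            clinear_on_diff[OF bounded_operator_onD(2)[OF Y(1)] cs]
          note Ml = clinear_onD(1)[OF bounded_operator_onD(2)[OF Mb]]
            clinear_on_diff[OF bounded_operator_onD(2)[OF Mb] cs]
          have w: "?w \<in> H" using v MH YH csubspace_diff[OF cs] csubspace_add[OF cs] by simp
          have "S ?w = v - 2 *\<^sub>R Y v + Y (Y v) - M (M v)"
          proof -
            have d: "v - Y v \<in> H" by (intro csubspace_diff[OF cs] v YH)
            have "Y ?w = (Y v - Y (Y v)) + Y (M v)" "M ?w = (M v - M (Y v)) + M (M v)"
              using Yl(1)[OF d MH[OF v]] Yl(2)[OF v YH[OF v]] Ml(1)[OF d MH[OF v]] Ml(2)[OF v YH[OF v]]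
              by simp_all
            then show ?thesis unfolding S_def MY[OF v] by (simp add: scaleR_2)
          qed
          also have "\<dots> = 0" using Y(3)[OF v] by (simp add: X_def)
          finally have "?w = 0" using w ker by blast
          then show ?thesis by (simp only: eq_neg_iff_add_eq_0 add.commute)
        qed
        then show ?thesis using pos by (metis inner_minus_right neg_le_0_iff_le)
      }
    qed
    moreover have "inner v (M v) = (inner v (T v) - l * inner v v) / K" for v
      by (simp add: M_def inner_diff_right)
    ultimately show ?thesis using K by (simp add: zero_le_divide_iff divide_le_0_iff)
  qed
  obtain e where e: "e \<in> H" "e \<noteq> 0" using H(2) csubspace_0[OF cs] by blast
  have e0: "inner e e > 0" using e(2) by simp
  have bnd: "\<bar>inner v (T v)\<bar> \<le> b * inner v v" if "v \<in> H" for v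
  proof -
    have "\<bar>inner v (T v)\<bar> \<le> norm v * norm (T v)" by (rule Cauchy_Schwarz_ineq2)
    also have "\<dots> \<le> norm v * (b * norm v)" using b(2)[OF that] by (intro mult_left_mono) auto
    also have "\<dots> = b * inner v v" by (simp add: power2_norm_eq_inner[symmetric] power2_eq_square)
    finally show ?thesis .
  qed
  define L where "L = {l. \<forall>v\<in>H. l * inner v v \<le> inner v (T v)}"
  have "- b \<in> L" using bnd by (auto simp: L_def abs_le_iff) (metis minus_le_iff)
  have up: "l \<le> b" if "l \<in> L" for l
  proof -
    have "l * inner e e \<le> inner e (T e)" using that e(1) by (simp add: L_def)
    then have "l * inner e e \<le> b * inner e e" using bnd[OF e(1)] by linarith
    then show ?thesis using e0 by simp
  qed
  have bdd: "bdd_above L" using up by (rule bdd_aboveI)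
  define c where "c = Sup L"
  have eq: "inner v (T v) = c * inner v v" if v: "v \<in> H" for v
  proof (cases "v = 0")
    case False
    then have v0: "inner v v > 0" by simp
    have "c \<le> inner v (T v) / inner v v"
      unfolding c_def
    proof (rule cSup_least)
      show "L \<noteq> {}" using \<open>- b \<in> L\<close> by blast
      fix l assume "l \<in> L"
      then show "l \<le> inner v (T v) / inner v v" using v v0 by (simp add: L_def le_divide_eq)
    qed
    moreover have "inner v (T v) / inner v v \<le> c"
    proof (rule dense_ge)
      fix l assume l: "c < l"
      then have "l \<notin> L" using cSup_upper[OF _ bdd] by (force simp: c_def)
      then have "inner v (T v) \<le> l * inner v v" using dich[of l] v by (auto simp: L_def)
      then show "inner v (T v) / inner v v \<le> l" using v0 by (simp add: divide_le_eq)
    qed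
    ultimately show ?thesis using v0 by (simp add: field_simps)
  qed simp
  \<comment> \<open>Polarisation at \<open>v + w\<close>, with the defect
    \<open>w = T v - c v\<close> itself as second vector, gives
    \<open>inner w w = 0\<close>.\<close>
  have "T v = complex_of_real c *\<^sub>C v" if v: "v \<in> H" for v
  proof -
    define w where "w = T v - c *\<^sub>R v"
    have cv: "c *\<^sub>R u \<in> H" if "u \<in> H" for u using subspace_scale[OF sub that] .
    have w: "w \<in> H" unfolding w_def by (intro csubspace_diff[OF cs] TH v cv)
    have "inner (v + w) (T (v + w)) = c * inner (v + w) (v + w)"
      using v w by (intro eq csubspace_add[OF cs])
    moreover have "T (v + w) = T v + T w" using clinear_onD(1)[OF Tlin v w] .
    moreover have "inner v (T w) = inner w (T v)" using saR[OF v w] by (simp add: inner_commute)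
    ultimately have "inner w (T v) = c * inner w v"
      using eq[OF v] eq[OF w] by (simp add: inner_add_left inner_add_right inner_commute algebra_simps)
    then have "inner w w = 0" by (simp add: w_def inner_diff_right)
    then show ?thesis by (simp add: w_def scaleR_scaleC)
  qed
  then show ?thesis by (rule that)
qed

subsection \<open>The homomorphism on generators\<close>

text \<open>Lets a multiplier acting from the left on an unknown element be computed as acting from
  the right on a known one.\<close>

lemma mult_algD:
  assumes "m \<in> carrier (mult_alg A)" "a \<in> carrier A" "b \<in> carrier A"
  shows "snd m a \<otimes>\<^bsub>A\<^esub> b = a \<otimes>\<^bsub>A\<^esub> fst m b"
  using assms by (auto simp: mult_alg_def)

locale tensor_star_alg = A: star_alg A + B: star_alg B
  for A :: "'a star_algebra" and B :: "'b star_algebra"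
begin

sublocale T: star_alg "tensor_alg A B"
  unfolding tensor_alg_def by (rule star_alg_pres_alg)

lemma tens_closed [simp, intro]:
  "a \<in> carrier A \<Longrightarrow> b \<in> carrier B \<Longrightarrow> tens A B a b \<in> carrier (tensor_alg A B)"
  by (auto simp: tens_def tensor_alg_def)

lemma tens_eqI:
  "(s, t) \<in> tensor_rel A B \<Longrightarrow> pres_cls (tensor_rel A B) s = pres_cls (tensor_rel A B) t"
  by (rule pres_cls_eqI[OF pres_cong.rel])

lemma tens_simps:
  assumes "a \<in> carrier A" "b \<in> carrier B"
  shows "a' \<in> carrier A \<Longrightarrow>
      tens A B (a \<oplus>\<^bsub>A\<^esub> a') b = tens A B a b \<oplus>\<^bsub>tensor_alg A B\<^esub> tens A B a' b"
    "b' \<in> carrier B \<Longrightarrow>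
      tens A B a (b \<oplus>\<^bsub>B\<^esub> b') = tens A B a b \<oplus>\<^bsub>tensor_alg A B\<^esub> tens A B a b'"
    "tens A B (c \<odot>\<^bsub>A\<^esub> a) b = c \<odot>\<^bsub>tensor_alg A B\<^esub> tens A B a b"
    "tens A B a (c \<odot>\<^bsub>B\<^esub> b) = c \<odot>\<^bsub>tensor_alg A B\<^esub> tens A B a b"
    "a' \<in> carrier A \<Longrightarrow> b' \<in> carrier B \<Longrightarrow>
      tens A B a b \<otimes>\<^bsub>tensor_alg A B\<^esub> tens A B a' b' = tens A B (a \<otimes>\<^bsub>A\<^esub> a') (b \<otimes>\<^bsub>B\<^esub> b')"
  unfolding tens_def tensor_alg_def pres_alg_simps
  by ((rule tens_eqI | rule tens_eqI[symmetric]), use assms in \<open>force simp: tensor_rel_def\<close>)+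

lemma tens_zero:
  "b \<in> carrier B \<Longrightarrow> tens A B \<zero>\<^bsub>A\<^esub> b = \<zero>\<^bsub>tensor_alg A B\<^esub>"
  "a \<in> carrier A \<Longrightarrow> tens A B a \<zero>\<^bsub>B\<^esub> = \<zero>\<^bsub>tensor_alg A B\<^esub>"
  using tens_simps(3)[OF A.zero_closed, of b 0] tens_simps(4)[OF _ B.zero_closed, of a 0]
  by simp_all

lemma tensor_star_gens:
  assumes "g \<in> carrier A \<times> carrier B"
  shows "\<exists>h\<in>carrier A \<times> carrier B. \<exists>c.
    pres_cong (tensor_rel A B) (TStar (Gen g)) (TScale c (Gen h))"
proof -
  obtain a b where g: "g = (a, b)" "a \<in> carrier A" "b \<in> carrier B" using assms by auto
  have "pres_cong (tensor_rel A B) (TStar (Gen g)) (Gen (adj A a, adj B b))"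
    by (rule pres_cong.rel) (use g in \<open>auto simp: tensor_rel_def\<close>)
  then have "pres_cong (tensor_rel A B) (TStar (Gen g)) (TScale 1 (Gen (adj A a, adj B b)))"
    by (meson pres_cong.scale_one pres_cong.sym pres_cong.trans)
  then show ?thesis using g by auto
qed

end

locale phi_rep = dyn_rep q x H \<pi> for q x and H :: "'h::chilbert_space set" and \<pi> +
  fixes \<Phi> :: "(su_gen sterm set \<times> su_gen sterm set) sterm set \<Rightarrow> dyn_gen sterm set"
  assumes \<Phi>: "is_\<Phi> q x \<Phi>"
begin

sublocale U1: su q x by unfold_locales (use q x in auto)
sublocale U2: su q 1 by unfold_locales (use q in auto)
sublocale U: tensor_star_alg "su_alg q x" "su_alg q 1" by unfold_locales

abbreviation "tns \<equiv> tens (su_alg q x) (su_alg q 1)"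
abbreviation "k \<equiv> complex_of_real (inverse q - q)"

lemma \<Phi>D:
  shows hom: "star_hom (su_tensor q x) (dyn_alg q x) \<Phi>"
    and nondeg: "nondegenerate_hom (su_tensor q x) (dyn_alg q x) \<Phi>"
    and ext: "extension_maps (su_tensor q x) (dyn_alg q x) \<Phi>
        (k \<odot>\<^bsub>mult_alg (su_tensor q x)\<^esub> leg1 q x (\<Gamma> q x) (su_Er q x))
        (dyn_u q x (-1) (-1) \<otimes>\<^bsub>mult_alg (dyn_alg q x)\<^esub> fun_lam q x (\<lambda>y. sqrt (\<tau> y))
          \<otimes>\<^bsub>mult_alg (dyn_alg q x)\<^esub> fun_rho q x (\<lambda>z. sqrt (\<tau> (q * z))))"
      "extension_maps (su_tensor q x) (dyn_alg q x) \<Phi>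
        (k \<odot>\<^bsub>mult_alg (su_tensor q x)\<^esub> leg2 q x (\<Gamma> q 1) (su_Er q 1))
        (dyn_u q x (-1) 1 \<otimes>\<^bsub>mult_alg (dyn_alg q x)\<^esub> fun_lam q x (\<lambda>y. sqrt (\<tau> y))
          \<otimes>\<^bsub>mult_alg (dyn_alg q x)\<^esub> fun_rho q x (\<lambda>z. sqrt (\<tau> (z / q))))"
      "extension_maps (su_tensor q x) (dyn_alg q x) \<Phi>
        (k \<odot>\<^bsub>mult_alg (su_tensor q x)\<^esub> leg1 q x (\<Gamma> q x) (su_Fr q x))
        (dyn_u q x 1 1 \<otimes>\<^bsub>mult_alg (dyn_alg q x)\<^esub> fun_lam q x (\<lambda>y. sqrt (\<tau> y))
          \<otimes>\<^bsub>mult_alg (dyn_alg q x)\<^esub> fun_rho q x (\<lambda>z. sqrt (\<tau> (z / q))))"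
      "extension_maps (su_tensor q x) (dyn_alg q x) \<Phi>
        (k \<odot>\<^bsub>mult_alg (su_tensor q x)\<^esub> leg2 q x (\<Gamma> q 1) (su_Fr q 1))
        ((- 1) \<odot>\<^bsub>mult_alg (dyn_alg q x)\<^esub> (dyn_u q x 1 (-1) \<otimes>\<^bsub>mult_alg (dyn_alg q x)\<^esub>
          fun_lam q x (\<lambda>y. sqrt (\<tau> y)) \<otimes>\<^bsub>mult_alg (dyn_alg q x)\<^esub> fun_rho q x (\<lambda>z. sqrt (\<tau> (q * z)))))"
      "r \<in> \<Gamma> q x \<Longrightarrow> extension_maps (su_tensor q x) (dyn_alg q x) \<Phi> (leg1 q x {r} (su_one q x))
        (strict_sum (dyn_alg q x) (\<Lambda> q x) (\<lambda>z. dyn_one q x (r\<^sup>2 / z) z))"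
      "s \<in> \<Gamma> q 1 \<Longrightarrow> extension_maps (su_tensor q x) (dyn_alg q x) \<Phi> (leg2 q x {s} (su_one q 1))
        (strict_sum (dyn_alg q x) (\<Lambda> q x) (\<lambda>z. dyn_one q x (s\<^sup>2 * z) z))"
  using \<Phi> unfolding is_\<Phi>_def Let_def by blast+

lemma \<Phi>_hom:
  assumes "X \<in> carrier (su_tensor q x)"
  shows "\<Phi> X \<in> carrier (dyn_alg q x)"
    "v \<in> H \<Longrightarrow> \<pi> (\<Phi> X) v \<in> H"
    "Y \<in> carrier (su_tensor q x) \<Longrightarrow> v \<in> H \<Longrightarrow>
      \<pi> (\<Phi> (X \<oplus>\<^bsub>su_tensor q x\<^esub> Y)) v = \<pi> (\<Phi> X) v + \<pi> (\<Phi> Y) v"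
    "Y \<in> carrier (su_tensor q x) \<Longrightarrow> v \<in> H \<Longrightarrow>
      \<pi> (\<Phi> (X \<otimes>\<^bsub>su_tensor q x\<^esub> Y)) v = \<pi> (\<Phi> X) (\<pi> (\<Phi> Y) v)"
    "v \<in> H \<Longrightarrow> \<pi> (\<Phi> (c \<odot>\<^bsub>su_tensor q x\<^esub> X)) v = c *\<^sub>C \<pi> (\<Phi> X) v"
    "v \<in> H \<Longrightarrow> w \<in> H \<Longrightarrow>
      cinner (\<pi> (\<Phi> (adj (su_tensor q x) X)) v) w = cinner v (\<pi> (\<Phi> X) w)"
proof -
  have *: "\<Phi> Z \<in> carrier (dyn_alg q x)" if "Z \<in> carrier (su_tensor q x)" for Z
    using hom that by (auto simp: star_hom_def)
  show "\<Phi> X \<in> carrier (dyn_alg q x)" using * assms .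
  show "v \<in> H \<Longrightarrow> \<pi> (\<Phi> X) v \<in> H" using *[OF assms] by (rule repD(5))
  note h = hom[unfolded star_hom_def]
  show "Y \<in> carrier (su_tensor q x) \<Longrightarrow> v \<in> H \<Longrightarrow>
      \<pi> (\<Phi> (X \<oplus>\<^bsub>su_tensor q x\<^esub> Y)) v = \<pi> (\<Phi> X) v + \<pi> (\<Phi> Y) v"
    using h assms * by (simp add: repD)
  show "Y \<in> carrier (su_tensor q x) \<Longrightarrow> v \<in> H \<Longrightarrow>
      \<pi> (\<Phi> (X \<otimes>\<^bsub>su_tensor q x\<^esub> Y)) v = \<pi> (\<Phi> X) (\<pi> (\<Phi> Y) v)"
    using h assms * by (simp add: repD)
  show "v \<in> H \<Longrightarrow> \<pi> (\<Phi> (c \<odot>\<^bsub>su_tensor q x\<^esub> X)) v = c *\<^sub>C \<pi> (\<Phi> X) v"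
    using h assms * by (simp add: repD)
  show "v \<in> H \<Longrightarrow> w \<in> H \<Longrightarrow>
      cinner (\<pi> (\<Phi> (adj (su_tensor q x) X)) v) w = cinner v (\<pi> (\<Phi> X) w)"
    using h assms * by (simp add: repD)
qed

lemma \<Phi>_zero: "v \<in> H \<Longrightarrow> \<pi> (\<Phi> \<zero>\<^bsub>su_tensor q x\<^esub>) v = 0"
  using \<Phi>_hom(5)[OF U.T.zero_closed, of v 0] by simp

text \<open>By non-degeneracy every element of \<open>dyn_alg q x\<close> is a sum of products
  beginning with some \<open>\<Phi> X\<close>, so the range of \<open>\<pi>\<close> lies in the span
  of that of \<open>\<pi> \<circ> \<Phi>\<close>.\<close>

lemma \<Phi>_total: "closure (cspan {\<pi> (\<Phi> X) v | X v. X \<in> carrier (su_tensor q x) \<and> v \<in> H}) = H"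
proof
  let ?S = "{\<pi> (\<Phi> X) v | X v. X \<in> carrier (su_tensor q x) \<and> v \<in> H}"
  show "closure (cspan ?S) \<subseteq> H"
    by (rule closure_cspan_minimal) (use \<Phi>_hom(2) repD(1) in auto)
  have "\<pi> b v \<in> cspan ?S" if b: "b \<in> carrier (dyn_alg q x)" and v: "v \<in> H" for b v
  proof -
    have "b \<in> generate (add_monoid (dyn_alg q x))
        {\<Phi> a \<otimes>\<^bsub>dyn_alg q x\<^esub> b | a b. a \<in> carrier (su_tensor q x) \<and> b \<in> carrier (dyn_alg q x)}"
      (is "_ \<in> generate _ ?G") using nondeg b by (simp add: nondegenerate_hom_def)
    then have "b \<in> carrier (dyn_alg q x) \<and> \<pi> b v \<in> cspan ?S"
    proof induction
      case one
      then show ?case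
        using v csubspace_0[OF csubspace_cspan] A.zero_closed
        by (simp add: star_rep_zero[OF rep A.star_alg_axioms])
    next
      case (incl h)
      then obtain X c where h: "h = \<Phi> X \<otimes>\<^bsub>dyn_alg q x\<^esub> c" "X \<in> carrier (su_tensor q x)"
        "c \<in> carrier (dyn_alg q x)" by blast
      have "\<pi> h v = \<pi> (\<Phi> X) (\<pi> c v)" using h v \<Phi>_hom(1) by (simp add: repD)
      then have "\<pi> h v \<in> ?S" using h v repD(5) by blast
      then have "\<pi> h v \<in> cspan ?S" by (rule cspan_superset)
      moreover have "h \<in> carrier (dyn_alg q x)" using h \<Phi>_hom(1) by simp
      ultimately show ?case by blast
    next
      \<comment> \<open>\<open>generate\<close> also closes under inverses, here additive ones,
        which act as multiplication by -1.\<close>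
      case (inv h)
      then obtain X c where h: "h = \<Phi> X \<otimes>\<^bsub>dyn_alg q x\<^esub> c" "X \<in> carrier (su_tensor q x)"
        "c \<in> carrier (dyn_alg q x)" by blast
      have hc: "h \<in> carrier (dyn_alg q x)" using h \<Phi>_hom(1) by auto
      have "\<pi> h v = \<pi> (\<Phi> X) (\<pi> c v)" using h v \<Phi>_hom(1) by (simp add: repD)
      then have "\<pi> h v \<in> ?S" using h v repD(5) by blast
      then have "\<pi> h v \<in> cspan ?S" by (rule cspan_superset)
      moreover have "\<pi> h v + \<pi> (\<ominus>\<^bsub>dyn_alg q x\<^esub> h) v = 0"
        using repD(6)[OF hc A.a_inv_closed[OF hc] v] A.r_neg[OF hc]
        by (simp add: star_rep_zero[OF rep A.star_alg_axioms v])
      then have "\<pi> (\<ominus>\<^bsub>dyn_alg q x\<^esub> h) v = (- 1) *\<^sub>C \<pi> h v"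
        by (simp add: scaleC_minus_left eq_neg_iff_add_eq_0 add.commute)
      ultimately show ?case
        using A.a_inv_closed[OF hc] csubspace_scaleC[OF csubspace_cspan]
        by (simp add: a_inv_def)
    next
      case (eng h1 h2)
      then show ?case using v by (auto simp: repD intro!: csubspace_add[OF csubspace_cspan])
    qed
    then show ?thesis by blast
  qed
  then have "{\<pi> b v | b v. b \<in> carrier (dyn_alg q x) \<and> v \<in> H} \<subseteq> cspan ?S" by blast
  then have "cspan {\<pi> b v | b v. b \<in> carrier (dyn_alg q x) \<and> v \<in> H} \<subseteq> cspan ?S"
    by (rule cspan_minimal) (rule csubspace_cspan)
  from closure_mono[OF this] show "H \<subseteq> closure (cspan ?S)"
    unfolding star_rep_total[OF rep] .
qed

text \<open>The way information is extracted from the extension of \<open>\<Phi>\<close> to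
  multipliers: multiplication by \<open>a\<close> from the left moves \<open>m'\<close> onto
  \<open>a\<close>, where its strict sums can be evaluated.\<close>

lemma ext_apply:
  assumes "extension_maps (su_tensor q x) (dyn_alg q x) \<Phi> m m'"
    and "X \<in> carrier (su_tensor q x)" "fst m X = Y" "a \<in> carrier (dyn_alg q x)"
  shows "a \<otimes>\<^bsub>dyn_alg q x\<^esub> \<Phi> Y = snd m' a \<otimes>\<^bsub>dyn_alg q x\<^esub> \<Phi> X"
  using assms mult_algD[of m' "dyn_alg q x" a "\<Phi> X"] \<Phi>_hom(1)[OF assms(2)]
  by (simp add: extension_maps_def)

text \<open>The sum over the other factor collapses because its units are orthogonal; in the factor
  carrying \<open>f\<close> only the index \<open>j\<close> can survive.\<close>

lemma leg1_apply:
  assumes "I \<subseteq> \<Gamma> q x" "\<And>i. i \<in> I \<Longrightarrow> f i \<in> carrier (su_alg q x)" "j \<in> I"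
    "\<And>i. i \<in> I \<Longrightarrow> i \<noteq> j \<Longrightarrow> f i \<otimes>\<^bsub>su_alg q x\<^esub> su_one q x r = \<zero>\<^bsub>su_alg q x\<^esub>"
    "f j \<otimes>\<^bsub>su_alg q x\<^esub> su_one q x r = f j"
    and rs: "r \<in> \<Gamma> q x" "s \<in> \<Gamma> q 1"
  shows "fst (leg1 q x I f) (tns (su_one q x r) (su_one q 1 s)) = tns (f j) (su_one q 1 s)"
  unfolding leg1_def
proof (rule U.T.strict_sum_fst_single[where k = "(j, s)"])
  fix i assume i: "i \<in> I \<times> \<Gamma> q 1" "i \<noteq> (j, s)"
  obtain p t where pt: "i = (p, t)" "p \<in> I" "t \<in> \<Gamma> q 1" using i by auto
  have "p \<noteq> j \<or> t \<noteq> s" using i pt by auto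
  then have "f p \<otimes>\<^bsub>su_alg q x\<^esub> su_one q x r = \<zero>\<^bsub>su_alg q x\<^esub> \<or>
      su_one q 1 t \<otimes>\<^bsub>su_alg q 1\<^esub> su_one q 1 s = \<zero>\<^bsub>su_alg q 1\<^esub>"
    using assms(4)[OF pt(2)] U2.su_one_one[OF pt(3) rs(2)] by auto
  then have "tns (f p \<otimes>\<^bsub>su_alg q x\<^esub> su_one q x r) (su_one q 1 t \<otimes>\<^bsub>su_alg q 1\<^esub> su_one q 1 s) =
      \<zero>\<^bsub>su_tensor q x\<^esub>"
    using pt rs assms(2)[OF pt(2)] by (elim disjE) (simp_all add: U.tens_zero)
  then show "(case i of (r, s) \<Rightarrow> tns (f r) (su_one q 1 s)) \<otimes>\<^bsub>su_tensor q x\<^esub>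
      tns (su_one q x r) (su_one q 1 s) = \<zero>\<^bsub>su_tensor q x\<^esub>"
    using pt rs assms(2)[OF pt(2)] by (simp add: U.tens_simps)
qed (use assms in \<open>auto simp: U.tens_simps U2.su_one_one\<close>)

lemma leg2_apply:
  assumes "I \<subseteq> \<Gamma> q 1" "\<And>i. i \<in> I \<Longrightarrow> f i \<in> carrier (su_alg q 1)" "j \<in> I"
    "\<And>i. i \<in> I \<Longrightarrow> i \<noteq> j \<Longrightarrow> f i \<otimes>\<^bsub>su_alg q 1\<^esub> su_one q 1 s = \<zero>\<^bsub>su_alg q 1\<^esub>"
    "f j \<otimes>\<^bsub>su_alg q 1\<^esub> su_one q 1 s = f j"
    and rs: "r \<in> \<Gamma> q x" "s \<in> \<Gamma> q 1"
  shows "fst (leg2 q x I f) (tns (su_one q x r) (su_one q 1 s)) = tns (su_one q x r) (f j)"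
  unfolding leg2_def
proof (rule U.T.strict_sum_fst_single[where k = "(r, j)"])
  fix i assume i: "i \<in> \<Gamma> q x \<times> I" "i \<noteq> (r, j)"
  obtain t p where pt: "i = (t, p)" "p \<in> I" "t \<in> \<Gamma> q x" using i by auto
  have "p \<noteq> j \<or> t \<noteq> r" using i pt by auto
  then have "f p \<otimes>\<^bsub>su_alg q 1\<^esub> su_one q 1 s = \<zero>\<^bsub>su_alg q 1\<^esub> \<or>
      su_one q x t \<otimes>\<^bsub>su_alg q x\<^esub> su_one q x r = \<zero>\<^bsub>su_alg q x\<^esub>"
    using assms(4)[OF pt(2)] U1.su_one_one[OF pt(3) rs(1)] by auto
  then have "tns (su_one q x t \<otimes>\<^bsub>su_alg q x\<^esub> su_one q x r) (f p \<otimes>\<^bsub>su_alg q 1\<^esub> su_one q 1 s) =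
      \<zero>\<^bsub>su_tensor q x\<^esub>"
    using pt rs assms(2)[OF pt(2)] by (elim disjE) (simp_all add: U.tens_zero)
  then show "(case i of (r, s) \<Rightarrow> tns (su_one q x r) (f s)) \<otimes>\<^bsub>su_tensor q x\<^esub>
      tns (su_one q x r) (su_one q 1 s) = \<zero>\<^bsub>su_tensor q x\<^esub>"
    using pt rs assms(2)[OF pt(2)] by (simp add: U.tens_simps)
qed (use assms in \<open>auto simp: U.tens_simps U1.su_one_one\<close>)

text \<open>The unit tensor is fixed by the units in both legs, whose images are supported on
  \<open>y * z = r\<^sup>2\<close> and on \<open>y = s\<^sup>2 * z\<close>; a weight violating
  either equation annihilates its image.\<close>

lemma P_\<Phi>_one_zero:
  assumes rs: "r \<in> \<Gamma> q x" "s \<in> \<Gamma> q 1" and yz: "y \<in> \<Lambda> q x" "z \<in> \<Lambda> q x" and v: "v \<in> H"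
    and neq: "\<not> (y * z = r\<^sup>2 \<and> y = s\<^sup>2 * z)"
  shows "P y z (\<pi> (\<Phi> (tns (su_one q x r) (su_one q 1 s))) v) = 0"
proof -
  let ?A = "dyn_alg q x" and ?T = "tns (su_one q x r) (su_one q 1 s)"
  have T: "?T \<in> carrier (su_tensor q x)" using rs by auto
  have r2: "r\<^sup>2 / z' \<in> \<Lambda> q x" if z': "z' \<in> \<Lambda> q x" for z'
  proof -
    have "r\<^sup>2 \<in> \<Lambda> q (x\<^sup>2)" using rs(1) by (simp add: \<Gamma>_iff[OF q(1) x])
    then obtain m :: int where m: "r\<^sup>2 = x\<^sup>2 * q powi m" unfolding \<Lambda>_def by blast
    obtain n :: int where "z' = x * q powi n" using z' unfolding \<Lambda>_def by blast
    with m have "r\<^sup>2 / z' = x * q powi (m - n)"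
      using q x by (simp add: power_int_diff power2_eq_square)
    then show ?thesis by (auto simp: \<Lambda>_def)
  qed
  have s2: "s\<^sup>2 * z' \<in> \<Lambda> q x" if "z' \<in> \<Lambda> q x" for z'
  proof -
    have "s\<^sup>2 \<in> \<Lambda> q (1\<^sup>2)" using rs(2) by (simp add: \<Gamma>_iff[OF q(1)])
    then obtain m :: int where "s\<^sup>2 = q powi m" unfolding \<Lambda>_def by auto
    then show ?thesis using \<Lambda>_q(1)[OF that] by simp
  qed
  have "dyn_one q x y z \<otimes>\<^bsub>?A\<^esub> \<Phi> ?T = \<zero>\<^bsub>?A\<^esub>"
  proof (cases "y * z = r\<^sup>2")
    case False
    have "fst (leg1 q x {r} (su_one q x)) ?T = ?T"
      by (rule leg1_apply) (use rs in \<open>auto simp: U1.su_one_one\<close>)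
    from ext_apply[OF ext(5)[OF rs(1)] T this dyn_closed(1)[OF yz]]
    have "dyn_one q x y z \<otimes>\<^bsub>?A\<^esub> \<Phi> ?T =
        snd (strict_sum ?A (\<Lambda> q x) (\<lambda>z. dyn_one q x (r\<^sup>2 / z) z)) (dyn_one q x y z) \<otimes>\<^bsub>?A\<^esub> \<Phi> ?T" .
    also have "snd (strict_sum ?A (\<Lambda> q x) (\<lambda>z. dyn_one q x (r\<^sup>2 / z) z)) (dyn_one q x y z) = \<zero>\<^bsub>?A\<^esub>"
      by (rule A.strict_sum_snd_none) (use yz r2 False \<Lambda>_q(4)[OF yz(2)] in \<open>auto simp: one_one\<close>)
    finally show ?thesis using \<Phi>_hom(1)[OF T] by simp
  next
    case True
    then have ne: "y \<noteq> s\<^sup>2 * z" using neq by blast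
    have "fst (leg2 q x {s} (su_one q 1)) ?T = ?T"
      by (rule leg2_apply) (use rs in \<open>auto simp: U2.su_one_one\<close>)
    from ext_apply[OF ext(6)[OF rs(2)] T this dyn_closed(1)[OF yz]]
    have "dyn_one q x y z \<otimes>\<^bsub>?A\<^esub> \<Phi> ?T =
        snd (strict_sum ?A (\<Lambda> q x) (\<lambda>z. dyn_one q x (s\<^sup>2 * z) z)) (dyn_one q x y z) \<otimes>\<^bsub>?A\<^esub> \<Phi> ?T" .
    also have "snd (strict_sum ?A (\<Lambda> q x) (\<lambda>z. dyn_one q x (s\<^sup>2 * z) z)) (dyn_one q x y z) = \<zero>\<^bsub>?A\<^esub>"
      by (rule A.strict_sum_snd_none) (use yz s2 ne in \<open>auto simp: one_one\<close>)
    finally show ?thesis using \<Phi>_hom(1)[OF T] by simp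
  qed
  moreover have "P y z (\<pi> (\<Phi> ?T) v) = \<pi> (dyn_one q x y z \<otimes>\<^bsub>?A\<^esub> \<Phi> ?T) v"
    using yz v \<Phi>_hom(1)[OF T] by (simp add: P_def repD)
  ultimately show ?thesis using v by (simp add: star_rep_zero[OF rep A.star_alg_axioms])
qed

lemma sqrt_weights:
  fixes r s y z :: real
  assumes "r > 0" "s > 0" "y > 0" "z > 0"
  shows "y * z = r\<^sup>2 \<and> y = s\<^sup>2 * z \<longleftrightarrow> y = r * s \<and> z = r / s"
proof
  assume *: "y * z = r\<^sup>2 \<and> y = s\<^sup>2 * z"
  have "(s * z)\<^sup>2 = (s\<^sup>2 * z) * z" by (simp add: power_mult_distrib power2_eq_square)
  also have "\<dots> = r\<^sup>2" unfolding conjunct2[OF *, symmetric] by (rule conjunct1[OF *])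
  finally have "s * z = r" using assms by (simp add: power2_eq_iff_nonneg)
  moreover from this have "y = r * s" using * by (auto simp: power2_eq_square)
  ultimately show "y = r * s \<and> z = r / s" using assms(2) by auto
qed (use assms in \<open>simp add: power2_eq_square\<close>)

text \<open>The multiplier identities only locate the support of the image of a unit tensor. That
  the image is the full weight projection is tested on the total range of
  \<open>\<pi> \<circ> \<Phi>\<close>, where by linearity a definite left weight may be
  assumed.\<close>

lemma P_\<Phi>_one:
  assumes rs: "r \<in> \<Gamma> q x" "s \<in> \<Gamma> q 1" and yz: "r * s \<in> \<Lambda> q x" "r / s \<in> \<Lambda> q x" and v: "v \<in> H"
  shows "P (r * s) (r / s) (\<pi> (\<Phi> (tns (su_one q x r) (su_one q 1 s))) v) = P (r * s) (r / s) v"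
proof -
  let ?T = "tns (su_one q x r) (su_one q 1 s)" and ?P = "P (r * s) (r / s)"
  have T: "?T \<in> carrier (su_tensor q x)" using rs by auto
  have pos: "r > 0" "s > 0" using rs U1.\<Gamma>_q(3) U2.\<Gamma>_q(3) by auto
  \<comment> \<open>For the matching weight the unit tensor is absorbed. For any other weight both
    sides vanish: the right one by \<open>P_\<Phi>_one_zero\<close>, the left one by orthogonality
    of unit tensors.\<close>
  have wt: "?P (\<pi> (\<Phi> ?T) (\<pi> (\<Phi> X) w)) = ?P (\<pi> (\<Phi> X) w)"
    if p: "p \<in> \<Gamma> q x" and t: "t \<in> \<Gamma> q 1" and X: "X \<in> carrier (su_tensor q x)" and w: "w \<in> H"
      and eq: "tns (su_one q x p) (su_one q 1 t) \<otimes>\<^bsub>su_tensor q x\<^esub> X = X" for p t X w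
  proof -
    let ?T' = "tns (su_one q x p) (su_one q 1 t)"
    have T': "?T' \<in> carrier (su_tensor q x)" using p t by auto
    have X': "\<pi> (\<Phi> X) w = \<pi> (\<Phi> ?T') (\<pi> (\<Phi> X) w)" using \<Phi>_hom(4)[OF T' X w] eq by simp
    show ?thesis
    proof (cases "p = r \<and> t = s")
      case True
      then show ?thesis using X' by simp
    next
      case False
      have "p > 0" "t > 0" using p t U1.\<Gamma>_q(3) U2.\<Gamma>_q(3) by auto
      have "\<not> (r * s * (r / s) = p\<^sup>2 \<and> r * s = t\<^sup>2 * (r / s))"
      proof
        assume "r * s * (r / s) = p\<^sup>2 \<and> r * s = t\<^sup>2 * (r / s)"
        then have "r\<^sup>2 = p\<^sup>2" "s\<^sup>2 = t\<^sup>2" using pos by (auto simp: power2_eq_square field_simps)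
        then show False
          using False pos \<open>p > 0\<close> \<open>t > 0\<close> by (simp add: power2_eq_iff_nonneg)
      qed
      then have "?P (\<pi> (\<Phi> ?T') (\<pi> (\<Phi> X) w)) = 0"
        using p t yz \<Phi>_hom(2)[OF X w] by (intro P_\<Phi>_one_zero) auto
      moreover have "\<pi> (\<Phi> ?T) (\<pi> (\<Phi> ?T') (\<pi> (\<Phi> X) w)) = 0"
      proof -
        have "?T \<otimes>\<^bsub>su_tensor q x\<^esub> ?T' = \<zero>\<^bsub>su_tensor q x\<^esub>"
          using False rs p t by (auto simp: U.tens_simps U1.su_one_one U2.su_one_one U.tens_zero)
        then show ?thesis
          using \<Phi>_hom(4)[OF T T' \<Phi>_hom(2)[OF X w]] \<Phi>_zero[OF \<Phi>_hom(2)[OF X w]] by simp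
      qed
      ultimately show ?thesis using X' yz by (simp add: P_linear)
    qed
  qed
  have key: "\<forall>w\<in>H. ?P (\<pi> (\<Phi> ?T) (\<pi> (\<Phi> X) w)) = ?P (\<pi> (\<Phi> X) w)"
    if "X \<in> carrier (su_tensor q x)" for X
    using that unfolding tensor_alg_def
  proof (induction rule: pres_alg_induct)
    have gen: "\<forall>w\<in>H. ?P (\<pi> (\<Phi> ?T) (\<pi> (\<Phi> (tns a b)) w)) = ?P (\<pi> (\<Phi> (tns a b)) w)"
      if "a \<in> carrier (su_alg q x)" "b \<in> carrier (su_alg q 1)" for a b
      using that
    proof (induction arbitrary: b rule: U1.su_induct)
      case (weight p a)
      from weight(4) show ?case
      proof (induction rule: U2.su_induct)
        case w: (weight t b)
        show ?case
          by (intro ballI wt[of p t]) (use weight w in \<open>auto simp: U.tens_simps\<close>)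
      next
        case (add b b')
        then show ?case using weight T yz by (simp add: U.tens_simps \<Phi>_hom P_linear rep_linear)
      next
        case (smult c b)
        then show ?case using weight T yz by (simp add: U.tens_simps \<Phi>_hom P_linear rep_linear)
      next
        case zero
        then show ?case
          using weight(2) T yz U2.A.zero_closed
          by (simp add: U.tens_zero \<Phi>_zero \<Phi>_hom rep_linear P_linear)
      qed
    next
      case (add a a')
      then show ?case using T yz by (simp add: U.tens_simps \<Phi>_hom P_linear rep_linear)
    next
      case (smult c a)
      then show ?case using T yz by (simp add: U.tens_simps \<Phi>_hom P_linear rep_linear)
    next
      case zero
      then show ?case
        using T yz U1.A.zero_closed
        by (simp add: U.tens_zero \<Phi>_zero \<Phi>_hom rep_linear P_linear)
    qed
    {
      fix g assume "g \<in> carrier (su_alg q x) \<times> carrier (su_alg q 1)"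
      then show "\<forall>w\<in>H. ?P (\<pi> (\<Phi> ?T) (\<pi> (\<Phi> (pres_cls (tensor_rel (su_alg q x) (su_alg q 1)) (Gen g))) w)) =
          ?P (\<pi> (\<Phi> (pres_cls (tensor_rel (su_alg q x) (su_alg q 1)) (Gen g))) w)"
        using gen by (auto simp: tens_def)
    next
      fix g X assume g: "g \<in> carrier (su_alg q x) \<times> carrier (su_alg q 1)"
        and X: "X \<in> carrier (pres_alg (carrier (su_alg q x) \<times> carrier (su_alg q 1)) (tensor_rel (su_alg q x) (su_alg q 1)))"
      obtain a b where ab: "g = (a, b)" "a \<in> carrier (su_alg q x)" "b \<in> carrier (su_alg q 1)" using g by auto
      have X: "X \<in> carrier (su_tensor q x)" using X by (simp add: tensor_alg_def)
      have "\<forall>w\<in>H. ?P (\<pi> (\<Phi> ?T) (\<pi> (\<Phi> (tns a b \<otimes>\<^bsub>su_tensor q x\<^esub> X)) w)) =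
          ?P (\<pi> (\<Phi> (tns a b \<otimes>\<^bsub>su_tensor q x\<^esub> X)) w)"
        using gen[OF ab(2,3)] ab X by (simp add: \<Phi>_hom)
      then show "\<forall>w\<in>H. ?P (\<pi> (\<Phi> ?T) (\<pi> (\<Phi> (pres_cls (tensor_rel (su_alg q x) (su_alg q 1)) (Gen g)
          \<otimes>\<^bsub>pres_alg (carrier (su_alg q x) \<times> carrier (su_alg q 1)) (tensor_rel (su_alg q x) (su_alg q 1))\<^esub> X)) w)) =
          ?P (\<pi> (\<Phi> (pres_cls (tensor_rel (su_alg q x) (su_alg q 1)) (Gen g)
          \<otimes>\<^bsub>pres_alg (carrier (su_alg q x) \<times> carrier (su_alg q 1)) (tensor_rel (su_alg q x) (su_alg q 1))\<^esub> X)) w)"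
        by (simp add: tens_def tensor_alg_def ab)
    }
  next
    case zero
    then show ?case using T yz by (simp add: \<Phi>_zero \<Phi>_hom rep_linear P_linear flip: tensor_alg_def)
  next
    case (add X Y)
    then show ?case using T yz by (simp add: \<Phi>_hom P_linear rep_linear flip: tensor_alg_def)
  next
    case (smult c X)
    then show ?case using T yz by (simp add: \<Phi>_hom P_linear rep_linear flip: tensor_alg_def)
  qed (rule U.tensor_star_gens)
  have "bounded_operator_on H (\<lambda>v. ?P (\<pi> (\<Phi> ?T) v))"
    by (intro bounded_operator_on_compose[OF P_bounded[OF yz]] repD(4) \<Phi>_hom(1) T)
  then show ?thesis
    by (rule bounded_operator_on_eqI[OF _ P_bounded[OF yz] _ \<Phi>_total _ v]) (use key \<Phi>_hom(2) in auto)
qed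

text \<open>If \<open>r * s\<close> and \<open>r / s\<close> are not both in
  \<open>\<Lambda> q x\<close>, there is no weight on which the image could be supported; hence the
  value 0.\<close>

lemma \<Phi>_one:
  assumes rs: "r \<in> \<Gamma> q x" "s \<in> \<Gamma> q 1" and v: "v \<in> H"
  shows "\<pi> (\<Phi> (tns (su_one q x r) (su_one q 1 s))) v =
    (if r * s \<in> \<Lambda> q x \<and> r / s \<in> \<Lambda> q x then P (r * s) (r / s) v else 0)"
proof (rule weight_eqI)
  have pos: "r > 0" "s > 0" using rs U1.\<Gamma>_q(3) U2.\<Gamma>_q(3) by auto
  show "\<pi> (\<Phi> (tns (su_one q x r) (su_one q 1 s))) v \<in> H" using rs v by (intro \<Phi>_hom(2)) auto
  show "(if r * s \<in> \<Lambda> q x \<and> r / s \<in> \<Lambda> q x then P (r * s) (r / s) v else 0) \<in> H"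
    using v csubspace_0[OF repD(2)] by simp
  fix y z assume yz: "y \<in> \<Lambda> q x" "z \<in> \<Lambda> q x"
  show "P y z (\<pi> (\<Phi> (tns (su_one q x r) (su_one q 1 s))) v) =
      P y z (if r * s \<in> \<Lambda> q x \<and> r / s \<in> \<Lambda> q x then P (r * s) (r / s) v else 0)"
  proof (cases "y = r * s \<and> z = r / s")
    case True
    then show ?thesis using yz rs v P_\<Phi>_one[OF rs] by (simp add: P_P)
  next
    case False
    then have "P y z (\<pi> (\<Phi> (tns (su_one q x r) (su_one q 1 s))) v) = 0"
      using sqrt_weights[OF pos] yz \<Lambda>_q(4) by (intro P_\<Phi>_one_zero rs yz v) blast
    then show ?thesis using False yz v by (auto simp: P_P P_linear)
  qed
qed

end

context dyn
begin

text \<open>The functions of \<open>\<lambda>\<close> and \<open>\<rho>\<close> stand to the right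
  of the generator and are therefore evaluated at its right weight.\<close>

lemma snd_dyn_u:
  assumes "\<epsilon> \<in> {-1, 1}" "\<nu> \<in> {-1, 1}" "a \<in> \<Lambda> q x" "b \<in> \<Lambda> q x"
  shows "snd (dyn_u q x \<epsilon> \<nu> \<otimes>\<^bsub>mult_alg (dyn_alg q x)\<^esub> fun_lam q x f \<otimes>\<^bsub>mult_alg (dyn_alg q x)\<^esub> fun_rho q x g)
      (dyn_one q x a b) =
    complex_of_real (f (q powi \<epsilon> * a) * g (q powi \<nu> * b)) \<odot>\<^bsub>dyn_alg q x\<^esub> u \<epsilon> \<nu> a b"
proof -
  let ?A = "dyn_alg q x"
  have c: "u \<epsilon> \<nu> a b \<in> carrier ?A" using assms by simp
  have c': "h \<odot>\<^bsub>?A\<^esub> u \<epsilon> \<nu> a b \<in> carrier ?A" for h using c by (rule A.smult_closed)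
  have d: "q powi \<epsilon> * a \<in> \<Lambda> q x" "q powi \<nu> * b \<in> \<Lambda> q x" using assms \<Lambda>_q(1) by auto
  have 1: "snd (dyn_u q x \<epsilon> \<nu>) (dyn_one q x a b) = u \<epsilon> \<nu> a b"
    unfolding dyn_u_def u_def[symmetric]
  proof (rule A.strict_sum_snd_single[where k = "(a, b)"])
    fix i assume i: "i \<in> \<Lambda> q x \<times> \<Lambda> q x" "i \<noteq> (a, b)"
    then show "dyn_one q x a b \<otimes>\<^bsub>?A\<^esub> (case i of (y, z) \<Rightarrow> u \<epsilon> \<nu> y z) = \<zero>\<^bsub>?A\<^esub>"
      using assms by (cases i) (auto simp: one_u(1)[OF assms(1,2)])
  qed (use assms in \<open>simp_all add: u_units(1)\<close>)
  have u_one: "(h \<odot>\<^bsub>?A\<^esub> u \<epsilon> \<nu> a b) \<otimes>\<^bsub>?A\<^esub> (h' \<odot>\<^bsub>?A\<^esub> dyn_one q x y z) =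
      (if (y, z) = (q powi \<epsilon> * a, q powi \<nu> * b) then (h' * h) \<odot>\<^bsub>?A\<^esub> u \<epsilon> \<nu> a b else \<zero>\<^bsub>?A\<^esub>)"
    if "y \<in> \<Lambda> q x" "z \<in> \<Lambda> q x" for h h' y z
    using that c by (simp add: A.smult_l A.smult_r one_u(2)[OF assms that] A.smult_smult mult.commute)
  have single: "snd (strict_sum ?A (\<Lambda> q x \<times> \<Lambda> q x) (\<lambda>(y, z). complex_of_real (F y z) \<odot>\<^bsub>?A\<^esub> dyn_one q x y z))
      (h \<odot>\<^bsub>?A\<^esub> u \<epsilon> \<nu> a b) = (complex_of_real (F (q powi \<epsilon> * a) (q powi \<nu> * b)) * h) \<odot>\<^bsub>?A\<^esub> u \<epsilon> \<nu> a b" for F h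
  proof (rule A.strict_sum_snd_single[where k = "(q powi \<epsilon> * a, q powi \<nu> * b)"])
    fix i assume i: "i \<in> \<Lambda> q x \<times> \<Lambda> q x" "i \<noteq> (q powi \<epsilon> * a, q powi \<nu> * b)"
    then show "(h \<odot>\<^bsub>?A\<^esub> u \<epsilon> \<nu> a b) \<otimes>\<^bsub>?A\<^esub> (case i of (y, z) \<Rightarrow> complex_of_real (F y z) \<odot>\<^bsub>?A\<^esub> dyn_one q x y z) =
        \<zero>\<^bsub>?A\<^esub>"
      by (cases i) (auto simp: u_one)
  qed (use d c' u_one in simp_all)
  have 2: "snd (fun_lam q x f) (u \<epsilon> \<nu> a b) = complex_of_real (f (q powi \<epsilon> * a)) \<odot>\<^bsub>?A\<^esub> u \<epsilon> \<nu> a b"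
    using single[of "\<lambda>y z. f y" 1] c by (simp add: fun_lam_def)
  have 3: "snd (fun_rho q x g) (h \<odot>\<^bsub>?A\<^esub> u \<epsilon> \<nu> a b) =
      (complex_of_real (g (q powi \<nu> * b)) * h) \<odot>\<^bsub>?A\<^esub> u \<epsilon> \<nu> a b" for h
    using single[of "\<lambda>y z. g z" h] by (simp add: fun_rho_def)
  show ?thesis
    using assms by (simp add: mult_alg_simps 1 2 3 mult.commute)
qed

end

context phi_rep
begin

text \<open>Both sides are compared weight by weight: \<open>ext_apply\<close> turns the left unit
  \<open>dyn_one q x a b\<close> into a multiple of \<open>u\<close>, and \<open>\<Phi>\<close>
  remains applied to a unit tensor only, which \<open>\<Phi>_one\<close> evaluates.\<close>

lemma \<Phi>_gen:
  assumes em: "extension_maps (su_tensor q x) (dyn_alg q x) \<Phi> m m'"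
    and \<epsilon>\<nu>: "\<epsilon> \<in> {-1, 1}" "\<nu> \<in> {-1, 1}" and rs: "r \<in> \<Gamma> q x" "s \<in> \<Gamma> q 1"
    and m: "fst m (tns (su_one q x r) (su_one q 1 s)) = k \<odot>\<^bsub>su_tensor q x\<^esub> Y" "Y \<in> carrier (su_tensor q x)"
    and m': "\<And>a b. a \<in> \<Lambda> q x \<Longrightarrow> b \<in> \<Lambda> q x \<Longrightarrow> snd m' (dyn_one q x a b) =
      complex_of_real (sg (- \<epsilon>) (- \<nu>) * (sqrt (\<tau> (q powi \<epsilon> * a)) * sqrt (\<tau> b))) \<odot>\<^bsub>dyn_alg q x\<^esub> u \<epsilon> \<nu> a b"
    and v: "v \<in> H"
  shows "k *\<^sub>C \<pi> (\<Phi> Y) v =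
    (if r * s \<in> \<Lambda> q x \<and> r / s \<in> \<Lambda> q x then D (- \<epsilon>) (- \<nu>) (r * s) (r / s) v else 0)"
proof (rule weight_eqI)
  let ?T = "tns (su_one q x r) (su_one q 1 s)"
  let ?R = "if r * s \<in> \<Lambda> q x \<and> r / s \<in> \<Lambda> q x then D (- \<epsilon>) (- \<nu>) (r * s) (r / s) v else 0"
  note \<epsilon>\<nu>' = sign_minus[OF \<epsilon>\<nu>(1)] sign_minus[OF \<epsilon>\<nu>(2)]
  have T: "?T \<in> carrier (su_tensor q x)" using rs by auto
  have kY: "k \<odot>\<^bsub>su_tensor q x\<^esub> Y \<in> carrier (su_tensor q x)" using m(2) by (rule U.T.smult_closed)
  show "k *\<^sub>C \<pi> (\<Phi> Y) v \<in> H" using csubspace_scaleC[OF repD(2) \<Phi>_hom(2)[OF m(2) v]] .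
  show "?R \<in> H" using \<epsilon>\<nu>' v csubspace_0[OF repD(2)] by simp
  fix a b assume ab: "a \<in> \<Lambda> q x" "b \<in> \<Lambda> q x"
  note ab' = \<Lambda>_q(1)[OF ab(1), of \<epsilon>] \<Lambda>_q(1)[OF ab(2), of \<nu>]
  have "P a b (k *\<^sub>C \<pi> (\<Phi> Y) v) = \<pi> (dyn_one q x a b \<otimes>\<^bsub>dyn_alg q x\<^esub> \<Phi> (k \<odot>\<^bsub>su_tensor q x\<^esub> Y)) v"
    using ab v \<Phi>_hom(1)[OF kY] by (simp add: repD P_def \<Phi>_hom(5)[OF m(2)])
  also have "dyn_one q x a b \<otimes>\<^bsub>dyn_alg q x\<^esub> \<Phi> (k \<odot>\<^bsub>su_tensor q x\<^esub> Y) =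
      snd m' (dyn_one q x a b) \<otimes>\<^bsub>dyn_alg q x\<^esub> \<Phi> ?T"
    by (rule ext_apply[OF em T m(1) dyn_closed(1)[OF ab]])
  also have "\<pi> \<dots> v = D (- \<epsilon>) (- \<nu>) (q powi \<epsilon> * a) (q powi \<nu> * b) (\<pi> (\<Phi> ?T) v)"
    using ab \<epsilon>\<nu> v \<Phi>_hom(1,2)[OF T]
    by (simp add: m' repD D_def real_sqrt_mult A.smult_l)
  also have "\<dots> = P a b ?R"
  proof (cases "r * s \<in> \<Lambda> q x \<and> r / s \<in> \<Lambda> q x")
    case True
    then have rs': "r * s \<in> \<Lambda> q x" "r / s \<in> \<Lambda> q x" by auto
    have eq: "r * s = q powi \<epsilon> * a \<and> r / s = q powi \<nu> * b \<longleftrightarrow>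
        a = q powi (- \<epsilon>) * (r * s) \<and> b = q powi (- \<nu>) * (r / s)"
      using powi_eq_iff by metis
    have "D (- \<epsilon>) (- \<nu>) (q powi \<epsilon> * a) (q powi \<nu> * b) (\<pi> (\<Phi> ?T) v) =
        (if r * s = q powi \<epsilon> * a \<and> r / s = q powi \<nu> * b
         then D (- \<epsilon>) (- \<nu>) (q powi \<epsilon> * a) (q powi \<nu> * b) v else 0)"
      using True P_D(2)[OF \<epsilon>\<nu>' ab' rs' v] by (simp add: \<Phi>_one[OF rs v])
    also have "\<dots> = P a b (D (- \<epsilon>) (- \<nu>) (r * s) (r / s) v)"
      using P_D(1)[OF \<epsilon>\<nu>' rs' ab v] eq by auto
    finally show ?thesis using True by simp
  next
    case False
    then have "\<pi> (\<Phi> ?T) v = 0" by (simp only: \<Phi>_one[OF rs v] if_False)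
    then show ?thesis using False \<epsilon>\<nu>' ab ab' by (simp only: D_linear P_linear if_False)
  qed
  finally show "P a b (k *\<^sub>C \<pi> (\<Phi> Y) v) = P a b ?R" .
qed

text \<open>\<open>F\<close> is indexed by the weight it leads to, so the one starting at
  \<open>r\<close> is \<open>su_Fr q x (r / q)\<close>. The minus sign of the fourth image is
  absorbed by \<open>sg\<close>.\<close>

lemma \<Phi>_generators:
  assumes rs: "r \<in> \<Gamma> q x" "s \<in> \<Gamma> q 1" and v: "v \<in> H"
  defines "W \<equiv> \<lambda>\<alpha> \<beta>. if r * s \<in> \<Lambda> q x \<and> r / s \<in> \<Lambda> q x then D \<alpha> \<beta> (r * s) (r / s) v else 0"
  shows "k *\<^sub>C \<pi> (\<Phi> (tns (su_Er q x r) (su_one q 1 s))) v = W 1 1"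
    "k *\<^sub>C \<pi> (\<Phi> (tns (su_one q x r) (su_Er q 1 s))) v = W 1 (-1)"
    "k *\<^sub>C \<pi> (\<Phi> (tns (su_Fr q x (r / q)) (su_one q 1 s))) v = W (-1) (-1)"
    "k *\<^sub>C \<pi> (\<Phi> (tns (su_one q x r) (su_Fr q 1 (s / q)))) v = W (-1) 1"
proof -
  have T: "tns (su_one q x r) (su_one q 1 s) \<in> carrier (su_tensor q x)" using rs by auto
  have rs': "r / q \<in> \<Gamma> q x" "s / q \<in> \<Gamma> q 1" using rs U1.\<Gamma>_q(2) U2.\<Gamma>_q(2) by auto
  have pm: "(-1::int) \<in> {-1, 1}" "(1::int) \<in> {-1, 1}" by auto
  note \<Gamma> = rs rs' U1.su_closed U2.su_closed
  have "k *\<^sub>C \<pi> (\<Phi> (tns (su_Er q x r) (su_one q 1 s))) v = W (- (-1)) (- (-1))"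
    unfolding W_def
  proof (rule \<Phi>_gen[OF ext(1) pm(1) pm(1) rs _ _ _ v])
    show "fst (k \<odot>\<^bsub>mult_alg (su_tensor q x)\<^esub> leg1 q x (\<Gamma> q x) (su_Er q x))
        (tns (su_one q x r) (su_one q 1 s)) = k \<odot>\<^bsub>su_tensor q x\<^esub> tns (su_Er q x r) (su_one q 1 s)"
      unfolding mult_alg_simps(4)[OF T]
      by (subst leg1_apply[where j = r]) (use \<Gamma> in \<open>auto simp: U1.su_one_E\<close>)
  qed (use \<Gamma> q in \<open>auto simp: snd_dyn_u sg_def field_simps\<close>)
  then show "k *\<^sub>C \<pi> (\<Phi> (tns (su_Er q x r) (su_one q 1 s))) v = W 1 1" by simp
  have "k *\<^sub>C \<pi> (\<Phi> (tns (su_one q x r) (su_Er q 1 s))) v = W (- (-1)) (- 1)"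
    unfolding W_def
  proof (rule \<Phi>_gen[OF ext(2) pm(1) pm(2) rs _ _ _ v])
    show "fst (k \<odot>\<^bsub>mult_alg (su_tensor q x)\<^esub> leg2 q x (\<Gamma> q 1) (su_Er q 1))
        (tns (su_one q x r) (su_one q 1 s)) = k \<odot>\<^bsub>su_tensor q x\<^esub> tns (su_one q x r) (su_Er q 1 s)"
      unfolding mult_alg_simps(4)[OF T]
      by (subst leg2_apply[where j = s]) (use \<Gamma> in \<open>auto simp: U2.su_one_E\<close>)
  qed (use \<Gamma> q in \<open>auto simp: snd_dyn_u sg_def\<close>)
  then show "k *\<^sub>C \<pi> (\<Phi> (tns (su_one q x r) (su_Er q 1 s))) v = W 1 (-1)" by simp
  show "k *\<^sub>C \<pi> (\<Phi> (tns (su_Fr q x (r / q)) (su_one q 1 s))) v = W (-1) (-1)"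
    unfolding W_def
  proof (rule \<Phi>_gen[OF ext(3) pm(2) pm(2) rs _ _ _ v])
    show "fst (k \<odot>\<^bsub>mult_alg (su_tensor q x)\<^esub> leg1 q x (\<Gamma> q x) (su_Fr q x))
        (tns (su_one q x r) (su_one q 1 s)) = k \<odot>\<^bsub>su_tensor q x\<^esub> tns (su_Fr q x (r / q)) (su_one q 1 s)"
      unfolding mult_alg_simps(4)[OF T]
      by (subst leg1_apply[where j = "r / q"]) (use \<Gamma> q in \<open>auto simp: U1.su_one_E field_simps\<close>)
  qed (use \<Gamma> q in \<open>auto simp: snd_dyn_u sg_def\<close>)
  have "k *\<^sub>C \<pi> (\<Phi> (tns (su_one q x r) (su_Fr q 1 (s / q)))) v = W (- 1) (- (- 1))"
    unfolding W_def
  proof (rule \<Phi>_gen[OF ext(4) pm(2) pm(1) rs _ _ _ v])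
    show "fst (k \<odot>\<^bsub>mult_alg (su_tensor q x)\<^esub> leg2 q x (\<Gamma> q 1) (su_Fr q 1))
        (tns (su_one q x r) (su_one q 1 s)) = k \<odot>\<^bsub>su_tensor q x\<^esub> tns (su_one q x r) (su_Fr q 1 (s / q))"
      unfolding mult_alg_simps(4)[OF T]
      by (subst leg2_apply[where j = "s / q"]) (use \<Gamma> q in \<open>auto simp: U2.su_one_E field_simps\<close>)
  qed (use \<Gamma> q in \<open>auto simp: snd_dyn_u sg_def mult_alg_simps(5) A.smult_smult field_simps\<close>)
  then show "k *\<^sub>C \<pi> (\<Phi> (tns (su_one q x r) (su_Fr q 1 (s / q)))) v = W (-1) 1" by simp
qed

end

section \<open>Scalar action of the Casimir operator on a weight space\<close>

lemma hilbert_on_preimage: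
  assumes H: "hilbert_on H" and V: "bounded_operator_on H V" and W: "hilbert_on W"
  shows "hilbert_on {v \<in> H. V v \<in> W}"
proof -
  have H': "csubspace H" "closed H" and W': "csubspace W" "closed W"
    using H W by (auto simp: hilbert_on_def)
  note l = clinear_onD[OF bounded_operator_onD(2)[OF V]] clinear_on_0[OF bounded_operator_onD(2)[OF V] H'(1)]
  have "csubspace {v \<in> H. V v \<in> W}"
    unfolding csubspace_def using H'(1) W'(1) l
    by (auto simp: csubspace_0 csubspace_add csubspace_scaleC)
  moreover have "closed {v \<in> H. V v \<in> W}"
    unfolding closed_sequential_limits
  proof (intro allI impI)
    fix f v assume f: "(\<forall>n. f n \<in> {v \<in> H. V v \<in> W}) \<and> f \<longlonglongrightarrow> v"
    then have f': "\<And>n. f n \<in> H" "\<And>n. V (f n) \<in> W" "f \<longlonglongrightarrow> v" by auto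
    have v: "v \<in> H" by (rule closed_sequentially[OF H'(2) _ f'(3)]) (rule f'(1))
    have "(\<lambda>n. V (f n)) \<longlonglongrightarrow> V v" by (rule bounded_operator_on_tendsto[OF V H'(1) f'(1) v f'(3)])
    then have "V v \<in> W" by (rule closed_sequentially[OF W'(2), rotated]) (rule f'(2))
    then show "v \<in> {v \<in> H. V v \<in> W}" using v by simp
  qed
  ultimately show ?thesis by (simp add: hilbert_on_def)
qed

lemma bounded_operator_on_compose_into:
  assumes S: "bounded_operator_on H0 S" and V: "bounded_operator_on H V"
    and sub: "H0 \<subseteq> H" "\<And>v. v \<in> H \<Longrightarrow> V v \<in> H0"
  shows "bounded_operator_on H (\<lambda>v. S (V v))"
proof -
  obtain B where B: "B > 0" "\<And>v. v \<in> H0 \<Longrightarrow> norm (S v) \<le> B * norm v"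
    using bounded_operator_on_bound[OF S] by metis
  obtain B' where B': "\<And>v. v \<in> H \<Longrightarrow> norm (V v) \<le> B' * norm v"
    using bounded_operator_on_bound[OF V] by metis
  have "norm (S (V v)) \<le> (B * B') * norm v" if "v \<in> H" for v
  proof -
    have "norm (S (V v)) \<le> B * norm (V v)" using B(2) sub(2)[OF that] by blast
    also have "\<dots> \<le> B * (B' * norm v)" using B(1) B'[OF that] by simp
    finally show ?thesis by (simp add: mult.assoc)
  qed
  then show ?thesis
    using bounded_operator_onD[OF S] bounded_operator_onD[OF V] sub
    unfolding bounded_operator_on_def clinear_on_def by (auto simp: subset_iff)
qed

lemma bounded_operator_on_subset:
  assumes "bounded_operator_on H V" "H0 \<subseteq> H" "\<And>v. v \<in> H0 \<Longrightarrow> V v \<in> H0"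
  shows "bounded_operator_on H0 V"
  using assms unfolding bounded_operator_on_def clinear_on_def by (meson subset_iff)

lemma bounded_operator_on_id: "bounded_operator_on H (\<lambda>v. v)"
  unfolding bounded_operator_on_def clinear_on_def by (auto intro: exI[of _ 1])

lemma powi_inject:
  fixes q :: real
  assumes "0 < q" "q < 1" "q powi m = q powi n"
  shows "m = n"
proof -
  have "q powr of_int m = q powr of_int n" using assms by (simp add: powr_real_of_int')
  then have "ln q * of_int m = ln q * of_int n" using assms by (simp add: powr_def)
  moreover have "ln q \<noteq> 0" using assms by simp
  ultimately show ?thesis by simp
qed

context dyn_rep
begin

text \<open>Schur's lemma is applied on the weight space \<open>H0\<close> at \<open>(y, z)\<close>.
  For \<open>S\<close> in the double commutant of the Casimir operator there, the vectors
  \<open>w\<close> with \<open>S (P y z (\<pi> a w)) = 0\<close> for all \<open>a\<close> form an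
  invariant subspace of \<open>H\<close>, so irreducibility of \<open>\<pi>\<close> controls the
  kernel of \<open>S\<close>.\<close>

lemma casimir_scalar:
  assumes irr: "irreducible_rep (dyn_alg q x) H \<pi>"
    and yz: "y \<in> \<Lambda> q x" "z \<in> \<Lambda> q x" and v0: "v0 \<in> H" "v0 \<noteq> 0" "P y z v0 = v0"
  obtains c :: real where "C y z v0 = complex_of_real c *\<^sub>C v0"
proof -
  define H0 where "H0 = {w \<in> H. P y z w = w}"
  have H0_eq: "H0 = {w \<in> H. P y z w - w = 0}" by (simp add: H0_def)
  have hH0: "hilbert_on H0"
    unfolding H0_eq
    by (intro hilbert_on_kernel repD(1) bounded_operator_on_diff repD(2) P_bounded yz bounded_operator_on_id)
  have sub: "H0 \<subseteq> H" by (auto simp: H0_def)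
  have PH0: "P y z v \<in> H0" if "v \<in> H" for v using that yz by (simp add: H0_def P_P)
  have CH0: "C y z v \<in> H0" if "v \<in> H0" for v
    using that yz C_P(2)[OF yz yz] by (simp add: H0_def)
  have T: "bounded_operator_on H0 (C y z)"
    using C_bounded[OF yz] sub CH0 by (rule bounded_operator_on_subset)
  show ?thesis
  proof (rule schur_selfadjoint[OF hH0 _ T])
    show "H0 \<noteq> {0}" using v0 by (auto simp: H0_def)
    show "cinner (C y z v) w = cinner v (C y z w)" if "v \<in> H0" "w \<in> H0" for v w
      using that sub yz by (intro cinner_C) auto
  next
    fix S assume S: "bounded_operator_on H0 S"
      and comm: "\<And>B v. bounded_operator_on H0 B \<Longrightarrow> (\<And>v. v \<in> H0 \<Longrightarrow> B (C y z v) = C y z (B v)) \<Longrightarrow>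
        v \<in> H0 \<Longrightarrow> B (S v) = S (B v)"
    define K where "K a = {w \<in> H. S (P y z (\<pi> a w)) = 0}" for a
    define W where "W = H \<inter> (\<Inter>a\<in>carrier (dyn_alg q x). K a)"
    have Pa: "bounded_operator_on H (\<lambda>w. P y z (\<pi> a w))" if "a \<in> carrier (dyn_alg q x)" for a
      using that by (intro bounded_operator_on_compose[OF P_bounded[OF yz]] repD(4))
    have hK: "hilbert_on (K a)" if a: "a \<in> carrier (dyn_alg q x)" for a
      unfolding K_def
      by (rule hilbert_on_kernel[OF repD(1) bounded_operator_on_compose_into[OF S Pa[OF a] sub]])
        (rule PH0[OF repD(5)[OF a]])
    have "hilbert_on W"
      using hK repD(1) unfolding W_def hilbert_on_def csubspace_def by auto
    moreover have "\<forall>a\<in>carrier (dyn_alg q x). \<forall>w\<in>W. \<pi> a w \<in> W"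
    proof (intro ballI)
      fix a w assume a: "a \<in> carrier (dyn_alg q x)" and w: "w \<in> W"
      have wH: "w \<in> H" using w by (simp add: W_def)
      have "\<pi> a w \<in> K b" if b: "b \<in> carrier (dyn_alg q x)" for b
      proof -
        have "w \<in> K (b \<otimes>\<^bsub>dyn_alg q x\<^esub> a)" using w A.m_closed[OF b a] by (auto simp: W_def)
        then show ?thesis using repD(5)[OF a wH] by (simp add: K_def repD(7)[OF b a wH])
      qed
      then show "\<pi> a w \<in> W" using repD(5)[OF a wH] by (simp add: W_def)
    qed
    moreover have "W \<subseteq> H" by (simp add: W_def)
    ultimately have "W = {0} \<or> W = H" using irr unfolding irreducible_rep_def by blast
    then show "{v \<in> H0. S v = 0} = {0} \<or> {v \<in> H0. S v = 0} = H0"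
    proof
      assume W: "W = H"
      have "S v = 0" if v: "v \<in> H0" for v
      proof -
        have "v \<in> K (dyn_one q x y z)" using v sub W dyn_closed(1)[OF yz] by (auto simp: W_def)
        then show ?thesis using v by (simp add: K_def P_def[symmetric] H0_def)
      qed
      then show ?thesis by blast
    next
      assume W: "W = {0}"
      have "v = 0" if v: "v \<in> H0" "S v = 0" for v
      proof -
        have vH: "v \<in> H" and Pv: "P y z v = v" using v by (auto simp: H0_def)
        have "v \<in> K a" if a: "a \<in> carrier (dyn_alg q x)" for a
        proof -
          let ?B = "\<lambda>w. P y z (\<pi> a w)"
          have B: "bounded_operator_on H0 ?B"
            by (rule bounded_operator_on_subset[OF Pa[OF a] sub]) (use PH0 repD(5)[OF a] sub in auto)
          \<comment> \<open>By \<open>C_central\<close> the corner of \<open>\<pi> a\<close> at the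
            weight commutes with the Casimir operator, hence with \<open>S\<close>.\<close>
          have "?B (C y z w) = C y z (?B w)" if w: "w \<in> H0" for w
          proof -
            have wH: "w \<in> H" and Pw: "P y z w = w" using w by (auto simp: H0_def)
            have "?B (C y z w) = C y z (\<pi> a (P y z w))" using C_central[OF a] wH yz by simp
            also have "\<dots> = C y z (?B w)"
              using C_P(1)[OF yz yz repD(5)[OF a wH]] by (simp add: Pw)
            finally show ?thesis .
          qed
          then have "S (?B v) = ?B (S v)" using comm[OF B _ v(1)] by simp
          also have "\<dots> = 0" using v(2) a yz by (simp add: rep_linear P_linear)
          finally show ?thesis using vH by (simp add: K_def)
        qed
        then have "v \<in> W" using vH by (simp add: W_def)
        then show ?thesis using W by simp
      qed
      moreover have "0 \<in> {v \<in> H0. S v = 0}"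
        using hH0 clinear_on_0[OF bounded_operator_onD(2)[OF S]] by (auto simp: hilbert_on_def csubspace_0)
      ultimately show ?thesis by blast
    qed
  next
    fix c :: real assume "\<And>v. v \<in> H0 \<Longrightarrow> C y z v = complex_of_real c *\<^sub>C v"
    then show thesis using v0 by (intro that[of c]) (auto simp: H0_def)
  qed
qed

end

subsection \<open>Ladders of weight vectors\<close>

text \<open>
  Because of \<open>inverse 0 = 0\<close>, the recursion yields zero vectors beyond the first vanishing \<open>g n\<close>.
\<close>

primrec ladder_up :: "(int \<Rightarrow> 'h::chilbert_space \<Rightarrow> 'h) \<Rightarrow> (int \<Rightarrow> real) \<Rightarrow> 'h \<Rightarrow> nat \<Rightarrow> 'h" where
  "ladder_up A g v 0 = v"
| "ladder_up A g v (Suc k) = complex_of_real (inverse (sqrt (g (int k)))) *\<^sub>C A (int k) (ladder_up A g v k)"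

primrec ladder_down :: "(int \<Rightarrow> 'h::chilbert_space \<Rightarrow> 'h) \<Rightarrow> (int \<Rightarrow> real) \<Rightarrow> 'h \<Rightarrow> nat \<Rightarrow> 'h" where
  "ladder_down B g v 0 = v"
| "ladder_down B g v (Suc k) =
    complex_of_real (inverse (sqrt (g (- int k - 1)))) *\<^sub>C B (- int k - 1) (ladder_down B g v k)"

text \<open>\<open>g n\<close> belongs to the edge between \<open>n\<close> and
  \<open>n + 1\<close>, whichever way it is traversed.\<close>

definition ladder_seq where
  "ladder_seq A B g v n = (if n \<ge> 0 then ladder_up A g v (nat n) else ladder_down B g v (nat (- n)))"

lemma ladder_seq_0 [simp]: "ladder_seq A B g v 0 = v"
  by (simp add: ladder_seq_def)

lemma ladder_seq_up:
  "n \<ge> 0 \<Longrightarrow> ladder_seq A B g v (n + 1) =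
    complex_of_real (inverse (sqrt (g n))) *\<^sub>C A n (ladder_seq A B g v n)"
  by (simp add: ladder_seq_def nat_add_distrib)

lemma ladder_seq_down:
  assumes "n < 0"
  shows "ladder_seq A B g v n =
    complex_of_real (inverse (sqrt (g n))) *\<^sub>C B n (ladder_seq A B g v (n + 1))"
proof -
  obtain k where n: "n = - int k - 1" using assms by (metis diff_minus_eq_add minus_diff_eq
    nat_0_le add.commute diff_add_cancel int_one_le_iff_zero_less neg_0_less_iff_less zle_diff1_eq
    diff_ge_0_iff_ge minus_minus)
  show ?thesis
  proof (cases "k = 0")
    case True
    then show ?thesis by (simp add: n ladder_seq_def)
  next
    case False
    moreover have "nat (- (n + 1)) = k" "nat (- n) = Suc k" by (simp_all add: n)
    ultimately show ?thesis by (simp add: n ladder_seq_def)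
  qed
qed

lemma int_ladder_induct [case_names zero up down]:
  fixes Q :: "int \<Rightarrow> bool"
  assumes "Q 0" "\<And>n. n \<ge> 0 \<Longrightarrow> Q n \<Longrightarrow> Q (n + 1)" "\<And>n. n < 0 \<Longrightarrow> Q (n + 1) \<Longrightarrow> Q n"
  shows "Q n"
proof (cases "n \<ge> 0")
  case True
  then show ?thesis by (induction rule: int_ge_induct) (use assms in auto)
next
  case False
  then have "n \<le> 0" by simp
  then show ?thesis
  proof (induction rule: int_le_induct)
    case (step i)
    then show ?case using assms(3)[of "i - 1"] by simp
  qed (rule assms(1))
qed

text \<open>A pair of mutually adjoint ladder operators along a sequence of weight spaces, both
  products being the scalar \<open>g n\<close>. It is instantiated for each of the two
  copies.\<close>

locale ladder_ops =
  fixes A B :: "int \<Rightarrow> 'h::chilbert_space \<Rightarrow> 'h" and g :: "int \<Rightarrow> real" and Wt :: "int \<Rightarrow> 'h set"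
  assumes A_Wt: "w \<in> Wt n \<Longrightarrow> A n w \<in> Wt (n + 1)" and B_Wt: "w \<in> Wt (n + 1) \<Longrightarrow> B n w \<in> Wt n"
    and BA: "w \<in> Wt n \<Longrightarrow> B n (A n w) = complex_of_real (g n) *\<^sub>C w"
    and AB: "w \<in> Wt (n + 1) \<Longrightarrow> A n (B n w) = complex_of_real (g n) *\<^sub>C w"
    and adj: "w \<in> Wt n \<Longrightarrow> w' \<in> Wt (n + 1) \<Longrightarrow> cinner (A n w) w' = cinner w (B n w')"
    and A_scale: "w \<in> Wt n \<Longrightarrow> A n (a *\<^sub>C w) = a *\<^sub>C A n w"
    and B_scale: "w \<in> Wt (n + 1) \<Longrightarrow> B n (a *\<^sub>C w) = a *\<^sub>C B n w"
    and Wt_scale: "w \<in> Wt n \<Longrightarrow> a *\<^sub>C w \<in> Wt n"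
begin

lemma norm_A: "w \<in> Wt n \<Longrightarrow> (norm (A n w))\<^sup>2 = g n * (norm w)\<^sup>2"
proof -
  assume w: "w \<in> Wt n"
  have "cinner (A n w) (A n w) = complex_of_real (g n) * cinner w w"
    using adj[OF w A_Wt[OF w]] by (simp add: BA[OF w] cinner_scaleC_right)
  then show ?thesis by (simp only: cinner_self of_real_mult[symmetric] of_real_eq_iff)
qed

lemma norm_B: "w \<in> Wt (n + 1) \<Longrightarrow> (norm (B n w))\<^sup>2 = g n * (norm w)\<^sup>2"
proof -
  assume w: "w \<in> Wt (n + 1)"
  have "cinner (B n w) (B n w) = complex_of_real (g n) * cinner w w"
    using adj[OF B_Wt[OF w] w] by (simp add: AB[OF w] cinner_scaleC_left)
  then show ?thesis by (simp only: cinner_self of_real_mult[symmetric] of_real_eq_iff)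
qed

text \<open>\<open>g n * (norm w)\<^sup>2\<close> is a squared norm.\<close>

lemma nonneg: "w \<in> Wt n \<Longrightarrow> w \<noteq> 0 \<Longrightarrow> 0 \<le> g n" "w \<in> Wt (n + 1) \<Longrightarrow> w \<noteq> 0 \<Longrightarrow> 0 \<le> g n"
  using norm_A[of w n] norm_B[of w n] by (metis zero_le_mult_iff zero_le_power2 zero_less_norm_iff
    zero_less_power2 linorder_not_less norm_eq_zero)+

text \<open>For \<open>g n > 0\<close> the factor \<open>sqrt (g n)\<close> cancels. Otherwise
  \<open>B n w'\<close> is 0 by its norm, and so is the right-hand side: either
  \<open>g n = 0\<close>, or \<open>g n < 0\<close> and then \<open>w = 0\<close>.\<close>

lemma A_imp_B:
  assumes w: "w \<in> Wt n" "w' \<in> Wt (n + 1)" and eq: "A n w = complex_of_real (sqrt (g n)) *\<^sub>C w'"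
  shows "B n w' = complex_of_real (sqrt (g n)) *\<^sub>C w"
proof (cases "g n > 0")
  case True
  have "complex_of_real (sqrt (g n)) *\<^sub>C B n w' = complex_of_real (g n) *\<^sub>C w"
    using BA[OF w(1)] by (simp add: eq B_scale[OF w(2)])
  also have "\<dots> = complex_of_real (sqrt (g n)) *\<^sub>C (complex_of_real (sqrt (g n)) *\<^sub>C w)"
    using True by (simp add: scaleC_scaleC flip: of_real_mult)
  finally have "complex_of_real (inverse (sqrt (g n))) *\<^sub>C complex_of_real (sqrt (g n)) *\<^sub>C B n w' =
      complex_of_real (inverse (sqrt (g n))) *\<^sub>C complex_of_real (sqrt (g n)) *\<^sub>C
        (complex_of_real (sqrt (g n)) *\<^sub>C w)" by simp
  then show ?thesis using True by (simp add: scaleC_scaleC flip: mult.assoc)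
next
  case False
  then have "(norm (B n w'))\<^sup>2 \<le> 0" using norm_B[OF w(2)] by (simp add: mult_nonpos_nonneg)
  then have "B n w' = 0" by simp
  moreover have "g n = 0 \<or> w = 0" using nonneg(1)[OF w(1)] False by force
  ultimately show ?thesis by auto
qed

lemma B_imp_A:
  assumes w: "w \<in> Wt n" "w' \<in> Wt (n + 1)" and eq: "B n w' = complex_of_real (sqrt (g n)) *\<^sub>C w"
  shows "A n w = complex_of_real (sqrt (g n)) *\<^sub>C w'"
proof (cases "g n > 0")
  case True
  have "complex_of_real (sqrt (g n)) *\<^sub>C A n w = complex_of_real (g n) *\<^sub>C w'"
    using AB[OF w(2)] by (simp add: eq A_scale[OF w(1)])
  also have "\<dots> = complex_of_real (sqrt (g n)) *\<^sub>C (complex_of_real (sqrt (g n)) *\<^sub>C w')"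
    using True by (simp add: scaleC_scaleC flip: of_real_mult)
  finally have "complex_of_real (inverse (sqrt (g n))) *\<^sub>C complex_of_real (sqrt (g n)) *\<^sub>C A n w =
      complex_of_real (inverse (sqrt (g n))) *\<^sub>C complex_of_real (sqrt (g n)) *\<^sub>C
        (complex_of_real (sqrt (g n)) *\<^sub>C w')" by simp
  then show ?thesis using True by (simp add: scaleC_scaleC flip: mult.assoc)
next
  case False
  then have "(norm (A n w))\<^sup>2 \<le> 0" using norm_A[OF w(1)] by (simp add: mult_nonpos_nonneg)
  then have "A n w = 0" by simp
  moreover have "g n = 0 \<or> w' = 0" using nonneg(2)[OF w(2)] False by force
  ultimately show ?thesis by auto
qed

context
  fixes v assumes v: "v \<in> Wt 0"
begin

abbreviation "seq \<equiv> ladder_seq A B g v"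

lemma seq_Wt: "seq n \<in> Wt n"
proof (induction n rule: int_ladder_induct)
  case zero
  then show ?case using v by simp
next
  case (up n)
  then show ?case by (simp add: ladder_seq_up Wt_scale A_Wt)
next
  case (down n)
  then show ?case by (subst ladder_seq_down) (simp_all add: Wt_scale B_Wt)
qed

text \<open>The recursion gives one of the two formulas, the upward one for \<open>n \<ge> 0\<close>
  and the downward one for \<open>n < 0\<close>; the other follows from it by \<open>A_imp_B\<close>
  or \<open>B_imp_A\<close>.\<close>

lemma seq_A_B:
  "A n (seq n) = complex_of_real (sqrt (g n)) *\<^sub>C seq (n + 1) \<and>
   B n (seq (n + 1)) = complex_of_real (sqrt (g n)) *\<^sub>C seq n"
proof (cases "n \<ge> 0")
  case True
  have "A n (seq n) = complex_of_real (sqrt (g n)) *\<^sub>C seq (n + 1)"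
  proof (cases "g n = 0")
    case True
    then show ?thesis using norm_A[OF seq_Wt, of n] by simp
  next
    case False
    then show ?thesis using True by (simp add: ladder_seq_up scaleC_scaleC)
  qed
  then show ?thesis using A_imp_B[OF seq_Wt seq_Wt] by blast
next
  case n: False
  have "B n (seq (n + 1)) = complex_of_real (sqrt (g n)) *\<^sub>C seq n"
  proof (cases "g n = 0")
    case True
    then show ?thesis using norm_B[OF seq_Wt, of n] by simp
  next
    case False
    then show ?thesis using n by (subst (2) ladder_seq_down) (simp_all add: scaleC_scaleC)
  qed
  then show ?thesis using B_imp_A[OF seq_Wt seq_Wt] by blast
qed

lemma norm_seq_eq:
  assumes "g n \<noteq> 0"
  shows "norm (seq (n + 1)) = norm (seq n)"
proof -
  have "(norm (A n (seq n)))\<^sup>2 = \<bar>g n\<bar> * (norm (seq (n + 1)))\<^sup>2"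
    using seq_A_B[of n] by (simp add: norm_scaleC power_mult_distrib real_sqrt_abs2
      flip: real_sqrt_abs) (simp add: power2_eq_square abs_mult[symmetric] flip: real_sqrt_mult)
  then have eq: "\<bar>g n\<bar> * (norm (seq (n + 1)))\<^sup>2 = g n * (norm (seq n))\<^sup>2"
    using norm_A[OF seq_Wt, of n] by simp
  show ?thesis
  proof (cases "g n > 0")
    case True
    then show ?thesis using eq by (simp add: power2_eq_iff_nonneg)
  next
    case False
    then have "g n < 0" using assms by simp
    then have "seq n = 0" "seq (n + 1) = 0"
      using nonneg(1)[OF seq_Wt, of n] nonneg(2)[OF seq_Wt, of n] by force+
    then show ?thesis by simp
  qed
qed

text \<open>Normalised steps preserve the norm until the ladder breaks off; after that only zero
  vectors follow.\<close>

lemma norm_seq: "seq n = 0 \<or> norm (seq n) = norm v"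
proof (induction n rule: int_ladder_induct)
  case (up n)
  show ?case
  proof (cases "g n = 0")
    case True
    then show ?thesis using up(1) by (simp add: ladder_seq_up)
  next
    case False
    then show ?thesis using norm_seq_eq[OF False] up(2) by (metis norm_eq_zero)
  qed
next
  case (down n)
  show ?case
  proof (cases "g n = 0")
    case True
    then show ?thesis using down(1) by (subst (1) ladder_seq_down) simp_all
  next
    case False
    then show ?thesis using norm_seq_eq[OF False] down(2) by (metis norm_eq_zero)
  qed
qed simp

text \<open>The ladder loses its vector at an edge with \<open>g n = 0\<close>, exactly where the
  generation of the component stops. Injectivity of the powers of \<open>q\<close> recovers
  \<open>n\<close> from the point.\<close>

lemma seq_nonzero_iff:
  assumes q: "q > 0" and p0: "p0 > 0" and g: "\<And>n. g n = c + \<tau> (q * (q powi (2 * n) * p0))"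
    and v0: "v \<noteq> 0" and inj: "q < 1"
  shows "seq n \<noteq> 0 \<longleftrightarrow> q powi (2 * n) * p0 \<in> c_component q c p0"
proof -
  have step: "q powi (2 * (n + 1)) * p0 = q\<^sup>2 * (q powi (2 * n) * p0)" for n
    using q by (simp add: distrib_left power_int_add)
  have "q powi (2 * n) * p0 \<in> c_component q c p0" if "seq n \<noteq> 0" for n
    using that
  proof (induction n rule: int_ladder_induct)
    case zero
    then show ?case by (simp add: c_component.base)
  next
    case (up n)
    then have gn: "g n \<noteq> 0" by (auto simp: ladder_seq_up)
    then have "seq n \<noteq> 0" using norm_seq_eq up(3) by (metis norm_eq_zero)
    from up(2)[OF this] show ?case
      unfolding step by (rule c_component.up) (use gn g in simp)
  next
    case (down n)
    then have gn: "g n \<noteq> 0" by (auto simp: ladder_seq_down[of n])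
    then have "seq (n + 1) \<noteq> 0" using norm_seq_eq down(3) by (metis norm_eq_zero)
    from down(2)[OF this] have "q\<^sup>2 * (q powi (2 * n) * p0) \<in> c_component q c p0"
      unfolding step .
    from c_component.down[OF this] gn q show ?case by (simp add: g power2_eq_square)
  qed
  moreover have "\<exists>n. p = q powi (2 * n) * p0 \<and> seq n \<noteq> 0" if "p \<in> c_component q c p0" for p
    using that
  proof induction
    case base
    then show ?case using v0 by (intro exI[of _ 0]) simp
  next
    case (up p)
    then obtain n where n: "p = q powi (2 * n) * p0" "seq n \<noteq> 0" by blast
    then have "g n \<noteq> 0" using up.hyps(2) g by simp
    then have "seq (n + 1) \<noteq> 0" using norm_seq_eq n(2) by (metis norm_eq_zero)
    moreover have "q\<^sup>2 * p = q powi (2 * (n + 1)) * p0" unfolding n(1) step ..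
    ultimately show ?case by blast
  next
    case (down p)
    then obtain n where n: "p = q powi (2 * n) * p0" "seq n \<noteq> 0" by blast
    have "p = q\<^sup>2 * (q powi (2 * (n - 1)) * p0)"
      using step[of "n - 1"] n(1) by (simp only: diff_add_cancel)
    then have p: "p / q\<^sup>2 = q powi (2 * (n - 1)) * p0" "p / q = q * (q powi (2 * (n - 1)) * p0)"
      using q by (simp_all add: power2_eq_square)
    from down.hyps(2)[unfolded p(2)] have "g (n - 1) \<noteq> 0" unfolding g .
    then have "seq (n - 1) \<noteq> 0" using norm_seq_eq[of "n - 1"] n(2) by (metis norm_eq_zero diff_add_cancel)
    then show ?case using p(1) by blast
  qed
  moreover have "m = n" if "q powi (2 * m) * p0 = q powi (2 * n) * p0" for m n :: int
    using that p0 powi_inject[OF q inj, of "2 * m" "2 * n"] by simp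
  ultimately show ?thesis by metis
qed

end

text \<open>Carries the operators of one copy along the ladder of the other copy, with which they
  commute.\<close>

lemma ladder_seq_intertwine:
  assumes v: "v \<in> Wt 0"
    and T_scale: "\<And>n w a. w \<in> Wt n \<Longrightarrow> T n (a *\<^sub>C w) = a *\<^sub>C T n w"
    and TA: "\<And>n w. w \<in> Wt n \<Longrightarrow> T (n + 1) (A n w) = A' n (T n w)"
    and TB: "\<And>n w. w \<in> Wt (n + 1) \<Longrightarrow> T n (B n w) = B' n (T (n + 1) w)"
  shows "T n (ladder_seq A B g v n) = ladder_seq A' B' g (T 0 v) n"
proof (induction n rule: int_ladder_induct)
  case (up n)
  then show ?case using seq_Wt[OF v] by (simp add: ladder_seq_up T_scale A_Wt TA)
next
  case (down n)
  then show ?case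
    using seq_Wt[OF v]
    by (subst (1 2) ladder_seq_down) (simp_all add: T_scale B_Wt TB)
qed simp

lemma ladder_seq_scale:
  assumes v: "v \<in> Wt 0"
  shows "ladder_seq A B g (a *\<^sub>C v) n = a *\<^sub>C ladder_seq A B g v n"
proof (induction n rule: int_ladder_induct)
  case (up n)
  then show ?case using seq_Wt[OF v] by (simp add: ladder_seq_up A_scale scaleC_left_commute[of a])
next
  case (down n)
  then show ?case
    using seq_Wt[OF v]
    by (subst (1 2) ladder_seq_down) (simp_all add: B_scale scaleC_left_commute[of a])
qed simp

end

subsection \<open>Standard bases\<close>

context dyn
begin

text \<open>The square root of the scalar in \<open>D_D\<close> when the Casimir operator is
  \<open>c\<close>.\<close>

definition dc :: "real \<Rightarrow> int \<Rightarrow> int \<Rightarrow> real \<Rightarrow> real \<Rightarrow> real" where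
  "dc c \<alpha> \<beta> y z = sqrt (sig \<alpha> \<beta> * c + \<tau> (q powi \<alpha> * pr \<alpha> \<beta> y z))"

definition wts :: "real set \<Rightarrow> real set \<Rightarrow> (real \<times> real) set" where
  "wts Zs Zt = {(y, z). y \<in> \<Lambda> q x \<and> z \<in> \<Lambda> q x \<and> y * z \<in> Zs \<and> y / z \<in> Zt}"

end

context dyn_rep
begin

text \<open>An orthonormal weight basis whose matrix coefficients retain nothing of the
  representation except \<open>c\<close> and the two index sets; the same data therefore force
  equivalent representations.\<close>

definition std :: "real \<Rightarrow> real set \<Rightarrow> real set \<Rightarrow> (real \<times> real \<Rightarrow> 'h) \<Rightarrow> bool" where
  "std c Zs Zt e \<longleftrightarrow>
    (\<forall>i\<in>wts Zs Zt. \<forall>j\<in>wts Zs Zt. cinner (e i) (e j) = (if i = j then 1 else 0)) \<and>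
    closure (cspan (e ` wts Zs Zt)) = H \<and>
    (\<forall>y z a b. (y, z) \<in> wts Zs Zt \<longrightarrow> a \<in> \<Lambda> q x \<longrightarrow> b \<in> \<Lambda> q x \<longrightarrow>
      P a b (e (y, z)) = (if a = y \<and> b = z then e (y, z) else 0)) \<and>
    (\<forall>\<alpha> \<beta> y z. \<alpha> \<in> {-1, 1} \<longrightarrow> \<beta> \<in> {-1, 1} \<longrightarrow> (y, z) \<in> wts Zs Zt \<longrightarrow>
      D \<alpha> \<beta> y z (e (y, z)) =
        (if (q powi \<alpha> * y, q powi \<beta> * z) \<in> wts Zs Zt
         then complex_of_real (dc c \<alpha> \<beta> y z) *\<^sub>C e (q powi \<alpha> * y, q powi \<beta> * z) else 0))"

definition EW :: "real \<Rightarrow> real \<Rightarrow> real \<Rightarrow> 'h set" where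
  "EW c y z = {w \<in> H. P y z w = w \<and> C y z w = complex_of_real c *\<^sub>C w}"

lemma EW_scale: "y \<in> \<Lambda> q x \<Longrightarrow> z \<in> \<Lambda> q x \<Longrightarrow> w \<in> EW c y z \<Longrightarrow> a *\<^sub>C w \<in> EW c y z"
  by (auto simp: EW_def P_linear C_linear csubspace_scaleC[OF repD(2)] scaleC_left_commute)

lemma EW_step:
  assumes \<alpha>\<beta>: "\<alpha> \<in> {-1, 1}" "\<beta> \<in> {-1, 1}" and yz: "y \<in> \<Lambda> q x" "z \<in> \<Lambda> q x" and w: "w \<in> EW c y z"
  shows "D \<alpha> \<beta> y z w \<in> EW c (q powi \<alpha> * y) (q powi \<beta> * z)"
    "D (- \<alpha>) (- \<beta>) (q powi \<alpha> * y) (q powi \<beta> * z) (D \<alpha> \<beta> y z w) =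
      complex_of_real (sig \<alpha> \<beta> * c + \<tau> (q powi \<alpha> * pr \<alpha> \<beta> y z)) *\<^sub>C w"
proof -
  have w': "w \<in> H" "P y z w = w" "C y z w = complex_of_real c *\<^sub>C w" using w by (auto simp: EW_def)
  show "D \<alpha> \<beta> y z w \<in> EW c (q powi \<alpha> * y) (q powi \<beta> * z)"
    using C_D[OF \<alpha>\<beta> yz w'(1)] P_D(1)[OF \<alpha>\<beta> yz \<Lambda>_q(1)[OF yz(1)] \<Lambda>_q(1)[OF yz(2)] w'(1)]
      D_in[OF \<alpha>\<beta> yz w'(1)] D_linear(2)[OF \<alpha>\<beta> yz w'(1)]
    by (simp add: EW_def w'(3))
  show "D (- \<alpha>) (- \<beta>) (q powi \<alpha> * y) (q powi \<beta> * z) (D \<alpha> \<beta> y z w) =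
      complex_of_real (sig \<alpha> \<beta> * c + \<tau> (q powi \<alpha> * pr \<alpha> \<beta> y z)) *\<^sub>C w"
    by (simp only: D_D[OF \<alpha>\<beta> yz w'(1)] w'(2,3) of_real_add of_real_mult scaleC_add_left scaleC_scaleC)
qed

lemma invariant_closure_cspan:
  assumes B: "B \<subseteq> H" and V: "bounded_operator_on H V"
    and BV: "\<And>w. w \<in> B \<Longrightarrow> V w \<in> closure (cspan B)" and w: "w \<in> closure (cspan B)"
  shows "V w \<in> closure (cspan B)"
proof -
  have "hilbert_on {v \<in> H. V v \<in> closure (cspan B)}"
    by (intro hilbert_on_preimage repD(1) V hilbert_on_closure_cspan)
  then have "closure (cspan B) \<subseteq> {v \<in> H. V v \<in> closure (cspan B)}"
    using B BV by (intro closure_cspan_minimal) auto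
  then show ?thesis using w by blast
qed

text \<open>Two ladders started at \<open>v\<close> produce vectors on a grid. Their closed span is
  invariant, hence all of \<open>H\<close>; nonnegativity of squared norms gives adaptedness, and
  the places where the ladders break off give the components.\<close>

lemma std_of_weight_vector:
  assumes irr: "irreducible_rep (dyn_alg q x) H \<pi>"
    and yz0: "y0 \<in> \<Lambda> q x" "z0 \<in> \<Lambda> q x"
    and v: "v \<in> H" "norm v = 1" "P y0 z0 v = v" "C y0 z0 v = complex_of_real c *\<^sub>C v"
  obtains e where "std c (c_component q c (y0 * z0)) (c_component q (- c) (y0 / z0)) e"
    "\<And>p. p \<in> c_component q c (y0 * z0) \<Longrightarrow> 0 \<le> c + \<tau> (q * p) \<and> 0 \<le> c + \<tau> (p / q)"
    "\<And>p. p \<in> c_component q (- c) (y0 / z0) \<Longrightarrow> 0 \<le> - c + \<tau> (q * p) \<and> 0 \<le> - c + \<tau> (p / q)"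
proof -
  have q0: "q \<noteq> 0" using q by simp
  have pos0: "y0 > 0" "z0 > 0" using \<Lambda>_q(4) yz0 by auto
  have pm: "(1::int) \<in> {-1, 1}" "(-1::int) \<in> {-1, 1}" by auto
  \<comment> \<open>In these coordinates the first copy moves \<open>n\<close> and the second moves
    \<open>m\<close>: \<open>y * z\<close> scales by \<open>q powi (2 * n)\<close> and
    \<open>y / z\<close> by \<open>q powi (2 * m)\<close>.\<close>
  define Y where "Y n m = q powi (n + m) * y0" for n m
  define Z where "Z n m = q powi (n - m) * z0" for n m
  have Y\<Lambda> [simp]: "Y n m \<in> \<Lambda> q x" and Z\<Lambda> [simp]: "Z n m \<in> \<Lambda> q x" for n m
    using yz0 \<Lambda>_q(1) by (auto simp: Y_def Z_def)
  have pos: "Y n m > 0" "Z n m > 0" for n m using \<Lambda>_q(4) Y\<Lambda> Z\<Lambda> by blast+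
  have Y1: "Y (n + 1) m = q * Y n m" "Y n (m + 1) = q * Y n m" for n m
    using q0 by (simp_all add: Y_def power_int_add power_int_add_1 add.assoc[symmetric])
  have Z1: "Z (n + 1) m = q * Z n m" "Z n (m + 1) = Z n m / q" for n m
    using q0 by (simp_all add: Z_def power_int_add power_int_diff)
  have YZ: "Y n m * Z n m = q powi (2 * n) * (y0 * z0)" "Y n m / Z n m = q powi (2 * m) * (y0 / z0)" for n m
  proof -
    have "q powi (n + m) * q powi (n - m) = q powi (2 * n)"
      using q0 by (simp flip: power_int_add)
    then show "Y n m * Z n m = q powi (2 * n) * (y0 * z0)"
      by (simp add: Y_def Z_def mult_ac)
    have "q powi (n + m) / q powi (n - m) = q powi (2 * m)"
      using q0 by (simp flip: power_int_diff)
    then show "Y n m / Z n m = q powi (2 * m) * (y0 / z0)"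
      unfolding Y_def Z_def by (simp only: times_divide_times_eq[symmetric])
  qed
  have YZ_unique: "\<exists>n m. y = Y n m \<and> z = Z n m"
    if "y > 0" "z > 0" "y * z = (y0 * z0) * q powi (2 * n)" "y / z = (y0 / z0) * q powi (2 * m)" for y z n m
  proof -
    have "y * z = Y n m * Z n m" "y / z = Y n m / Z n m"
      using that(3,4) YZ by (simp_all add: mult.commute)
    moreover have "y\<^sup>2 = (y * z) * (y / z)" "z\<^sup>2 = (y * z) / (y / z)"
      "(Y n m)\<^sup>2 = (Y n m * Z n m) * (Y n m / Z n m)" "(Z n m)\<^sup>2 = (Y n m * Z n m) / (Y n m / Z n m)"
      using that(1,2) pos[of n m] by (simp_all add: power2_eq_square)
    ultimately have "y\<^sup>2 = (Y n m)\<^sup>2" "z\<^sup>2 = (Z n m)\<^sup>2" by simp_all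
    then have "y = Y n m" "z = Z n m" using that(1,2) pos[of n m] by (simp_all add: power2_eq_iff_nonneg)
    then show ?thesis by blast
  qed
  define Wt where "Wt n m = EW c (Y n m) (Z n m)" for n m
  have WtH: "w \<in> H" "P (Y n m) (Z n m) w = w" if "w \<in> Wt n m" for w n m
    using that by (auto simp: Wt_def EW_def)
  have Wt_scale: "w \<in> Wt n m \<Longrightarrow> a *\<^sub>C w \<in> Wt n m" for w n m a
    unfolding Wt_def by (rule EW_scale[OF Y\<Lambda> Z\<Lambda>])
  \<comment> \<open>\<open>g\<close> depends on \<open>n\<close> alone and \<open>h\<close> on
    \<open>m\<close> alone, so parallel ladders share their coefficients.\<close>
  define g where "g n = c + \<tau> (q * (q powi (2 * n) * (y0 * z0)))" for n
  define h where "h m = - c + \<tau> (q * (q powi (2 * m) * (y0 / z0)))" for m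
  have shift: "q powi (2 * (n + 1)) = q\<^sup>2 * q powi (2 * n)" for n :: int
    using q0 by (simp add: distrib_left power_int_add)
  have g': "c + \<tau> (inverse q * (Y (n + 1) m * Z (n + 1) m)) = g n"
    "c + \<tau> (q * (Y n m * Z n m)) = g n" for n m
    unfolding YZ g_def shift using q0 by (simp_all add: power2_eq_square mult.assoc)
  have h': "- c + \<tau> (inverse q * (Y n (m + 1) / Z n (m + 1))) = h m"
    "- c + \<tau> (q * (Y n m / Z n m)) = h m" for n m
    unfolding YZ h_def shift using q0 by (simp_all add: power2_eq_square mult.assoc)
  define A1 where "A1 n m = D 1 1 (Y n m) (Z n m)" for n m
  define B1 where "B1 n m = D (-1) (-1) (Y (n + 1) m) (Z (n + 1) m)" for n m
  define A2 where "A2 n m = D 1 (-1) (Y n m) (Z n m)" for n m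
  define B2 where "B2 n m = D (-1) 1 (Y n (m + 1)) (Z n (m + 1))" for n m
  have L1: "ladder_ops (\<lambda>n. A1 n m) (\<lambda>n. B1 n m) g (\<lambda>n. Wt n m)" for m
  proof
    fix w n a assume w: "w \<in> Wt n m"
    note st = EW_step[OF pm(1) pm(1) Y\<Lambda> Z\<Lambda> w[unfolded Wt_def]]
    show "A1 n m w \<in> Wt (n + 1) m" using st(1) by (simp add: A1_def Wt_def Y1 Z1)
    show "B1 n m (A1 n m w) = complex_of_real (g n) *\<^sub>C w"
      using st(2) by (simp add: A1_def B1_def Y1 Z1 sig_def pr_def g'(2) flip: of_real_add)
    show "A1 n m (a *\<^sub>C w) = a *\<^sub>C A1 n m w"
      unfolding A1_def by (rule D_linear(2)[OF pm(1) pm(1) Y\<Lambda> Z\<Lambda> WtH(1)[OF w]])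
    show "a *\<^sub>C w \<in> Wt n m" by (rule Wt_scale[OF w])
  next
    fix w n a assume w: "w \<in> Wt (n + 1) m"
    note st = EW_step[OF pm(2) pm(2) Y\<Lambda> Z\<Lambda> w[unfolded Wt_def]]
    show "B1 n m w \<in> Wt n m" using st(1) by (simp add: B1_def Wt_def Y1 Z1)
    have "inverse q * Y (n + 1) m = Y n m" "inverse q * Z (n + 1) m = Z n m" by (simp_all add: Y1 Z1)
    with st(2) show "A1 n m (B1 n m w) = complex_of_real (g n) *\<^sub>C w"
      by (simp add: A1_def B1_def sig_def pr_def g'(1) flip: of_real_add)
    show "B1 n m (a *\<^sub>C w) = a *\<^sub>C B1 n m w"
      unfolding B1_def by (rule D_linear(2)[OF pm(2) pm(2) Y\<Lambda> Z\<Lambda> WtH(1)[OF w]])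
  next
    fix w w' n assume "w \<in> Wt n m" "w' \<in> Wt (n + 1) m"
    then show "cinner (A1 n m w) w' = cinner w (B1 n m w')"
      using cinner_D[OF pm(1) pm(1) Y\<Lambda> Z\<Lambda>, of w w' n m n m] WtH
      by (simp add: A1_def B1_def Y1 Z1)
  qed
  have L2: "ladder_ops (A2 n) (B2 n) h (Wt n)" for n
  proof
    fix w m a assume w: "w \<in> Wt n m"
    note st = EW_step[OF pm(1) pm(2) Y\<Lambda> Z\<Lambda> w[unfolded Wt_def]]
    have e: "inverse q * Z n m = Z n (m + 1)" by (simp add: Z1 divide_inverse mult.commute)
    show "A2 n m w \<in> Wt n (m + 1)" using st(1) by (simp add: A2_def Wt_def Y1 e)
    show "B2 n m (A2 n m w) = complex_of_real (h m) *\<^sub>C w"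
    proof -
      have "sig 1 (-1) * c + \<tau> (q powi 1 * pr 1 (-1) (Y n m) (Z n m)) = h m"
        using h'(2)[of n m] by (simp add: sig_def pr_def)
      from st(2)[unfolded this] show ?thesis by (simp add: A2_def B2_def Y1 e)
    qed
    show "A2 n m (a *\<^sub>C w) = a *\<^sub>C A2 n m w"
      unfolding A2_def by (rule D_linear(2)[OF pm Y\<Lambda> Z\<Lambda> WtH(1)[OF w]])
    show "a *\<^sub>C w \<in> Wt n m" by (rule Wt_scale[OF w])
  next
    fix w m a assume w: "w \<in> Wt n (m + 1)"
    note st = EW_step[OF pm(2) pm(1) Y\<Lambda> Z\<Lambda> w[unfolded Wt_def]]
    have e: "inverse q * Y n (m + 1) = Y n m" "q * Z n (m + 1) = Z n m" using q0 by (simp_all add: Y1 Z1)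
    show "B2 n m w \<in> Wt n m" using st(1) by (simp add: B2_def Wt_def e)
    show "A2 n m (B2 n m w) = complex_of_real (h m) *\<^sub>C w"
    proof -
      have "sig (-1) 1 * c + \<tau> (q powi (-1) * pr (-1) 1 (Y n (m + 1)) (Z n (m + 1))) = h m"
        using h'(1)[where n = n and m = m] by (simp add: sig_def pr_def)
      from st(2)[unfolded this] show ?thesis by (simp add: A2_def B2_def e)
    qed
    show "B2 n m (a *\<^sub>C w) = a *\<^sub>C B2 n m w"
      unfolding B2_def by (rule D_linear(2)[OF pm(2) pm(1) Y\<Lambda> Z\<Lambda> WtH(1)[OF w]])
  next
    fix w w' m assume "w \<in> Wt n m" "w' \<in> Wt n (m + 1)"
    moreover have e: "inverse q * Z n m = Z n (m + 1)" by (simp add: Z1 divide_inverse mult.commute)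
    ultimately show "cinner (A2 n m w) w' = cinner w (B2 n m w')"
      using cinner_D[OF pm Y\<Lambda> Z\<Lambda>, of w w' n m n m] WtH
      by (simp add: A2_def B2_def Y1)
  qed
  have v0: "v \<in> Wt 0 0" using v by (simp add: Wt_def EW_def Y_def Z_def)
  \<comment> \<open>The first ladder runs along \<open>m = 0\<close>; the second ladder then starts
    from each of its vectors.\<close>
  define a where "a n = ladder_seq (\<lambda>n. A1 n 0) (\<lambda>n. B1 n 0) g v n" for n
  define b where "b n m = ladder_seq (A2 n) (B2 n) h (a n) m" for n m
  have aWt: "a n \<in> Wt n 0" for n unfolding a_def by (rule ladder_ops.seq_Wt[OF L1 v0])
  have bWt: "b n m \<in> Wt n m" for n m unfolding b_def by (rule ladder_ops.seq_Wt[OF L2 aWt])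
  have A2b: "A2 n m (b n m) = complex_of_real (sqrt (h m)) *\<^sub>C b n (m + 1)"
    and B2b: "B2 n m (b n (m + 1)) = complex_of_real (sqrt (h m)) *\<^sub>C b n m" for n m
    using ladder_ops.seq_A_B[OF L2 aWt] by (auto simp: b_def)
  \<comment> \<open>By construction the first copy is under control on \<open>m = 0\<close> only;
    commutation with the second copy extends the formula to all \<open>m\<close>.\<close>
  have A1b: "A1 n m (b n m) = complex_of_real (sqrt (g n)) *\<^sub>C b (n + 1) m" for n m
  proof -
    have "A1 n m (b n m) = ladder_seq (A2 (n + 1)) (B2 (n + 1)) h (A1 n 0 (a n)) m"
      unfolding b_def
    proof (rule ladder_ops.ladder_seq_intertwine[OF L2 aWt])
      fix m w a assume "w \<in> Wt n m"
      then show "A1 n m (a *\<^sub>C w) = a *\<^sub>C A1 n m w"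
        unfolding A1_def by (intro D_linear(2)[OF pm(1) pm(1) Y\<Lambda> Z\<Lambda>] WtH(1))
    next
      fix m w assume "w \<in> Wt n m"
      then show "A1 n (m + 1) (A2 n m w) = A2 (n + 1) m (A1 n m w)"
        using D_commute2[OF pm(1) Y\<Lambda> Z\<Lambda> WtH(1), of w n m n m]
        by (simp add: A1_def A2_def Y1 Z1)
    next
      fix m w assume "w \<in> Wt n (m + 1)"
      then show "A1 n m (B2 n m w) = B2 (n + 1) m (A1 n (m + 1) w)"
        using D_commute1[OF pm(1) Y\<Lambda>[of n "m + 1"] Z\<Lambda>[of n "m + 1"] WtH(1)] q0
        by (simp add: A1_def B2_def Y1 Z1)
    qed
    also have "A1 n 0 (a n) = complex_of_real (sqrt (g n)) *\<^sub>C a (n + 1)"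
      using ladder_ops.seq_A_B[OF L1 v0] by (simp add: a_def)
    finally show ?thesis by (simp add: b_def ladder_ops.ladder_seq_scale[OF L2 aWt])
  qed
  have B1b: "B1 n m (b (n + 1) m) = complex_of_real (sqrt (g n)) *\<^sub>C b n m" for n m
    by (rule ladder_ops.A_imp_B[OF L1[of m] bWt[of n m] bWt[of "n + 1" m] A1b[of n m]])
  have v1: "v \<noteq> 0" using v(2) by auto
  have a_iff: "a n \<noteq> 0 \<longleftrightarrow> q powi (2 * n) * (y0 * z0) \<in> c_component q c (y0 * z0)" for n
    unfolding a_def
    by (rule ladder_ops.seq_nonzero_iff[OF L1[of 0] v0 q(1) _ g_def v1 q(2)]) (use pos0 in simp)
  have b_iff: "b n m \<noteq> 0 \<longleftrightarrow> (Y n m, Z n m) \<in> wts (c_component q c (y0 * z0)) (c_component q (- c) (y0 / z0))" for n m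
  proof (cases "a n = 0")
    case True
    then have "b n m = 0" using ladder_ops.norm_seq[OF L2 aWt, of n m] by (auto simp: b_def)
    then show ?thesis using True a_iff by (auto simp: wts_def YZ)
  next
    case False
    have "b n m \<noteq> 0 \<longleftrightarrow> q powi (2 * m) * (y0 / z0) \<in> c_component q (- c) (y0 / z0)"
      unfolding b_def
      by (rule ladder_ops.seq_nonzero_iff[OF L2[of n] aWt[of n] q(1) _ h_def False q(2)]) (use pos0 in simp)
    then show ?thesis using False a_iff by (auto simp: wts_def YZ)
  qed
  have b_norm: "b n m = 0 \<or> norm (b n m) = 1" for n m
    using ladder_ops.norm_seq[OF L2 aWt, of n m] ladder_ops.norm_seq[OF L1 v0, of n] v(2)
    by (auto simp: b_def a_def)
  let ?I = "wts (c_component q c (y0 * z0)) (c_component q (- c) (y0 / z0))"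
  \<comment> \<open>A nonzero vector at \<open>n\<close> makes the coefficients \<open>g n\<close>
    and \<open>g (n - 1)\<close> of both adjacent edges nonnegative.\<close>
  have ad1: "0 \<le> c + \<tau> (q * p) \<and> 0 \<le> c + \<tau> (p / q)" if p: "p \<in> c_component q c (y0 * z0)" for p
  proof -
    obtain n :: int where "p = y0 * z0 * q powi (2 * n)" using c_component_form[OF p q(1)] by blast
    then have n: "p = q powi (2 * n) * (y0 * z0)" by simp
    have nz: "a n \<noteq> 0" using p n a_iff by simp
    have "p = q\<^sup>2 * (q powi (2 * (n - 1)) * (y0 * z0))"
      using shift[of "n - 1"] n by (simp only: diff_add_cancel mult.assoc)
    then have "p / q = q * (q powi (2 * (n - 1)) * (y0 * z0))" using q0 by (simp add: power2_eq_square)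
    then have "c + \<tau> (q * p) = g n" "c + \<tau> (p / q) = g (n - 1)" by (simp_all only: g_def n)
    then show ?thesis
      using ladder_ops.nonneg(1)[OF L1[of 0] aWt[of n] nz]
        ladder_ops.nonneg(2)[OF L1[of 0], of "a n" "n - 1"] aWt[of n] nz
      by simp
  qed
  have ad2: "0 \<le> - c + \<tau> (q * p) \<and> 0 \<le> - c + \<tau> (p / q)" if p: "p \<in> c_component q (- c) (y0 / z0)" for p
  proof -
    obtain m :: int where "p = y0 / z0 * q powi (2 * m)" using c_component_form[OF p q(1)] by blast
    then have m: "p = q powi (2 * m) * (y0 / z0)" by simp
    \<comment> \<open>The row \<open>n = 0\<close> is used because it starts at the nonzero vector
      \<open>v\<close>.\<close>
    have "y0 * z0 \<in> c_component q c (y0 * z0)" by (rule c_component.base)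
    then have nz: "b 0 m \<noteq> 0" using p m b_iff[of 0 m] by (simp add: wts_def YZ)
    have "p = q\<^sup>2 * (q powi (2 * (m - 1)) * (y0 / z0))"
      using shift[of "m - 1"] m by (simp only: diff_add_cancel mult.assoc)
    then have "p / q = q * (q powi (2 * (m - 1)) * (y0 / z0))" using q0 by (simp add: power2_eq_square)
    then have "- c + \<tau> (q * p) = h m" "- c + \<tau> (p / q) = h (m - 1)" by (simp_all only: h_def m)
    then show ?thesis
      using ladder_ops.nonneg(1)[OF L2[of 0] bWt[of 0 m] nz]
        ladder_ops.nonneg(2)[OF L2[of 0], of "b 0 m" "m - 1"] bWt[of 0 m] nz
      by simp
  qed
  \<comment> \<open>The grid coordinates are read off from the exponents of \<open>y * z\<close> and
    \<open>y / z\<close>.\<close>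
  define e where "e i = (case i of (y, z) \<Rightarrow>
    b (THE n. y * z = q powi (2 * n) * (y0 * z0)) (THE m. y / z = q powi (2 * m) * (y0 / z0)))" for i
  have e: "e (Y n m, Z n m) = b n m" for n m
  proof -
    have "(THE k. q powi (2 * n) * p = q powi (2 * k) * p) = n" if "p > 0" for n :: int and p
      using that by (intro the_equality) (auto dest: powi_inject[OF q])
    then show ?thesis using pos0 by (simp only: e_def YZ prod.case) simp
  qed
  have I_form: "\<exists>n m. y = Y n m \<and> z = Z n m \<and> b n m \<noteq> 0" if "(y, z) \<in> ?I" for y z
  proof -
    obtain n m where "y * z = (y0 * z0) * q powi (2 * n)" "y / z = (y0 / z0) * q powi (2 * m)"
      using \<open>(y, z) \<in> ?I\<close> c_component_form[OF _ q(1)] unfolding wts_def by blast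
    moreover have "y > 0" "z > 0" using that \<Lambda>_q(4) by (auto simp: wts_def)
    ultimately obtain n m where "y = Y n m" "z = Z n m" using YZ_unique by blast
    then show ?thesis using that b_iff by blast
  qed
  have on: "cinner (e i) (e j) = (if i = j then 1 else 0)" if ij: "i \<in> ?I" "j \<in> ?I" for i j
  proof -
    obtain n m where n: "i = (Y n m, Z n m)" "b n m \<noteq> 0" using I_form ij(1) by (cases i) blast
    obtain n' m' where n': "j = (Y n' m', Z n' m')" "b n' m' \<noteq> 0" using I_form ij(2) by (cases j) blast
    show ?thesis
    proof (cases "i = j")
      case True
      have "norm (e i) = 1" using b_norm n by (auto simp: e)
      then show ?thesis using True by (simp add: cinner_self)
    next
      case False
      have "cinner (b n m) (b n' m') = cinner (P (Y n m) (Z n m) (b n m)) (P (Y n' m') (Z n' m') (b n' m'))"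
        using WtH(2)[OF bWt] by simp
      also have "\<dots> = cinner (b n m) (P (Y n m) (Z n m) (P (Y n' m') (Z n' m') (b n' m')))"
        by (intro cinner_P Y\<Lambda> Z\<Lambda> P_in WtH(1)[OF bWt])
      also have "\<dots> = 0" using False n n' by (auto simp: P_P WtH(1)[OF bWt])
      finally show ?thesis using False by (simp add: n n' e)
    qed
  qed
  have Pe: "P s t (e (y, z)) = (if s = y \<and> t = z then e (y, z) else 0)"
    if yz: "(y, z) \<in> ?I" and st: "s \<in> \<Lambda> q x" "t \<in> \<Lambda> q x" for y z s t
  proof -
    obtain n m where n: "y = Y n m" "z = Z n m" using I_form[OF yz] by blast
    have "P s t (P (Y n m) (Z n m) (b n m)) = (if s = Y n m \<and> t = Z n m then P s t (b n m) else 0)"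
      using st by (intro P_P Y\<Lambda> Z\<Lambda> WtH(1)[OF bWt])
    then show ?thesis using WtH(2)[OF bWt, of n m] by (auto simp: n e)
  qed
  have De: "D \<alpha> \<beta> y z (e (y, z)) = (if (q powi \<alpha> * y, q powi \<beta> * z) \<in> ?I
      then complex_of_real (dc c \<alpha> \<beta> y z) *\<^sub>C e (q powi \<alpha> * y, q powi \<beta> * z) else 0)"
    if \<alpha>\<beta>: "\<alpha> \<in> {-1, 1}" "\<beta> \<in> {-1, 1}" and yz: "(y, z) \<in> ?I" for \<alpha> \<beta> y z
  proof -
    obtain n m where n: "y = Y n m" "z = Z n m" using I_form[OF yz] by blast
    have main: ?thesis
      if "D \<alpha> \<beta> y z (b n m) = complex_of_real (sqrt k) *\<^sub>C b n' m'"
        "q powi \<alpha> * y = Y n' m'" "q powi \<beta> * z = Z n' m'" "dc c \<alpha> \<beta> y z = sqrt k" for n' m' k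
      using that b_iff[of n' m'] by (auto simp: n e)
    consider "\<alpha> = 1" "\<beta> = 1" | "\<alpha> = 1" "\<beta> = -1" | "\<alpha> = -1" "\<beta> = 1" | "\<alpha> = -1" "\<beta> = -1"
      using \<alpha>\<beta> by auto
    then show ?thesis
    proof cases
      case 1
      show ?thesis
        by (rule main[of "g n" "n + 1" m])
          (use A1b[of n m] g'(2)[of n m] in \<open>simp_all add: 1 n A1_def Y1 Z1 dc_def sig_def pr_def\<close>)
    next
      case 2
      show ?thesis
        by (rule main[of "h m" n "m + 1"])
          (use A2b[of n m] h'(2)[of n m] in \<open>simp_all add: 2 n A2_def Y1 Z1 dc_def sig_def pr_def
            divide_inverse mult.commute\<close>)
    next
      case 3
      have s: "Y n m = q * Y n (m - 1)" "Z n m = Z n (m - 1) / q"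
        using Y1(2)[of n "m - 1"] Z1(2)[of n "m - 1"] by simp_all
      have "q powi \<alpha> * y = Y n (m - 1)" "q powi \<beta> * z = Z n (m - 1)" using q0 by (simp_all add: 3 n s)
      moreover have "dc c \<alpha> \<beta> y z = sqrt (h (m - 1))"
        using h'(1)[of n "m - 1"] by (simp add: 3 n dc_def sig_def pr_def)
      ultimately show ?thesis
        using B2b[of n "m - 1"] by (intro main[of "h (m - 1)" n "m - 1"]) (simp_all add: 3 n B2_def)
    next
      case 4
      have s: "Y n m = q * Y (n - 1) m" "Z n m = q * Z (n - 1) m"
        using Y1(1)[of "n - 1" m] Z1(1)[of "n - 1" m] by simp_all
      have "q powi \<alpha> * y = Y (n - 1) m" "q powi \<beta> * z = Z (n - 1) m" using q0 by (simp_all add: 4 n s)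
      moreover have "dc c \<alpha> \<beta> y z = sqrt (g (n - 1))"
        using g'(1)[of "n - 1" m] by (simp add: 4 n dc_def sig_def pr_def)
      ultimately show ?thesis
        using B1b[of "n - 1" m] by (intro main[of "g (n - 1)" "n - 1" m]) (simp_all add: 4 n B1_def)
    qed
  qed
  \<comment> \<open>The generators act as multiples of the \<open>P\<close> and \<open>D\<close>,
    which send basis vectors to multiples of basis vectors; hence \<open>W\<close> is
    invariant.\<close>
  define W where "W = closure (cspan (e ` ?I))"
  have eH: "e ` ?I \<subseteq> H"
  proof
    fix w assume "w \<in> e ` ?I"
    then obtain y z where "(y, z) \<in> ?I" "w = e (y, z)" by auto
    then show "w \<in> H" using I_form WtH(1)[OF bWt] e by metis
  qed
  have hW: "hilbert_on W" unfolding W_def by (rule hilbert_on_closure_cspan)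
  have csW: "csubspace W" using hW by (simp add: hilbert_on_def)
  have eW: "e i \<in> W" if "i \<in> ?I" for i unfolding W_def by (intro closure_cspan_superset imageI that)
  have WH: "W \<subseteq> H" unfolding W_def by (rule closure_cspan_minimal[OF eH repD(1)])
  have PW: "P s t w \<in> W" if st: "s \<in> \<Lambda> q x" "t \<in> \<Lambda> q x" and w: "w \<in> W" for s t w
    unfolding W_def
  proof (rule invariant_closure_cspan[OF eH P_bounded[OF st] _ w[unfolded W_def]])
    fix w assume "w \<in> e ` ?I"
    then obtain y z where "(y, z) \<in> ?I" "w = e (y, z)" by auto
    then show "P s t w \<in> closure (cspan (e ` ?I))"
      unfolding W_def[symmetric] using Pe[OF _ st] eW csubspace_0[OF csW] by auto
  qed
  have DW: "D \<alpha> \<beta> s t w \<in> W"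
    if \<alpha>\<beta>: "\<alpha> \<in> {-1, 1}" "\<beta> \<in> {-1, 1}" and st: "s \<in> \<Lambda> q x" "t \<in> \<Lambda> q x" and w: "w \<in> W" for \<alpha> \<beta> s t w
    unfolding W_def
  proof (rule invariant_closure_cspan[OF eH D_bounded[OF \<alpha>\<beta> st] _ w[unfolded W_def]])
    fix w assume "w \<in> e ` ?I"
    then obtain y z where yz: "(y, z) \<in> ?I" "w = e (y, z)" by auto
    have \<Lambda>: "y \<in> \<Lambda> q x" "z \<in> \<Lambda> q x" using yz by (auto simp: wts_def)
    have wH: "w \<in> H" using yz eH by blast
    have "D \<alpha> \<beta> s t w = D \<alpha> \<beta> s t (P y z w)" using Pe[OF yz(1) \<Lambda>] yz(2) by simp
    also have "\<dots> = (if y = s \<and> z = t then D \<alpha> \<beta> s t w else 0)" by (rule P_D(2)[OF \<alpha>\<beta> st \<Lambda> wH])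
    also have "\<dots> \<in> W"
      using De[OF \<alpha>\<beta> yz(1)] eW csubspace_0[OF csW] csubspace_scaleC[OF csW] yz(2) by auto
    finally show "D \<alpha> \<beta> s t w \<in> closure (cspan (e ` ?I))" unfolding W_def .
  qed
  have "\<forall>w\<in>W. \<pi> X w \<in> W" if "X \<in> carrier (dyn_alg q x)" for X
    using that
  proof (induction rule: dyn_induct)
    have uW: "\<pi> (u \<epsilon> \<nu> s t) w \<in> W"
      if "\<epsilon> \<in> {-1, 1}" "\<nu> \<in> {-1, 1}" "s \<in> \<Lambda> q x" "t \<in> \<Lambda> q x" "w \<in> W" for \<epsilon> \<nu> s t w
    proof -
      have "w \<in> H" using that WH by blast
      then show ?thesis
        unfolding u_eq_D(1)[OF that(1-4) \<open>w \<in> H\<close>]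
        by (intro csubspace_scaleC[OF csW] DW sign_minus that \<Lambda>_q(1))
    qed
    {
      case (u \<epsilon> \<nu> s t)
      then show ?case using uW by blast
    next
      case (mult_u \<epsilon> \<nu> s t X)
      then show ?case using uW WH by (simp add: subset_iff repD(7))
    }
  next
    case zero
    then show ?case using WH csubspace_0[OF csW] star_rep_zero[OF rep A.star_alg_axioms] by auto
  next
    case (add X Y)
    then show ?case using WH csubspace_add[OF csW] by (simp add: subset_iff repD(6))
  next
    case (smult d X)
    then show ?case using WH csubspace_scaleC[OF csW] by (simp add: subset_iff repD(8))
  next
    case (one s t)
    then show ?case using PW by (simp add: P_def)
  next
    case (mult_one s t X)
    then show ?case using PW WH by (simp add: subset_iff repD(7) P_def)
  qed
  then have "W = {0} \<or> W = H" using irr hW WH unfolding irreducible_rep_def by blast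
  moreover have "W \<noteq> {0}"
  proof -
    have v00: "b 0 0 = v" by (simp add: b_def a_def)
    then have "(Y 0 0, Z 0 0) \<in> ?I" using b_iff[of 0 0] v1 by simp
    then have "v \<in> W" using eW e v00 by metis
    then show ?thesis using v1 by blast
  qed
  ultimately have "W = H" by blast
  then have "std c (c_component q c (y0 * z0)) (c_component q (- c) (y0 / z0)) e"
    unfolding std_def W_def using on Pe De by blast
  then show ?thesis using that ad1 ad2 by blast
qed

end

section \<open>Operators in a standard basis, and uniqueness of the representation\<close>

lemma bounded_operator_on_rank_one:
  assumes "csubspace H" "w \<in> H"
  shows "bounded_operator_on H (\<lambda>v. (a * cinner u v) *\<^sub>C w)"
proof -
  have "norm ((a * cinner u v) *\<^sub>C w) \<le> (cmod a * norm u * norm w) * norm v" for v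
  proof -
    have "cmod (cinner u v) * (cmod a * norm w) \<le> norm u * norm v * (cmod a * norm w)"
      by (intro mult_right_mono cmod_cinner_le) simp
    then show ?thesis by (simp add: norm_scaleC norm_mult mult_ac)
  qed
  then show ?thesis
    unfolding bounded_operator_on_def clinear_on_def
    using assms by (intro conjI ballI allI exI[of _ "cmod a * norm u * norm w"])
      (simp_all add: csubspace_scaleC cinner_add_right cinner_scaleC_right scaleC_add_left
        scaleC_scaleC distrib_left mult_ac)
qed

context dyn_rep
begin

context
  fixes c Zs Zt e
  assumes std: "std c Zs Zt e"
begin

lemma std_orthonormal:
  "i \<in> wts Zs Zt \<Longrightarrow> j \<in> wts Zs Zt \<Longrightarrow> cinner (e i) (e j) = (if i = j then 1 else 0)"
  and std_total: "closure (cspan (e ` wts Zs Zt)) = H"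
  using std by (simp_all add: std_def)

lemma std_D_basis:
  assumes "\<alpha> \<in> {-1, 1}" "\<beta> \<in> {-1, 1}" "(y, z) \<in> wts Zs Zt"
  shows "D \<alpha> \<beta> y z (e (y, z)) =
    (if (q powi \<alpha> * y, q powi \<beta> * z) \<in> wts Zs Zt
     then complex_of_real (dc c \<alpha> \<beta> y z) *\<^sub>C e (q powi \<alpha> * y, q powi \<beta> * z) else 0)"
  using std[unfolded std_def, THEN conjunct2, THEN conjunct2, THEN conjunct2, rule_format, OF assms] .

lemma std_in: "i \<in> wts Zs Zt \<Longrightarrow> e i \<in> H"
  unfolding std_total[symmetric] by (intro closure_cspan_superset) simp

text \<open>A bounded operator that kills all basis vectors but one has rank at most one and is
  determined by its value there.\<close>

lemma std_operator_eqI: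
  assumes V: "bounded_operator_on H V" and w: "w \<in> H" and i: "i \<in> wts Zs Zt"
    and eq: "\<And>j. j \<in> wts Zs Zt \<Longrightarrow> V (e j) = (if j = i then a *\<^sub>C w else 0)" and v: "v \<in> H"
  shows "V v = (a * cinner (e i) v) *\<^sub>C w"
proof (rule bounded_operator_on_eqI[OF V bounded_operator_on_rank_one _ std_total _ v])
  fix u assume "u \<in> e ` wts Zs Zt"
  then obtain j where j: "j \<in> wts Zs Zt" "u = e j" by blast
  show "V u = (a * cinner (e i) u) *\<^sub>C w"
    using i j(1) by (simp add: j(2) eq std_orthonormal)
qed (use w std_in repD(2) in auto)

lemma std_operator_eq_zero:
  assumes V: "bounded_operator_on H V" and eq: "\<And>j. j \<in> wts Zs Zt \<Longrightarrow> V (e j) = 0" and v: "v \<in> H"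
  shows "V v = 0"
proof -
  have "V v = (0 * cinner 0 v) *\<^sub>C 0"
  proof (rule bounded_operator_on_eqI[OF V bounded_operator_on_rank_one _ std_total _ v])
    fix u assume "u \<in> e ` wts Zs Zt"
    then show "V u = (0 * cinner 0 u) *\<^sub>C 0" using eq by auto
  qed (use std_in repD(2) csubspace_0 in auto)
  then show ?thesis by simp
qed

lemma std_P:
  assumes yz: "y \<in> \<Lambda> q x" "z \<in> \<Lambda> q x" and v: "v \<in> H"
  shows "P y z v = (if (y, z) \<in> wts Zs Zt then cinner (e (y, z)) v *\<^sub>C e (y, z) else 0)"
proof -
  have P: "P y z (e j) = (if j = (y, z) then e (y, z) else 0)" if "j \<in> wts Zs Zt" for j
    using std that yz by (cases j) (auto simp: std_def)
  show ?thesis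
  proof (cases "(y, z) \<in> wts Zs Zt")
    case True
    have "P y z v = (1 * cinner (e (y, z)) v) *\<^sub>C e (y, z)"
      by (rule std_operator_eqI[OF P_bounded[OF yz] std_in[OF True] True _ v]) (simp add: P)
    then show ?thesis using True by simp
  next
    case False
    have "P y z v = 0"
      by (rule std_operator_eq_zero[OF P_bounded[OF yz] _ v]) (use False P in auto)
    then show ?thesis using False by simp
  qed
qed

lemma std_D:
  assumes \<alpha>\<beta>: "\<alpha> \<in> {-1, 1}" "\<beta> \<in> {-1, 1}" and yz: "y \<in> \<Lambda> q x" "z \<in> \<Lambda> q x" and v: "v \<in> H"
  shows "D \<alpha> \<beta> y z v =
    (if (y, z) \<in> wts Zs Zt \<and> (q powi \<alpha> * y, q powi \<beta> * z) \<in> wts Zs Zt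
     then (complex_of_real (dc c \<alpha> \<beta> y z) * cinner (e (y, z)) v) *\<^sub>C e (q powi \<alpha> * y, q powi \<beta> * z) else 0)"
proof -
  note bd = D_bounded[OF \<alpha>\<beta> yz]
  have D0: "D \<alpha> \<beta> y z (e j) = 0" if j: "j \<in> wts Zs Zt" "j \<noteq> (y, z)" for j
  proof -
    obtain a b where ab: "j = (a, b)" by (cases j)
    have \<Lambda>: "a \<in> \<Lambda> q x" "b \<in> \<Lambda> q x" using j(1) by (auto simp: ab wts_def)
    have "P a b (e (a, b)) = e (a, b)" using std j(1) \<Lambda> by (simp add: std_def ab)
    then show ?thesis using P_D(2)[OF \<alpha>\<beta> yz \<Lambda> std_in[OF j(1)]] j(2) by (auto simp: ab)
  qed
  show ?thesis
  proof (cases "(y, z) \<in> wts Zs Zt \<and> (q powi \<alpha> * y, q powi \<beta> * z) \<in> wts Zs Zt")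
    case True
    have "D \<alpha> \<beta> y z v =
        (complex_of_real (dc c \<alpha> \<beta> y z) * cinner (e (y, z)) v) *\<^sub>C e (q powi \<alpha> * y, q powi \<beta> * z)"
    proof (rule std_operator_eqI[OF bd std_in _ _ v])
      fix j assume "j \<in> wts Zs Zt"
      then show "D \<alpha> \<beta> y z (e j) = (if j = (y, z) then
          complex_of_real (dc c \<alpha> \<beta> y z) *\<^sub>C e (q powi \<alpha> * y, q powi \<beta> * z) else 0)"
        using D0 std_D_basis[OF \<alpha>\<beta>] True by (cases "j = (y, z)") simp_all
    qed (use True in auto)
    then show ?thesis using True by simp
  next
    case False
    have "D \<alpha> \<beta> y z v = 0"
    proof (rule std_operator_eq_zero[OF bd _ v])
      fix j assume j: "j \<in> wts Zs Zt"
      show "D \<alpha> \<beta> y z (e j) = 0"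
      proof (cases "j = (y, z)")
        case True
        then have "(q powi \<alpha> * y, q powi \<beta> * z) \<notin> wts Zs Zt" using False j by simp
        then show ?thesis using std_D_basis[OF \<alpha>\<beta>] j True by simp
      qed (use D0 j in simp)
    qed
    then show ?thesis using False by auto
  qed
qed

end

end

text \<open>Matching two orthonormal bases gives a unitary. It intertwines because the
  \<open>P\<close> and \<open>D\<close> have the same matrices in both bases and the generators are
  multiples of them.\<close>

lemma (in dyn) std_unique:
  assumes rep: "star_rep (dyn_alg q x) H \<pi>" "star_rep (dyn_alg q x) H' \<pi>'"
    and std: "dyn_rep.std q x H \<pi> c Zs Zt e" "dyn_rep.std q x H' \<pi>' c Zs Zt e'"
  shows "unitarily_equivalent (dyn_alg q x) H \<pi> H' \<pi>'"
proof -
  interpret R1: dyn_rep q x H \<pi> by unfold_locales (rule rep)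
  interpret R2: dyn_rep q x H' \<pi>' by unfold_locales (rule rep)
  let ?I = "wts Zs Zt"
  have gram: "cinner (e a) (e b) = cinner (e' a) (e' b)" if "a \<in> ?I" "b \<in> ?I" for a b
    using that by (simp add: R1.std_orthonormal[OF std(1)] R2.std_orthonormal[OF std(2)])
  obtain V where V: "unitary_on H H' V" "\<And>i. i \<in> ?I \<Longrightarrow> V (e i) = e' i"
    by (rule unitary_of_equal_gram[OF gram R1.std_total[OF std(1)] R2.std_total[OF std(2)]]) blast+
  note VD = unitary_onD[OF V(1)]
  have ce: "cinner (e' i) (V v) = cinner (e i) v" if "i \<in> ?I" "v \<in> H" for i v
    using VD(4)[OF R1.std_in[OF std(1) that(1)] that(2)] V(2)[OF that(1)] by simp
  have Vs: "V (a *\<^sub>C e i) = a *\<^sub>C e' i" if "i \<in> ?I" for a i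
    using clinear_onD(2)[OF VD(1) R1.std_in[OF std(1) that]] V(2)[OF that] by simp
  have V0: "V 0 = 0" using clinear_on_0[OF VD(1) R1.repD(2)] .
  have VDD: "V (R1.D \<alpha> \<beta> y z v) = R2.D \<alpha> \<beta> y z (V v)"
    if "\<alpha> \<in> {-1, 1}" "\<beta> \<in> {-1, 1}" "y \<in> \<Lambda> q x" "z \<in> \<Lambda> q x" "v \<in> H" for \<alpha> \<beta> y z v
    unfolding R1.std_D[OF std(1) that] R2.std_D[OF std(2) that(1-4) VD(3)[OF that(5)]]
    using that(5) by (simp add: ce Vs V0)
  have "\<forall>v\<in>H. V (\<pi> a v) = \<pi>' a (V v)" if "a \<in> carrier (dyn_alg q x)" for a
  proof (rule intertwiner_pres_alg[OF rep[unfolded dyn_alg_def] dyn_star_gens VD(1) VD(3) _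
        that[unfolded dyn_alg_def]])
    fix g v assume g: "g \<in> dyn_gens q x" and v: "v \<in> H"
    consider y z where "g = One2 y z" "y \<in> \<Lambda> q x" "z \<in> \<Lambda> q x"
      | \<epsilon> \<nu> y z where "g = Uel \<epsilon> \<nu> y z" "\<epsilon> \<in> {-1, 1}" "\<nu> \<in> {-1, 1}" "y \<in> \<Lambda> q x" "z \<in> \<Lambda> q x"
      using g unfolding dyn_gens_def by blast
    then show "V (\<pi> (pres_cls (dyn_rel q x) (Gen g)) v) = \<pi>' (pres_cls (dyn_rel q x) (Gen g)) (V v)"
    proof cases
      case 1
      have "V (R1.P y z v) = R2.P y z (V v)"
        unfolding R1.std_P[OF std(1) 1(2,3) v] R2.std_P[OF std(2) 1(2,3) VD(3)[OF v]]
        using v by (simp add: ce Vs V0)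
      then show ?thesis by (simp add: 1(1) R1.P_def R2.P_def dyn_one_def)
    next
      case 2
      note s = R1.sign_minus[OF 2(2)] R1.sign_minus[OF 2(3)]
      note \<Lambda> = \<Lambda>_q(1)[OF 2(4), of \<epsilon>] \<Lambda>_q(1)[OF 2(5), of \<nu>]
      have "V (\<pi> (u \<epsilon> \<nu> y z) v) = \<pi>' (u \<epsilon> \<nu> y z) (V v)"
        unfolding R1.u_eq_D(1)[OF 2(2-5) v] R2.u_eq_D(1)[OF 2(2-5) VD(3)[OF v]]
          clinear_onD(2)[OF VD(1) R1.D_in[OF s \<Lambda> v]] VDD[OF s \<Lambda> v] ..
      then show ?thesis by (simp add: 2(1) u_def)
    qed
  qed
  then show ?thesis unfolding unitarily_equivalent_def using V(1) by blast
qed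

subsection \<open>Standard representations as tensor products\<close>

context phi_rep
begin

text \<open>The parity condition in \<open>admissible\<close> makes \<open>(r * s)\<^sup>2\<close>
  equal to \<open>x\<^sup>2\<close> times an even power of \<open>q\<close>, so its root
  \<open>r * s\<close> lies in \<open>\<Lambda> q x\<close>; division by \<open>s\<^sup>2\<close>, a
  power of \<open>q\<close>, gives \<open>r / s\<close>.\<close>

lemma admissible_\<Lambda>:
  assumes adm: "admissible q x c S T" and rs: "r \<in> S" "s \<in> T"
  shows "r * s \<in> \<Lambda> q x" "r / s \<in> \<Lambda> q x"
proof -
  have pos: "r > 0" "s > 0" using adm rs by (auto simp: admissible_def)
  have q0: "q \<noteq> 0" using q by simp
  have Z: "r\<^sup>2 \<in> Zset S" "s\<^sup>2 \<in> Zset T" using rs by (auto simp: Zset_def)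
  then obtain n :: int where n: "r\<^sup>2 * s\<^sup>2 = x\<^sup>2 * q powi (2 * n)"
    using adm unfolding admissible_def by blast
  have "q powi (2 * n) = q powi n * q powi n" unfolding mult_2 using q0 by (intro power_int_add) simp
  then have "(r * s)\<^sup>2 = (x * q powi n)\<^sup>2" using n by (simp add: power2_eq_square mult_ac)
  then have eq: "r * s = x * q powi n" using pos x q by (simp add: power2_eq_iff_nonneg)
  then show "r * s \<in> \<Lambda> q x" by (auto simp: \<Lambda>_def)
  obtain m :: int where m: "s\<^sup>2 = q powi m"
    using adm Z(2) unfolding admissible_def \<Lambda>_def by auto
  have "r / s = r * s / s\<^sup>2" using pos by (simp add: power2_eq_square)
  also have "\<dots> = x * q powi (n - m)" using q0 by (simp add: eq m power_int_diff)
  finally show "r / s \<in> \<Lambda> q x" by (auto simp: \<Lambda>_def)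
qed

lemma Zset_iff: "S \<subseteq> {0<..} \<Longrightarrow> r > 0 \<Longrightarrow> r\<^sup>2 \<in> Zset S \<longleftrightarrow> r \<in> S"
  by (auto simp: Zset_def power2_eq_iff_nonneg subset_iff dest!: less_imp_le)

lemma wts_iff:
  assumes adm: "admissible q x c S T" and rs: "r > 0" "s > 0"
  shows "(r * s, r / s) \<in> wts (Zset S) (Zset T) \<longleftrightarrow> r \<in> S \<and> s \<in> T"
proof -
  have e: "r * s * (r / s) = r\<^sup>2" "r * s / (r / s) = s\<^sup>2"
    using rs by (simp_all add: power2_eq_square)
  have ST: "S \<subseteq> {0<..}" "T \<subseteq> {0<..}" using adm by (simp_all add: admissible_def)
  have "(r * s, r / s) \<in> wts (Zset S) (Zset T) \<longleftrightarrow> r * s \<in> \<Lambda> q x \<and> r / s \<in> \<Lambda> q x \<and> r \<in> S \<and> s \<in> T"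
    by (simp only: wts_def mem_Collect_eq prod.case e Zset_iff[OF ST(1) rs(1)] Zset_iff[OF ST(2) rs(2)])
  then show ?thesis using admissible_\<Lambda>[OF adm, of r s] by blast
qed

lemma bij_wts:
  assumes adm: "admissible q x c S T"
  shows "bij_betw (\<lambda>(r, s). (r * s, r / s)) (S \<times> T) (wts (Zset S) (Zset T))"
  unfolding bij_betw_def
proof
  have ST: "r \<in> S \<Longrightarrow> r > 0" "s \<in> T \<Longrightarrow> s > 0" for r s using adm by (auto simp: admissible_def)
  show "inj_on (\<lambda>(r, s). (r * s, r / s)) (S \<times> T)"
  proof (rule inj_onI, clarify)
    fix r s r' s' assume *: "r \<in> S" "s \<in> T" "r' \<in> S" "s' \<in> T" "r * s = r' * s'" "r / s = r' / s'"
    have e: "a * b * (a / b) = a\<^sup>2" "a * b / (a / b) = b\<^sup>2" if "a > 0" "b > 0" for a b :: real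
      using that by (simp_all add: power2_eq_square)
    have "r\<^sup>2 = r'\<^sup>2" "s\<^sup>2 = s'\<^sup>2"
      using e[OF ST(1)[OF *(1)] ST(2)[OF *(2)]] e[OF ST(1)[OF *(3)] ST(2)[OF *(4)]] *(5,6) by simp_all
    then show "r = r' \<and> s = s'" using ST[of r] ST[of r'] ST(2)[of s] ST(2)[of s'] * by (simp add: power2_eq_iff_nonneg)
  qed
  show "(\<lambda>(r, s). (r * s, r / s)) ` (S \<times> T) = wts (Zset S) (Zset T)"
  proof (intro subset_antisym subsetI)
    fix p assume "p \<in> wts (Zset S) (Zset T)"
    then obtain y z r s where p: "p = (y, z)" "y \<in> \<Lambda> q x" "z \<in> \<Lambda> q x" "y * z = r\<^sup>2" "y / z = s\<^sup>2" "r \<in> S" "s \<in> T"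
      by (auto simp: wts_def Zset_def)
    have pos: "y > 0" "z > 0" using p \<Lambda>_q(4) by auto
    have "y = r * s \<and> z = r / s"
      using sqrt_weights[OF ST(1)[OF p(6)] ST(2)[OF p(7)] pos] p(4,5) pos by (simp add: field_simps)
    then show "p \<in> (\<lambda>(r, s). (r * s, r / s)) ` (S \<times> T)" using p by force
  next
    fix p assume "p \<in> (\<lambda>(r, s). (r * s, r / s)) ` (S \<times> T)"
    then show "p \<in> wts (Zset S) (Zset T)" using wts_iff[OF adm] ST by auto
  qed
qed

lemma star_rep_\<Phi>: "star_rep (su_tensor q x) H (\<pi> \<circ> \<Phi>)"
proof -
  let ?A = "{(\<pi> \<circ> \<Phi>) X v | X v. X \<in> carrier (su_tensor q x) \<and> v \<in> H}"
  have "{a *\<^sub>C w | a w. w \<in> ?A} = ?A"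
  proof (intro subset_antisym subsetI)
    fix u assume "u \<in> {a *\<^sub>C w | a w. w \<in> ?A}"
    then obtain a X v where u: "u = a *\<^sub>C \<pi> (\<Phi> X) v" "X \<in> carrier (su_tensor q x)" "v \<in> H" by auto
    have "u = (\<pi> \<circ> \<Phi>) (a \<odot>\<^bsub>su_tensor q x\<^esub> X) v" using u by (simp add: \<Phi>_hom)
    moreover have "a \<odot>\<^bsub>su_tensor q x\<^esub> X \<in> carrier (su_tensor q x)" using u by simp
    ultimately show "u \<in> ?A" using u(3) by blast
  next
    fix u assume u: "u \<in> ?A"
    have "u = 1 *\<^sub>C u" by simp
    then show "u \<in> {a *\<^sub>C w | a w. w \<in> ?A}" using u by blast
  qed
  then have "closure (span ?A) = H" using \<Phi>_total by (simp add: cspan_def)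
  then show ?thesis
    unfolding star_rep_def using repD(1) \<Phi>_hom by (simp add: repD(4))
qed

text \<open>Reindexing the basis of \<open>H\<close> by \<open>S \<times> T\<close> defines the
  tensor map \<open>t\<close>. The factorisation of \<open>\<pi> \<circ> \<Phi>\<close> is read off
  from matrix coefficients on generators paired with local units, and then extended to all tensors,
  with local units standing in for the missing unit.\<close>

lemma is_\<pi>ST_of_std:
  assumes irr: "irreducible_rep (dyn_alg q x) H \<pi>" and adm: "admissible q x c S T"
    and std: "std c (Zset S) (Zset T) e"
  shows "is_\<pi>ST q x \<Phi> c S T H \<pi>"
proof -
  let ?I = "wts (Zset S) (Zset T)" and ?A = "su_alg q x" and ?B = "su_alg q 1"
  have q0: "q \<noteq> 0" using q by simp
  have pos: "r \<in> S \<Longrightarrow> r > 0" "s \<in> T \<Longrightarrow> s > 0" for r s using adm by (auto simp: admissible_def)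
  obtain \<pi>S where \<pi>S: "is_\<pi> q x c S (ell2_on S) \<pi>S"
    "\<And>r v. r \<in> \<Gamma> q x \<Longrightarrow> \<pi>S (su_one q x r) v = (if r \<in> S then ell2_fun v r *\<^sub>C \<delta> r else 0)"
    "\<And>r v. r \<in> \<Gamma> q x \<Longrightarrow> \<pi>S (su_Er q x r) v =
      (if r \<in> S \<and> q * r \<in> S then (of_real (U1.ladder c r) * ell2_fun v r) *\<^sub>C \<delta> (q * r) else 0)"
    "\<And>r v. r \<in> \<Gamma> q x \<Longrightarrow> \<pi>S (su_Fr q x r) v =
      (if r \<in> S \<and> q * r \<in> S then (of_real (U1.ladder c r) * ell2_fun v (q * r)) *\<^sub>C \<delta> r else 0)"
    by (rule U1.su_model[of S c]) (use adm in \<open>auto simp: admissible_def\<close>)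
  obtain \<pi>T where \<pi>T: "is_\<pi> q 1 (- c) T (ell2_on T) \<pi>T"
    "\<And>r v. r \<in> \<Gamma> q 1 \<Longrightarrow> \<pi>T (su_one q 1 r) v = (if r \<in> T then ell2_fun v r *\<^sub>C \<delta> r else 0)"
    "\<And>r v. r \<in> \<Gamma> q 1 \<Longrightarrow> \<pi>T (su_Er q 1 r) v =
      (if r \<in> T \<and> q * r \<in> T then (of_real (U2.ladder (- c) r) * ell2_fun v r) *\<^sub>C \<delta> (q * r) else 0)"
    "\<And>r v. r \<in> \<Gamma> q 1 \<Longrightarrow> \<pi>T (su_Fr q 1 r) v =
      (if r \<in> T \<and> q * r \<in> T then (of_real (U2.ladder (- c) r) * ell2_fun v (q * r)) *\<^sub>C \<delta> r else 0)"
    by (rule U2.su_model[of T "- c"]) (use adm in \<open>auto simp: admissible_def\<close>)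
  have repS: "star_rep ?A (ell2_on S) \<pi>S" and repT: "star_rep ?B (ell2_on T) \<pi>T"
    using \<pi>S(1) \<pi>T(1) by (auto simp: is_\<pi>_def irreducible_rep_def)
  note SD = star_repD[OF repS] and TD = star_repD[OF repT]
  define f where "f = (\<lambda>(r :: real, s :: real). (r * s, r / s))"
  have bij: "bij_betw f (S \<times> T) ?I" unfolding f_def by (rule bij_wts[OF adm])
  have fI: "f p \<in> ?I" if "p \<in> S \<times> T" for p using bij that by (auto simp: bij_betw_def)
  have "inj_on f (S \<times> T)" using bij by (simp add: bij_betw_def)
  have on: "cinner ((e \<circ> f) i) ((e \<circ> f) j) = (if i = j then 1 else 0)" if "i \<in> S \<times> T" "j \<in> S \<times> T" for i j
    using that fI inj_onD[OF \<open>inj_on f (S \<times> T)\<close>, of i j] by (auto simp: std_orthonormal[OF std])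
  have tot: "closure (cspan ((e \<circ> f) ` (S \<times> T))) = H"
    using bij std_total[OF std] unfolding image_comp[symmetric] by (simp add: bij_betw_def)
  obtain t where t: "hilbert_tensor (ell2_on S) (ell2_on T) H t"
    "\<And>r s. r \<in> S \<Longrightarrow> s \<in> T \<Longrightarrow> t (\<delta> r) (\<delta> s) = (e \<circ> f) (r, s)"
    "\<And>v w r s. v \<in> ell2_on S \<Longrightarrow> w \<in> ell2_on T \<Longrightarrow> r \<in> S \<Longrightarrow> s \<in> T \<Longrightarrow>
      cinner ((e \<circ> f) (r, s)) (t v w) = ell2_fun v r * ell2_fun w s"
    by (rule hilbert_tensor_of_basis[OF on tot]) blast+
  have tl1: "clinear_on (ell2_on S) (\<lambda>v. t v w)" if "w \<in> ell2_on T" for w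
    using t(1) that by (simp add: hilbert_tensor_def)
  have tl2: "clinear_on (ell2_on T) (\<lambda>w. t v w)" if "v \<in> ell2_on S" for v
    using t(1) that by (simp add: hilbert_tensor_def)
  note cs = hilbert_on_ell2_on[of S, unfolded hilbert_on_def, THEN conjunct1]
    hilbert_on_ell2_on[of T, unfolded hilbert_on_def, THEN conjunct1]
  have t0: "w \<in> ell2_on T \<Longrightarrow> t 0 w = 0" "v \<in> ell2_on S \<Longrightarrow> t v 0 = 0" for v w
    using clinear_on_0[OF tl1 cs(1)] clinear_on_0[OF tl2 cs(2)] by auto
  have tH: "t v w \<in> H" if "v \<in> ell2_on S" "w \<in> ell2_on T" for v w
  proof -
    have "t v w \<in> {t v w |v w. v \<in> ell2_on S \<and> w \<in> ell2_on T}" using that by blast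
    then have "t v w \<in> closure (span {t v w |v w. v \<in> ell2_on S \<and> w \<in> ell2_on T})"
      by (intro subsetD[OF closure_subset] span_base)
    then show ?thesis using t(1) by (simp add: hilbert_tensor_def)
  qed
  have t\<delta>: "t (a *\<^sub>C \<delta> r) (b *\<^sub>C \<delta> s) = (a * b) *\<^sub>C e (r * s, r / s)" if "r \<in> S" "s \<in> T" for a b r s
  proof -
    have \<delta>: "\<delta> r \<in> ell2_on S" "\<delta> s \<in> ell2_on T" "b *\<^sub>C \<delta> s \<in> ell2_on T"
      using that cs by (auto simp: \<delta>_in_ell2_on csubspace_scaleC)
    show ?thesis
      using clinear_onD(2)[OF tl1[OF \<delta>(3)] \<delta>(1)] clinear_onD(2)[OF tl2[OF \<delta>(1)] \<delta>(2)] t(2)[OF that]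
      by (simp add: scaleC_scaleC f_def)
  qed
  have t\<delta>c: "cinner (e (r * s, r / s)) (t v w) = ell2_fun v r * ell2_fun w s"
    if "r \<in> S" "s \<in> T" "v \<in> ell2_on S" "w \<in> ell2_on T" for r s v w
    using t(3)[OF that(3,4,1,2)] by (simp add: f_def)
  have wI: "(r * s, r / s) \<in> ?I \<longleftrightarrow> r \<in> S \<and> s \<in> T" if "r > 0" "s > 0" for r s
    using wts_iff[OF adm that] .

  define Q where "Q a b \<longleftrightarrow> (\<forall>v\<in>ell2_on S. \<forall>w\<in>ell2_on T. \<pi> (\<Phi> (tns a b)) (t v w) = t (\<pi>S a v) (\<pi>T b w))"
    for a b
  have Q_one: "Q (su_one q x r) (su_one q 1 s)" if rs: "r \<in> \<Gamma> q x" "s \<in> \<Gamma> q 1" for r s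
    unfolding Q_def
  proof (intro ballI)
    fix v w assume vw: "v \<in> ell2_on S" "w \<in> ell2_on T"
    note rs0 = U1.\<Gamma>_q(3)[OF rs(1)] U2.\<Gamma>_q(3)[OF rs(2)]
    show "\<pi> (\<Phi> (tns (su_one q x r) (su_one q 1 s))) (t v w) = t (\<pi>S (su_one q x r) v) (\<pi>T (su_one q 1 s) w)"
    proof (cases "r \<in> S \<and> s \<in> T")
      case True
      then show ?thesis
        using admissible_\<Lambda>[OF adm, of r s] tH[OF vw] vw
        by (simp add: \<Phi>_one[OF rs] std_P[OF std] wI[OF rs0] \<pi>S(2)[OF rs(1)] \<pi>T(2)[OF rs(2)] t\<delta> t\<delta>c)
    next
      case False
      then have "t (\<pi>S (su_one q x r) v) (\<pi>T (su_one q 1 s) w) = 0"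
        using t0 SD(5)[OF U1.su_closed(1)[OF rs(1)] vw(1)] TD(5)[OF U2.su_closed(1)[OF rs(2)] vw(2)]
        by (auto simp: \<pi>S(2)[OF rs(1)] \<pi>T(2)[OF rs(2)])
      then show ?thesis
        using False tH[OF vw] by (auto simp: \<Phi>_one[OF rs] std_P[OF std] wI[OF rs0])
    qed
  qed
  have k0: "k \<noteq> 0" unfolding of_real_eq_0_iff using U1.inverse_q_minus_q by linarith
  \<comment> \<open>One computation serves all four generators: \<open>k\<close> times the image of
    \<open>X\<close> is a ladder operator, whose coefficient \<open>dc\<close> is
    \<open>inverse q - q\<close> times the coefficient \<open>m\<close> of the model on
    \<open>S\<close> or \<open>T\<close>.\<close>
  have gen: "\<pi> (\<Phi> X) (t v w) = (if r \<in> S \<and> s \<in> T \<and> r' \<in> S \<and> s' \<in> T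
      then (complex_of_real m * (ell2_fun v r * ell2_fun w s)) *\<^sub>C e (r' * s', r' / s') else 0)"
    if vw: "v \<in> ell2_on S" "w \<in> ell2_on T" and \<alpha>\<beta>: "\<alpha> \<in> {-1, 1}" "\<beta> \<in> {-1, 1}"
      and p: "r > 0" "s > 0" "r' > 0" "s' > 0"
      and tgt: "q powi \<alpha> * (r * s) = r' * s'" "q powi \<beta> * (r / s) = r' / s'"
      and X: "k *\<^sub>C \<pi> (\<Phi> X) (t v w) =
        (if r * s \<in> \<Lambda> q x \<and> r / s \<in> \<Lambda> q x then D \<alpha> \<beta> (r * s) (r / s) (t v w) else 0)"
      and m: "dc c \<alpha> \<beta> (r * s) (r / s) = (inverse q - q) * m"
    for X v w \<alpha> \<beta> r s r' s' m
  proof -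
    let ?R = "if r \<in> S \<and> s \<in> T \<and> r' \<in> S \<and> s' \<in> T
      then (complex_of_real m * (ell2_fun v r * ell2_fun w s)) *\<^sub>C e (r' * s', r' / s') else 0"
    have "k *\<^sub>C \<pi> (\<Phi> X) (t v w) = k *\<^sub>C ?R"
    proof (cases "r \<in> S \<and> s \<in> T")
      case True
      note \<Lambda> = admissible_\<Lambda>[OF adm conjunct1[OF True] conjunct2[OF True]]
      have "D \<alpha> \<beta> (r * s) (r / s) (t v w) = (if r' \<in> S \<and> s' \<in> T
          then (complex_of_real ((inverse q - q) * m) * (ell2_fun v r * ell2_fun w s)) *\<^sub>C e (r' * s', r' / s') else 0)"
        unfolding std_D[OF std \<alpha>\<beta> \<Lambda> tH[OF vw]] tgt wI[OF p(1,2)] wI[OF p(3,4)] m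
        using True vw by (simp add: t\<delta>c)
      then show ?thesis
        unfolding X using True \<Lambda> by (simp add: scaleC_scaleC mult.assoc)
    next
      case False
      then show ?thesis
        unfolding X using tH[OF vw] \<alpha>\<beta> by (auto simp: std_D[OF std \<alpha>\<beta>] wI[OF p(1,2)])
    qed
    then have "inverse k *\<^sub>C k *\<^sub>C \<pi> (\<Phi> X) (t v w) = inverse k *\<^sub>C k *\<^sub>C ?R" by simp
    then show ?thesis by (simp only: scaleC_scaleC left_inverse[OF k0] scaleC_one)
  qed
  have tz: "t 0 0 = 0" "r \<in> S \<Longrightarrow> t (a *\<^sub>C \<delta> r) 0 = 0" "s \<in> T \<Longrightarrow> t 0 (a *\<^sub>C \<delta> s) = 0" for a r s
    using t0 cs by (simp_all add: csubspace_0 csubspace_scaleC \<delta>_in_ell2_on)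
  have lad: "(inverse q - q) * su.ladder q c' r = sqrt (c' + \<tau> (q * r\<^sup>2))" for c' r
    using U1.inverse_q_minus_q by (simp add: U1.ladder_def)
  have dcs: "dc c 1 1 (a * b) (a / b) = sqrt (c + \<tau> (q * a\<^sup>2))"
    "dc c (-1) (-1) (a * b) (a / b) = sqrt (c + \<tau> (inverse q * a\<^sup>2))"
    "dc c 1 (-1) (a * b) (a / b) = sqrt (- c + \<tau> (q * b\<^sup>2))"
    "dc c (-1) 1 (a * b) (a / b) = sqrt (- c + \<tau> (inverse q * b\<^sup>2))" if "a > 0" "b > 0" for a b
  proof -
    have "a * b * (a / b) = a\<^sup>2" "a * b / (a / b) = b\<^sup>2" using that by (simp_all add: power2_eq_square)
    then show "dc c 1 1 (a * b) (a / b) = sqrt (c + \<tau> (q * a\<^sup>2))"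
      "dc c (-1) (-1) (a * b) (a / b) = sqrt (c + \<tau> (inverse q * a\<^sup>2))"
      "dc c 1 (-1) (a * b) (a / b) = sqrt (- c + \<tau> (q * b\<^sup>2))"
      "dc c (-1) 1 (a * b) (a / b) = sqrt (- c + \<tau> (inverse q * b\<^sup>2))"
      unfolding dc_def pr_def sig_def by simp_all
  qed
  \<comment> \<open>The downward coefficient at \<open>q * a\<close> is the upward one at
    \<open>a\<close>, as both belong to the same edge.\<close>
  have iq: "inverse q * (q * a)\<^sup>2 = q * a\<^sup>2" for a using q0 by (simp add: power2_eq_square)
  have pm: "(1::int) \<in> {-1, 1}" "(-1::int) \<in> {-1, 1}" by simp_all
  have Q_gens: "Q (su_Er q x r) (su_one q 1 s)" "Q (su_Fr q x r) (su_one q 1 s)"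
    "Q (su_one q x r) (su_Er q 1 s)" "Q (su_one q x r) (su_Fr q 1 s)"
    if rs: "r \<in> \<Gamma> q x" "s \<in> \<Gamma> q 1" for r s
  proof -
    have p: "r > 0" "s > 0" using rs U1.\<Gamma>_q(3) U2.\<Gamma>_q(3) by auto
    then have p': "q * r > 0" "q * s > 0" using q by simp_all
    note rs' = U1.\<Gamma>_q(1)[OF rs(1)] U2.\<Gamma>_q(1)[OF rs(2)]
    have qq: "q * r / q = r" "q * s / q = s" using q0 by simp_all
    have tg1: "q powi 1 * (r * s) = (q * r) * s" "q powi 1 * (r / s) = (q * r) / s" using p by simp_all
    have tg2: "q powi (-1) * (q * r * s) = r * s" "q powi (-1) * (q * r / s) = r / s"
      using p q0 by (simp_all add: mult.assoc[symmetric])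
    have tg3: "q powi 1 * (r * s) = r * (q * s)" "q powi (-1) * (r / s) = r / (q * s)"
      using p q0 by (simp_all add: divide_inverse mult_ac)
    have tg4: "q powi (-1) * (r * (q * s)) = r * s" "q powi 1 * (r / (q * s)) = r / s"
      using p q0 by simp_all
    have m1: "dc c 1 1 (r * s) (r / s) = (inverse q - q) * su.ladder q c r"
      unfolding lad using p by (simp only: dcs)
    have m2: "dc c (-1) (-1) (q * r * s) (q * r / s) = (inverse q - q) * su.ladder q c r"
      unfolding lad using p p' by (simp only: dcs iq)
    have m3: "dc c 1 (-1) (r * s) (r / s) = (inverse q - q) * su.ladder q (- c) s"
      unfolding lad using p by (simp only: dcs)
    have m4: "dc c (-1) 1 (r * (q * s)) (r / (q * s)) = (inverse q - q) * su.ladder q (- c) s"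
      unfolding lad using p p' by (simp only: dcs iq)
    note sm = \<pi>S(2-4)[OF rs(1)] \<pi>T(2-4)[OF rs(2)]
    show "Q (su_Er q x r) (su_one q 1 s)"
      unfolding Q_def
    proof (intro ballI)
      fix v w assume vw: "v \<in> ell2_on S" "w \<in> ell2_on T"
      note g = gen[OF vw pm(1) pm(1) p p'(1) p(2) tg1 \<Phi>_generators(1)[OF rs tH[OF vw]] m1]
      show "\<pi> (\<Phi> (tns (su_Er q x r) (su_one q 1 s))) (t v w) = t (\<pi>S (su_Er q x r) v) (\<pi>T (su_one q 1 s) w)"
        unfolding g sm by (auto simp: t\<delta> tz mult.assoc)
    qed
    show "Q (su_Fr q x r) (su_one q 1 s)"
      unfolding Q_def
    proof (intro ballI)
      fix v w assume vw: "v \<in> ell2_on S" "w \<in> ell2_on T"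
      note g = gen[OF vw pm(2) pm(2) p'(1) p(2) p tg2 \<Phi>_generators(3)[OF rs'(1) rs(2) tH[OF vw], unfolded qq] m2]
      show "\<pi> (\<Phi> (tns (su_Fr q x r) (su_one q 1 s))) (t v w) = t (\<pi>S (su_Fr q x r) v) (\<pi>T (su_one q 1 s) w)"
        unfolding g sm by (auto simp: t\<delta> tz mult.assoc)
    qed
    show "Q (su_one q x r) (su_Er q 1 s)"
      unfolding Q_def
    proof (intro ballI)
      fix v w assume vw: "v \<in> ell2_on S" "w \<in> ell2_on T"
      note g = gen[OF vw pm p p(1) p'(2) tg3 \<Phi>_generators(2)[OF rs tH[OF vw]] m3]
      show "\<pi> (\<Phi> (tns (su_one q x r) (su_Er q 1 s))) (t v w) = t (\<pi>S (su_one q x r) v) (\<pi>T (su_Er q 1 s) w)"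
        unfolding g sm by (auto simp: t\<delta> tz mult_ac)
    qed
    show "Q (su_one q x r) (su_Fr q 1 s)"
      unfolding Q_def
    proof (intro ballI)
      fix v w assume vw: "v \<in> ell2_on S" "w \<in> ell2_on T"
      note g = gen[OF vw pm(2,1) p(1) p'(2) p tg4 \<Phi>_generators(4)[OF rs(1) rs'(2) tH[OF vw], unfolded qq] m4]
      show "\<pi> (\<Phi> (tns (su_one q x r) (su_Fr q 1 s))) (t v w) = t (\<pi>S (su_one q x r) v) (\<pi>T (su_Fr q 1 s) w)"
        unfolding g sm by (auto simp: t\<delta> tz mult_ac)
    qed
  qed

  have Q_mult: "Q (a \<otimes>\<^bsub>?A\<^esub> a') (b \<otimes>\<^bsub>?B\<^esub> b')"
    if "a \<in> carrier ?A" "a' \<in> carrier ?A" "b \<in> carrier ?B" "b' \<in> carrier ?B" "Q a b" "Q a' b'" for a a' b b'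
    using that unfolding Q_def
    by (simp add: U.tens_simps(5)[symmetric] \<Phi>_hom SD(5,7) TD(5,7) U.tens_closed tH)
  have Q_lin1: "Q (a \<oplus>\<^bsub>?A\<^esub> a') b" if "a \<in> carrier ?A" "a' \<in> carrier ?A" "b \<in> carrier ?B" "Q a b" "Q a' b" for a a' b
    using that unfolding Q_def
    by (simp add: U.tens_simps(1) \<Phi>_hom SD(5,6) TD(5) U.tens_closed tH clinear_onD(1)[OF tl1])
  have Q_lin2: "Q a (b \<oplus>\<^bsub>?B\<^esub> b')" if "a \<in> carrier ?A" "b \<in> carrier ?B" "b' \<in> carrier ?B" "Q a b" "Q a b'" for a b b'
    using that unfolding Q_def
    by (simp add: U.tens_simps(2) \<Phi>_hom SD(5) TD(5,6) U.tens_closed tH clinear_onD(1)[OF tl2])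
  have Q_scale: "Q (d \<odot>\<^bsub>?A\<^esub> a) b" "Q a (d \<odot>\<^bsub>?B\<^esub> b)" if "a \<in> carrier ?A" "b \<in> carrier ?B" "Q a b" for a b d
    using that unfolding Q_def
    by (simp_all add: U.tens_simps(3,4) \<Phi>_hom SD(5,8) TD(5,8) U.tens_closed tH
        clinear_onD(2)[OF tl1] clinear_onD(2)[OF tl2])
  have Q_zero: "b \<in> carrier ?B \<Longrightarrow> Q \<zero>\<^bsub>?A\<^esub> b" "a \<in> carrier ?A \<Longrightarrow> Q a \<zero>\<^bsub>?B\<^esub>" for a b
    unfolding Q_def
    by (simp_all add: U.tens_zero \<Phi>_zero tH t0 SD(5) TD(5) star_rep_zero[OF repS U1.A.star_alg_axioms]
        star_rep_zero[OF repT U2.A.star_alg_axioms])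
  \<comment> \<open>With an idempotent unit in the first slot, words in the second slot can be built
    up letter by letter.\<close>
  have Q1: "Q (su_one q x r) b" if r: "r \<in> \<Gamma> q x" and b: "b \<in> carrier ?B" for r b
    using b unfolding su_alg_def
  proof (induction rule: pres_alg_induct)
    case (gen g)
    then consider s where "g = One1 s" "s \<in> \<Gamma> q 1" | s where "g = Egen s" "s \<in> \<Gamma> q 1"
      | s where "g = Fgen s" "s \<in> \<Gamma> q 1"
      unfolding su_gens_def by blast
    then show ?case using Q_one[OF r] Q_gens(3,4)[OF r]
      by cases (simp_all add: su_one_def su_Er_def su_Fr_def)
  next
    case (mult g b)
    then consider s where "g = One1 s" "s \<in> \<Gamma> q 1" | s where "g = Egen s" "s \<in> \<Gamma> q 1"
      | s where "g = Fgen s" "s \<in> \<Gamma> q 1"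
      unfolding su_gens_def by blast
    then have "Q (su_one q x r) (pres_cls (su_rel q 1) (Gen g))" "pres_cls (su_rel q 1) (Gen g) \<in> carrier ?B"
      using Q_one[OF r] Q_gens(3,4)[OF r] U2.su_closed
      by (cases; simp add: su_one_def su_Er_def su_Fr_def)+
    then show ?case
      using Q_mult[of "su_one q x r" "su_one q x r" "pres_cls (su_rel q 1) (Gen g)" b] mult r
      by (simp add: U1.su_one_one su_alg_def[symmetric])
  qed (use Q_zero Q_lin2 Q_scale U1.su_closed(1)[OF r] U2.su_star_gens in \<open>simp_all add: su_alg_def[symmetric]\<close>)
  \<comment> \<open>A letter in the first slot has to be paired with a unit in the second. This is
    possible when \<open>b\<close> is fixed on the left by a single unit, to which
    \<open>su_induct\<close> reduces the general case.\<close>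
  have Qw: "Q a b" if s: "s \<in> \<Gamma> q 1" and b: "b \<in> carrier ?B" "su_one q 1 s \<otimes>\<^bsub>?B\<^esub> b = b"
    and a: "a \<in> carrier ?A" for s a b
    using a unfolding su_alg_def[of q x]
  proof (induction rule: pres_alg_induct)
    case (gen g)
    then consider r where "g = One1 r" "r \<in> \<Gamma> q x" | r where "g = Egen r" "r \<in> \<Gamma> q x"
      | r where "g = Fgen r" "r \<in> \<Gamma> q x"
      unfolding su_gens_def by blast
    then show ?case
    proof cases
      case 1
      then show ?thesis using Q1[OF 1(2) b(1)] by (simp add: su_one_def)
    next
      case 2
      then show ?thesis
        using Q_mult[OF U1.su_closed(2)[OF 2(2)] U1.su_closed(1)[OF 2(2)] U2.su_closed(1)[OF s] b(1)
            Q_gens(1)[OF 2(2) s] Q1[OF 2(2) b(1)]] b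
        by (simp add: U1.su_units) (simp add: su_Er_def)
    next
      case 3
      note r' = U1.\<Gamma>_q(1)[OF 3(2)]
      show ?thesis
        using Q_mult[OF U1.su_closed(3)[OF 3(2)] U1.su_closed(1)[OF r'] U2.su_closed(1)[OF s] b(1)
            Q_gens(2)[OF 3(2) s] Q1[OF r' b(1)]] b 3
        by (simp add: U1.su_units) (simp add: su_Fr_def)
    qed
  next
    case (mult g a)
    then consider r where "g = One1 r" "r \<in> \<Gamma> q x" | r where "g = Egen r" "r \<in> \<Gamma> q x"
      | r where "g = Fgen r" "r \<in> \<Gamma> q x"
      unfolding su_gens_def by blast
    then have "Q (pres_cls (su_rel q x) (Gen g)) (su_one q 1 s)" "pres_cls (su_rel q x) (Gen g) \<in> carrier ?A"
      using Q_one[OF _ s] Q_gens(1,2)[OF _ s] U1.su_closed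
      by (cases; simp add: su_one_def su_Er_def su_Fr_def)+
    then show ?case
      using Q_mult[of "pres_cls (su_rel q x) (Gen g)" a "su_one q 1 s" b] mult s b
      by (simp add: su_alg_def[symmetric])
  qed (use Q_zero Q_lin1 Q_scale b U1.su_star_gens in \<open>simp_all add: su_alg_def[symmetric]\<close>)
  have "Q a b" if a: "a \<in> carrier ?A" and b: "b \<in> carrier ?B" for a b
    using b
  proof (induction rule: U2.su_induct)
    case (weight s b)
    then show ?case using Qw a by blast
  qed (use a Q_zero Q_lin2 Q_scale in auto)
  then have "tensor_rep ?A (ell2_on S) \<pi>S ?B (ell2_on T) \<pi>T H t (\<pi> \<circ> \<Phi>)"
    unfolding tensor_rep_def using t(1) star_rep_\<Phi> by (simp add: Q_def)
  then show ?thesis unfolding is_\<pi>ST_def using irr \<pi>S(1) \<pi>T(1) by blast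
qed

end

subsection \<open>Existence of standard representations\<close>

context dyn
begin

text \<open>Adjointness with real coefficients requires opposite ladder operators on one edge to
  share their coefficient.\<close>

lemma dc_sym:
  assumes \<alpha>\<beta>: "\<alpha> \<in> {-1, 1}" "\<beta> \<in> {-1, 1}" and pos: "y > 0" "z > 0"
  shows "dc c (- \<alpha>) (- \<beta>) (q powi \<alpha> * y) (q powi \<beta> * z) = dc c \<alpha> \<beta> y z"
proof -
  have "q powi (- \<alpha>) * pr (- \<alpha>) (- \<beta>) (q powi \<alpha> * y) (q powi \<beta> * z) = q powi \<alpha> * pr \<alpha> \<beta> y z"
    using \<alpha>\<beta> q pos by (auto simp: pr_def field_simps)
  then show ?thesis by (simp only: dc_def) (simp add: sig_def)
qed

text \<open>Operators compose from right to left, so the right weight of a generator is its source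
  and the left weight its target.\<close>

primrec dsrc :: "dyn_gen \<Rightarrow> real \<times> real" where
  "dsrc (One2 y z) = (y, z)" | "dsrc (Uel \<epsilon> \<nu> y z) = (q powi \<epsilon> * y, q powi \<nu> * z)"

primrec dtgt :: "dyn_gen \<Rightarrow> real \<times> real" where
  "dtgt (One2 y z) = (y, z)" | "dtgt (Uel \<epsilon> \<nu> y z) = (y, z)"

text \<open>The coefficient of a generator in a standard basis, obtained by undoing the rescaling in
  \<open>D\<close>.\<close>

definition mr :: "real \<Rightarrow> int \<Rightarrow> int \<Rightarrow> real \<Rightarrow> real \<Rightarrow> real" where
  "mr c \<epsilon> \<nu> y z = sg (- \<epsilon>) (- \<nu>) * dc c \<epsilon> \<nu> y z / sqrt (\<tau> (q powi \<epsilon> * y) * \<tau> z)"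

primrec dcoeff :: "real \<Rightarrow> dyn_gen \<Rightarrow> complex" where
  "dcoeff c (One2 y z) = 1" | "dcoeff c (Uel \<epsilon> \<nu> y z) = complex_of_real (mr c \<epsilon> \<nu> y z)"

end

locale dyn_model = dyn q x for q x +
  fixes c :: real and Zs Zt :: "real set"
  assumes Zs: "irreducible_c_set q c Zs" and Zt: "irreducible_c_set q (- c) Zt" "Zt \<subseteq> \<Lambda> q 1"
    and ZsZt: "p \<in> Zs \<Longrightarrow> p' \<in> Zt \<Longrightarrow> \<exists>n::int. p * p' = x\<^sup>2 * q powi (2 * n)"
begin

lemma q_cancel_middle [simp]: "q * (w * (inverse q * t)) = w * t" "inverse q * (w * (q * t)) = w * t"
  using q by (simp_all add: field_simps)

abbreviation "I \<equiv> wts Zs Zt"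

lemma cs: "c_set q c Zs" "c_set q (- c) Zt"
  using Zs Zt by (auto simp: irreducible_c_set_def)

text \<open>\<open>y\<close> has to be a root of \<open>p * p'\<close>; the even exponent in
  \<open>ZsZt\<close> provides the root \<open>x * q powi n\<close> inside
  \<open>\<Lambda> q x\<close>, and \<open>z\<close> is then \<open>y / p'\<close>.\<close>

lemma I_point:
  assumes "p \<in> Zs" "p' \<in> Zt"
  obtains y z where "(y, z) \<in> I" "y * z = p" "y / z = p'"
proof -
  obtain n :: int where n: "p * p' = x\<^sup>2 * q powi (2 * n)" using ZsZt assms by blast
  obtain m :: int where m: "p' = q powi m" using Zt(2) assms(2) by (auto simp: \<Lambda>_def)
  define y where "y = x * q powi n"
  define z where "z = x * q powi (n - m)"
  have q0: "q \<noteq> 0" using q by simp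
  have nn: "q powi (2 * n) = q powi n * q powi n" unfolding mult_2 using q0 by (intro power_int_add) simp
  have "y / z = p'" using q0 x by (simp add: y_def z_def m power_int_diff)
  moreover have "y * z = p"
  proof -
    have "p = x\<^sup>2 * q powi (2 * n) / q powi m" using n m q0 by (simp add: eq_divide_eq)
    then show ?thesis using q0 by (simp add: y_def z_def nn power_int_diff power2_eq_square)
  qed
  moreover have "y \<in> \<Lambda> q x" "z \<in> \<Lambda> q x" by (auto simp: y_def z_def \<Lambda>_def)
  ultimately show ?thesis using assms by (intro that[of y z]) (auto simp: wts_def)
qed

lemma I_\<Lambda>: "(y, z) \<in> I \<Longrightarrow> y \<in> \<Lambda> q x" "(y, z) \<in> I \<Longrightarrow> z \<in> \<Lambda> q x"
  "(y, z) \<in> I \<Longrightarrow> y > 0" "(y, z) \<in> I \<Longrightarrow> z > 0"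
  using \<Lambda>_q(4) by (auto simp: wts_def)

lemma nonneg_step: "0 \<le> r \<Longrightarrow> (0 < r \<Longrightarrow> A) \<Longrightarrow> 0 \<le> r \<and> (\<not> A \<longrightarrow> r = 0)" for r :: real
  by (auto simp: order_le_less)

text \<open>Each ladder operator changes only one of \<open>y * z\<close> and \<open>y / z\<close>,
  so its behaviour at the boundary is that of a single \<open>c\<close>-set.\<close>

lemma I_step:
  assumes \<alpha>\<beta>: "\<alpha> \<in> {-1, 1}" "\<beta> \<in> {-1, 1}" and yz: "(y, z) \<in> I"
  shows "0 \<le> sig \<alpha> \<beta> * c + \<tau> (q powi \<alpha> * pr \<alpha> \<beta> y z)"
    "(q powi \<alpha> * y, q powi \<beta> * z) \<notin> I \<Longrightarrow> sig \<alpha> \<beta> * c + \<tau> (q powi \<alpha> * pr \<alpha> \<beta> y z) = 0"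
proof -
  have yz': "y \<in> \<Lambda> q x" "z \<in> \<Lambda> q x" "y * z \<in> Zs" "y / z \<in> Zt" "y > 0" "z > 0"
    using yz I_\<Lambda>[OF yz] by (auto simp: wts_def)
  have q1: "inverse q * p = p / q" for p by (simp add: divide_inverse mult.commute)
  have \<Lambda>: "q powi \<alpha> * y \<in> \<Lambda> q x" "q powi \<beta> * z \<in> \<Lambda> q x" using \<Lambda>_q(1) yz' by auto
  note s1 = cs(1)[unfolded c_set_iff[OF q(1)], THEN conjunct2, THEN conjunct2, rule_format, OF yz'(3)]
  note s2 = cs(2)[unfolded c_set_iff[OF q(1)], THEN conjunct2, THEN conjunct2, rule_format, OF yz'(4)]
  have tgt: "(q powi \<alpha> * y, q powi \<beta> * z) \<in> I \<longleftrightarrow>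
      (q powi \<alpha> * y) * (q powi \<beta> * z) \<in> Zs \<and> (q powi \<alpha> * y) / (q powi \<beta> * z) \<in> Zt"
    using \<Lambda> by (simp add: wts_def)
  consider "\<alpha> = 1" "\<beta> = 1" | "\<alpha> = 1" "\<beta> = -1" | "\<alpha> = -1" "\<beta> = 1" | "\<alpha> = -1" "\<beta> = -1"
    using \<alpha>\<beta> by auto
  then have "0 \<le> sig \<alpha> \<beta> * c + \<tau> (q powi \<alpha> * pr \<alpha> \<beta> y z) \<and>
    ((q powi \<alpha> * y, q powi \<beta> * z) \<notin> I \<longrightarrow> sig \<alpha> \<beta> * c + \<tau> (q powi \<alpha> * pr \<alpha> \<beta> y z) = 0)"
  proof cases
    case 1
    have e: "q * y * (q * z) = q\<^sup>2 * (y * z)" "q * y / (q * z) = y / z"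
      using q by (simp_all add: power2_eq_square)
    have X: "sig \<alpha> \<beta> * c + \<tau> (q powi \<alpha> * pr \<alpha> \<beta> y z) = c + \<tau> (q * (y * z))" by (simp add: 1 sig_def pr_def divide_inverse mult_ac)
    have A: "(q powi \<alpha> * y, q powi \<beta> * z) \<in> I \<longleftrightarrow> q\<^sup>2 * (y * z) \<in> Zs" unfolding tgt using yz'(3,4) q by (simp add: 1 e)
    show ?thesis unfolding X A using s1 by (intro nonneg_step) simp_all
  next
    case 2
    have e: "q * y * (inverse q * z) = y * z" "q * y / (inverse q * z) = q\<^sup>2 * (y / z)"
      using q by (simp_all add: power2_eq_square field_simps)
    have X: "sig \<alpha> \<beta> * c + \<tau> (q powi \<alpha> * pr \<alpha> \<beta> y z) = - c + \<tau> (q * (y / z))" by (simp add: 2 sig_def pr_def divide_inverse mult_ac)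
    have A: "(q powi \<alpha> * y, q powi \<beta> * z) \<in> I \<longleftrightarrow> q\<^sup>2 * (y / z) \<in> Zt" unfolding tgt using yz'(3,4) q by (simp add: 2 e)
    show ?thesis unfolding X A using s2 by (intro nonneg_step) simp_all
  next
    case 3
    have e: "inverse q * y * (q * z) = y * z" "inverse q * y / (q * z) = y / z / q\<^sup>2"
      using q by (simp_all add: power2_eq_square field_simps)
    have X: "sig \<alpha> \<beta> * c + \<tau> (q powi \<alpha> * pr \<alpha> \<beta> y z) = - c + \<tau> (y / z / q)" by (simp add: 3 sig_def pr_def divide_inverse mult_ac)
    have A: "(q powi \<alpha> * y, q powi \<beta> * z) \<in> I \<longleftrightarrow> y / z / q\<^sup>2 \<in> Zt" unfolding tgt using yz'(3,4) q by (simp add: 3 e)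
    show ?thesis unfolding X A using s2 by (intro nonneg_step) simp_all
  next
    case 4
    have e: "inverse q * y * (inverse q * z) = y * z / q\<^sup>2" "inverse q * y / (inverse q * z) = y / z"
      using q by (simp_all add: power2_eq_square field_simps)
    have X: "sig \<alpha> \<beta> * c + \<tau> (q powi \<alpha> * pr \<alpha> \<beta> y z) = c + \<tau> (y * z / q)" by (simp add: 4 sig_def pr_def divide_inverse mult_ac)
    have A: "(q powi \<alpha> * y, q powi \<beta> * z) \<in> I \<longleftrightarrow> y * z / q\<^sup>2 \<in> Zs" unfolding tgt using yz'(3,4) q by (simp add: 4 e)
    show ?thesis unfolding X A using s1 by (intro nonneg_step) simp_all
  qed
  then show "0 \<le> sig \<alpha> \<beta> * c + \<tau> (q powi \<alpha> * pr \<alpha> \<beta> y z)"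
    "(q powi \<alpha> * y, q powi \<beta> * z) \<notin> I \<Longrightarrow> sig \<alpha> \<beta> * c + \<tau> (q powi \<alpha> * pr \<alpha> \<beta> y z) = 0" by auto
qed

lemma dc_square:
  assumes "\<alpha> \<in> {-1, 1}" "\<beta> \<in> {-1, 1}" "(y, z) \<in> I"
  shows "(if (q powi \<alpha> * y, q powi \<beta> * z) \<in> I then (dc c \<alpha> \<beta> y z)\<^sup>2 else 0) =
    sig \<alpha> \<beta> * c + \<tau> (q powi \<alpha> * pr \<alpha> \<beta> y z)"
  using I_step[OF assms] by (simp add: dc_def)

sublocale R: rank_one_data "\<delta> :: real \<times> real \<Rightarrow> (real \<times> real) ell2" I dsrc dtgt "dcoeff c"
  by unfold_locales (rule cinner_\<delta>_\<delta>)

lemma rk_sum: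
  assumes "a \<in> I \<Longrightarrow> b \<in> I \<Longrightarrow> (if A then s else 0) + (if B then t else 0) = (r :: real)"
  shows "(if A then R.rk (complex_of_real s) a b v else 0) + (if B then R.rk (complex_of_real t) a b v else 0) =
    R.rk (complex_of_real r) a b v"
proof (cases "a \<in> I \<and> b \<in> I")
  case True
  have "(if A then R.rk (complex_of_real s) a b v else 0) + (if B then R.rk (complex_of_real t) a b v else 0) =
      R.rk (complex_of_real ((if A then s else 0) + (if B then t else 0))) a b v"
    by (simp add: R.rk_add)
  then show ?thesis using assms True by simp
qed (simp add: R.rk_outside)

text \<open>For equal indices the two squared coefficients add up to
  \<open>\<tau> (w * y) + \<tau> (w / y) = \<tau> w * \<tau> y\<close>, even at the boundary, where
  a truncated square is 0 anyway. For different indices the two products cancel by the sign in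
  \<open>sg\<close>.\<close>

lemma rel1:
  assumes \<epsilon>\<nu>: "\<epsilon> \<in> {-1, 1}" "\<nu> \<in> {-1, 1}" and wy: "w \<in> \<Lambda> q x" "y \<in> \<Lambda> q x"
  shows "(if (q * w, y) \<in> I then R.rk (complex_of_real (mr c (-1) \<epsilon> (q * w) y * mr c (-1) \<nu> (q * w) y))
        (w, q powi \<epsilon> * y) (w, q powi \<nu> * y) v else 0) +
      (if (w / q, y) \<in> I then R.rk (complex_of_real (mr c 1 \<epsilon> (w / q) y * mr c 1 \<nu> (w / q) y))
        (w, q powi \<epsilon> * y) (w, q powi \<nu> * y) v else 0) =
    R.rk (complex_of_real (if \<epsilon> = \<nu> then 1 else 0)) (w, q powi \<epsilon> * y) (w, q powi \<nu> * y) v"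
proof (rule rk_sum)
  assume I: "(w, q powi \<epsilon> * y) \<in> I" "(w, q powi \<nu> * y) \<in> I"
  have q0: "q \<noteq> 0" using q by simp
  have pos: "w > 0" "y > 0" using wy \<Lambda>_q(4) by auto
  define a where "a = sqrt (c + \<tau> (w * y))"
  define b where "b = sqrt (- c + \<tau> (w / y))"
  have K: "\<tau> w * \<tau> y > 0" using pos by (simp add: \<tau>_pos)
  have d1: "dc c (-1) \<mu> (q * w) y = (if \<mu> = -1 then a else b)" if "\<mu> \<in> {-1, 1}" for \<mu>
    using that q0 by (auto simp: dc_def sig_def pr_def a_def b_def field_simps)
  have d2: "dc c 1 \<mu> (w / q) y = (if \<mu> = 1 then a else b)" if "\<mu> \<in> {-1, 1}" for \<mu>
    using that q0 by (auto simp: dc_def sig_def pr_def a_def b_def field_simps)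
  have m1: "mr c (-1) \<mu> (q * w) y = (if \<mu> = -1 then a else b) / sqrt (\<tau> w * \<tau> y)" if "\<mu> \<in> {-1, 1}" for \<mu>
    using q0 by (simp add: mr_def d1[OF that] sg_def)
  have m2: "mr c 1 \<mu> (w / q) y = (if \<mu> = 1 then a else - b) / sqrt (\<tau> w * \<tau> y)" if "\<mu> \<in> {-1, 1}" for \<mu>
    using q0 that by (auto simp: mr_def d2[OF that] sg_def)
  have sq: "s / sqrt (\<tau> w * \<tau> y) * (t / sqrt (\<tau> w * \<tau> y)) = s * t / (\<tau> w * \<tau> y)" for s t
    using K by simp
  show "(if (q * w, y) \<in> I then mr c (-1) \<epsilon> (q * w) y * mr c (-1) \<nu> (q * w) y else 0) +
      (if (w / q, y) \<in> I then mr c 1 \<epsilon> (w / q) y * mr c 1 \<nu> (w / q) y else 0) = (if \<epsilon> = \<nu> then 1 else 0)"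
  proof (cases "\<epsilon> = \<nu>")
    case True
    have pm: "(1::int) \<in> {-1, 1}" "(-1::int) \<in> {-1, 1}" "- \<epsilon> \<in> {-1, 1}" using \<epsilon>\<nu> by auto
    have w1: "inverse q * w = w / q" by (simp add: divide_inverse mult.commute)
    have "(if (q * w, y) \<in> I then (dc c 1 (- \<epsilon>) w (q powi \<epsilon> * y))\<^sup>2 else 0) =
        sig 1 (- \<epsilon>) * c + \<tau> (q * pr 1 (- \<epsilon>) w (q powi \<epsilon> * y))"
      using dc_square[OF pm(1,3) I(1)] by (simp only: powi_cancel power_int_1_right)
    moreover have "dc c 1 (- \<epsilon>) w (q powi \<epsilon> * y) = dc c (-1) \<epsilon> (q * w) y"
      using dc_sym[of 1 "- \<epsilon>" w "q powi \<epsilon> * y" c] pm pos q by simp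
    ultimately have 1: "(if (q * w, y) \<in> I then (if \<epsilon> = -1 then a else b)\<^sup>2 else 0) =
        (if \<epsilon> = -1 then c + \<tau> (w * y) else - c + \<tau> (w / y))"
      using \<epsilon>\<nu> q0 d1[OF \<epsilon>\<nu>(1)] by (auto simp: sig_def pr_def)
    have "(if (w / q, y) \<in> I then (dc c (-1) (- \<epsilon>) w (q powi \<epsilon> * y))\<^sup>2 else 0) =
        sig (-1) (- \<epsilon>) * c + \<tau> (inverse q * pr (-1) (- \<epsilon>) w (q powi \<epsilon> * y))"
      using dc_square[OF pm(2,3) I(1)] by (simp add: w1)
    moreover have "dc c (-1) (- \<epsilon>) w (q powi \<epsilon> * y) = dc c 1 \<epsilon> (w / q) y"
      using dc_sym[of "-1" "- \<epsilon>" w "q powi \<epsilon> * y" c] pm pos q by (simp add: w1)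
    ultimately have 2: "(if (w / q, y) \<in> I then (if \<epsilon> = 1 then a else b)\<^sup>2 else 0) =
        (if \<epsilon> = 1 then c + \<tau> (w * y) else - c + \<tau> (w / y))"
      using \<epsilon>\<nu> q0 d2[OF \<epsilon>\<nu>(1)] by (auto simp: sig_def pr_def)
    have "(if (q * w, y) \<in> I then mr c (-1) \<epsilon> (q * w) y * mr c (-1) \<epsilon> (q * w) y else 0) +
        (if (w / q, y) \<in> I then mr c 1 \<epsilon> (w / q) y * mr c 1 \<epsilon> (w / q) y else 0) =
        ((if (q * w, y) \<in> I then (if \<epsilon> = -1 then a else b)\<^sup>2 else 0) +
         (if (w / q, y) \<in> I then (if \<epsilon> = 1 then a else b)\<^sup>2 else 0)) / (\<tau> w * \<tau> y)"
      unfolding m1[OF \<epsilon>\<nu>(1)] m2[OF \<epsilon>\<nu>(1)] sq by (simp add: power2_eq_square add_divide_distrib)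
    also have "\<dots> = (\<tau> (w * y) + \<tau> (w / y)) / (\<tau> w * \<tau> y)"
      unfolding 1 2 using \<epsilon>\<nu> by auto
    also have "\<dots> = 1" using K pos \<tau>_pos[of w] \<tau>_pos[of y] by (simp add: \<tau>_mult[symmetric])
    finally show ?thesis unfolding True[symmetric] by (simp only: simp_thms if_True)
  next
    case False
    \<comment> \<open>The endpoints are \<open>(w, q * y)\<close> and
      \<open>(w, inverse q * y)\<close>. Products and ratios of the intermediate points
      \<open>(q * w, y)\<close> and \<open>(w / q, y)\<close> occur among theirs, so neither of the
      two cancelling terms is truncated.\<close>
    have in1: "w * (q * y) \<in> Zs" "w / (q * y) \<in> Zt" "w * (inverse q * y) \<in> Zs" "w / (inverse q * y) \<in> Zt"
      using I False \<epsilon>\<nu> by (auto simp: wts_def)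
    have "q * w * y = w * (q * y)" "q * w / y = w / (inverse q * y)"
      "w / q * y = w * (inverse q * y)" "w / q / y = w / (q * y)"
      by (simp_all add: divide_inverse mult_ac)
    note eqs = this
    have "(q * w, y) \<in> I" "(w / q, y) \<in> I"
      unfolding wts_def mem_Collect_eq prod.case eqs
      using in1 wy \<Lambda>_q(2,3)[OF wy(1)] by blast+
    then show ?thesis
      unfolding m1[OF \<epsilon>\<nu>(1)] m2[OF \<epsilon>\<nu>(1)] m1[OF \<epsilon>\<nu>(2)] m2[OF \<epsilon>\<nu>(2)] sq
      using False \<epsilon>\<nu> by auto
  qed
qed

text \<open>The row relation, with the same two mechanisms: the sum of squares for equal signs, and
  cancellation for different ones. \<open>eq\<close> is the condition that the intermediate weights
  agree.\<close>

lemma rel2: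
  assumes \<epsilon>\<nu>: "\<epsilon> \<in> {-1, 1}" "\<nu> \<in> {-1, 1}" and yzw: "y \<in> \<Lambda> q x" "z \<in> \<Lambda> q x" "w \<in> \<Lambda> q x"
    and eq: "q powi \<epsilon> * y = q powi \<nu> * z"
  shows "(if (q powi \<epsilon> * y, inverse q * w) \<in> I then R.rk (complex_of_real (mr c \<epsilon> (-1) y w * mr c \<nu> (-1) z w))
        (y, w) (z, w) v else 0) +
      (if (q powi \<epsilon> * y, q * w) \<in> I then R.rk (complex_of_real (mr c \<epsilon> 1 y w * mr c \<nu> 1 z w)) (y, w) (z, w) v else 0) =
    R.rk (complex_of_real (if \<epsilon> = \<nu> then 1 else 0)) (y, w) (z, w) v"
proof (rule rk_sum)
  assume I: "(y, w) \<in> I" "(z, w) \<in> I"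
  have q0: "q \<noteq> 0" using q by simp
  let ?m = "q powi \<epsilon> * y"
  have m\<Lambda>: "?m \<in> \<Lambda> q x" using yzw \<Lambda>_q(1) by blast
  have pos: "?m > 0" "w > 0" using m\<Lambda> yzw \<Lambda>_q(4) by auto
  define a where "a = sqrt (c + \<tau> (?m * w))"
  define b where "b = sqrt (- c + \<tau> (?m / w))"
  have K: "\<tau> ?m * \<tau> w > 0" using pos by (simp add: \<tau>_pos)
  have d1: "dc c \<epsilon> \<mu> y w = (if \<mu> = \<epsilon> then a else b)" for \<mu>
    by (auto simp: dc_def sig_def pr_def a_def b_def mult.assoc)
  have d2: "dc c \<nu> \<mu> z w = (if \<mu> = \<nu> then a else b)" for \<mu>
    by (auto simp: dc_def sig_def pr_def a_def b_def mult.assoc eq)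
  have m1: "mr c \<epsilon> \<mu> y w = sg (- \<epsilon>) (- \<mu>) * (if \<mu> = \<epsilon> then a else b) / sqrt (\<tau> ?m * \<tau> w)" for \<mu>
    by (simp add: mr_def d1)
  have m2: "mr c \<nu> \<mu> z w = sg (- \<nu>) (- \<mu>) * (if \<mu> = \<nu> then a else b) / sqrt (\<tau> ?m * \<tau> w)" for \<mu>
    by (simp add: mr_def d2 eq)
  have sq: "s / sqrt (\<tau> ?m * \<tau> w) * (t / sqrt (\<tau> ?m * \<tau> w)) = s * t / (\<tau> ?m * \<tau> w)" for s t
    using K by simp
  show "(if (?m, inverse q * w) \<in> I then mr c \<epsilon> (-1) y w * mr c \<nu> (-1) z w else 0) +
      (if (?m, q * w) \<in> I then mr c \<epsilon> 1 y w * mr c \<nu> 1 z w else 0) = (if \<epsilon> = \<nu> then 1 else 0)"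
  proof (cases "\<epsilon> = \<nu>")
    case True
    then have yz: "y = z" using eq q0 by simp
    have 1: "(if (?m, q powi \<mu> * w) \<in> I then (if \<mu> = \<epsilon> then a else b)\<^sup>2 else 0) =
        (if \<mu> = \<epsilon> then c + \<tau> (?m * w) else - c + \<tau> (?m / w))" if "\<mu> \<in> {-1, 1}" for \<mu>
      using dc_square[OF \<epsilon>\<nu>(1) that I(1)] unfolding d1 by (auto simp: sig_def pr_def mult.assoc)
    have sg2: "sg s t * r * (sg s t * r) = r\<^sup>2" for s t r by (simp add: sg_def power2_eq_square)
    have "(if (?m, inverse q * w) \<in> I then mr c \<epsilon> (-1) y w * mr c \<epsilon> (-1) y w else 0) +
      (if (?m, q * w) \<in> I then mr c \<epsilon> 1 y w * mr c \<epsilon> 1 y w else 0) =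
      ((if (?m, q powi (-1) * w) \<in> I then (if -1 = \<epsilon> then a else b)\<^sup>2 else 0) +
       (if (?m, q powi 1 * w) \<in> I then (if 1 = \<epsilon> then a else b)\<^sup>2 else 0)) / (\<tau> ?m * \<tau> w)"
      unfolding m1 sq sg2 by (simp add: add_divide_distrib)
    also have "\<dots> = (\<tau> (?m * w) + \<tau> (?m / w)) / (\<tau> ?m * \<tau> w)"
      using 1[of "-1"] 1[of 1] \<epsilon>\<nu> by auto
    also have "\<dots> = 1"
      unfolding \<tau>_mult[OF pos[THEN less_imp_neq, symmetric], symmetric]
      using \<tau>_pos[OF pos(1)] \<tau>_pos[OF pos(2)] by simp
    finally show ?thesis unfolding True[symmetric] yz[symmetric] by (simp only: simp_thms if_True)
  next
    case False
    have e1: "y * w \<in> Zs" "y / w \<in> Zt" "z * w \<in> Zs" "z / w \<in> Zt" using I by (auto simp: wts_def)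
    define M where "M = ?m"
    \<comment> \<open>For different signs \<open>y\<close> and \<open>z\<close> are the two
      neighbours of the common midpoint \<open>M\<close>; again the endpoints in \<open>I\<close>
      force both intermediate points into \<open>I\<close>.\<close>
    have "(y = inverse q * M \<and> z = q * M) \<or> (y = q * M \<and> z = inverse q * M)"
      unfolding M_def using False \<epsilon>\<nu> eq q0 by (auto simp: field_simps)
    then have "inverse q * M * w \<in> Zs" "inverse q * M / w \<in> Zt" "q * M * w \<in> Zs" "q * M / w \<in> Zt"
      using e1 by auto
    note in1 = this[unfolded M_def]
    have "?m * (q * w) = q * ?m * w" "?m / (q * w) = inverse q * ?m / w"
      "?m * (inverse q * w) = inverse q * ?m * w" "?m / (inverse q * w) = q * ?m / w"
      by (simp_all add: divide_inverse mult_ac)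
    note eqs = this
    have \<Lambda>: "q * w \<in> \<Lambda> q x" "inverse q * w \<in> \<Lambda> q x"
      using \<Lambda>_q(2)[OF yzw(3)] \<Lambda>_q(1)[OF yzw(3), of "-1"] by simp_all
    have "(?m, q * w) \<in> I" "(?m, inverse q * w) \<in> I"
      unfolding wts_def mem_Collect_eq prod.case eqs using in1 m\<Lambda> \<Lambda> by blast+
    then show ?thesis
      unfolding m1 m2 sq using False \<epsilon>\<nu> by (auto simp: sg_def)
  qed
qed

lemma mr_adj:
  assumes "\<epsilon> \<in> {-1, 1}" "\<nu> \<in> {-1, 1}" "y \<in> \<Lambda> q x" "z \<in> \<Lambda> q x"
  shows "of_int \<nu> * sqrt (wfun q \<nu> z) / (of_int \<epsilon> * sqrt (wfun q \<epsilon> y)) *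
    mr c (- \<epsilon>) (- \<nu>) (q powi \<epsilon> * y) (q powi \<nu> * z) = mr c \<epsilon> \<nu> y z"
proof -
  have pos: "y > 0" "z > 0" using assms \<Lambda>_q(4) by auto
  have "\<tau> (q powi \<nu> * z) > 0" "\<tau> y > 0" using pos q by (simp_all add: \<tau>_pos)
  then have k: "sqrt (\<tau> y * \<tau> (q powi \<nu> * z)) > 0" by simp
  have "sg \<epsilon> \<nu> * k * (sg \<epsilon> \<nu> * d / k) = d" if "k > 0" for k d :: real
    using that by (simp add: sg_def)
  from this[OF k] show ?thesis
    unfolding adj_coeff[OF assms(1,2) pos] mr_def dc_sym[OF assms(1,2) pos]
    by (simp only: minus_minus powi_cancel mult.assoc times_divide_eq_left)
qed

text \<open>Since \<open>ev\<close> records adjoints too, each relation is verified twice; this is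
  why \<open>rel1\<close> and \<open>rel2\<close> are used with both orders of the indices.\<close>

sublocale R: rank_one_rep "\<delta> :: real \<times> real \<Rightarrow> (real \<times> real) ell2" I dsrc dtgt "dcoeff c"
  "dyn_gens q x" "dyn_rel q x"
proof
  have q0: "q \<noteq> 0" using q by simp
  have q1: "inverse q * (q * w) = w" "q * (w / q) = w" for w using q by simp_all
  have rel5: "R.ev (TAdd (TMult (TStar (Gen (Uel (-1) \<epsilon> (q * w) y))) (Gen (Uel (-1) \<nu> (q * w) z)))
            (TMult (TStar (Gen (Uel 1 \<epsilon> (w / q) y))) (Gen (Uel 1 \<nu> (w / q) z)))) =
      R.ev (if \<epsilon> = \<nu> \<and> y = z then Gen (One2 w (q powi \<epsilon> * y)) else TZero)"
    if *: "\<epsilon> \<in> {-1, 1}" "\<nu> \<in> {-1, 1}" "w \<in> \<Lambda> q x" "y \<in> \<Lambda> q x" "z \<in> \<Lambda> q x" for \<epsilon> \<nu> w y z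
  proof (cases "y = z")
    case True
    have "(if \<epsilon> = \<nu> then R.rk 1 (w, q powi \<epsilon> * y) (w, q powi \<epsilon> * y) v else 0) =
        R.rk (complex_of_real (if \<epsilon> = \<nu> then 1 else 0)) (w, q powi \<epsilon> * y) (w, q powi \<nu> * y) v"
      "(if \<epsilon> = \<nu> then R.rk 1 (w, q powi \<epsilon> * y) (w, q powi \<epsilon> * y) v else 0) =
        R.rk (complex_of_real (if \<nu> = \<epsilon> then 1 else 0)) (w, q powi \<nu> * y) (w, q powi \<epsilon> * y) v" for v
      by auto
    then show ?thesis
      using rel1[OF *(1,2,3,4)] rel1[OF *(2,1,3,4)] True q0
      by (auto simp: fun_eq_iff R.rk_rk q1 simp del: of_real_mult simp flip: of_real_mult)
  qed (auto simp: fun_eq_iff R.rk_rk)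
  have rel6: "R.ev (TAdd (TMult (Gen (Uel \<epsilon> (-1) y w)) (TStar (Gen (Uel \<nu> (-1) z w))))
            (TMult (Gen (Uel \<epsilon> 1 y w)) (TStar (Gen (Uel \<nu> 1 z w))))) =
      R.ev (if \<epsilon> = \<nu> \<and> y = z then Gen (One2 y w) else TZero)"
    if *: "\<epsilon> \<in> {-1, 1}" "\<nu> \<in> {-1, 1}" "w \<in> \<Lambda> q x" "y \<in> \<Lambda> q x" "z \<in> \<Lambda> q x" for \<epsilon> \<nu> w y z
  proof (cases "q powi \<epsilon> * y = q powi \<nu> * z")
    case True
    have yz: "\<epsilon> = \<nu> \<Longrightarrow> y = z" using True q by simp
    have "(if \<epsilon> = \<nu> \<and> y = z then R.rk 1 (y, w) (y, w) v else 0) =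
        R.rk (complex_of_real (if \<epsilon> = \<nu> then 1 else 0)) (y, w) (z, w) v"
      "(if \<epsilon> = \<nu> \<and> y = z then R.rk 1 (y, w) (y, w) v else 0) =
        R.rk (complex_of_real (if \<nu> = \<epsilon> then 1 else 0)) (z, w) (y, w) v" for v
      using yz by auto
    then show ?thesis
      using rel2[OF *(1,2,4,5,3) True] rel2[OF *(2,1,5,4,3) True[symmetric]] True
      by (auto simp: fun_eq_iff R.rk_rk simp del: of_real_mult simp flip: of_real_mult)
  next
    case False
    then show ?thesis by (auto simp: fun_eq_iff R.rk_rk)
  qed
  have rel7: "R.ev (TStar (Gen (Uel \<epsilon> \<nu> y z))) = R.ev (TScale (complex_of_real
                (of_int \<nu> * sqrt (wfun q \<nu> z) / (of_int \<epsilon> * sqrt (wfun q \<epsilon> y))))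
              (Gen (Uel (- \<epsilon>) (- \<nu>) (q powi \<epsilon> * y) (q powi \<nu> * z))))"
    if *: "\<epsilon> \<in> {-1, 1}" "\<nu> \<in> {-1, 1}" "y \<in> \<Lambda> q x" "z \<in> \<Lambda> q x" for \<epsilon> \<nu> y z
    unfolding R.ev.simps dsrc.simps dtgt.simps dcoeff.simps
    by (simp only: fun_eq_iff prod.inject fst_conv snd_conv complex_cnj_complex_of_real R.rk_scale
        of_real_mult[symmetric] mr_adj[OF *] powi_cancel simp_thms)
  fix s t assume "(s, t) \<in> dyn_rel q x"
  then show "R.ev s = R.ev t"
    unfolding dyn_rel_def
  proof (elim UnE CollectE exE conjE Pair_inject, goal_cases)
    case 1
    then show ?case by (auto simp: fun_eq_iff R.rk_rk R.rk_outside)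
  next
    case 2
    then show ?case by simp
  next
    case 3
    then show ?case by (simp add: fun_eq_iff R.rk_rk R.rk_outside)
  next
    case 4
    then show ?case by (simp add: fun_eq_iff R.rk_rk R.rk_outside)
  next
    case 5
    then show ?case using rel5 by simp
  next
    case 6
    then show ?case using rel6 by simp
  next
    case 7
    then show ?case using rel7 by simp
  qed
next
  fix i assume "i \<in> I"
  then show "\<exists>g\<in>dyn_gens q x. dsrc g = i \<and> dtgt g = i \<and> dcoeff c g = 1"
    by (cases i, intro bexI[of _ "One2 (fst i) (snd i)"]) (auto simp: dyn_gens_def wts_def)
qed


lemma irr_components:
  "p \<in> Zs \<Longrightarrow> Zs = c_component q c p" "p \<in> Zt \<Longrightarrow> Zt = c_component q (- c) p"
  using irreducible_c_set_eq_component[OF q(1)] Zs Zt(1) by blast+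

context
  fixes J y0 z0
  assumes yz0: "(y0, z0) \<in> I" "(y0, z0) \<in> J"
    and step: "\<And>g. g \<in> dyn_gens q x \<Longrightarrow> dcoeff c g \<noteq> 0 \<Longrightarrow> dsrc g \<in> J \<Longrightarrow> dsrc g \<in> I \<Longrightarrow>
      dtgt g \<in> I \<Longrightarrow> dtgt g \<in> J"
begin

lemma connected_step:
  assumes \<alpha>\<beta>: "\<alpha> \<in> {-1, 1}" "\<beta> \<in> {-1, 1}" and yz: "(y, z) \<in> I" "(y, z) \<in> J"
    and tgt: "(q powi \<alpha> * y, q powi \<beta> * z) \<in> I"
    and nz: "sig \<alpha> \<beta> * c + \<tau> (q powi \<alpha> * pr \<alpha> \<beta> y z) \<noteq> 0"
  shows "(q powi \<alpha> * y, q powi \<beta> * z) \<in> J"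
proof -
  let ?g = "Uel (- \<alpha>) (- \<beta>) (q powi \<alpha> * y) (q powi \<beta> * z)"
  have pos: "y > 0" "z > 0" using I_\<Lambda>(3,4)[OF yz(1)] by auto
  have g: "?g \<in> dyn_gens q x"
    using \<alpha>\<beta> I_\<Lambda>(1,2)[OF tgt] unfolding dyn_gens_def by auto
  have src: "dsrc ?g = (y, z)" by (simp only: dsrc.simps powi_cancel)
  have "\<tau> y > 0" "\<tau> (q powi \<beta> * z) > 0" using pos q by (simp_all add: \<tau>_pos)
  moreover have "dc c \<alpha> \<beta> y z \<noteq> 0" using nz by (simp add: dc_def)
  moreover have "sg \<alpha> \<beta> \<noteq> 0" by (simp add: sg_def)
  ultimately have "dcoeff c ?g \<noteq> 0"
    unfolding dcoeff.simps mr_def minus_minus powi_cancel dc_sym[OF \<alpha>\<beta> pos] by simp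
  then show ?thesis using step[OF g] src yz tgt by simp
qed

text \<open>Moving with the first copy keeps \<open>y / z\<close> fixed while \<open>y * z\<close>
  runs through its component.\<close>

lemma connected_Zs: "p \<in> Zs \<Longrightarrow> \<exists>y z. (y, z) \<in> I \<and> (y, z) \<in> J \<and> y * z = p \<and> y / z = y0 / z0"
proof -
  have in0: "y0 * z0 \<in> Zs" "y0 / z0 \<in> Zt" using yz0 by (auto simp: wts_def)
  note Zs_eq = irr_components(1)[OF in0(1)]
  assume "p \<in> Zs"
  then have "p \<in> c_component q c (y0 * z0)" using Zs_eq by simp
  then show ?thesis
  proof induction
    case base
    then show ?case using yz0 by blast
  next
    case (up p)
    then obtain y z where yz: "(y, z) \<in> I" "(y, z) \<in> J" "y * z = p" "y / z = y0 / z0" by blast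
    have e: "q * y * (q * z) = q\<^sup>2 * p" "q * y / (q * z) = y0 / z0"
      using yz q by (simp_all add: power2_eq_square)
    have "q\<^sup>2 * p \<in> Zs" using c_component.up[OF up(1,2)] Zs_eq by simp
    then have I': "(q * y, q * z) \<in> I"
      unfolding wts_def mem_Collect_eq prod.case e
      using \<Lambda>_q(2) I_\<Lambda>(1,2)[OF yz(1)] in0 by simp
    have "(q * y, q * z) \<in> J"
      using connected_step[of 1 1 y z] yz I' up(2) by (simp add: sig_def pr_def)
    then show ?case using I' e by blast
  next
    case (down p)
    then obtain y z where yz: "(y, z) \<in> I" "(y, z) \<in> J" "y * z = p" "y / z = y0 / z0" by blast
    have iq: "inverse q * a = a / q" for a by (simp add: divide_inverse mult.commute)
    have e: "y / q * (z / q) = p / q\<^sup>2" "y / q / (z / q) = y0 / z0"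
      using yz q by (simp_all add: power2_eq_square)
    have "p / q\<^sup>2 \<in> Zs" using c_component.down[OF down(1,2)] Zs_eq by simp
    then have I': "(y / q, z / q) \<in> I"
      unfolding wts_def mem_Collect_eq prod.case e
      using \<Lambda>_q(3) I_\<Lambda>(1,2)[OF yz(1)] in0 by simp
    have "(y / q, z / q) \<in> J"
      using connected_step[of "-1" "-1" y z] yz I' down(2) by (simp add: sig_def pr_def iq)
    then show ?case using I' e by blast
  qed
qed

text \<open>From the line reached by \<open>connected_Zs\<close>, the second copy moves
  \<open>y / z\<close> through its component and keeps \<open>y * z\<close>.\<close>

lemma connected_Zt: "p' \<in> Zt \<Longrightarrow> p \<in> Zs \<Longrightarrow> \<exists>y z. (y, z) \<in> I \<and> (y, z) \<in> J \<and> y * z = p \<and> y / z = p'"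
proof -
  have in0: "y0 * z0 \<in> Zs" "y0 / z0 \<in> Zt" using yz0 by (auto simp: wts_def)
  note Zt_eq = irr_components(2)[OF in0(2)]
  assume p: "p \<in> Zs" and "p' \<in> Zt"
  then have "p' \<in> c_component q (- c) (y0 / z0)" using Zt_eq by simp
  then show ?thesis
  proof induction
    case base
    then show ?case using connected_Zs[OF p] .
  next
    case (up p')
    then obtain y z where yz: "(y, z) \<in> I" "(y, z) \<in> J" "y * z = p" "y / z = p'" by blast
    have iq: "inverse q * a = a / q" for a by (simp add: divide_inverse mult.commute)
    have e: "q * y * (z / q) = p" "q * y / (z / q) = q\<^sup>2 * p'"
      using yz(3,4) q by (auto simp: power2_eq_square)
    have "q\<^sup>2 * p' \<in> Zt" using c_component.up[OF up(1,2)] Zt_eq by simp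
    then have I': "(q * y, z / q) \<in> I"
      unfolding wts_def mem_Collect_eq prod.case e
      using \<Lambda>_q(2,3) I_\<Lambda>(1,2)[OF yz(1)] p by simp
    have "(q * y, z / q) \<in> J"
      using connected_step[of 1 "-1" y z] yz I' up(2) by (simp add: sig_def pr_def iq)
    then show ?case using I' e by blast
  next
    case (down p')
    then obtain y z where yz: "(y, z) \<in> I" "(y, z) \<in> J" "y * z = p" "y / z = p'" by blast
    have iq: "inverse q * a = a / q" for a by (simp add: divide_inverse mult.commute)
    have e: "y / q * (q * z) = p" "y / q / (q * z) = p' / q\<^sup>2"
      using yz(3,4) q by (auto simp: power2_eq_square)
    have "p' / q\<^sup>2 \<in> Zt" using c_component.down[OF down(1,2)] Zt_eq by simp
    then have I': "(y / q, q * z) \<in> I"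
      unfolding wts_def mem_Collect_eq prod.case e
      using \<Lambda>_q(2,3) I_\<Lambda>(1,2)[OF yz(1)] p by simp
    have "(y / q, q * z) \<in> J"
      using connected_step[of "-1" 1 y z] yz I' down(2) by (simp add: sig_def pr_def iq)
    then show ?case using I' e by blast
  qed
qed

text \<open>Product and ratio determine a point with positive coordinates, so reaching every pair of
  values means reaching every weight.\<close>

lemma connected: "I \<subseteq> J"
proof
  fix i assume i: "i \<in> I"
  obtain y z where yz: "i = (y, z)" by (cases i)
  have "y * z \<in> Zs" "y / z \<in> Zt" using i by (auto simp: yz wts_def)
  then obtain y' z' where *: "(y', z') \<in> I" "(y', z') \<in> J" "y' * z' = y * z" "y' / z' = y / z"
    using connected_Zt by blast
  have pos: "y > 0" "z > 0" "y' > 0" "z' > 0" using I_\<Lambda>(3,4) i *(1) by (auto simp: yz)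
  have sq: "(a * b) * (a / b) = a\<^sup>2" "(a * b) / (a / b) = b\<^sup>2" if "a > 0" "b > 0" for a b :: real
    using that by (simp_all add: power2_eq_square)
  have "y'\<^sup>2 = y\<^sup>2" "z'\<^sup>2 = z\<^sup>2"
    using sq[OF pos(1,2)] sq[OF pos(3,4)] *(3,4) by simp_all
  then have "y' = y" "z' = z" using pos by (simp_all add: power2_eq_iff_nonneg)
  then show "i \<in> J" using * yz by simp
qed

end

lemma irreducible_model: "irreducible_rep (dyn_alg q x) (ell2_on I) R.\<pi>"
  unfolding dyn_alg_def
proof (rule R.irreducible_rep_\<pi>)
  obtain p p' where "p \<in> Zs" "p' \<in> Zt" using cs by (auto simp: c_set_def)
  then show "I \<noteq> {}" by (rule I_point) blast
  fix i J assume i: "i \<in> I" "i \<in> J"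
    and "\<And>g. g \<in> dyn_gens q x \<Longrightarrow> dcoeff c g \<noteq> 0 \<Longrightarrow> dsrc g \<in> J \<Longrightarrow> dsrc g \<in> I \<Longrightarrow>
      dtgt g \<in> I \<Longrightarrow> dtgt g \<in> J"
  then show "I \<subseteq> J" by (cases i) (rule connected; simp)
qed (rule closure_cspan_\<delta>[symmetric])

text \<open>The normalisation in \<open>D\<close> undoes the one in \<open>mr\<close>, which leaves
  the coefficients \<open>dc\<close>.\<close>

lemma std_model: "dyn_rep.std q x (ell2_on I) R.\<pi> c Zs Zt \<delta>"
proof -
  interpret M: dyn_rep q x "ell2_on I" R.\<pi>
    by unfold_locales (use irreducible_model in \<open>simp add: irreducible_rep_def\<close>)
  have P: "M.P a b v = R.rk 1 (a, b) (a, b) v" for a b v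
    by (simp add: M.P_def dyn_one_def R.\<pi>_cls)
  have D: "M.D \<alpha> \<beta> y z v = R.rk (complex_of_real (dc c \<alpha> \<beta> y z)) (q powi \<alpha> * y, q powi \<beta> * z) (y, z) v"
    if \<alpha>\<beta>: "\<alpha> \<in> {-1, 1}" "\<beta> \<in> {-1, 1}" and yz: "(y, z) \<in> I" for \<alpha> \<beta> y z v
  proof -
    have pos: "y > 0" "z > 0" using I_\<Lambda>(3,4)[OF yz] by auto
    have "\<tau> y * \<tau> (q powi \<beta> * z) > 0" using pos q by (simp add: \<tau>_pos)
    then have k: "sqrt (\<tau> y * \<tau> (q powi \<beta> * z)) > 0" by simp
    have "sg \<alpha> \<beta> * r * (sg \<alpha> \<beta> * d / r) = d" if "r > 0" for r d :: real
      using that by (simp add: sg_def)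
    from this[OF k] have m: "sg \<alpha> \<beta> * sqrt (\<tau> y * \<tau> (q powi \<beta> * z)) *
        mr c (- \<alpha>) (- \<beta>) (q powi \<alpha> * y) (q powi \<beta> * z) = dc c \<alpha> \<beta> y z"
      unfolding mr_def minus_minus powi_cancel dc_sym[OF \<alpha>\<beta> pos] .
    show ?thesis
      unfolding M.D_def u_def R.\<pi>_cls R.ev.simps fst_conv dsrc.simps dtgt.simps dcoeff.simps powi_cancel
        R.rk_scale of_real_mult[symmetric] m ..
  qed
  show ?thesis
    unfolding M.std_def
    by (auto simp: P D R.rk_def cinner_\<delta>_\<delta> closure_cspan_\<delta> simp del: insert_iff)
qed

end

subsection \<open>The classification\<close>

lemma Zset_sqrt:
  assumes "Z \<subseteq> {0<..}"
  shows "Zset {s. 0 < s \<and> s\<^sup>2 \<in> Z} = Z"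
proof (intro subset_antisym subsetI)
  fix z assume z: "z \<in> Z"
  then have "0 < sqrt z" "(sqrt z)\<^sup>2 = z" using assms by auto
  then show "z \<in> Zset {s. 0 < s \<and> s\<^sup>2 \<in> Z}"
    unfolding Zset_def using z by (intro image_eqI[of _ _ "sqrt z"]) simp_all
qed (auto simp: Zset_def)

context phi_rep
begin

lemma std_of_nonzero:
  assumes irr: "irreducible_rep (dyn_alg q x) H \<pi>"
    and yz: "y \<in> \<Lambda> q x" "z \<in> \<Lambda> q x"
    and v: "v \<in> H" "v \<noteq> 0" "P y z v = v" "C y z v = complex_of_real c *\<^sub>C v"
  obtains e where "std c (c_component q c (y * z)) (c_component q (- c) (y / z)) e"
    "\<And>p. p \<in> c_component q c (y * z) \<Longrightarrow> 0 \<le> c + \<tau> (q * p) \<and> 0 \<le> c + \<tau> (p / q)"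
    "\<And>p. p \<in> c_component q (- c) (y / z) \<Longrightarrow> 0 \<le> - c + \<tau> (q * p) \<and> 0 \<le> - c + \<tau> (p / q)"
proof -
  define u where "u = complex_of_real (inverse (norm v)) *\<^sub>C v"
  have u: "u \<in> H" "norm u = 1" "P y z u = u" "C y z u = complex_of_real c *\<^sub>C u"
    using v csubspace_scaleC[OF repD(2)] P_linear(2)[OF yz v(1)] C_linear(2)[OF yz v(1)]
    by (simp_all add: u_def norm_scaleC scaleC_left_commute[of "complex_of_real c"]) (simp add: norm_inverse)?
  show ?thesis by (rule std_of_weight_vector[OF irr yz u]) (rule that)
qed

text \<open>Some weight component of a nonzero vector is nonzero. Its Casimir scalar is
  \<open>c\<close>, and the components through \<open>y * z\<close> and \<open>y / z\<close> are the
  squared weights of \<open>S\<close> and \<open>T\<close>.\<close>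

lemma irreducible_is_\<pi>ST:
  assumes irr: "irreducible_rep (dyn_alg q x) H \<pi>"
  shows "\<exists>c S T. admissible q x c S T \<and> is_\<pi>ST q x \<Phi> c S T H \<pi>"
proof -
  have q0: "q \<noteq> 0" using q by simp
  obtain v where v: "v \<in> H" "v \<noteq> 0"
    using irr csubspace_0[OF repD(2)] unfolding irreducible_rep_def by blast
  then obtain y z where yz: "y \<in> \<Lambda> q x" "z \<in> \<Lambda> q x" and Pv: "P y z v \<noteq> 0"
    using weight_zero by blast
  let ?w = "P y z v"
  have w: "?w \<in> H" "?w \<noteq> 0" "P y z ?w = ?w" using P_in[OF yz v(1)] Pv P_P[OF yz yz v(1)] by simp_all
  obtain c where c: "C y z ?w = complex_of_real c *\<^sub>C ?w" by (rule casimir_scalar[OF irr yz w])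
  let ?Zs = "c_component q c (y * z)" and ?Zt = "c_component q (- c) (y / z)"
  obtain e where e: "std c ?Zs ?Zt e"
    "\<And>p. p \<in> ?Zs \<Longrightarrow> 0 \<le> c + \<tau> (q * p) \<and> 0 \<le> c + \<tau> (p / q)"
    "\<And>p. p \<in> ?Zt \<Longrightarrow> 0 \<le> - c + \<tau> (q * p) \<and> 0 \<le> - c + \<tau> (p / q)"
    by (rule std_of_nonzero[OF irr yz w c]) (rule that)
  have pos: "y * z > 0" "y / z > 0" using yz \<Lambda>_q(4) by simp_all
  define S where "S = {s. 0 < s \<and> s\<^sup>2 \<in> ?Zs}"
  define T where "T = {s. 0 < s \<and> s\<^sup>2 \<in> ?Zt}"
  have Z: "Zset S = ?Zs" "Zset T = ?Zt"
    unfolding S_def T_def using c_component_pos[OF _ q(1) pos(1)] c_component_pos[OF _ q(1) pos(2)]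
    by (intro Zset_sqrt; auto)+
  obtain a b :: int where ab: "y = x * q powi a" "z = x * q powi b" using yz by (auto simp: \<Lambda>_def)
  have Zs: "\<exists>n::int. p = x\<^sup>2 * q powi (a + b + 2 * n)" if "p \<in> ?Zs" for p
    using c_component_form[OF that q(1)] q0 by (auto simp: ab power_int_add power2_eq_square mult_ac)
  have Zt: "\<exists>n::int. p = q powi (a - b + 2 * n)" if "p \<in> ?Zt" for p
    using c_component_form[OF that q(1)] q0 x by (auto simp: ab power_int_add power_int_diff)
  have "\<exists>n::int. p * p' = x\<^sup>2 * q powi (2 * n)" if "p \<in> ?Zs" "p' \<in> ?Zt" for p p'
  proof -
    obtain n m :: int where nm: "p = x\<^sup>2 * q powi (a + b + 2 * n)" "p' = q powi (a - b + 2 * m)"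
      using Zs Zt \<open>p \<in> ?Zs\<close> \<open>p' \<in> ?Zt\<close> by blast
    \<comment> \<open>The exponents \<open>a + b\<close> and \<open>a - b\<close> add up to an even
      number; this is the origin of the parity condition.\<close>
    have "q powi (a + b + 2 * n) * q powi (a - b + 2 * m) = q powi (2 * (a + n + m))"
      using q0 by (simp add: algebra_simps flip: power_int_add)
    then show ?thesis unfolding nm by (intro exI[of _ "a + n + m"]) (simp add: mult.assoc)
  qed
  moreover have "p \<in> \<Lambda> q (x\<^sup>2)" if "p \<in> ?Zs" for p
    using Zs[OF that] unfolding \<Lambda>_def by blast
  moreover have "p \<in> \<Lambda> q 1" if "p \<in> ?Zt" for p
    using Zt[OF that] unfolding \<Lambda>_def mult_1 by blast
  ultimately have adm: "admissible q x c S T"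
    unfolding admissible_def Z
    using irreducible_c_set_component[OF q(1) pos(1) e(2)] irreducible_c_set_component[OF q(1) pos(2) e(3)]
    by (auto simp: S_def T_def)
  then show ?thesis using is_\<pi>ST_of_std[OF irr adm] e(1) Z by metis
qed

text \<open>In any realisation, the tensor of two weight vectors is a weight vector on which the
  Casimir operator is \<open>c\<close>, because \<open>is_\<pi>\<close> imposes this on the first
  factor. The ladders started there rebuild a standard basis, which is what uniqueness
  needs.\<close>

lemma is_\<pi>ST_std:
  assumes adm: "admissible q x c S T" and ST: "is_\<pi>ST q x \<Phi> c S T H \<pi>"
  obtains e where "std c (Zset S) (Zset T) e"
proof -
  let ?A = "su_alg q x" and ?B = "su_alg q 1"
  obtain \<pi>S and HS :: "real ell2 set" and \<pi>T and HT :: "real ell2 set" and t where irr: "irreducible_rep (dyn_alg q x) H \<pi>"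
    and \<pi>S: "is_\<pi> q x c S HS \<pi>S" and \<pi>T: "is_\<pi> q 1 (- c) T HT \<pi>T"
    and tr: "tensor_rep ?A HS \<pi>S ?B HT \<pi>T H t (\<pi> \<circ> \<Phi>)"
    using ST unfolding is_\<pi>ST_def by blast
  have repS: "star_rep ?A HS \<pi>S" and repT: "star_rep ?B HT \<pi>T"
    using \<pi>S \<pi>T by (auto simp: is_\<pi>_def irreducible_rep_def)
  note SD = star_repD[OF repS] and TD = star_repD[OF repT]
  have ht: "hilbert_tensor HS HT H t"
    and tens: "\<And>a b v w. a \<in> carrier ?A \<Longrightarrow> b \<in> carrier ?B \<Longrightarrow> v \<in> HS \<Longrightarrow> w \<in> HT \<Longrightarrow>
      \<pi> (\<Phi> (tns a b)) (t v w) = t (\<pi>S a v) (\<pi>T b w)"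
    using tr unfolding tensor_rep_def by auto
  have "Zset S \<noteq> {}" "Zset T \<noteq> {}"
    using adm by (simp_all add: admissible_def irreducible_c_set_def c_set_def)
  then obtain r s where rs: "r \<in> S" "s \<in> T" by (auto simp: Zset_def)
  have r: "r \<in> \<Gamma> q x" and s: "s \<in> \<Gamma> q 1" using rs \<pi>S \<pi>T unfolding is_\<pi>_def by auto
  obtain v' where v': "v' \<in> HS" "\<pi>S (su_one q x r) v' \<noteq> 0" using rs(1) \<pi>S unfolding is_\<pi>_def by blast
  obtain w' where w': "w' \<in> HT" "\<pi>T (su_one q 1 s) w' \<noteq> 0" using rs(2) \<pi>T unfolding is_\<pi>_def by blast
  define v where "v = \<pi>S (su_one q x r) v'"
  define w where "w = \<pi>T (su_one q 1 s) w'"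
  have v: "v \<in> HS" "v \<noteq> 0" and w: "w \<in> HT" "w \<noteq> 0"
    using v' w' r s by (simp_all add: v_def w_def SD(5) TD(5))
  have v1: "\<pi>S (su_one q x r) v = v"
    using SD(7)[OF U1.su_closed(1)[OF r] U1.su_closed(1)[OF r] v'(1)] r by (simp add: v_def U1.su_one_one)
  have w1: "\<pi>T (su_one q 1 s) w = w"
    using TD(7)[OF U2.su_closed(1)[OF s] U2.su_closed(1)[OF s] w'(1)] s by (simp add: w_def U2.su_one_one)
  have tH: "t v w \<in> H" if "v \<in> HS" "w \<in> HT" for v w
  proof -
    have "t v w \<in> {t v w |v w. v \<in> HS \<and> w \<in> HT}" using that by blast
    then have "t v w \<in> closure (span {t v w |v w. v \<in> HS \<and> w \<in> HT})"
      by (intro subsetD[OF closure_subset] span_base)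
    then show ?thesis using ht by (simp add: hilbert_tensor_def)
  qed
  have lin: "clinear_on HS (\<lambda>v. t v w)" using ht w(1) by (simp add: hilbert_tensor_def)
  let ?u = "t v w" and ?y = "r * s" and ?z = "r / s"
  note u = tH[OF v(1) w(1)]
  have "cinner ?u ?u = cinner v v * cinner w w" using ht v w by (simp add: hilbert_tensor_def)
  then have u0: "?u \<noteq> 0" using v(2) w(2) by (auto simp: cinner_self)
  note \<Lambda> = admissible_\<Lambda>[OF adm rs]
  have p: "r > 0" "s > 0" using r s U1.\<Gamma>_q(3) U2.\<Gamma>_q(3) by auto
  have yz: "?y * ?z = r\<^sup>2" "?y / ?z = s\<^sup>2" using p by (simp_all add: power2_eq_square)
  have Pu: "P ?y ?z ?u = ?u"
    using tens[OF U1.su_closed(1)[OF r] U2.su_closed(1)[OF s] v(1) w(1)] \<Phi>_one[OF r s u] \<Lambda>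
    by (simp add: v1 w1)
  have qr: "q * r \<in> \<Gamma> q x" "q * r / q = r" using U1.\<Gamma>_q(1)[OF r] q by simp_all
  have Ev: "\<pi>S (su_Er q x r) v \<in> HS" using SD(5) r v(1) by simp
  have D1: "D 1 1 ?y ?z ?u = k *\<^sub>C t (\<pi>S (su_Er q x r) v) w"
    using \<Phi>_generators(1)[OF r s u] \<Lambda> tens[OF U1.su_closed(2)[OF r] U2.su_closed(1)[OF s] v(1) w(1)]
    by (simp add: w1)
  have q\<Lambda>: "q * r * s \<in> \<Lambda> q x" "q * r / s \<in> \<Lambda> q x"
    using \<Lambda>_q(2)[OF \<Lambda>(1)] \<Lambda>_q(2)[OF \<Lambda>(2)] by (simp_all add: mult.assoc)
  have D2: "D (-1) (-1) (q * r * s) (q * r / s) (t (\<pi>S (su_Er q x r) v) w) =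
      k *\<^sub>C t (\<pi>S (su_Fr q x r) (\<pi>S (su_Er q x r) v)) w"
    using \<Phi>_generators(3)[OF qr(1) s tH[OF Ev w(1)]] q\<Lambda>
      tens[OF U1.su_closed(3)[OF r] U2.su_closed(1)[OF s] Ev w(1)]
    unfolding qr(2) by (simp add: w1)
  \<comment> \<open>The Casimir relation of \<open>\<pi>S\<close> at weight \<open>r\<close>, solved
    for \<open>F E\<close>.\<close>
  have "complex_of_real ((inverse q - q)\<^sup>2) *\<^sub>C \<pi>S (su_Fr q x r) (\<pi>S (su_Er q x r) v) =
      complex_of_real (c + \<tau> (q * r\<^sup>2)) *\<^sub>C v"
  proof -
    have "\<pi>S (fst (casimir q x) (su_one q x r)) v = complex_of_real c *\<^sub>C v"
      using \<pi>S r v(1) v1 unfolding is_\<pi>_def by simp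
    moreover have "\<pi>S (fst (casimir q x) (su_one q x r)) v =
        complex_of_real ((inverse q - q)\<^sup>2) *\<^sub>C \<pi>S (su_Fr q x r) (\<pi>S (su_Er q x r) v) +
        complex_of_real (- q) *\<^sub>C complex_of_real (r powi 2) *\<^sub>C v +
        complex_of_real (- inverse q) *\<^sub>C complex_of_real (r powi (-2)) *\<^sub>C v"
      using r v(1)
      by (simp only: U1.fst_casimir[OF r] SD(6-8) U1.su_closed U1.A.m_closed U1.A.smult_closed U1.A.a_closed v1)
    ultimately have "complex_of_real ((inverse q - q)\<^sup>2) *\<^sub>C \<pi>S (su_Fr q x r) (\<pi>S (su_Er q x r) v) =
        complex_of_real c *\<^sub>C v - complex_of_real (- q) *\<^sub>C complex_of_real (r powi 2) *\<^sub>C v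
          - complex_of_real (- inverse q) *\<^sub>C complex_of_real (r powi (-2)) *\<^sub>C v"
      by (simp add: algebra_simps)
    also have "\<dots> = complex_of_real (c + (q * r powi 2 + inverse q * r powi (-2))) *\<^sub>C v"
      by (simp only: scaleC_scaleC scaleC_diff_left[symmetric] of_real_mult[symmetric] of_real_diff[symmetric])
        (simp add: add.assoc)
    also have "q * r powi 2 + inverse q * r powi (-2) = \<tau> (q * r\<^sup>2)"
      by (simp add: \<tau>_def power_int_minus)
    finally show ?thesis .
  qed
  note FE = this
  have kk: "k * k = complex_of_real ((inverse q - q)\<^sup>2)" by (simp add: power2_eq_square)
  have FEH: "\<pi>S (su_Fr q x r) (\<pi>S (su_Er q x r) v) \<in> HS" using SD(5) r Ev by simp
  have "D (-1) (-1) (q * ?y) (q * ?z) (D 1 1 ?y ?z ?u) = complex_of_real (c + \<tau> (q * r\<^sup>2)) *\<^sub>C ?u"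
  proof -
    have "D (-1) (-1) (q * r * s) (q * r / s) (D 1 1 ?y ?z ?u) =
        (k * k) *\<^sub>C t (\<pi>S (su_Fr q x r) (\<pi>S (su_Er q x r) v)) w"
      unfolding D1 using D_linear(2)[of "-1" "-1", OF _ _ q\<Lambda> tH[OF Ev w(1)]] by (simp add: D2 scaleC_scaleC)
    also have "\<dots> = complex_of_real (c + \<tau> (q * r\<^sup>2)) *\<^sub>C ?u"
      unfolding kk clinear_onD(2)[OF lin FEH, symmetric] FE clinear_onD(2)[OF lin v(1)] ..
    finally show ?thesis by (simp add: mult.assoc)
  qed
  then have Cu: "C ?y ?z ?u = complex_of_real c *\<^sub>C ?u"
    unfolding C_def yz Pu by (simp only: scaleC_diff_left[symmetric] of_real_diff[symmetric]) simp
  obtain e where "std c (c_component q c (?y * ?z)) (c_component q (- c) (?y / ?z)) e"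
    by (rule std_of_nonzero[OF irr \<Lambda> u u0 Pu Cu]) (rule that)
  \<comment> \<open>An irreducible \<open>c\<close>-set is the component of any of its points, so
    the components produced by the ladders are the prescribed sets.\<close>
  moreover have "Zset S = c_component q c (r\<^sup>2)" "Zset T = c_component q (- c) (s\<^sup>2)"
    using adm rs by (auto simp: admissible_def Zset_def intro!: irreducible_c_set_eq_component[OF q(1)])
  ultimately show ?thesis using that unfolding yz by simp
qed

end

lemma (in dyn) is_\<pi>ST_exists:
  assumes \<Phi>: "is_\<Phi> q x \<Phi>" and adm: "admissible q x c S T"
  shows "\<exists>(H :: (real \<times> real) ell2 set) \<pi>. is_\<pi>ST q x \<Phi> c S T H \<pi>"
proof -
  interpret M: dyn_model q x c "Zset S" "Zset T"
    by unfold_locales (use adm in \<open>auto simp: admissible_def\<close>)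
  interpret phi_rep q x "ell2_on M.I" M.R.\<pi> \<Phi>
    by unfold_locales (use M.irreducible_model \<Phi> in \<open>simp_all add: irreducible_rep_def\<close>)
  show ?thesis using is_\<pi>ST_of_std[OF M.irreducible_model adm M.std_model] by blast
qed

lemma (in dyn) is_\<pi>ST_unique:
  assumes \<Phi>: "is_\<Phi> q x \<Phi>" and adm: "admissible q x c S T"
    and ST: "is_\<pi>ST q x \<Phi> c S T H \<pi>" "is_\<pi>ST q x \<Phi> c S T H' \<pi>'"
  shows "unitarily_equivalent (dyn_alg q x) H \<pi> H' \<pi>'"
proof -
  have rep: "star_rep (dyn_alg q x) H \<pi>" "star_rep (dyn_alg q x) H' \<pi>'"
    using ST by (auto simp: is_\<pi>ST_def irreducible_rep_def)
  interpret R1: phi_rep q x H \<pi> \<Phi> by unfold_locales (rule rep \<Phi>)+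
  interpret R2: phi_rep q x H' \<pi>' \<Phi> by unfold_locales (rule rep \<Phi>)+
  obtain e where e: "R1.std c (Zset S) (Zset T) e" by (rule R1.is_\<pi>ST_std[OF adm ST(1)])
  obtain e' where e': "R2.std c (Zset S) (Zset T) e'" by (rule R2.is_\<pi>ST_std[OF adm ST(2)])
  show ?thesis by (rule std_unique[OF rep e e'])
qed

text \<open>Existence is asserted on a concrete square-summable space, since an arbitrary type of
  class \<open>chilbert_space\<close> may be too small to carry the representation; equivalence is
  stated between spaces of two possibly different types.\<close>

theorem theorem6p13:
  fixes q x :: real
    and \<Phi> :: "(su_gen sterm set \<times> su_gen sterm set) sterm set \<Rightarrow> dyn_gen sterm set"
  assumes q: "0 < q" "q < 1" and x: "0 < x" and \<Phi>: "is_\<Phi> q x \<Phi>"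
  shows "(\<forall>(H :: 'h::chilbert_space set) \<pi>. irreducible_rep (dyn_alg q x) H \<pi> \<longrightarrow>
            (\<exists>c S T. admissible q x c S T \<and> is_\<pi>ST q x \<Phi> c S T H \<pi>)) \<and>
         (\<forall>c S T. admissible q x c S T \<longrightarrow>
            (\<exists>(H :: (real \<times> real) ell2 set) \<pi>. is_\<pi>ST q x \<Phi> c S T H \<pi>) \<and>
            (\<forall>(H :: 'h set) \<pi> (H' :: 'k::chilbert_space set) \<pi>'.
               is_\<pi>ST q x \<Phi> c S T H \<pi> \<and> is_\<pi>ST q x \<Phi> c S T H' \<pi>' \<longrightarrow>
               unitarily_equivalent (dyn_alg q x) H \<pi> H' \<pi>'))"
proof (intro conjI allI impI)
  interpret dyn q x by unfold_locales (fact q x)+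
  show "\<exists>c S T. admissible q x c S T \<and> is_\<pi>ST q x \<Phi> c S T H \<pi>"
    if irr: "irreducible_rep (dyn_alg q x) H \<pi>" for H :: "'h set" and \<pi>
  proof -
    interpret phi_rep q x H \<pi> \<Phi>
      by unfold_locales (use irr \<Phi> in \<open>simp_all add: irreducible_rep_def\<close>)
    show ?thesis by (rule irreducible_is_\<pi>ST[OF irr])
  qed
  fix c S T assume adm: "admissible q x c S T"
  show "\<exists>(H :: (real \<times> real) ell2 set) \<pi>. is_\<pi>ST q x \<Phi> c S T H \<pi>"
    by (rule is_\<pi>ST_exists[OF \<Phi> adm])
  show "unitarily_equivalent (dyn_alg q x) H \<pi> H' \<pi>'"
    if "is_\<pi>ST q x \<Phi> c S T H \<pi> \<and> is_\<pi>ST q x \<Phi> c S T H' \<pi>'"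
    for H :: "'h set" and \<pi> and H' :: "'k set" and \<pi>'
    by (rule is_\<pi>ST_unique[OF \<Phi> adm]) (use that in blast)+
qed

end
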